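(* Let $\gamma\colon[a,b]\to\mathbf{R}^3$ be a closed rectifiable curve of length $L$ and inradius $r>0$. Then $$L\geq 4\pi r.$$ Moreover, equality $L=4\pi r$ holds only if, up to a reparameterization, $\gamma$ is simple, is $\mathcal{C}^{1,1}$, lies on a sphere of radius $\sqrt{2}\,r$, and traces consecutively $4$ semicircles each of length $\pi r$ (i.e., $[a,b]$ can be divided, after possibly a cyclic shift of the parameter, into $4$ consecutive intervals on each of which $\gamma$ traces half of a circle of radius $r$).
   Context: A curve is a continuous map $\gamma\colon[a,b]\to\mathbf{R}^3$, $a<b$; it is also identified with its image. It is closed if $\gamma(a)=\gamma(b)$. Its length is $L(\gamma)=\sup\sum_i|\gamma(t_i)-\gamma(t_{i-1})|$ over all partitions of $[a,b]$; it is rectifiable if $L(\gamma)<\infty$. The convex hull $\mathrm{conv}(X)$ of a set $X$ is the intersection of all closed half-spaces containing $X$. The inradius of $\gamma$ is the supremum of the radii of the (round 2-dimensional) spheres which are contained in $\mathrm{conv}(\gamma)$ and are disjoint from the image of $\gamma$. A closed curve is simple if it is one-to-one on $[a,b)$; it is $\mathcal{C}^1$ if it is continuously differentiable with $\gamma'_+(a)=\gamma'_-(b)$, and $\mathcal{C}^{1,1}$ if in addition $\gamma'$ is Lipschitz. A curve $\widehat\gamma\colon[a,b]\to\mathbf{R}^3$ is a reparameterization of $\gamma$ if there is a nondecreasing continuous map $\phi\colon[a,b]\to[a,b]$ with $\gamma=\widehat\gamma\circ\phi$. *)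

theory Defs
  imports "HOL-Analysis.Analysis"
begin

text \<open>A curve is a function \<^term>\<open>\<gamma> :: real \<Rightarrow> real^3\<close> together with a parameter
  interval \<^term>\<open>{a..b}\<close>; its values outside that interval are irrelevant.\<close>

definition curve_on :: "real \<Rightarrow> real \<Rightarrow> (real \<Rightarrow> real^3) \<Rightarrow> bool" where
  "curve_on a b \<gamma> \<longleftrightarrow> a < b \<and> continuous_on {a..b} \<gamma>"

definition closed_curve_on :: "real \<Rightarrow> real \<Rightarrow> (real \<Rightarrow> real^3) \<Rightarrow> bool" where
  "closed_curve_on a b \<gamma> \<longleftrightarrow> curve_on a b \<gamma> \<and> \<gamma> a = \<gamma> b"

definition partition_of :: "real \<Rightarrow> real \<Rightarrow> nat \<Rightarrow> (nat \<Rightarrow> real) \<Rightarrow> bool" where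
  "partition_of a b n t \<longleftrightarrow> t 0 = a \<and> t n = b \<and> (\<forall>i<n. t i \<le> t (Suc i))"

definition curve_length :: "real \<Rightarrow> real \<Rightarrow> (real \<Rightarrow> real^3) \<Rightarrow> ereal" where
  "curve_length a b \<gamma> =
     Sup {ereal (\<Sum>i<n. norm (\<gamma> (t (Suc i)) - \<gamma> (t i))) | n t. partition_of a b n t}"

definition rectifiable_on :: "real \<Rightarrow> real \<Rightarrow> (real \<Rightarrow> real^3) \<Rightarrow> bool" where
  "rectifiable_on a b \<gamma> \<longleftrightarrow> curve_length a b \<gamma> < \<infinity>"

definition closed_halfspace :: "(real^3) set \<Rightarrow> bool" where
  "closed_halfspace H \<longleftrightarrow> (\<exists>v c. v \<noteq> 0 \<and> H = {x. v \<bullet> x \<le> c})"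

definition conv :: "(real^3) set \<Rightarrow> (real^3) set" where
  "conv X = \<Inter>{H. closed_halfspace H \<and> X \<subseteq> H}"

text \<open>On the compact sets to which it is applied, \<^const>\<open>conv\<close> is the library's convex hull.\<close>

lemma conv_eq_convex_hull:
  assumes "compact X"
  shows "conv X = convex hull X"
proof
  show "convex hull X \<subseteq> conv X"
    unfolding conv_def closed_halfspace_def
    by (rule hull_minimal) (auto intro!: convex_Inter convex_halfspace_le)
next
  show "conv X \<subseteq> convex hull X"
  proof
    fix z assume z: "z \<in> conv X"
    show "z \<in> convex hull X"
    proof (rule ccontr)
      assume nz: "z \<notin> convex hull X"
      have "closed (convex hull X)"
        using assms by (simp add: compact_convex_hull compact_imp_closed)
      then obtain v c where vc: "v \<bullet> z < c" "\<forall>x\<in>convex hull X. v \<bullet> x > c"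
        using separating_hyperplane_closed_point[OF convex_convex_hull _ nz] by blast
      define w where "w = (if v = 0 then axis 1 1 else - v)"
      define d where "d = (if v = 0 then w \<bullet> z - 1 else - c)"
      have X: "X = {}" if "v = 0"
      proof -
        have "convex hull X = {}" using vc that by fastforce
        then show ?thesis by simp
      qed
      have "w \<noteq> 0" by (auto simp: w_def axis_eq_0_iff)
      moreover have "X \<subseteq> {x. w \<bullet> x \<le> d}"
        using vc(2) X hull_subset[of X convex] by (fastforce simp: w_def d_def)
      ultimately have "w \<bullet> z \<le> d"
        using z unfolding conv_def closed_halfspace_def by blast
      then show False using vc(1) by (auto simp: w_def d_def split: if_splits)
    qed
  qed
qed

text \<open>The value is extended real so that, if there is no admissible sphere, the supremum
  is \<^term>\<open>-\<infinity>\<close> rather than an unspecified real number.\<close>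

definition inradius :: "real \<Rightarrow> real \<Rightarrow> (real \<Rightarrow> real^3) \<Rightarrow> ereal" where
  "inradius a b \<gamma> =
     Sup {ereal \<rho> | \<rho> p. 0 < \<rho> \<and> sphere p \<rho> \<subseteq> conv (\<gamma> ` {a..b}) \<and> sphere p \<rho> \<inter> \<gamma> ` {a..b} = {}}"

definition simple_closed_on :: "real \<Rightarrow> real \<Rightarrow> (real \<Rightarrow> real^3) \<Rightarrow> bool" where
  "simple_closed_on a b \<gamma> \<longleftrightarrow> closed_curve_on a b \<gamma> \<and> inj_on \<gamma> {a..<b}"

text \<open>Within \<^term>\<open>{a..b}\<close>, derivatives at the two endpoints are one-sided.\<close>

definition curve_deriv :: "real \<Rightarrow> real \<Rightarrow> (real \<Rightarrow> real^3) \<Rightarrow> real \<Rightarrow> real^3" where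
  "curve_deriv a b \<gamma> t = vector_derivative \<gamma> (at t within {a..b})"

definition C1_closed_on :: "real \<Rightarrow> real \<Rightarrow> (real \<Rightarrow> real^3) \<Rightarrow> bool" where
  "C1_closed_on a b \<gamma> \<longleftrightarrow>
     closed_curve_on a b \<gamma> \<and> \<gamma> differentiable_on {a..b} \<and>
     continuous_on {a..b} (curve_deriv a b \<gamma>) \<and>
     curve_deriv a b \<gamma> a = curve_deriv a b \<gamma> b"

definition C11_closed_on :: "real \<Rightarrow> real \<Rightarrow> (real \<Rightarrow> real^3) \<Rightarrow> bool" where
  "C11_closed_on a b \<gamma> \<longleftrightarrow>
     C1_closed_on a b \<gamma> \<and> (\<exists>K. K-lipschitz_on {a..b} (curve_deriv a b \<gamma>))"

definition reparameterization_on ::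
  "real \<Rightarrow> real \<Rightarrow> (real \<Rightarrow> real^3) \<Rightarrow> (real \<Rightarrow> real^3) \<Rightarrow> bool" where
  \<comment> \<open>the first curve is a reparameterization of the second\<close>
  "reparameterization_on a b \<gamma>' \<gamma> \<longleftrightarrow>
     curve_on a b \<gamma>' \<and>
     (\<exists>\<phi>. \<phi> ` {a..b} \<subseteq> {a..b} \<and> continuous_on {a..b} \<phi> \<and> mono_on {a..b} \<phi> \<and>
          (\<forall>t\<in>{a..b}. \<gamma> t = \<gamma>' (\<phi> t)))"

text \<open>The closed curve, traversed starting from parameter value \<open>s\<close> instead of \<open>a\<close>.\<close>

definition cyclic_shift :: "real \<Rightarrow> real \<Rightarrow> real \<Rightarrow> (real \<Rightarrow> real^3) \<Rightarrow> real \<Rightarrow> real^3" where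
  "cyclic_shift a b s \<gamma> t =
     (if t + (s - a) \<le> b then \<gamma> (t + (s - a)) else \<gamma> (t + (s - a) - (b - a)))"

text \<open>On \<^term>\<open>{c..d}\<close> the curve runs monotonically, from one end to the other, through half
  of the circle of radius \<open>r\<close> centred at \<open>p\<close> in the plane spanned by the
  orthonormal vectors \<open>u\<close>, \<open>v\<close>; \<open>\<theta>\<close> is the angle.\<close>

definition traces_semicircle :: "real \<Rightarrow> real \<Rightarrow> (real \<Rightarrow> real^3) \<Rightarrow> real \<Rightarrow> bool" where
  "traces_semicircle c d \<gamma> r \<longleftrightarrow>
     (\<exists>p u v \<theta>. norm u = 1 \<and> norm v = 1 \<and> u \<bullet> v = 0 \<and>
        continuous_on {c..d} \<theta> \<and> mono_on {c..d} \<theta> \<and> \<theta> c = 0 \<and> \<theta> d = pi \<and>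
        (\<forall>t\<in>{c..d}. \<gamma> t = p + r *\<^sub>R (cos (\<theta> t) *\<^sub>R u + sin (\<theta> t) *\<^sub>R v)))"

definition traces_four_semicircles :: "real \<Rightarrow> real \<Rightarrow> (real \<Rightarrow> real^3) \<Rightarrow> real \<Rightarrow> bool" where
  "traces_four_semicircles a b \<gamma> r \<longleftrightarrow>
     (\<exists>s\<in>{a..b}. \<exists>t :: nat \<Rightarrow> real. t 0 = a \<and> t 4 = b \<and>
        (\<forall>i<4. t i < t (Suc i) \<and>
               traces_semicircle (t i) (t (Suc i)) (cyclic_shift a b s \<gamma>) r \<and>
               curve_length (t i) (t (Suc i)) (cyclic_shift a b s \<gamma>) = ereal (pi * r)))"

end

theory Submission
  imports Defs
begin

text \<open>
  Put the centre of the sphere at the origin. A point \<open>y\<close> with \<open>c \<le> norm y\<close> sees the cap of directions \<open>v\<close> with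
  \<open>c * norm v \<le> v \<bullet> y\<close>, and an inscribed sphere of radius \<open>c\<close> means that every direction is seen from the curve.
  Roll an inscribed polygon out into a plane with polar angle \<open>th\<close> and go round it \<open>M\<close> times. Each direction is
  entered at least \<open>M - 1\<close> times, and the solid angle newly entered along an edge is an integral over planes
  through the origin of an increment of a function \<open>capw\<close> of the distance of a vertex. Let \<open>h\<close> be the pointwise
  maximum of the functions \<open>norm (x i) * cs (b - th i)\<close> of the angle \<open>b\<close>. The total of the increments is at most
  twice the integral of \<open>capw\<close> of \<open>h\<close>, the integral of \<open>h\<close> is bounded by the length, and
  \<open>2 * c * capw c h \<le> h\<close>, with equality at \<open>h = sqrt 2 * c\<close>. Dividing by \<open>M\<close> and refining the polygon gives
  \<open>4 * pi * c \<le> L\<close>.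

  In the case of equality scale to \<open>c = 1 / sqrt 2\<close>. The deficit in the estimate forces the curve \<open>s\<close> onto the unit
  sphere, and no open set of directions can be entered twice in one turn. Hence any cap through two parameters
  meets the curve in a restricted way: \<open>s\<close> is differentiable with a Lipschitz derivative \<open>T\<close>, and both caps
  with boundary circle tangent to \<open>s\<close> at \<open>t\<close>, namely those around \<open>s t \<plusminus> n t\<close> with \<open>n = s \<times> T\<close>, contain no point
  of \<open>s\<close> in their interior. Each parameter lies in an arc of contact with one of these caps of at least half a
  circle, and consecutive arcs alternate between the two signs, so there are exactly four of them.
\<close>

text \<open>Two entries of one direction could be counted in overlapping plane regions. This is
  cured by a convexification: each vertex is pushed radially outwards to the largest radius
  \<open>rt\<close> whose cosine arch stays below \<open>h\<close>. Then, at a fixed plane angle and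
  height, the vertices that see it are consecutive, so the entry regions are disjoint and lie below
  the graph of \<open>h\<close>. Pushing outwards can destroy invisibility, however, so an entry is
  guaranteed only between a vertex that sees the opposite direction and one that sees the direction
  itself. This costs one turn, and the two open ends cost \<open>2 * rho 0\<close>; neither grows
  with \<open>M\<close>. The critical radius \<open>sqrt 2 * c\<close> comes from squaring
  \<open>2 * c * sqrt (1 - (c/h)^2) <= h\<close>, which leaves \<open>(h^2 - 2*c^2)^2 >= 0\<close>.
  Polygons satisfy the hypotheses only with a slightly smaller threshold than the curve, so rigidity
  is read off from surpluses that do not shrink with the mesh. No smoothness is available at the
  start: tangents are first cluster points of secants and become unique through the ban on double
  entries.\<close>

text \<open>Cylindrical coordinates of the ball, with the cube of the radius as first coordinate; the Jacobian is constant.\<close>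

definition cyl_map :: "real^3 \<Rightarrow> real^3" where
  "cyl_map v = (\<chi> i. if i = 1 then (v$1) powr (1/3) * (sqrt (1 - (v$3)\<^sup>2) * cos (v$2))
     else if i = 2 then (v$1) powr (1/3) * (sqrt (1 - (v$3)\<^sup>2) * sin (v$2))
     else (v$1) powr (1/3) * v$3)"

definition cyl_deriv :: "real^3 \<Rightarrow> real^3^3" where
  "cyl_deriv v = (let r = (v$1) powr (1/3); r' = r / (3 * v$1); u = sqrt (1 - (v$3)\<^sup>2);
       c = cos (v$2); s = sin (v$2) in
     vector [vector [r' * (u * c), - r * (u * s), - r * (v$3 / u * c)],
             vector [r' * (u * s), r * (u * c), - r * (v$3 / u * s)],
             vector [r' * v$3, 0, r]])"

lemma has_derivative_cyl_map:
  assumes "0 < v$1" "\<bar>v$3\<bar> < 1"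
  shows "(cyl_map has_derivative (\<lambda>h. cyl_deriv v *v h)) (at v within S)"
proof -
  have pos: "(v$3)\<^sup>2 < 1" using assms(2) by (simp add: abs_square_less_1)
  have nth: "((\<lambda>v::real^3. v$i) has_derivative (\<lambda>h. h$i)) (at v within S)" for i
    by (rule bounded_linear_imp_has_derivative) (rule bounded_linear_vec_nth)
  have R: "((\<lambda>v::real^3. (v$1) powr (1/3)) has_derivative
      (\<lambda>h. (v$1) powr (1/3) / (3 * v$1) * h$1)) (at v within S)"
  proof -
    have "((\<lambda>x. x powr (1/3)) has_real_derivative (v$1) powr (1/3) / (3 * v$1)) (at (v$1))"
      using has_real_derivative_powr[of "v$1" "1/3"] assms(1) powr_diff[of "v$1" "1/3" 1]
      by (simp add: mult.commute)
    then have "((\<lambda>x. x powr (1/3)) has_derivative (\<lambda>y. (v$1) powr (1/3) / (3 * v$1) * y)) (at (v$1))"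
      unfolding has_field_derivative_def .
    from has_derivative_compose[OF nth[of 1] this] show ?thesis .
  qed
  have U: "((\<lambda>v::real^3. sqrt (1 - (v$3)\<^sup>2)) has_derivative
      (\<lambda>h. - (v$3 / sqrt (1 - (v$3)\<^sup>2)) * h$3)) (at v within S)"
    using pos by (auto intro!: derivative_eq_intros nth simp: divide_simps)
  have C: "((\<lambda>v::real^3. cos (v$2)) has_derivative (\<lambda>h. - sin (v$2) * h$2)) (at v within S)"
    by (auto intro!: derivative_eq_intros nth)
  have Sn: "((\<lambda>v::real^3. sin (v$2)) has_derivative (\<lambda>h. cos (v$2) * h$2)) (at v within S)"
    by (auto intro!: derivative_eq_intros nth)
  have comp: "((\<lambda>v. cyl_map v $ i) has_derivative (\<lambda>h. (cyl_deriv v *v h) $ i)) (at v within S)" for i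
  proof -
    have "i = 1 \<or> i = 2 \<or> i = 3" using exhaust_3 by blast
    then show ?thesis
    proof (elim disjE)
      assume i: "i = 1"
      show ?thesis unfolding i cyl_map_def
        apply simp
        apply (rule has_derivative_eq_rhs[OF has_derivative_mult[OF R has_derivative_mult[OF U C]]])
        by (simp add: fun_eq_iff matrix_vector_mult_def sum_3 cyl_deriv_def Let_def algebra_simps)
    next
      assume i: "i = 2"
      show ?thesis unfolding i cyl_map_def
        apply simp
        apply (rule has_derivative_eq_rhs[OF has_derivative_mult[OF R has_derivative_mult[OF U Sn]]])
        by (simp add: fun_eq_iff matrix_vector_mult_def sum_3 cyl_deriv_def Let_def algebra_simps)
    next
      assume i: "i = 3"
      show ?thesis unfolding i cyl_map_def
        apply simp
        apply (rule has_derivative_eq_rhs[OF has_derivative_mult[OF R nth]])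
        by (simp add: fun_eq_iff matrix_vector_mult_def sum_3 cyl_deriv_def Let_def algebra_simps)
    qed
  qed
  show ?thesis
    unfolding has_derivative_componentwise_within[of cyl_map]
    using comp by (auto simp: Basis_vec_def inner_axis)
qed

text \<open>This is Archimedes' theorem: projecting the sphere to the cylinder preserves area, and
  the cube of the radius as coordinate absorbs the factor \<open>r^2\<close> of the volume element
  up to \<open>1/3\<close>.\<close>

lemma det_cyl_deriv:
  assumes "0 < v$1" "\<bar>v$3\<bar> < 1"
  shows "det (cyl_deriv v) = 1/3"
proof -
  have pos: "(v$3)\<^sup>2 < 1" using assms(2) by (simp add: abs_square_less_1)
  define r where "r = (v$1) powr (1/3)"
  have r3: "r * (r * r) = v$1"
    using assms by (simp add: r_def powr_add[symmetric] )
  define u where "u = sqrt (1 - (v$3)\<^sup>2)"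
  have u: "u > 0" "u * u = 1 - v$3 * v$3"
    using pos by (auto simp: u_def power2_eq_square[symmetric])
  define c s where "c = cos (v$2)" and "s = sin (v$2)"
  have cs: "c * c + s * s = 1" by (simp add: c_def s_def power2_eq_square[symmetric])
  define k where "k = v$3 / u"
  have k: "k * u = v$3" using u by (simp add: k_def)
  define q where "q = r / (3 * v$1)"
  have D: "det (cyl_deriv v) = q * r * r * ((c * c + s * s) * (u * u) + (v$3 * (k * u)) * (c * c + s * s))"
    unfolding det_3 cyl_deriv_def Let_def r_def[symmetric] u_def[symmetric] c_def[symmetric] s_def[symmetric]
      k_def[symmetric] q_def[symmetric] vector_3
    by (simp add: algebra_simps)
  also have "\<dots> = q * r * r" by (simp add: cs u(2) k)
  also have "\<dots> = (r * (r * r)) / (3 * v$1)" by (simp add: q_def)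
  also have "\<dots> = 1/3" unfolding r3 using assms by simp
  finally show ?thesis .
qed

text \<open>The angle may run over several turns, so \<open>cyl_map\<close> can cover points
  repeatedly; hence an inequality, which is the direction that upper bounds for solid angles
  require.\<close>

lemma measure_cyl_map_image:
  assumes "E \<in> lmeasurable" "\<And>v. v \<in> E \<Longrightarrow> 0 < v$1 \<and> \<bar>v$3\<bar> < 1"
  shows "cyl_map ` E \<in> lmeasurable" "measure lebesgue (cyl_map ` E) \<le> measure lebesgue E / 3"
proof -
  have d: "(cyl_map has_derivative (\<lambda>h. cyl_deriv v *v h)) (at v within E)" if "v \<in> E" for v
    using has_derivative_cyl_map assms(2) that by blast
  have dt: "\<bar>det (matrix (\<lambda>h. cyl_deriv v *v h))\<bar> = 1/3" if "v \<in> E" for v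
    using det_cyl_deriv[of v] assms(2)[OF that] by simp
  have "((\<lambda>v. 1::real) has_integral measure lebesgue E) E"
    using assms(1) lmeasure_integral[OF assms(1)]
    by (simp add: has_integral_integrable_integral lmeasurable_iff_integrable_on)
  from has_integral_mult_right[OF this, of "1/3"]
  have "((\<lambda>v. 1/3::real) has_integral (measure lebesgue E / 3)) E" by simp
  then have hi: "((\<lambda>v. \<bar>det (matrix (\<lambda>h. cyl_deriv v *v h))\<bar>) has_integral (measure lebesgue E / 3)) E"
    using has_integral_cong[of E "\<lambda>v. \<bar>det (matrix (\<lambda>h. cyl_deriv v *v h))\<bar>" "\<lambda>v. 1/3"] dt by blast
  have E: "E \<in> sets lebesgue" using assms(1) by (rule fmeasurableD)
  note M = measurable_differentiable_image[where f = cyl_map and f' = "\<lambda>v h. cyl_deriv v *v h" and S = E]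
    and M' = measure_differentiable_image[where f = cyl_map and f' = "\<lambda>v h. cyl_deriv v *v h" and S = E]
  show "cyl_map ` E \<in> lmeasurable" by (rule M[OF E d has_integral_integrable[OF hi]])
  show "measure lebesgue (cyl_map ` E) \<le> measure lebesgue E / 3"
    using M'[OF E d has_integral_integrable[OF hi]] integral_unique[OF hi] by simp
qed

section \<open>Volume of a region of angles and heights\<close>

lemma measurable_vec3_map: "(\<lambda>(a,b,c). vector [a,b,c] :: real^3) \<in> borel_measurable borel"
proof (rule borel_measurable_continuous_onI)
  show "continuous_on UNIV (\<lambda>(a::real,b,c). vector [a,b,c] :: real^3)"
    unfolding case_prod_beta vector_def
  proof (intro continuous_on_vec_lambda)
    fix i :: 3
    have "i = 1 \<or> i = 2 \<or> i = 3" using exhaust_3 by blast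
    then show "continuous_on UNIV (\<lambda>x::real\<times>real\<times>real. foldr (\<lambda>x f n. (f (n + 1))(n := x)) [fst x, fst (snd x), snd (snd x)] (\<lambda>n x. 0) 1 i)"
      by (elim disjE) (auto intro!: continuous_intros)
  qed
qed

text \<open>Change of variables is carried out in \<open>real^3\<close>, Fubini in iterated
  products; this identification connects the two.\<close>

lemma lborel_vec3:
  "distr (lborel :: (real \<times> real \<times> real) measure) borel (\<lambda>(a,b,c). vector [a,b,c]) = (lborel :: (real^3) measure)"
proof (rule lborel_eqI[symmetric])
  fix l u :: "real^3"
  assume lu: "\<And>b. b \<in> Basis \<Longrightarrow> l \<bullet> b \<le> u \<bullet> b"
  have lu': "l$i \<le> u$i" for i
    using lu[of "axis i 1"] by (simp add: inner_axis)
  have "(\<lambda>(a::real,b::real,c::real). vector [a,b,c] :: real^3) -` box l u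
      = {l$1<..<u$1} \<times> {l$2<..<u$2} \<times> {l$3<..<u$3}"
    by (auto simp: mem_box_cart forall_3)
  then have "emeasure (distr lborel borel (\<lambda>(a,b,c). vector [a,b,c] :: real^3)) (box l u)
      = emeasure (lborel \<Otimes>\<^sub>M (lborel \<Otimes>\<^sub>M lborel)) ({l$1<..<u$1} \<times> {l$2<..<u$2} \<times> {l$3<..<u$3})"
    using measurable_vec3_map by (subst emeasure_distr) (auto simp: lborel_prod)
  also have "\<dots> = ennreal (u$1 - l$1) * (ennreal (u$2 - l$2) * ennreal (u$3 - l$3))"
  proof -
    have o: "{l$2<..<u$2} \<times> {l$3<..<u$3} \<in> sets borel"
      by (intro borel_open open_Times) auto
    have "emeasure (lborel \<Otimes>\<^sub>M lborel) ({l$2<..<u$2} \<times> {l$3<..<u$3}) = ennreal (u$2 - l$2) * ennreal (u$3 - l$3)"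
      using lu' by (subst lborel.emeasure_pair_measure_Times) auto
    then show ?thesis
      using lu' o unfolding lborel_prod[where 'a=real and 'b=real] by (subst lborel.emeasure_pair_measure_Times) auto
  qed
  also have "\<dots> = ennreal ((u$1 - l$1) * ((u$2 - l$2) * (u$3 - l$3)))"
    using lu' by (simp add: ennreal_mult)
  also have "(u$1 - l$1) * ((u$2 - l$2) * (u$3 - l$3)) = (\<Prod>b\<in>Basis. (u - l) \<bullet> b)"
  proof -
    have inj: "inj_on (\<lambda>i. axis i (1::real) :: real^3) UNIV" by (auto simp: inj_on_def axis_eq_axis)
    have B: "(Basis :: (real^3) set) = range (\<lambda>i. axis i 1)" by (auto simp: Basis_vec_def)
    have "(\<Prod>b\<in>Basis. (u - l) \<bullet> b) = (\<Prod>i\<in>UNIV. (u - l) \<bullet> axis i 1)"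
      unfolding B prod.reindex[OF inj] comp_def ..
    also have "\<dots> = (\<Prod>i\<in>{1,2,3::3}. (u - l) $ i)"
      by (intro prod.cong) (auto simp: inner_axis UNIV_3[symmetric])
    also have "\<dots> = (u$1 - l$1) * ((u$2 - l$2) * (u$3 - l$3))" by simp
    finally show ?thesis by (rule sym)
  qed
  finally show "emeasure (distr lborel borel (\<lambda>(a,b,c). vector [a,b,c] :: real^3)) (box l u)
      = (\<Prod>b\<in>Basis. (u - l) \<bullet> b)" by simp
qed simp

text \<open>Half the height of a cap in one angular section: the \<open>z\<close> with
  \<open>c \<le> sqrt (1 - z^2) * d\<close> form the interval of this half-length. Taking
  \<open>max c d\<close> makes the value \<open>0\<close> for \<open>d \<le> c\<close>, where the
  section is at most one point, and keeps the function continuous for positive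
  \<open>c\<close>.\<close>

definition capw :: "real \<Rightarrow> real \<Rightarrow> real" where
  "capw c d = sqrt (1 - (c / max c d)\<^sup>2)"

text \<open>Only the arch around \<open>0\<close> is kept: angles in the rolled-out plane are real
  numbers and not residues, so a vertex must not be seen again one period later.\<close>

definition cs :: "real \<Rightarrow> real" where
  "cs b = (if \<bar>b\<bar> \<le> pi/2 then cos b else 0)"

lemma capw_nonneg: "c > 0 \<Longrightarrow> 0 \<le> capw c d"
  unfolding capw_def by (intro real_sqrt_ge_zero) (simp add: power_le_one)

lemma cs_nonneg: "0 \<le> cs b"
  by (auto simp: cs_def cos_ge_zero)

text \<open>By Fubini: the first coordinate contributes length at most \<open>1\<close>, and above
  each angle \<open>b\<close> the heights fill an interval of half-length
  \<open>capw c (h b)\<close>.\<close>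

lemma cyl_region:
  fixes h :: "real \<Rightarrow> real" and B0 B1 c :: real
  assumes c: "c > 0" and h: "continuous_on UNIV h"
  defines "R \<equiv> {v::real^3. 0 < v$1 \<and> v$1 \<le> 1 \<and> \<bar>v$3\<bar> < 1 \<and> B0 \<le> v$2 \<and> v$2 \<le> B1 \<and>
      c \<le> sqrt (1 - (v$3)\<^sup>2) * h (v$2)}"
  shows "R \<in> sets borel" "R \<in> lmeasurable"
    "measure lebesgue R \<le> integral {B0..B1} (\<lambda>b. 2 * capw c (h b))"
proof -
  have [measurable]: "(\<lambda>v::real^3. v$i) \<in> borel_measurable borel" for i
    by (intro borel_measurable_continuous_onI continuous_intros)
  have [measurable]: "h \<in> borel_measurable borel"
    using h by (rule borel_measurable_continuous_onI)
  show Rb: "R \<in> sets borel" unfolding R_def by measurable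
  have cw: "continuous_on UNIV (\<lambda>b. capw c (h b))"
    unfolding capw_def using c by (intro continuous_intros h) (auto simp: max_def)
  have [measurable]: "(\<lambda>b. capw c (h b)) \<in> borel_measurable borel"
    using cw by (rule borel_measurable_continuous_onI)
  define Q where "Q = {p::real\<times>real. B0 \<le> fst p \<and> fst p \<le> B1 \<and> - capw c (h (fst p)) \<le> snd p \<and> snd p \<le> capw c (h (fst p))}"
  have Qc: "closed Q"
  proof -
    have "continuous_on UNIV (\<lambda>p::real\<times>real. capw c (h (fst p)))"
      by (rule continuous_on_compose2[OF cw]) (auto intro!: continuous_intros)
    then show "closed Q" unfolding Q_def
      by (intro closed_Collect_conj closed_Collect_le continuous_intros)
  qed
  then have Qb: "Q \<in> sets borel" by (rule borel_closed)
  have sub: "(\<lambda>(a,b,c). vector [a,b,c] :: real^3) -` R \<subseteq> {0..1} \<times> Q"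
  proof -
    \<comment> \<open>The assumption forces \<open>d > 0\<close> and \<open>c \<le> d\<close>, so
      the maximum in \<open>capw\<close> is \<open>d\<close> and squaring is harmless.\<close>
    have "\<bar>z\<bar> \<le> capw c d" if "c \<le> sqrt (1 - z\<^sup>2) * d" "\<bar>z\<bar> < 1" for z d
    proof -
      have z: "z\<^sup>2 < 1" using that(2) by (simp add: abs_square_less_1)
      have d: "d > 0" using that(1) c z by (smt (verit) mult_nonneg_nonpos real_sqrt_ge_zero)
      have "sqrt (1 - z\<^sup>2) * d \<le> 1 * d" using d z by (intro mult_right_mono) auto
      then have cd: "c \<le> d" using that(1) by simp
      have "c / d \<le> sqrt (1 - z\<^sup>2)" using that(1) d by (simp add: field_simps)
      then have "(c / d)\<^sup>2 \<le> (sqrt (1 - z\<^sup>2))\<^sup>2" using c d by (intro power_mono) auto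
      then have "(c/d)\<^sup>2 \<le> 1 - z\<^sup>2" using z by simp
      then have "sqrt (z\<^sup>2) \<le> sqrt (1 - (c / d)\<^sup>2)" by (intro real_sqrt_le_mono) simp
      then show ?thesis using cd by (simp add: capw_def max_def)
    qed
    then show ?thesis by (auto simp: R_def Q_def; smt (verit))
  qed
  have QI: "emeasure lborel Q = ennreal (integral {B0..B1} (\<lambda>b. 2 * capw c (h b)))"
  proof -
    have "emeasure (lborel \<Otimes>\<^sub>M lborel) Q = (\<integral>\<^sup>+b. emeasure lborel (Pair b -` Q) \<partial>lborel)"
      by (rule lborel.emeasure_pair_measure_alt) (simp only: lborel_prod sets_lborel Qb)
    also have "\<dots> = (\<integral>\<^sup>+b. ennreal (2 * capw c (h b)) * indicator {B0..B1} b \<partial>lborel)"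
    proof (rule nn_integral_cong)
      fix b
      have "Pair b -` Q = (if b \<in> {B0..B1} then {- capw c (h b)..capw c (h b)} else {})"
        by (auto simp: Q_def)
      then show "emeasure lborel (Pair b -` Q) = ennreal (2 * capw c (h b)) * indicator {B0..B1} b"
        using capw_nonneg[OF c, of "h b"] by simp
    qed
    also have "\<dots> = ennreal (integral {B0..B1} (\<lambda>b. 2 * capw c (h b)))"
    proof (rule nn_integral_has_integral_lebesgue')
      show "((\<lambda>b. 2 * capw c (h b)) has_integral integral {B0..B1} (\<lambda>b. 2 * capw c (h b))) {B0..B1}"
        by (intro integrable_integral integrable_continuous_real continuous_intros continuous_on_subset[OF cw]) auto
    qed (use capw_nonneg[OF c] in auto)
    finally show ?thesis by (simp add: lborel_prod)
  qed
  have "emeasure lborel R = emeasure (lborel :: (real\<times>real\<times>real) measure) ((\<lambda>(a,b,c). vector [a,b,c] :: real^3) -` R)"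
    using Rb measurable_vec3_map by (subst lborel_vec3[symmetric], subst emeasure_distr) auto
  also have "\<dots> \<le> emeasure (lborel \<Otimes>\<^sub>M lborel) ({0..1::real} \<times> Q)"
    unfolding lborel_prod
  proof (rule emeasure_mono[OF sub])
    show "{0..1::real} \<times> Q \<in> sets lborel" by (simp add: borel_closed closed_Times Qc)
  qed
  also have "\<dots> = emeasure lborel Q"
    using Qb by (subst lborel.emeasure_pair_measure_Times) auto
  finally have le: "emeasure lborel R \<le> ennreal (integral {B0..B1} (\<lambda>b. 2 * capw c (h b)))"
    unfolding QI .
  then have le': "emeasure lebesgue R \<le> ennreal (integral {B0..B1} (\<lambda>b. 2 * capw c (h b)))"
    using Rb by simp
  show "R \<in> lmeasurable"
    using Rb le_less_trans[OF le' ennreal_less_top] by (intro fmeasurableI) auto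
  have "0 \<le> integral {B0..B1} (\<lambda>b. 2 * capw c (h b))"
    by (intro integral_nonneg integrable_continuous_real continuous_intros continuous_on_subset[OF cw])
      (use capw_nonneg[OF c] in auto)
  then show "measure lebesgue R \<le> integral {B0..B1} (\<lambda>b. 2 * capw c (h b))"
    unfolding measure_def using le' enn2real_mono[OF le'] by simp
qed

section \<open>Directions newly seen along an edge\<close>

lemma orthonormal_expansion:
  fixes e1 e2 v :: "real^3"
  assumes "norm e1 = 1" "norm e2 = 1" "e1 \<bullet> e2 = 0"
  shows "(norm v)\<^sup>2 = (v \<bullet> e1)\<^sup>2 + (v \<bullet> e2)\<^sup>2 + (v \<bullet> cross3 e1 e2)\<^sup>2"
    "v = (v \<bullet> e1) *\<^sub>R e1 + (v \<bullet> e2) *\<^sub>R e2 + (v \<bullet> cross3 e1 e2) *\<^sub>R cross3 e1 e2"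
proof -
  have e: "e1 \<bullet> e1 = 1" "e2 \<bullet> e2 = 1" "e2 \<bullet> e1 = 0" using assms
    by (simp_all add: norm_eq_1 inner_commute)
  \<comment> \<open>The square of a triple product is the Gram determinant of its three
    vectors.\<close>
  have gram: "(w \<bullet> cross3 e1 e2)\<^sup>2 = (w \<bullet> w) * ((e1 \<bullet> e1) * (e2 \<bullet> e2) - (e1 \<bullet> e2)\<^sup>2)
     - (w \<bullet> e1) * ((w \<bullet> e1) * (e2 \<bullet> e2) - (e1 \<bullet> e2) * (w \<bullet> e2))
     + (w \<bullet> e2) * ((w \<bullet> e1) * (e1 \<bullet> e2) - (e1 \<bullet> e1) * (w \<bullet> e2))" for w :: "real^3"
    unfolding cross3_def inner_vec_def sum_3 power2_eq_square vector_3 by (simp add: algebra_simps)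
  have g: "(norm w)\<^sup>2 = (w \<bullet> e1)\<^sup>2 + (w \<bullet> e2)\<^sup>2 + (w \<bullet> cross3 e1 e2)\<^sup>2" for w
    unfolding power2_norm_eq_inner using gram[of w] e assms(3) by (simp add: power2_eq_square)
  show "(norm v)\<^sup>2 = (v \<bullet> e1)\<^sup>2 + (v \<bullet> e2)\<^sup>2 + (v \<bullet> cross3 e1 e2)\<^sup>2" by (rule g)
  have c3: "cross3 e1 e2 \<bullet> cross3 e1 e2 = 1" "e1 \<bullet> cross3 e1 e2 = 0" "e2 \<bullet> cross3 e1 e2 = 0"
    "cross3 e1 e2 \<bullet> e1 = 0" "cross3 e1 e2 \<bullet> e2 = 0"
    using norm_cross_dot[of e1 e2] assms by (auto simp: dot_cross_self power2_norm_eq_inner)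
  let ?w = "v - ((v \<bullet> e1) *\<^sub>R e1 + (v \<bullet> e2) *\<^sub>R e2 + (v \<bullet> cross3 e1 e2) *\<^sub>R cross3 e1 e2)"
  have "(norm ?w)\<^sup>2 = 0"
    unfolding g[of ?w] using e c3 assms(3) by (simp add: inner_simps)
  then show "v = (v \<bullet> e1) *\<^sub>R e1 + (v \<bullet> e2) *\<^sub>R e2 + (v \<bullet> cross3 e1 e2) *\<^sub>R cross3 e1 e2" by simp
qed

text \<open>In the plane of an edge with end points at the angles \<theta> and \<theta>', a
  direction with angle \<open>b\<close> and height \<open>z\<close> sees the end point with inner
  product proportional to \<open>sqrt (1 - z^2) * \<rho> * cos (b - \<theta>)\<close>. The angles
  are prescribed from outside, so that edges lying in different planes of space use one common
  strip.\<close>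

lemma cap_entry_measure:
  fixes e1 e2 :: "real^3"
  assumes e: "norm e1 = 1" "norm e2 = 1" "e1 \<bullet> e2 = 0" and c: "c > 0" and rho: "\<rho> > 0" "\<rho>' > 0"
    and y: "y = \<rho> *\<^sub>R (cos \<theta> *\<^sub>R e1 + sin \<theta> *\<^sub>R e2)" and y': "y' = \<rho>' *\<^sub>R (cos \<theta>' *\<^sub>R e1 + sin \<theta>' *\<^sub>R e2)"
    and B: "B0 \<le> \<theta>' - pi/2" "\<theta>' + pi/2 \<le> B1"
    and E: "E = {v::real^3. 0 < v$1 \<and> v$1 \<le> 1 \<and> \<bar>v$3\<bar> < 1 \<and> B0 \<le> v$2 \<and> v$2 \<le> B1 \<and>
      c \<le> sqrt (1 - (v$3)\<^sup>2) * (\<rho>' * cs (v$2 - \<theta>')) \<and> sqrt (1 - (v$3)\<^sup>2) * (\<rho> * cs (v$2 - \<theta>)) < c}"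
      "E \<in> lmeasurable"
    and S: "S = {v. norm v \<le> 1 \<and> c * norm v \<le> v \<bullet> y' \<and> v \<bullet> y < c * norm v}"
  shows "S \<in> lmeasurable" "measure lebesgue S \<le> measure lebesgue E / 3"
proof -
  define A where "A = (\<lambda>v::real^3. v$1 *\<^sub>R e1 + v$2 *\<^sub>R e2 + v$3 *\<^sub>R cross3 e1 e2)"
  have lin: "linear A" unfolding A_def by (intro linearI) (auto simp: algebra_simps)
  have e': "e1 \<bullet> e1 = 1" "e2 \<bullet> e2 = 1" "e2 \<bullet> e1 = 0" using e
    by (simp_all add: norm_eq_1 inner_commute)
  have c3: "cross3 e1 e2 \<bullet> cross3 e1 e2 = 1" "e1 \<bullet> cross3 e1 e2 = 0" "e2 \<bullet> cross3 e1 e2 = 0"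
    "cross3 e1 e2 \<bullet> e1 = 0" "cross3 e1 e2 \<bullet> e2 = 0"
    using norm_cross_dot[of e1 e2] e by (auto simp: dot_cross_self power2_norm_eq_inner)
  have orth: "orthogonal_transformation A"
    unfolding orthogonal_transformation_def
  proof (intro conjI lin allI)
    fix v w
    have "A v \<bullet> A w = v$1 * w$1 + v$2 * w$2 + v$3 * w$3"
      using e' e(3) c3 by (simp add: A_def inner_simps)
    then show "A v \<bullet> A w = v \<bullet> w" by (simp add: inner_vec_def sum_3)
  qed
  have bor: "S \<in> sets borel" unfolding S by measurable
  have bdd: "bounded S" unfolding S by (rule bounded_subset[OF bounded_cball[of 0 1]]) auto
  show Sm: "S \<in> lmeasurable" using bor bdd by (intro bounded_set_imp_lmeasurable) auto
  have Epos: "0 < v$1 \<and> \<bar>v$3\<bar> < 1" if "v \<in> E" for v using that unfolding E(1) by blast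
  note cyl = measure_cyl_map_image[OF E(2) Epos]
  have sub: "S \<subseteq> A ` (cyl_map ` E)"
  proof
    fix v assume vS: "v \<in> S"
    then have v: "norm v \<le> 1" "c * norm v \<le> v \<bullet> y'" "v \<bullet> y < c * norm v" unfolding S by auto
    define R where "R = norm v"
    have "v \<noteq> 0" using v(3) by (metis inner_zero_left less_irrefl mult_zero_right norm_zero)
    then have R: "R > 0" by (simp add: R_def)
    define z where "z = (v \<bullet> cross3 e1 e2) / R"
    define X where "X = (v \<bullet> e1) * cos \<theta>' + (v \<bullet> e2) * sin \<theta>'"
    define Y where "Y = - (v \<bullet> e1) * sin \<theta>' + (v \<bullet> e2) * cos \<theta>'"
    have XY: "X\<^sup>2 + Y\<^sup>2 = (v \<bullet> e1)\<^sup>2 + (v \<bullet> e2)\<^sup>2"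
    proof -
      have "X\<^sup>2 + Y\<^sup>2 = ((v \<bullet> e1)\<^sup>2 + (v \<bullet> e2)\<^sup>2) * ((cos \<theta>')\<^sup>2 + (sin \<theta>')\<^sup>2)"
        unfolding X_def Y_def by algebra
      then show ?thesis by simp
    qed
    have vy': "v \<bullet> y' = \<rho>' * X" by (simp add: y' X_def inner_simps algebra_simps)
    have "0 < \<rho>' * X" using v(2) mult_pos_pos[OF c R] unfolding vy' R_def by linarith
    then have X: "X > 0" using rho(2) by (rule zero_less_mult_pos)
    have n2: "R\<^sup>2 = X\<^sup>2 + Y\<^sup>2 + (R * z)\<^sup>2"
      using orthonormal_expansion(1)[OF e, of v] R XY by (simp add: R_def z_def)
    define u where "u = sqrt (1 - z\<^sup>2)"
    have Ru: "R\<^sup>2 * (1 - z\<^sup>2) = X\<^sup>2 + Y\<^sup>2" using n2 by (simp add: power_mult_distrib algebra_simps)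
    have "X\<^sup>2 + Y\<^sup>2 > 0" using X by (simp add: add_pos_nonneg)
    then have z1: "z\<^sup>2 < 1" using Ru R zero_less_mult_pos[of "R\<^sup>2" "1 - z\<^sup>2"] by simp
    then have u: "u > 0" "u\<^sup>2 = 1 - z\<^sup>2" by (auto simp: u_def)
    \<comment> \<open>The angle of the projection of \<open>v\<close> relative to \<open>y'\<close>.
      The arcsine gives it because \<open>X > 0\<close> puts the projection into the open half-plane
      around \<open>y'\<close>.\<close>
    define \<delta> where "\<delta> = arcsin (Y / (R * u))"
    have Ru2: "(R * u)\<^sup>2 = X\<^sup>2 + Y\<^sup>2" using Ru u by (simp add: power_mult_distrib)
    have Yb: "(Y / (R * u))\<^sup>2 \<le> 1" using Ru2 R u \<open>X\<^sup>2 + Y\<^sup>2 > 0\<close> by (simp add: power_divide)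
    then have "\<bar>Y / (R * u)\<bar> \<le> 1" by (simp only: abs_square_le_1)
    then have Yb': "-1 \<le> Y / (R * u)" "Y / (R * u) \<le> 1" by linarith+
    have sd: "R * u * sin \<delta> = Y" unfolding \<delta>_def using Yb' R u by simp
    have cd: "R * u * cos \<delta> = X"
    proof -
      have "cos \<delta> = sqrt (1 - (Y / (R * u))\<^sup>2)" unfolding \<delta>_def using Yb' by (rule cos_arcsin)
      also have "1 - (Y / (R * u))\<^sup>2 = (X / (R * u))\<^sup>2"
      proof -
        have "X\<^sup>2 / (R * u)\<^sup>2 + Y\<^sup>2 / (R * u)\<^sup>2 = 1"
          using X by (simp add: Ru2 add_divide_distrib[symmetric])
        then show ?thesis unfolding power_divide by linarith
      qed
      also have "sqrt \<dots> = X / (R * u)" using X R u by simp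
      finally show ?thesis using R u by simp
    qed
    have db: "- (pi/2) \<le> \<delta>" "\<delta> \<le> pi/2" unfolding \<delta>_def using Yb' arcsin_bounded by auto
    define b where "b = \<theta>' + \<delta>"
    have ve1: "v \<bullet> e1 = R * u * cos b"
    proof -
      have "R * u * cos b = X * cos \<theta>' - Y * sin \<theta>'" unfolding b_def cos_add sd[symmetric] cd[symmetric]
        by (simp add: algebra_simps)
      also have "\<dots> = (v \<bullet> e1) * ((cos \<theta>')\<^sup>2 + (sin \<theta>')\<^sup>2)"
        unfolding X_def Y_def by algebra
      finally show ?thesis by simp
    qed
    have ve2: "v \<bullet> e2 = R * u * sin b"
    proof -
      have "R * u * sin b = X * sin \<theta>' + Y * cos \<theta>'" unfolding b_def sin_add sd[symmetric] cd[symmetric]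
        by (simp add: algebra_simps)
      also have "\<dots> = (v \<bullet> e2) * ((cos \<theta>')\<^sup>2 + (sin \<theta>')\<^sup>2)"
        unfolding X_def Y_def by algebra
      finally show ?thesis by simp
    qed
    define p :: "real^3" where "p = vector [R ^ 3, b, z]"
    have root: "(R ^ 3) powr (1/3) = R"
    proof -
      have "(R ^ 3) powr (1/3) = (R powr real 3) powr (1/3)" by (simp only: powr_realpow[OF R])
      also have "\<dots> = R powr (real 3 * (1/3))" by (rule powr_powr)
      also have "\<dots> = R" using R by simp
      finally show ?thesis .
    qed
    have vz: "v \<bullet> cross3 e1 e2 = R * z" using R by (simp add: z_def)
    have "v = (R * u * cos b) *\<^sub>R e1 + (R * u * sin b) *\<^sub>R e2 + (R * z) *\<^sub>R cross3 e1 e2"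
      using orthonormal_expansion(2)[OF e, of v] unfolding ve1 ve2 vz .
    moreover have "A (cyl_map p) = (R * u * cos b) *\<^sub>R e1 + (R * u * sin b) *\<^sub>R e2 + (R * z) *\<^sub>R cross3 e1 e2"
      by (simp add: A_def cyl_map_def p_def root u_def[symmetric] algebra_simps)
    ultimately have "A (cyl_map p) = v" by metis
    moreover have "p \<in> E"
    proof -
      have 1: "c \<le> u * (\<rho>' * cs (b - \<theta>'))"
      proof -
        have "c * R \<le> (u * (\<rho>' * cos \<delta>)) * R" using v(2) unfolding vy' R_def[symmetric] cd[symmetric] by (simp add: mult_ac)
        then have "c \<le> u * (\<rho>' * cos \<delta>)" using R by simp
        moreover have "\<bar>\<delta>\<bar> \<le> pi/2" using db by linarith
        ultimately show ?thesis by (simp add: b_def cs_def)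
      qed
      \<comment> \<open>If \<open>b\<close> is more than a quarter turn away from \<theta>, the
        truncated cosine vanishes and the condition is \<open>0 < c\<close>.\<close>
      have 2: "u * (\<rho> * cs (b - \<theta>)) < c"
      proof (cases "\<bar>b - \<theta>\<bar> \<le> pi/2")
        case True
        have "v \<bullet> y = (u * (\<rho> * cos (b - \<theta>))) * R"
          unfolding y cos_diff by (simp add: inner_simps ve1 ve2 algebra_simps)
        then have "(u * (\<rho> * cos (b - \<theta>))) * R < c * R" using v(3) unfolding R_def[symmetric] by simp
        then have "u * (\<rho> * cos (b - \<theta>)) < c" using R by (simp only: mult_less_cancel_right_pos)
        then show ?thesis using True by (simp add: cs_def)
      qed (use c in \<open>simp add: cs_def\<close>)
      have "\<bar>z\<bar> < 1" using z1 by (simp add: abs_square_less_1)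
      moreover have "R ^ 3 \<le> 1" using R v(1) by (simp add: power_le_one R_def)
      ultimately show ?thesis using 1 2 R B db unfolding E(1) p_def u_def by (auto simp: b_def)
    qed
    ultimately show "v \<in> A ` (cyl_map ` E)" by (metis imageI)
  qed
  have "measure lebesgue S \<le> measure lebesgue (A ` (cyl_map ` E))"
    by (intro measure_mono_fmeasurable[OF sub] measurable_orthogonal_image[OF orth cyl(1)]) (use Sm in auto)
  \<comment> \<open>The frame enters only through the rotation \<open>A\<close>, which preserves
    volume.\<close>
  also have "\<dots> = measure lebesgue (cyl_map ` E)" by (rule measure_orthogonal_image[OF orth cyl(1)])
  finally show "measure lebesgue S \<le> measure lebesgue E / 3" using cyl(2) by simp
qed

section \<open>Integrals of truncated cosines\<close>

lemma cs_eq: "cs b = max 0 (cos (max (- pi) (min pi b)))"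
proof -
  consider "\<bar>b\<bar> \<le> pi/2" | "pi/2 < \<bar>b\<bar>" "\<bar>b\<bar> \<le> pi" | "pi < \<bar>b\<bar>" by linarith
  then show ?thesis
  proof cases
    case 1
    have "max (- pi) (min pi b) = b" using 1 pi_gt_zero by (simp add: abs_le_iff)
    then show ?thesis using 1 cos_ge_zero[of b] by (simp add: cs_def abs_le_iff)
  next
    case 2
    have m: "max (- pi) (min pi b) = b" using 2(2) by (simp add: abs_le_iff)
    have "cos \<bar>b\<bar> \<le> cos (pi/2)" using 2 by (intro cos_monotone_0_pi_le) auto
    then have "cos b \<le> 0" by simp
    then show ?thesis using 2 m by (simp add: cs_def)
  next
    case 3
    then have "max (- pi) (min pi b) = pi \<or> max (- pi) (min pi b) = - pi"
      using pi_gt_zero by linarith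
    then have "cos (max (- pi) (min pi b)) = -1" by auto
    then show ?thesis using 3 pi_gt_zero by (simp add: cs_def)
  qed
qed

text \<open>The clamped form \<open>cs_eq\<close> is a composite of continuous functions, unlike the
  definition by cases.\<close>

lemma continuous_on_cs [continuous_intros]:
  fixes f :: "real \<Rightarrow> real"
  shows "continuous_on S f \<Longrightarrow> continuous_on S (\<lambda>b. cs (f b))"
  unfolding cs_eq
  by (intro continuous_on_max continuous_on_min continuous_on_const continuous_on_cos)

lemma cs_le_1: "cs b \<le> 1" by (simp add: cs_def)

lemma cs_eq_cos: "- (pi/2) \<le> b \<Longrightarrow> b \<le> pi/2 \<Longrightarrow> cs b = cos b"
proof -
  assume "- (pi/2) \<le> b" "b \<le> pi/2"
  then have "\<bar>b\<bar> \<le> pi/2" by linarith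
  then show ?thesis by (simp add: cs_def)
qed

lemma cs_eq_0: "b \<le> - (pi/2) \<or> pi/2 \<le> b \<Longrightarrow> cs b = 0"
proof (cases "\<bar>b\<bar> \<le> pi/2")
  case True
  moreover assume "b \<le> - (pi/2) \<or> pi/2 \<le> b"
  ultimately have "b = - (pi/2) \<or> b = pi/2" by linarith
  then have "cos b = 0" by (metis cos_minus cos_pi_half)
  then show ?thesis by (simp add: cs_def)
qed (simp add: cs_def)

lemma has_integral_scaled_cs:
  assumes "lo \<le> t - pi/2" "t + pi/2 \<le> hi"
  shows "((\<lambda>b. r * cs (b - t)) has_integral 2 * r) {lo..hi}"
proof -
  have 1: "((\<lambda>b. r * cs (b - t)) has_integral 0) {lo..t - pi/2}"
  by (rule has_integral_is_0) (auto intro!: cs_eq_0)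
  have 3: "((\<lambda>b. r * cs (b - t)) has_integral 0) {t + pi/2..hi}"
  by (rule has_integral_is_0) (auto intro!: cs_eq_0)
  have 2: "((\<lambda>b. r * cs (b - t)) has_integral 2 * r) {t - pi/2..t + pi/2}"
  proof (rule has_integral_eq)
    have "((\<lambda>b. r * cos (b - t)) has_integral (r * sin (t + pi/2 - t) - r * sin (t - pi/2 - t))) {t - pi/2..t + pi/2}"
      by (rule fundamental_theorem_of_calculus)
        (auto intro!: derivative_eq_intros simp flip: has_real_derivative_iff_has_vector_derivative)
    then show "((\<lambda>b. r * cos (b - t)) has_integral 2 * r) {t - pi/2..t + pi/2}" by simp
  qed (auto simp: cs_eq_cos)
  have "((\<lambda>b. r * cs (b - t)) has_integral (0 + 2 * r)) {lo..t + pi/2}"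
    by (rule has_integral_combine[OF _ _ 1 2]) (use assms in auto)
  then have "((\<lambda>b. r * cs (b - t)) has_integral (0 + 2 * r + 0)) {lo..hi}"
    by (rule has_integral_combine[OF _ _ _ 3, rotated 2]) (use assms in \<open>auto simp: pi_ge_zero intro: order_trans\<close>)
  then show ?thesis by simp
qed

text \<open>A form of Crofton's formula: \<open>A\<close> is the length of the third side of the
  triangle with sides \<open>r\<close>, \<open>r'\<close> and angle \<open>f\<close>, and where both
  arches are positive their difference is the projection of that side to the direction
  \<open>b\<close>, a sinusoid of amplitude \<open>A\<close>. The pieces where only one arch is
  positive combine with the two middle pieces to exactly \<open>2 * G b0\<close>, with
  \<open>G\<close> the primitive of this sinusoid.\<close>

lemma integral_abs_diff_cs:
  assumes r: "r > 0" "r' > 0" and f: "0 \<le> f" "f \<le> pi/2"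
    and lh: "lo \<le> t - pi/2" "t + f + pi/2 \<le> hi"
    and A: "A \<ge> 0" "A\<^sup>2 = r\<^sup>2 + r'\<^sup>2 - 2 * r * r' * cos f"
  shows "integral {lo..hi} (\<lambda>b. \<bar>r * cs (b - t) - r' * cs (b - (t + f))\<bar>) \<le> 2 * A"
proof (cases "f = 0")
  case True
  have "\<bar>r * cs (b - t) - r' * cs (b - (t + f))\<bar> = \<bar>r - r'\<bar> * cs (b - t)" for b
    using True cs_nonneg[of "b - t"] by (simp add: left_diff_distrib[symmetric] abs_mult)
  then have "integral {lo..hi} (\<lambda>b. \<bar>r * cs (b - t) - r' * cs (b - (t + f))\<bar>) = 2 * \<bar>r - r'\<bar>"
    using has_integral_scaled_cs[of lo t hi "\<bar>r - r'\<bar>"] lh True by (simp only: integral_unique)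
  moreover have "A\<^sup>2 = \<bar>r - r'\<bar>\<^sup>2" using A True by (simp add: power2_diff)
  then have "A = \<bar>r - r'\<bar>" using A(1) by (auto simp: power2_eq_iff)
  ultimately show ?thesis by simp
next
  case False
  with f have fp: "f > 0" by simp
  define D where "D = (\<lambda>b. \<bar>r * cs (b - t) - r' * cs (b - (t + f))\<bar>)"
  define F where "F = (\<lambda>b. r * cos (b - t) - r' * cos (b - (t + f)))"
  define G where "G = (\<lambda>b. r * sin (b - t) - r' * sin (b - (t + f)))"
  have GF: "(G has_vector_derivative F b) (at b within S)" for b S
    unfolding G_def F_def
    by (auto intro!: derivative_eq_intros simp flip: has_real_derivative_iff_has_vector_derivative)
  have c1: "cos (t + f - pi/2 - t) = sin f" by (simp add: cos_diff)
  have s1: "sin (t + f - pi/2 - t) = - cos f" by (simp add: sin_diff)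
  have c2: "cos (t + pi/2 - (t + f)) = sin f" by (simp add: cos_diff cos_add sin_diff)
  have s2: "sin (t + pi/2 - (t + f)) = cos f" by (simp add: cos_diff cos_add sin_diff)
  have s3: "sin (t + f - pi/2 - (t + f)) = -1" "cos (t + f - pi/2 - (t + f)) = 0" by simp_all
  have s4: "sin (t + pi/2 - t) = 1" "cos (t + pi/2 - t) = 0" by simp_all
  have sf: "sin f \<ge> 0" using f by (intro sin_ge_zero) auto
  have Fl: "F (t + f - pi/2) \<ge> 0" unfolding F_def c1 s3 using r sf by simp
  have Fr: "F (t + pi/2) \<le> 0" unfolding F_def c2 s4 using r sf by simp
  have Fc: "continuous_on {t + f - pi/2..t + pi/2} F" unfolding F_def by (intro continuous_intros)
  \<comment> \<open>At \<open>b0\<close> the direction is orthogonal to the side, which is where the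
    absolute value changes its branch.\<close>
  obtain b0 where b0: "t + f - pi/2 \<le> b0" "b0 \<le> t + pi/2" "F b0 = 0"
    using IVT2'[of F "t + pi/2" 0 "t + f - pi/2"] Fl Fr Fc f pi_gt_zero by auto
  define k where "k = - r * sin (b0 - t) + r' * sin (b0 - (t + f))"
  have Fk: "F b = k * sin (b - b0)" for b
  proof -
    have "F b = F b0 * cos (b - b0) + k * sin (b - b0)"
    proof -
      have e1: "b - t = (b0 - t) + (b - b0)" and e2: "b - (t + f) = (b0 - (t + f)) + (b - b0)" by auto
      show ?thesis unfolding F_def k_def by (subst e1, subst e2) (simp only: cos_add, simp add: algebra_simps)
    qed
    then show ?thesis using b0 by simp
  qed
  \<comment> \<open>A positive \<open>k\<close> would contradict the signs of \<open>F\<close> found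
    at the ends of the overlap of the two arches.\<close>
  have k: "k \<le> 0"
  proof (rule ccontr)
    assume "\<not> k \<le> 0"
    then have k: "k > 0" by simp
    show False
    proof (cases "b0 < t + pi/2")
      case True
      then have "sin (t + pi/2 - b0) > 0" using b0 fp by (intro sin_gt_zero) linarith+
      then have "F (t + pi/2) > 0" unfolding Fk using k by simp
      then show False using Fr by simp
    next
      case False
      then have b: "b0 = t + pi/2" using b0 by linarith
      have "sin (b0 - (t + f - pi/2)) > 0" using b fp f pi_gt_zero by (intro sin_gt_zero) linarith+
      then have "sin (t + f - pi/2 - b0) < 0" using sin_minus[of "b0 - (t + f - pi/2)"] by simp
      then have "F (t + f - pi/2) < 0" unfolding Fk using k by (rule mult_pos_neg[rotated])
      then show False using Fl by simp
    qed
  qed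
  have Fpos: "F b \<ge> 0" if "t + f - pi/2 \<le> b" "b \<le> b0" for b
  proof -
    have "sin (b0 - b) \<ge> 0" using that b0 f by (intro sin_ge_zero) auto
    then have "sin (b - b0) \<le> 0" using sin_minus[of "b0 - b"] by simp
    then show ?thesis unfolding Fk using k by (simp add: mult_nonpos_nonpos)
  qed
  have Fneg: "F b \<le> 0" if "b0 \<le> b" "b \<le> t + pi/2" for b
  proof -
    have "sin (b - b0) \<ge> 0" using that b0 f by (intro sin_ge_zero) auto
    then show ?thesis unfolding Fk using k by (simp add: mult_nonpos_nonneg)
  qed
  have 0: "(D has_integral 0) {lo..t - pi/2}"
  by (rule has_integral_is_0) (use f in \<open>auto simp: D_def cs_eq_0\<close>)
  have 1: "(D has_integral r * (1 - cos f)) {t - pi/2..t + f - pi/2}"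
  proof (rule has_integral_eq[rotated])
    have "((\<lambda>b. r * cos (b - t)) has_integral (r * sin (t + f - pi/2 - t) - r * sin (t - pi/2 - t))) {t - pi/2..t + f - pi/2}"
      by (rule fundamental_theorem_of_calculus)
        (use f in \<open>auto intro!: derivative_eq_intros simp flip: has_real_derivative_iff_has_vector_derivative\<close>)
    then show "((\<lambda>b. r * cos (b - t)) has_integral r * (1 - cos f)) {t - pi/2..t + f - pi/2}"
      unfolding s1 by (simp add: algebra_simps)
    fix b assume b: "b \<in> {t - pi/2..t + f - pi/2}"
    then have c: "cs (b - t) = cos (b - t)" "cs (b - (t + f)) = 0" using f by (auto intro!: cs_eq_cos cs_eq_0)
    show "r * cos (b - t) = D b" unfolding D_def c(2) using c(1) cs_nonneg[of "b - t"] r by simp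
  qed
  have mid: "D b = \<bar>F b\<bar>" if "t + f - pi/2 \<le> b" "b \<le> t + pi/2" for b
    using that f by (simp add: D_def F_def cs_eq_cos)
  have 2: "(D has_integral (G b0 - G (t + f - pi/2))) {t + f - pi/2..b0}"
  proof (rule has_integral_eq)
    show "(F has_integral (G b0 - G (t + f - pi/2))) {t + f - pi/2..b0}"
      by (rule fundamental_theorem_of_calculus) (use b0 GF in auto)
    show "F b = D b" if "b \<in> {t + f - pi/2..b0}" for b
      using that Fpos[of b] mid[of b] b0 by auto
  qed
  have 3: "(D has_integral (- (G (t + pi/2) - G b0))) {b0..t + pi/2}"
  proof (rule has_integral_eq)
    show "((\<lambda>b. - F b) has_integral (- (G (t + pi/2) - G b0))) {b0..t + pi/2}"
      by (intro has_integral_neg fundamental_theorem_of_calculus) (use b0 GF in auto)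
    show "- F b = D b" if "b \<in> {b0..t + pi/2}" for b
      using that Fneg[of b] mid[of b] b0 by auto
  qed
  have 4: "(D has_integral r' * (1 - cos f)) {t + pi/2..t + f + pi/2}"
  proof (rule has_integral_eq[rotated])
    have "((\<lambda>b. r' * cos (b - (t + f))) has_integral (r' * sin (t + f + pi/2 - (t + f)) - r' * sin (t + pi/2 - (t + f)))) {t + pi/2..t + f + pi/2}"
      by (rule fundamental_theorem_of_calculus)
        (use f in \<open>auto intro!: derivative_eq_intros simp flip: has_real_derivative_iff_has_vector_derivative\<close>)
    then show "((\<lambda>b. r' * cos (b - (t + f))) has_integral r' * (1 - cos f)) {t + pi/2..t + f + pi/2}"
      unfolding s2 by (simp add: algebra_simps)
    fix b assume b: "b \<in> {t + pi/2..t + f + pi/2}"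
    then have c: "cs (b - (t + f)) = cos (b - (t + f))" "cs (b - t) = 0" using f by (auto intro!: cs_eq_cos cs_eq_0)
    show "r' * cos (b - (t + f)) = D b" unfolding D_def c(2) using c(1) cs_nonneg[of "b - (t + f)"] r by simp
  qed
  have 5: "(D has_integral 0) {t + f + pi/2..hi}"
  by (rule has_integral_is_0) (use f in \<open>auto simp: D_def cs_eq_0\<close>)
  have i1: "(D has_integral 0 + r * (1 - cos f)) {lo..t + f - pi/2}"
    by (rule has_integral_combine[OF _ _ 0 1]) (use lh f in linarith)+
  have i2: "(D has_integral 0 + r * (1 - cos f) + (G b0 - G (t + f - pi/2))) {lo..b0}"
    by (rule has_integral_combine[OF _ _ i1 2]) (use lh f b0 in linarith)+
  have i3: "(D has_integral 0 + r * (1 - cos f) + (G b0 - G (t + f - pi/2)) + (- (G (t + pi/2) - G b0))) {lo..t + pi/2}"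
    by (rule has_integral_combine[OF _ _ i2 3]) (use lh f b0 in linarith)+
  have i4: "(D has_integral 0 + r * (1 - cos f) + (G b0 - G (t + f - pi/2)) + (- (G (t + pi/2) - G b0)) + r' * (1 - cos f)) {lo..t + f + pi/2}"
    by (rule has_integral_combine[OF _ _ i3 4]) (use lh f b0 in linarith)+
  have "(D has_integral 0 + r * (1 - cos f) + (G b0 - G (t + f - pi/2)) + (- (G (t + pi/2) - G b0)) + r' * (1 - cos f) + 0) {lo..hi}"
    by (rule has_integral_combine[OF _ _ i4 5]) (use lh f b0 in linarith)+
  moreover have "0 + r * (1 - cos f) + (G b0 - G (t + f - pi/2)) + (- (G (t + pi/2) - G b0)) + r' * (1 - cos f) + 0 = 2 * G b0"
  proof -
    have "G (t + f - pi/2) = - r * cos f + r'" "G (t + pi/2) = r - r' * cos f"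
      unfolding G_def s1 s2 s3 s4 by simp_all
    then show ?thesis by (simp add: algebra_simps)
  qed
  ultimately have I: "integral {lo..hi} D = 2 * G b0" by (simp add: integral_unique)
  have "G b0 \<le> A"
  proof -
    \<comment> \<open>Sinusoid and primitive are the two coordinates of one vector of length
      \<open>A\<close>.\<close>
    have "(G b0)\<^sup>2 + (F b0)\<^sup>2 = A\<^sup>2"
    proof -
      define y where "y = b0 - t"
      have e: "b0 - (t + f) = y - f" by (simp add: y_def)
      have "(G b0)\<^sup>2 + (F b0)\<^sup>2 = r\<^sup>2 * ((sin y)\<^sup>2 + (cos y)\<^sup>2) + r'\<^sup>2 * ((sin (y - f))\<^sup>2 + (cos (y - f))\<^sup>2)
          - 2 * r * r' * (cos y * cos (y - f) + sin y * sin (y - f))"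
        unfolding G_def F_def e y_def[symmetric] by (simp only: power2_eq_square) algebra
      also have "cos y * cos (y - f) + sin y * sin (y - f) = cos f"
        using cos_diff[of y "y - f"] by simp
      finally show ?thesis using A by simp
    qed
    then have "(G b0)\<^sup>2 \<le> A\<^sup>2" using b0 by simp
    then show ?thesis using A(1) by (rule power2_le_imp_le)
  qed
  then show ?thesis using I unfolding D_def by simp
qed

section \<open>Running maxima, counting of entries, frames\<close>

fun runmax :: "(nat \<Rightarrow> real \<Rightarrow> real) \<Rightarrow> nat \<Rightarrow> real \<Rightarrow> real" where
  "runmax d 0 b = d 0 b"
| "runmax d (Suc n) b = max (runmax d n b) (d (Suc n) b)"

lemma runmax_ge: "i \<le> n \<Longrightarrow> d i b \<le> runmax d n b"
  by (induction n) (auto simp: le_Suc_eq max_def)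

lemma runmax_attained: "\<exists>i\<le>n. runmax d n b = d i b"
  by (induction n) (auto simp: max_def intro: le_SucI)

lemma continuous_on_runmax: "(\<And>i. continuous_on S (d i)) \<Longrightarrow> continuous_on S (runmax d n)"
proof (induction n)
  case 0 then show ?case by (simp cong: continuous_on_cong)
next
  case (Suc n)
  have "runmax d (Suc n) = (\<lambda>b. max (runmax d n b) (d (Suc n) b))" by auto
  then show ?case using Suc by (auto intro!: continuous_intros)
qed

lemma abs_diff_le_sum_steps:
  fixes d :: "nat \<Rightarrow> real"
  assumes "i \<le> j" shows "\<bar>d j - d i\<bar> \<le> (\<Sum>k\<in>{i..<j}. \<bar>d k - d (Suc k)\<bar>)"
  using assms by (induction j rule: dec_induct) auto

text \<open>The variation has to climb from \<open>d 0\<close> to the maximum and then to descend to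
  \<open>d n\<close>.\<close>

lemma sum_steps_ge_runmax:
  "2 * runmax d n b \<le> (\<Sum>i<n. \<bar>d i b - d (Suc i) b\<bar>) + d 0 b + d n b"
proof -
  obtain k where k: "k \<le> n" "runmax d n b = d k b" using runmax_attained by blast
  have "(\<Sum>i<n. \<bar>d i b - d (Suc i) b\<bar>) = (\<Sum>i\<in>{0..<k}. \<bar>d i b - d (Suc i) b\<bar>) + (\<Sum>i\<in>{k..<n}. \<bar>d i b - d (Suc i) b\<bar>)"
    using k by (subst sum.atLeastLessThan_concat) (auto simp: lessThan_atLeast0)
  then show ?thesis
    using abs_diff_le_sum_steps[of 0 k "\<lambda>i. d i b"] abs_diff_le_sum_steps[of k n "\<lambda>i. d i b"] k by auto
qed

lemma crossing_between:
  fixes P :: "nat \<Rightarrow> bool"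
  assumes "\<not> P e" "P f" "e < f"
  shows "\<exists>j. e \<le> j \<and> j < f \<and> \<not> P j \<and> P (Suc j)"
  using assms
proof (induction f)
  case (Suc f)
  show ?case
  proof (cases "P f")
    case True
    then have "e < f" using Suc.prems by (metis less_Suc_eq)
    then show ?thesis using Suc.IH[OF Suc.prems(1) True] by (meson less_SucI)
  next
    case False
    then show ?thesis using Suc.prems by (intro exI[of _ f]) auto
  qed
qed simp

text \<open>Each interval from \<open>e k\<close> to \<open>f k\<close> contains an entry, and since
  the intervals follow one another these entries are distinct.\<close>

lemma card_crossings:
  fixes P :: "nat \<Rightarrow> bool"
  assumes "\<And>k. k < m \<Longrightarrow> \<not> P (e k) \<and> P (f k) \<and> e k < f k \<and> f k \<le> n"
    and "\<And>k. Suc k < m \<Longrightarrow> f k \<le> e (Suc k)"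
  shows "m \<le> card {j. j < n \<and> \<not> P j \<and> P (Suc j)}"
proof -
  have "\<forall>k\<in>{..<m}. \<exists>j. e k \<le> j \<and> j < f k \<and> \<not> P j \<and> P (Suc j)"
  proof
    fix k assume "k \<in> {..<m}"
    then have "\<not> P (e k)" "P (f k)" "e k < f k" using assms(1)[of k] by auto
    then show "\<exists>j. e k \<le> j \<and> j < f k \<and> \<not> P j \<and> P (Suc j)" by (rule crossing_between)
  qed
  from bchoice[OF this] obtain g where
    "\<forall>k\<in>{..<m}. e k \<le> g k \<and> g k < f k \<and> \<not> P (g k) \<and> P (Suc (g k))" ..
  then have g: "e k \<le> g k \<and> g k < f k \<and> \<not> P (g k) \<and> P (Suc (g k))" if "k < m" for k using that by simp
  have fe: "f k \<le> e k'" if "k < k'" "k' < m" for k k'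
    using that
  proof (induction k')
    case (Suc k')
    then show ?case
    proof (cases "k = k'")
      case False
      then have "f k \<le> e k'" using Suc by auto
      also have "e k' \<le> f k'" using assms(1)[of k'] Suc by auto
      also have "f k' \<le> e (Suc k')" using assms(2) Suc by auto
      finally show ?thesis .
    qed (use assms(2) in auto)
  qed simp
  have lt: "g k < g k'" if "k < k'" "k' < m" for k k'
    using g[of k] g[of k'] fe[OF that] that by auto
  have "inj_on g {..<m}"
  proof (rule inj_onI)
    fix i j assume ij: "i \<in> {..<m}" "j \<in> {..<m}" "g i = g j"
    then show "i = j" using lt[of i j] lt[of j i] by (cases i j rule: linorder_cases) auto
  qed
  then have "m = card (g ` {..<m})" by (simp add: card_image)
  also have "\<dots> \<le> card {j. j < n \<and> \<not> P j \<and> P (Suc j)}"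
  proof (rule card_mono)
    show "g ` {..<m} \<subseteq> {j. j < n \<and> \<not> P j \<and> P (Suc j)}"
    proof
      fix j assume "j \<in> g ` {..<m}"
      then obtain k where k: "k < m" "j = g k" by auto
      then show "j \<in> {j. j < n \<and> \<not> P j \<and> P (Suc j)}" using g[of k] assms(1)[of k] by simp
    qed
  qed simp
  finally show ?thesis .
qed

text \<open>The frame of an edge is turned back by \<open>t\<close>, so that its first end point
  appears at the angle already accumulated by the earlier edges.\<close>

lemma frame_exists:
  fixes u u' :: "real^3"
  assumes "norm u = 1" "norm u' = 1" "u \<bullet> u' = cos f" "0 \<le> f" "f < pi"
  shows "\<exists>e1 e2. norm e1 = 1 \<and> norm e2 = 1 \<and> e1 \<bullet> e2 = 0 \<and> u = cos t *\<^sub>R e1 + sin t *\<^sub>R e2 \<and>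
     u' = cos (t + f) *\<^sub>R e1 + sin (t + f) *\<^sub>R e2"
proof -
  have u: "u \<bullet> u = 1" "u' \<bullet> u' = 1" using assms by (auto simp: norm_eq_1)
  \<comment> \<open>For \<open>f = 0\<close> the two vectors coincide and span no plane; any unit
    vector orthogonal to \<open>u\<close> will do.\<close>
  obtain w where w: "norm w = 1" "u \<bullet> w = 0" "u' = cos f *\<^sub>R u + sin f *\<^sub>R w"
  proof (cases "f = 0")
    case True
    have "(norm (u' - u))\<^sup>2 = 0"
      using u assms(3) True by (simp add: power2_norm_eq_inner inner_simps inner_commute)
    then have "u' = u" by simp
    obtain y where y: "y \<noteq> 0" "orthogonal u y" using orthogonal_to_vector_exists[of u] by auto
    have "norm (y /\<^sub>R norm y) = 1" "u \<bullet> (y /\<^sub>R norm y) = 0" using y by (auto simp: orthogonal_def)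
    moreover have "u' = cos f *\<^sub>R u + sin f *\<^sub>R (y /\<^sub>R norm y)" using True \<open>u' = u\<close> by simp
    ultimately show ?thesis by (rule that)
  next
    case False
    then have s: "sin f > 0" using assms by (intro sin_gt_zero) auto
    define w where "w = (1 / sin f) *\<^sub>R (u' - cos f *\<^sub>R u)"
    have "w \<bullet> w = (1 / sin f)\<^sup>2 * (1 - (cos f)\<^sup>2)"
    proof -
      have "(u' - cos f *\<^sub>R u) \<bullet> (u' - cos f *\<^sub>R u) = 1 - (cos f)\<^sup>2"
        using u assms(3) by (simp add: inner_simps inner_commute power2_eq_square algebra_simps)
      then show ?thesis unfolding w_def by (simp add: power2_eq_square)
    qed
    also have "1 - (cos f)\<^sup>2 = (sin f)\<^sup>2" by (simp add: sin_squared_eq)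
    also have "(1 / sin f)\<^sup>2 * (sin f)\<^sup>2 = 1" using s by (simp add: power_divide)
    finally have "norm w = 1" by (simp add: norm_eq_1)
    moreover have "u \<bullet> w = 0" unfolding w_def using u assms(3) by (simp add: inner_simps)
    moreover have "u' = cos f *\<^sub>R u + sin f *\<^sub>R w" unfolding w_def using s by simp
    ultimately show ?thesis using that by blast
  qed
  have ww: "w \<bullet> w = 1" "w \<bullet> u = 0" using w by (auto simp: norm_eq_1 inner_commute)
  define e1 where "e1 = cos t *\<^sub>R u - sin t *\<^sub>R w"
  define e2 where "e2 = sin t *\<^sub>R u + cos t *\<^sub>R w"
  have "e1 \<bullet> e1 = (cos t)\<^sup>2 + (sin t)\<^sup>2" "e2 \<bullet> e2 = (sin t)\<^sup>2 + (cos t)\<^sup>2" and e12: "e1 \<bullet> e2 = 0"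
    unfolding e1_def e2_def using u ww w by (simp_all add: inner_simps power2_eq_square)
  then have n: "norm e1 = 1" "norm e2 = 1" by (simp_all add: norm_eq_1)
  have rec: "cos s *\<^sub>R e1 + sin s *\<^sub>R e2 = cos (s - t) *\<^sub>R u + sin (s - t) *\<^sub>R w" for s
    unfolding e1_def e2_def cos_diff sin_diff by (simp add: algebra_simps)
  have "u = cos t *\<^sub>R e1 + sin t *\<^sub>R e2" using rec[of t] by simp
  moreover have "u' = cos (t + f) *\<^sub>R e1 + sin (t + f) *\<^sub>R e2" using rec[of "t + f"] w(3) by simp
  ultimately show ?thesis using n e12 by blast
qed

section \<open>The polygon rolled out into the plane\<close>

locale polygon =
  fixes x :: "nat \<Rightarrow> real^3"
  assumes nz: "x i \<noteq> 0"
    and small: "norm (x i) * norm (x (Suc i)) / 2 \<le> x i \<bullet> x (Suc i)"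
begin

definition rho :: "nat \<Rightarrow> real" where "rho i = norm (x i)"

definition phi :: "nat \<Rightarrow> real" where
  "phi i = arccos (x i \<bullet> x (Suc i) / (rho i * rho (Suc i)))"

definition th :: "nat \<Rightarrow> real" where "th n = (\<Sum>j<n. phi j)"

definition d :: "nat \<Rightarrow> real \<Rightarrow> real" where "d i b = rho i * cs (b - th i)"

lemma rho_pos: "rho i > 0" using nz by (simp add: rho_def)

lemma th_Suc: "th (Suc n) = th n + phi n" by (simp add: th_def)

text \<open>The hypothesis \<open>small\<close> says that the cosine is at least \<open>1/2\<close>.
  The bound \<open>pi/3\<close> keeps every step within the range of
  \<open>integral_abs_diff_cs\<close> and later leaves no large angular gap between
  vertices.\<close>

lemma cos_phi: "cos (phi i) = x i \<bullet> x (Suc i) / (rho i * rho (Suc i))"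
  and phi_nonneg: "0 \<le> phi i" and phi_le: "phi i \<le> pi/3"
proof -
  let ?y = "x i \<bullet> x (Suc i) / (rho i * rho (Suc i))"
  have p: "rho i * rho (Suc i) > 0" using rho_pos by simp
  have "?y \<le> 1" using norm_cauchy_schwarz[of "x i" "x (Suc i)"] p by (simp add: rho_def)
  moreover have h: "1/2 \<le> ?y"
    using small[of i] p by (simp add: rho_def field_simps)
  ultimately have y: "-1 \<le> ?y" "?y \<le> 1" by linarith+
  show c: "cos (phi i) = ?y" unfolding phi_def using y by (rule cos_arccos)
  show 0: "0 \<le> phi i" unfolding phi_def using y by (rule arccos_lbound)
  have pp: "phi i \<le> pi" unfolding phi_def using y by (rule arccos_ubound)
  show "phi i \<le> pi/3"
  proof (rule ccontr)
    assume "\<not> phi i \<le> pi/3"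
    then have "cos (phi i) < cos (pi/3)" using pp pi_gt_zero by (intro cos_monotone_0_pi) auto
    then show False using h c by (simp add: cos_60)
  qed
qed

lemma th_mono: "i \<le> j \<Longrightarrow> th i \<le> th j"
  by (induction j rule: dec_induct) (use phi_nonneg in \<open>auto simp: th_Suc intro: order_trans\<close>)

lemma th_nonneg: "0 \<le> th i" using th_mono[of 0 i] by (simp add: th_def)

lemma step_length: "(norm (x (Suc i) - x i))\<^sup>2 = (rho i)\<^sup>2 + (rho (Suc i))\<^sup>2 - 2 * rho i * rho (Suc i) * cos (phi i)"
proof -
  have "rho i * rho (Suc i) * cos (phi i) = x i \<bullet> x (Suc i)"
    unfolding cos_phi using rho_pos[of i] rho_pos[of "Suc i"] by simp
  then show ?thesis
    by (simp add: rho_def power2_norm_eq_inner inner_simps inner_commute algebra_simps)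
qed

lemma continuous_on_d: "continuous_on S (d i)"
  unfolding d_def by (intro continuous_intros)

lemma continuous_on_hh: "continuous_on S (runmax d n)"
  by (intro continuous_on_runmax continuous_on_d)

lemma d_nonneg: "0 \<le> d i b" using rho_pos[of i] cs_nonneg[of "b - th i"] by (simp add: d_def)

lemma hh_nonneg: "0 \<le> runmax d n b" using runmax_ge[of 0 n d b] d_nonneg[of 0 b] by simp

text \<open>Integrate \<open>sum_steps_ge_runmax\<close>: an edge contributes at most twice its
  length and each of the two end arches \<open>2 * rho\<close>. A margin \<open>pi\<close> on both
  sides contains all arches.\<close>

lemma integral_hh_le:
  "integral {- pi..th n + pi} (runmax d n) \<le> (\<Sum>i<n. norm (x (Suc i) - x i)) + rho 0 + rho n"
proof -
  let ?I = "{- pi..th n + pi}"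
  have c: "continuous_on ?I (\<lambda>b. \<bar>d i b - d (Suc i) b\<bar>)" for i by (intro continuous_intros continuous_on_d)
  have e: "integral ?I (d i) = 2 * rho i" if "i \<le> n" for i
    unfolding d_def by (rule integral_unique, rule has_integral_scaled_cs)
      (use th_nonneg[of i] th_mono[OF that] pi_gt_zero in linarith)+
  have s: "integral ?I (\<lambda>b. \<bar>d i b - d (Suc i) b\<bar>) \<le> 2 * norm (x (Suc i) - x i)" if "i < n" for i
  proof -
    have "- pi \<le> th i - pi/2" "th i + phi i + pi/2 \<le> th n + pi" "phi i \<le> pi/2"
      using th_nonneg[of i] th_mono[of "Suc i" n] that phi_le[of i] pi_gt_zero unfolding th_Suc by linarith+
    then show ?thesis
      unfolding d_def th_Suc
      using rho_pos[of i] rho_pos[of "Suc i"] phi_nonneg[of i] step_length[of i] by (intro integral_abs_diff_cs) auto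
  qed
  have "integral ?I (\<lambda>b. 2 * runmax d n b) \<le> integral ?I (\<lambda>b. (\<Sum>i<n. \<bar>d i b - d (Suc i) b\<bar>) + d 0 b + d n b)"
    by (intro integral_le integrable_continuous_real continuous_intros continuous_on_hh continuous_on_d sum_steps_ge_runmax)
  also have "\<dots> = integral ?I (\<lambda>b. (\<Sum>i<n. \<bar>d i b - d (Suc i) b\<bar>)) + integral ?I (d 0) + integral ?I (d n)"
  proof -
    have i: "(\<lambda>b. \<Sum>i<n. \<bar>d i b - d (Suc i) b\<bar>) integrable_on ?I" "d 0 integrable_on ?I" "d n integrable_on ?I"
      by (intro integrable_continuous_real continuous_intros continuous_on_d)+
    show ?thesis using integral_add[OF integrable_add[OF i(1,2)] i(3)] integral_add[OF i(1,2)] by simp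
  qed
  also have "integral ?I (\<lambda>b. (\<Sum>i<n. \<bar>d i b - d (Suc i) b\<bar>)) = (\<Sum>i<n. integral ?I (\<lambda>b. \<bar>d i b - d (Suc i) b\<bar>))"
    by (intro integral_sum integrable_continuous_real c) auto
  also have "\<dots> \<le> (\<Sum>i<n. 2 * norm (x (Suc i) - x i))" by (intro sum_mono s) auto
  finally show ?thesis using e[of 0] e[of n] by (simp add: sum_distrib_left[symmetric])
qed

text \<open>\<open>runmax d n\<close> acts as a support function in the plane, and
  \<open>rt n j\<close> is the largest radius at the angle \<open>th j\<close> whose arch stays
  below it. So the rolled-out polygon is replaced by a convex one with the same support
  function.\<close>

definition rt :: "nat \<Rightarrow> nat \<Rightarrow> real" where
  "rt n j = Inf {runmax d n b / cos (b - th j) | b. \<bar>b - th j\<bar> < pi/2}"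

lemma cos_window: "\<bar>b - t\<bar> < pi/2 \<Longrightarrow> cos (b - t) > 0" for b t :: real
  by (intro cos_gt_zero_pi) linarith+

lemma rho_le_ratio: "j \<le> n \<Longrightarrow> \<bar>b - th j\<bar> < pi/2 \<Longrightarrow> rho j \<le> runmax d n b / cos (b - th j)"
  using runmax_ge[of j n d b] cos_window[of b "th j"] by (simp add: d_def cs_def pos_le_divide_eq)

lemma rt_greatest:
  assumes "\<And>b. \<bar>b - th j\<bar> < pi/2 \<Longrightarrow> m * cos (b - th j) \<le> runmax d n b"
  shows "m \<le> rt n j"
  unfolding rt_def
proof (rule cInf_greatest)
  have "\<bar>th j - th j\<bar> < pi/2" by simp
  then show "{runmax d n b / cos (b - th j) | b. \<bar>b - th j\<bar> < pi/2} \<noteq> {}" by blast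
  fix y assume "y \<in> {runmax d n b / cos (b - th j) | b. \<bar>b - th j\<bar> < pi/2}"
  then obtain b where b: "\<bar>b - th j\<bar> < pi/2" "y = runmax d n b / cos (b - th j)" by blast
  show "m \<le> y" unfolding b(2) using assms[OF b(1)] cos_window[OF b(1)] by (simp add: pos_le_divide_eq)
qed

lemma rt_ge_rho: "j \<le> n \<Longrightarrow> rho j \<le> rt n j"
proof (rule rt_greatest)
  fix b assume "j \<le> n" "\<bar>b - th j\<bar> < pi/2"
  then show "rho j * cos (b - th j) \<le> runmax d n b"
    using runmax_ge[of j n d b] by (simp add: d_def cs_def)
qed

lemma rt_cos_le:
  assumes "j \<le> n" "\<bar>b - th j\<bar> < pi/2" shows "rt n j * cos (b - th j) \<le> runmax d n b"
proof -
  have "rt n j \<le> runmax d n b / cos (b - th j)"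
    unfolding rt_def
  proof (rule cInf_lower)
    show "bdd_below {runmax d n b / cos (b - th j) | b. \<bar>b - th j\<bar> < pi/2}"
      using rho_le_ratio[OF assms(1)] by (intro bdd_belowI[of _ "rho j"]) blast
  qed (use assms in blast)
  then show ?thesis using cos_window[OF assms(2)] by (simp add: pos_le_divide_eq)
qed

definition dt :: "nat \<Rightarrow> nat \<Rightarrow> real \<Rightarrow> real" where "dt n j b = rt n j * cs (b - th j)"

lemma dt_le: assumes "j \<le> n" shows "dt n j b \<le> runmax d n b"
proof (cases "\<bar>b - th j\<bar> < pi/2")
  case True
  then show ?thesis using rt_cos_le[OF assms True] by (simp add: dt_def cs_def)
next
  case False
  then have "b - th j \<le> - (pi/2) \<or> pi/2 \<le> b - th j" by linarith
  then have "cs (b - th j) = 0" by (rule cs_eq_0)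
  then show ?thesis using hh_nonneg by (simp add: dt_def)
qed

lemma dt_pos_window:
  assumes "0 < m" "m \<le> dt n i b"
  shows "\<bar>b - th i\<bar> < pi/2" "m \<le> rt n i * cos (b - th i)"
proof -
  show w: "\<bar>b - th i\<bar> < pi/2"
  proof (rule ccontr)
    assume "\<not> \<bar>b - th i\<bar> < pi/2"
    then have "b - th i \<le> - (pi/2) \<or> pi/2 \<le> b - th i" by linarith
    then have "cs (b - th i) = 0" by (rule cs_eq_0)
    then show False using assms by (simp add: dt_def)
  qed
  then show "m \<le> rt n i * cos (b - th i)" using assms(2) by (simp add: dt_def cs_def)
qed

text \<open>The difference of the two sides is a product of two 2 by 2 determinants, namely
  \<open>sin (b' - b) * sin (s' - s)\<close>.\<close>

lemma cos_ratio_mono: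
  assumes "sin ((b'::real) - b) * sin (s' - s) \<ge> 0"
  shows "cos (b' - s) * cos (b - s') \<le> cos (b' - s') * cos (b - s)"
proof -
  have "cos (b' - s') * cos (b - s) - cos (b' - s) * cos (b - s')
      = (sin b' * cos b - cos b' * sin b) * (sin s' * cos s - cos s' * sin s)"
    unfolding cos_diff by algebra
  also have "\<dots> = sin (b' - b) * sin (s' - s)" by (simp add: sin_diff)
  finally show ?thesis using assms by simp
qed

text \<open>The ratio of the arches at \<open>th k\<close> and \<open>th j\<close> is monotone in
  the angle. Going from \<open>b\<close> to \<open>b'\<close> on the side of \<open>k\<close> it
  only grows, so a bound by the arch of \<open>k\<close> at \<open>b\<close> passes to the arch of
  \<open>j\<close> at \<open>b'\<close>.\<close>

lemma dt_unimodal_aux: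
  assumes m: "0 < m" and k: "k \<le> n" "m \<le> dt n k b" and w: "\<bar>b' - th j\<bar> < pi/2" "\<bar>b - th j\<bar> < pi/2"
    and o: "b \<le> b' \<and> th j \<le> th k \<or> b' \<le> b \<and> th k \<le> th j"
  shows "m * cos (b' - th j) \<le> runmax d n b' * cos (b - th j)"
proof -
  note wk = dt_pos_window[OF m k(2)]
  have wk': "\<bar>b' - th k\<bar> < pi/2" using o w wk by linarith
  have "sin (b' - b) * sin (th k - th j) \<ge> 0"
    using o
  proof
    assume a: "b \<le> b' \<and> th j \<le> th k"
    have "0 \<le> sin (b' - b)" using a w by (intro sin_ge_zero) linarith+
    moreover have "0 \<le> sin (th k - th j)" using a w wk by (intro sin_ge_zero) linarith+
    ultimately show ?thesis by simp
  next
    assume a: "b' \<le> b \<and> th k \<le> th j"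
    have "0 \<le> sin (b - b')" using a w by (intro sin_ge_zero) linarith+
    moreover have "0 \<le> sin (th j - th k)" using a w wk by (intro sin_ge_zero) linarith+
    ultimately have "0 \<le> sin (b - b') * sin (th j - th k)" by simp
    also have "\<dots> = sin (b' - b) * sin (th k - th j)"
      using sin_minus[of "b - b'"] sin_minus[of "th j - th k"] by simp
    finally show ?thesis .
  qed
  from cos_ratio_mono[OF this]
  have r: "cos (b' - th j) * cos (b - th k) \<le> cos (b' - th k) * cos (b - th j)" .
  have p: "cos (b - th k) > 0" "cos (b - th j) > 0" "cos (b' - th j) > 0" using wk w cos_window by auto
  have "m * cos (b' - th j) * cos (b - th k) \<le> (rt n k * cos (b - th k)) * cos (b' - th j) * cos (b - th k)"
    if "cos (b - th k) = 0" using that by simp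
  have "(m * cos (b' - th j)) * cos (b - th k) \<le> m * (cos (b' - th k) * cos (b - th j))"
    using mult_left_mono[OF r, of m] m by (simp add: mult.assoc)
  also have "\<dots> \<le> (rt n k * cos (b - th k)) * (cos (b' - th k) * cos (b - th j))"
    using wk(2) cos_window[OF wk'] p by (intro mult_right_mono) auto
  also have "\<dots> = ((rt n k * cos (b' - th k)) * cos (b - th j)) * cos (b - th k)" by simp
  also have "\<dots> \<le> (runmax d n b' * cos (b - th j)) * cos (b - th k)"
    using rt_cos_le[OF k(1) wk'] p by (intro mult_right_mono) auto
  finally show ?thesis using p(1) by (rule mult_right_le_imp_le)
qed

text \<open>As \<open>rt n j\<close> is an infimum over all angles \<open>b'\<close>, the claim has
  to be tested at each of them: those to the right of \<open>b\<close> are handled by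
  \<open>k\<close> and those to the left by \<open>i\<close>.\<close>

lemma dt_unimodal:
  assumes m: "0 < m" and ijk: "i \<le> j" "j \<le> k" "k \<le> n" and mi: "m \<le> dt n i b" and mk: "m \<le> dt n k b"
  shows "m \<le> dt n j b"
proof -
  have o: "th i \<le> th j" "th j \<le> th k" using th_mono ijk by auto
  have w: "\<bar>b - th j\<bar> < pi/2" using dt_pos_window(1)[OF m mi] dt_pos_window(1)[OF m mk] o by linarith
  have c: "cos (b - th j) > 0" using cos_window[OF w] .
  have "m / cos (b - th j) \<le> rt n j"
  proof (rule rt_greatest)
    fix b' assume w': "\<bar>b' - th j\<bar> < pi/2"
    have "m * cos (b' - th j) \<le> runmax d n b' * cos (b - th j)"
    proof (cases "b \<le> b'")
      case True
      then show ?thesis using dt_unimodal_aux[OF m ijk(3) mk w' w] o by auto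
    next
      case False
      then show ?thesis using dt_unimodal_aux[OF m _ mi w' w] o ijk by auto
    qed
    then show "m / cos (b - th j) * cos (b' - th j) \<le> runmax d n b'" using c by (simp add: pos_divide_le_eq)
  qed
  then have "m \<le> rt n j * cos (b - th j)" using c by (simp add: pos_divide_le_eq)
  then show ?thesis using w by (simp add: dt_def cs_def)
qed

definition X :: "nat \<Rightarrow> nat \<Rightarrow> real^3" where "X n j = (rt n j / rho j) *\<^sub>R x j"

definition Ent :: "real \<Rightarrow> nat \<Rightarrow> nat \<Rightarrow> (real^3) set" where
  "Ent c n j = {v. norm v \<le> 1 \<and> c * norm v \<le> v \<bullet> X n (Suc j) \<and> v \<bullet> X n j < c * norm v}"

text \<open>The entries embed into regions \<open>E j\<close> of one strip, which lie below the
  graph of \<open>runmax d n\<close>. They are disjoint by unimodality.\<close>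

lemma sum_Ent_le:
  assumes c: "c > 0"
  shows "j < n \<Longrightarrow> Ent c n j \<in> lmeasurable"
    "(\<Sum>j<n. measure lebesgue (Ent c n j)) \<le> integral {- pi..th n + pi} (\<lambda>b. 2 * capw c (runmax d n b)) / 3"
proof -
  define E where "E j = {v::real^3. 0 < v$1 \<and> v$1 \<le> 1 \<and> \<bar>v$3\<bar> < 1 \<and> - pi \<le> v$2 \<and> v$2 \<le> th n + pi \<and>
      c \<le> sqrt (1 - (v$3)\<^sup>2) * (rt n (Suc j) * cs (v$2 - th (Suc j))) \<and> sqrt (1 - (v$3)\<^sup>2) * (rt n j * cs (v$2 - th j)) < c}" for j
  define R where "R = {v::real^3. 0 < v$1 \<and> v$1 \<le> 1 \<and> \<bar>v$3\<bar> < 1 \<and> - pi \<le> v$2 \<and> v$2 \<le> th n + pi \<and>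
      c \<le> sqrt (1 - (v$3)\<^sup>2) * runmax d n (v$2)}"
  note cyl = cyl_region[OF c continuous_on_hh[of UNIV n], of "- pi" "th n + pi", folded R_def]
  have [measurable]: "(\<lambda>v::real^3. v$i) \<in> borel_measurable borel" for i
    by (intro borel_measurable_continuous_onI continuous_intros)
  have [measurable]: "cs \<in> borel_measurable borel"
    by (intro borel_measurable_continuous_onI continuous_on_cs[of UNIV "\<lambda>x. x", simplified])
  have ER: "E j \<subseteq> R" if "j < n" for j
  proof
    fix v assume v: "v \<in> E j"
    then have z: "(v$3)\<^sup>2 \<le> 1" by (simp add: E_def abs_square_le_1)
    have "c \<le> sqrt (1 - (v$3)\<^sup>2) * dt n (Suc j) (v$2)" using v by (simp add: E_def dt_def)
    also have "\<dots> \<le> sqrt (1 - (v$3)\<^sup>2) * runmax d n (v$2)"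
      using dt_le[of "Suc j" n "v$2"] that z by (intro mult_left_mono) auto
    finally show "v \<in> R" using v by (simp add: E_def R_def)
  qed
  have Em: "E j \<in> lmeasurable" if "j < n" for j
  proof (rule fmeasurableI2[OF cyl(2) ER[OF that]])
    have "E j \<in> sets borel" unfolding E_def by measurable
    then show "E j \<in> sets lebesgue" by simp
  qed
  have disj: "pairwise (\<lambda>i j. disjnt (E i) (E j)) {..<n}"
  proof -
    have "disjnt (E i) (E j)" if "i < j" "j < n" for i j
    proof (rule ccontr)
      assume "\<not> disjnt (E i) (E j)"
      then obtain v where v: "v \<in> E i" "v \<in> E j" by (auto simp: disjnt_def)
      define u where "u = sqrt (1 - (v$3)\<^sup>2)"
      have "(v$3)\<^sup>2 < 1" using v by (simp add: E_def abs_square_less_1)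
      then have u: "u > 0" by (simp add: u_def)
      \<comment> \<open>Seen from \<open>Suc i\<close> and from \<open>Suc j\<close> but not from
        the intermediate \<open>j\<close>: this is what \<open>dt_unimodal\<close> excludes.\<close>
      have a: "c / u \<le> dt n (Suc i) (v$2)" "dt n j (v$2) < c / u" "c / u \<le> dt n (Suc j) (v$2)"
        using v u by (auto simp: E_def dt_def u_def[symmetric] pos_divide_le_eq pos_less_divide_eq mult.commute)
      have "c / u \<le> dt n j (v$2)"
        by (rule dt_unimodal[OF _ _ _ _ a(1) a(3)]) (use that c u in auto)
      then show False using a by simp
    qed
    then show ?thesis unfolding pairwise_def by (metis disjnt_sym lessThan_iff linorder_neqE_nat)
  qed
  have ent: "Ent c n j \<in> lmeasurable \<and> measure lebesgue (Ent c n j) \<le> measure lebesgue (E j) / 3" if j: "j < n" for j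
  proof -
    have u: "norm (x i /\<^sub>R rho i) = 1" for i using nz by (simp add: rho_def)
    have "(x j /\<^sub>R rho j) \<bullet> (x (Suc j) /\<^sub>R rho (Suc j)) = cos (phi j)"
      unfolding cos_phi by (simp add: divide_inverse mult.commute)
    from frame_exists[OF u u this phi_nonneg, of "th j"] phi_le[of j] pi_gt_zero
    obtain e1 e2 where e: "norm e1 = 1" "norm e2 = 1" "e1 \<bullet> e2 = 0"
      "x j /\<^sub>R rho j = cos (th j) *\<^sub>R e1 + sin (th j) *\<^sub>R e2"
      "x (Suc j) /\<^sub>R rho (Suc j) = cos (th (Suc j)) *\<^sub>R e1 + sin (th (Suc j)) *\<^sub>R e2"
      unfolding th_Suc by auto
    have r: "rt n j > 0" "rt n (Suc j) > 0"
      using rt_ge_rho[of j n] rt_ge_rho[of "Suc j" n] rho_pos[of j] rho_pos[of "Suc j"] j by auto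
    have y: "X n j = rt n j *\<^sub>R (cos (th j) *\<^sub>R e1 + sin (th j) *\<^sub>R e2)"
      "X n (Suc j) = rt n (Suc j) *\<^sub>R (cos (th (Suc j)) *\<^sub>R e1 + sin (th (Suc j)) *\<^sub>R e2)"
      unfolding e(4,5)[symmetric] by (simp_all add: X_def divide_inverse)
    have B: "- pi \<le> th (Suc j) - pi/2" "th (Suc j) + pi/2 \<le> th n + pi"
      using th_nonneg[of "Suc j"] th_mono[of "Suc j" n] j pi_gt_zero by linarith+
    show ?thesis
      using cap_entry_measure[OF e(1-3) c r y B E_def[of j] Em[OF j] Ent_def[of c n j]] by blast
  qed
  show "j < n \<Longrightarrow> Ent c n j \<in> lmeasurable" using ent by blast
  have "(\<Sum>j<n. measure lebesgue (Ent c n j)) \<le> (\<Sum>j<n. measure lebesgue (E j) / 3)"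
    by (intro sum_mono) (use ent in auto)
  also have "\<dots> = (\<Sum>j<n. measure lebesgue (E j)) / 3" by (simp add: sum_divide_distrib)
  also have "(\<Sum>j<n. measure lebesgue (E j)) = measure lebesgue (\<Union>j\<in>{..<n}. E j)"
    by (rule measure_UNION'[symmetric]) (use Em disj in auto)
  also have "\<dots> \<le> measure lebesgue R"
  proof (rule measure_mono_fmeasurable)
    show "(\<Union>j\<in>{..<n}. E j) \<in> sets lebesgue" using Em by (intro sets.finite_UN) (auto simp: fmeasurableD)
  qed (use ER cyl(2) in auto)
  also have "\<dots> \<le> integral {- pi..th n + pi} (\<lambda>b. 2 * capw c (runmax d n b))" by (rule cyl(3))
  finally show "(\<Sum>j<n. measure lebesgue (Ent c n j)) \<le> integral {- pi..th n + pi} (\<lambda>b. 2 * capw c (runmax d n b)) / 3"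
    by simp
qed

text \<open>Integrate the number of entries over the unit ball without its centre. Its volume
  \<open>4/3 * pi\<close> meets the Jacobian \<open>1/3\<close>, which leaves \<open>4 * pi\<close>;
  the set \<open>Q\<close> carries the additional entries.\<close>

lemma capw_integral_ge:
  assumes c: "c > 0" and Q: "Q \<in> lmeasurable"
    and card: "\<And>v. norm v < 1 \<Longrightarrow> v \<noteq> 0 \<Longrightarrow> m1 + m2 * indicator Q v \<le>
      real (card {j. j < n \<and> \<not> c * norm v \<le> v \<bullet> X n j \<and> c * norm v \<le> v \<bullet> X n (Suc j)})"
    and Ob: "Q \<subseteq> ball 0 1 - {0}" and m: "m1 \<ge> 0"
  shows "m1 * (4 * pi) + m2 * (3 * measure lebesgue Q)
    \<le> integral {- pi..th n + pi} (\<lambda>b. 2 * capw c (runmax d n b))"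
proof -
  let ?B = "ball (0::real^3) 1 - {0}"
  have ind: "(indicat_real S has_integral measure lebesgue S) UNIV" if "S \<in> lmeasurable" for S :: "(real^3) set"
    using that lmeasurable_iff_has_integral by blast
  have z: "{0::real^3} \<in> null_sets lebesgue" using negligible_iff_null_sets negligible_sing by blast
  have Bm: "?B \<in> lmeasurable" by (rule fmeasurable.Diff[OF lmeasurable_ball negligible_imp_measurable[OF negligible_sing]])
  have "measure lebesgue ?B = measure lebesgue (ball (0::real^3) 1)"
    by (rule measure_Diff_null_set[OF _ z]) auto
  also have "\<dots> = 4/3 * pi" by (simp add: content_ball unit_ball_vol_3)
  finally have vB: "measure lebesgue ?B = 4/3 * pi" .
  have "((\<lambda>v. m1 * indicator ?B v + m2 * indicator Q v) has_integral (m1 * measure lebesgue ?B + m2 * measure lebesgue Q)) UNIV"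
    by (intro has_integral_add has_integral_mult_right ind Bm Q)
  moreover have "((\<lambda>v. \<Sum>j<n. indicator (Ent c n j) v) has_integral (\<Sum>j<n. measure lebesgue (Ent c n j))) UNIV"
    by (intro has_integral_sum ind sum_Ent_le(1)[OF c]) auto
  moreover have "m1 * indicator ?B v + m2 * indicator Q v \<le> (\<Sum>j<n. indicat_real (Ent c n j) v)" for v
  proof (cases "v \<in> ?B")
    case True
    have "(\<Sum>j<n. indicat_real (Ent c n j) v) = real (card {j. j < n \<and> v \<in> Ent c n j})"
      by (simp add: indicator_def sum.If_cases Int_def)
    also have "{j. j < n \<and> v \<in> Ent c n j} = {j. j < n \<and> \<not> c * norm v \<le> v \<bullet> X n j \<and> c * norm v \<le> v \<bullet> X n (Suc j)}"
      using True by (auto simp: Ent_def)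
    finally show ?thesis using card[of v] True by simp
  next
    case False
    then have "v \<notin> Q" using Ob by blast
    then show ?thesis using False by (simp add: sum_nonneg)
  qed
  ultimately have "m1 * measure lebesgue ?B + m2 * measure lebesgue Q \<le> (\<Sum>j<n. measure lebesgue (Ent c n j))"
    by (rule has_integral_le)
  then show ?thesis using sum_Ent_le(2)[OF c, of n] by (simp only: vB)
qed

end

section \<open>The deficit \<open>h - 2 * c * capw c h\<close>\<close>

lemma defect_lower_bound:
  assumes c: "c > 0" and h: "c \<le> h"
  shows "(h\<^sup>2 - 2 * c\<^sup>2)\<^sup>2 / (2 * h ^ 3) \<le> h - 2 * c * capw c h"
proof -
  define w where "w = capw c h"
  have hp: "h > 0" using c h by simp
  have "(c / h)\<^sup>2 \<le> 1" using c h by (simp add: power_le_one)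
  then have w: "w \<ge> 0" "w\<^sup>2 = 1 - (c / h)\<^sup>2" using h by (simp_all add: w_def capw_def max_def)
  have w2: "h\<^sup>2 * w\<^sup>2 = h\<^sup>2 - c\<^sup>2" unfolding w(2) using hp by (simp add: power_divide right_diff_distrib)
  \<comment> \<open>Multiplication by the conjugate turns the deficit into a perfect square, which
    vanishes only at \<open>h = sqrt 2 * c\<close>. The conjugate is then bounded by
    \<open>2 * h\<close>.\<close>
  have pr: "h\<^sup>2 * ((h - 2 * c * w) * (h + 2 * c * w)) = (h\<^sup>2 - 2 * c\<^sup>2)\<^sup>2"
  proof -
    have "h\<^sup>2 * ((h - 2 * c * w) * (h + 2 * c * w)) = h\<^sup>2 * h\<^sup>2 - 4 * c\<^sup>2 * (h\<^sup>2 * w\<^sup>2)"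
      by (simp add: power2_eq_square algebra_simps)
    also have "\<dots> = (h\<^sup>2 - 2 * c\<^sup>2)\<^sup>2" unfolding w2 by (simp add: power2_eq_square algebra_simps)
    finally show ?thesis .
  qed
  have p: "h + 2 * c * w > 0" using hp c w by (simp add: add_pos_nonneg)
  have "0 \<le> h\<^sup>2 * ((h - 2 * c * w) * (h + 2 * c * w))" unfolding pr by simp
  then have "0 \<le> (h - 2 * c * w) * (h + 2 * c * w)" using hp by (simp add: zero_le_mult_iff)
  then have nn: "0 \<le> h - 2 * c * w" using p by (simp add: zero_le_mult_iff)
  have "(h\<^sup>2 - 2 * c\<^sup>2)\<^sup>2 \<le> h\<^sup>2 * ((h - 2 * c * w) * (2 * h))"
    unfolding pr[symmetric] using nn by (intro mult_left_mono) auto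
  also have "\<dots> = (h - 2 * c * w) * (2 * h ^ 3)" by (simp add: power2_eq_square power3_eq_cube)
  finally show ?thesis using hp by (simp add: w_def pos_divide_le_eq)
qed

lemma capw_below: "h \<le> c \<Longrightarrow> c > 0 \<Longrightarrow> capw c h = 0"
  by (simp add: capw_def max_def)

lemma defect_nonneg:
  assumes "c > 0" "h \<ge> 0" shows "0 \<le> h - 2 * c * capw c h"
proof (cases "c \<le> h")
  case True
  then have "0 \<le> (h\<^sup>2 - 2 * c\<^sup>2)\<^sup>2 / (2 * h ^ 3)" using assms by simp
  then show ?thesis using defect_lower_bound[OF assms(1) True] by linarith
qed (use assms capw_below[of h c] in simp)

text \<open>The critical radius \<open>sqrt 2 * c\<close> is at most \<open>1\<close> here, so radii
  beyond \<open>H > 1\<close> stay away from it, uniformly in \<open>c\<close>.\<close>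

lemma defect_above:
  assumes c: "c > 0" "2 * c\<^sup>2 \<le> 1" and h: "1 < H" "H \<le> h"
  shows "(1 - 1 / H\<^sup>2)\<^sup>2 / 2 \<le> h - 2 * c * capw c h"
proof -
  have "c\<^sup>2 \<le> 1\<^sup>2" using c by simp
  then have "c \<le> 1" by (rule power2_le_imp_le) simp
  then have ch: "c \<le> h" using h by simp
  have hp: "h > 0" "h \<ge> 1" using h by auto
  have H2: "H\<^sup>2 \<le> h\<^sup>2" using h by (intro power_mono) auto
  have H1: "H\<^sup>2 > 1" using h by (simp add: one_less_power)
  have "h\<^sup>2 * (1 - 1 / H\<^sup>2) \<le> h\<^sup>2 - 2 * c\<^sup>2"
  proof -
    have "0 < H\<^sup>2" using H1 by linarith
    then have "1 \<le> h\<^sup>2 / H\<^sup>2" using H2 by simp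
    then show ?thesis using c by (simp add: right_diff_distrib)
  qed
  moreover have "1 / H\<^sup>2 < 1" using H1 by (subst divide_less_eq_1_pos) linarith+
  then have "0 \<le> 1 - 1 / H\<^sup>2" by linarith
  ultimately have "(h\<^sup>2 * (1 - 1 / H\<^sup>2))\<^sup>2 \<le> (h\<^sup>2 - 2 * c\<^sup>2)\<^sup>2" by (intro power_mono) auto
  then have "(h\<^sup>2 * (1 - 1 / H\<^sup>2))\<^sup>2 / (2 * h ^ 3) \<le> (h\<^sup>2 - 2 * c\<^sup>2)\<^sup>2 / (2 * h ^ 3)"
    using hp by (intro divide_right_mono) auto
  also have "(h\<^sup>2 * (1 - 1 / H\<^sup>2))\<^sup>2 / (2 * h ^ 3) = h * ((1 - 1 / H\<^sup>2)\<^sup>2 / 2)"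
    using hp by (simp add: power2_eq_square power3_eq_cube)
  finally have "h * ((1 - 1 / H\<^sup>2)\<^sup>2 / 2) \<le> h - 2 * c * capw c h"
    using defect_lower_bound[OF c(1) ch] by linarith
  moreover have "1 * ((1 - 1 / H\<^sup>2)\<^sup>2 / 2) \<le> h * ((1 - 1 / H\<^sup>2)\<^sup>2 / 2)" using hp by (intro mult_right_mono) auto
  ultimately show ?thesis by linarith
qed

text \<open>The assumption on \<open>c\<close> keeps the square of the critical radius above the
  midpoint of \<open>q^2\<close> and \<open>1\<close>, which tolerates the loss of threshold by the
  mesh. Below \<open>c\<close> the cap is empty and the deficit is \<open>h\<close> itself, whence
  the term \<open>r0\<close>.\<close>

lemma defect_below:
  assumes c: "c > 0" "(1 + q\<^sup>2) / 2 \<le> 2 * c\<^sup>2" and h: "r0 \<le> h" "0 < h" "h \<le> q" "q < 1"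
  shows "min r0 (((1 - q\<^sup>2) / 2)\<^sup>2 / 2) \<le> h - 2 * c * capw c h"
proof (cases "c \<le> h")
  case False
  then show ?thesis using capw_below[of h c] c h by simp
next
  case True
  have "h\<^sup>2 \<le> q\<^sup>2" using h by (intro power_mono) auto
  moreover have "q\<^sup>2 \<le> 1" using h by (simp add: power_le_one)
  ultimately have "((1 - q\<^sup>2) / 2)\<^sup>2 \<le> (2 * c\<^sup>2 - h\<^sup>2)\<^sup>2"
    using c(2) by (intro power_mono) (auto simp: field_simps)
  also have "\<dots> = (h\<^sup>2 - 2 * c\<^sup>2)\<^sup>2" by (rule power2_commute)
  finally have a: "((1 - q\<^sup>2) / 2)\<^sup>2 \<le> (h\<^sup>2 - 2 * c\<^sup>2)\<^sup>2" .
  have "h ^ 3 \<le> 1" using h by (simp add: power_le_one)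
  then have "((1 - q\<^sup>2) / 2)\<^sup>2 / 2 \<le> (h\<^sup>2 - 2 * c\<^sup>2)\<^sup>2 / (2 * h ^ 3)"
    using a h by (intro frac_le) auto
  then show ?thesis using defect_lower_bound[OF c(1) True] by linarith
qed

section \<open>Closed polygons traversed many times\<close>

lemma sum_lessThan_add:
  fixes f :: "nat \<Rightarrow> real"
  shows "(\<Sum>i<m + k. f i) = (\<Sum>i<m. f i) + (\<Sum>i<k. f (i + m))"
  by (induction k) (auto simp: add.commute)

locale periodic_polygon = polygon +
  fixes N :: nat and c :: real
  assumes N: "N > 0" and per: "x (i + N) = x i" and c: "c > 0"
    and cov: "\<exists>i<N. c * norm v \<le> v \<bullet> x i"
begin

definition \<Theta> :: real where "\<Theta> = th N"
definition len :: real where "len = (\<Sum>i<N. norm (x (Suc i) - x i))"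

lemma per_mult: "x (i + k * N) = x i"
proof (induction k)
  case (Suc k)
  have "x (i + Suc k * N) = x ((i + k * N) + N)" by (simp add: add_ac)
  then show ?case using per[of "i + k * N"] Suc by simp
qed simp

lemma per_Suc: "x (Suc (i + k * N)) = x (Suc i)" using per_mult[of "Suc i" k] by simp

lemma rho_per: "rho (i + k * N) = rho i" by (simp add: rho_def per_mult)
lemma rho_per0: "rho (k * N) = rho 0" using rho_per[of 0 k] by simp

lemma phi_per: "phi (i + k * N) = phi i"
  using rho_per[of "Suc i" k] by (simp add: phi_def rho_per per_mult per_Suc)

lemma th_per: "th (i + k * N) = th i + k * \<Theta>"
proof -
  have a: "th (m + j) = th m + (\<Sum>l<j. phi (l + m))" for m j
    unfolding th_def by (rule sum_lessThan_add)
  have b: "th (k * N) = k * \<Theta>"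
  proof (induction k)
    case (Suc k)
    have "th (Suc k * N) = th (k * N + N)" by (simp add: add.commute)
    also have "\<dots> = th (k * N) + \<Theta>" unfolding a[of "k * N" N] phi_per by (simp add: \<Theta>_def th_def)
    finally show ?case using Suc by (simp add: algebra_simps)
  qed (simp add: th_def)
  show ?thesis using a[of "k * N" i] b by (simp add: add.commute phi_per th_def)
qed

lemma th_per0: "th (k * N) = k * \<Theta>" using th_per[of 0 k] by (simp add: th_def)

lemma \<Theta>_nonneg: "\<Theta> \<ge> 0" by (simp add: \<Theta>_def th_nonneg)

lemma sum_len: "(\<Sum>i<M * N. norm (x (Suc i) - x i)) = M * len"
proof (induction M)
  case (Suc M)
  have "(\<Sum>i<Suc M * N. norm (x (Suc i) - x i)) = (\<Sum>i<M * N + N. norm (x (Suc i) - x i))"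
    by (simp add: add.commute)
  also have "\<dots> = (\<Sum>i<M * N. norm (x (Suc i) - x i)) + (\<Sum>i<N. norm (x (Suc (i + M * N)) - x (i + M * N)))"
    by (rule sum_lessThan_add)
  finally show ?case using Suc by (simp add: len_def per_mult per_Suc algebra_simps)
qed simp

lemma X_in:
  assumes "c * norm v \<le> v \<bullet> x i" "i + k * N \<le> n"
  shows "c * norm v \<le> v \<bullet> X n (i + k * N)"
proof -
  let ?j = "i + k * N"
  have p: "rho ?j > 0" by (rule rho_pos)
  have "1 \<le> rt n ?j / rho ?j" using rt_ge_rho[OF assms(2)] p by simp
  moreover have "0 \<le> v \<bullet> x i" using assms(1) c by (smt (verit) mult_nonneg_nonneg norm_ge_zero)
  ultimately have "1 * (v \<bullet> x i) \<le> (rt n ?j / rho ?j) * (v \<bullet> x i)" by (intro mult_right_mono)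
  then show ?thesis using assms(1) by (simp add: X_def per_mult)
qed

text \<open>Moving a vertex outwards enlarges a positive inner product, so mere invisibility would
  not survive; a negative inner product does.\<close>

lemma X_out:
  assumes "v \<bullet> x i < 0" "i + k * N \<le> n" "v \<noteq> 0"
  shows "\<not> c * norm v \<le> v \<bullet> X n (i + k * N)"
proof -
  let ?j = "i + k * N"
  have p: "rho ?j > 0" by (rule rho_pos)
  have "rt n ?j / rho ?j > 0" using rt_ge_rho[OF assms(2)] p by simp
  then have "(rt n ?j / rho ?j) * (v \<bullet> x i) < 0" using assms(1) by (rule mult_pos_neg)
  then have "v \<bullet> X n ?j < 0" by (simp add: X_def per_mult)
  moreover have "0 \<le> c * norm v" using c by simp
  ultimately show ?thesis by linarith
qed

lemma mult_N_le: "k \<le> M \<Longrightarrow> k * N \<le> M * N" by simp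

text \<open>A vertex that sees \<open>- v\<close> has negative inner product with \<open>v\<close>.
  In each turn the polygon has to get from such a vertex to one that sees \<open>v\<close>.\<close>

lemma entries_ge:
  assumes v: "v \<noteq> 0"
  shows "M - 1 \<le> card {j. j < M * N \<and> \<not> c * norm v \<le> v \<bullet> X (M * N) j \<and> c * norm v \<le> v \<bullet> X (M * N) (Suc j)}"
proof -
  obtain a where a: "a < N" "c * norm v \<le> v \<bullet> x a" using cov by blast
  obtain b where b: "b < N" "c * norm (- v) \<le> (- v) \<bullet> x b" using cov by blast
  have "0 < c * norm v" using c v by simp
  then have b': "v \<bullet> x b < 0" using b(2) by simp
  have ab: "a \<noteq> b" using a(2) b' \<open>0 < c * norm v\<close> by auto
  \<comment> \<open>If \<open>a\<close> precedes \<open>b\<close> in the period, the entry ends one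
    turn later; hence only \<open>M - 1\<close> complete intervals.\<close>
  define s where "s = (if b < a then 0 else 1::nat)"
  show ?thesis
  proof (rule card_crossings[where e = "\<lambda>k. b + k * N" and f = "\<lambda>k. a + (k + s) * N"])
    fix k assume k: "k < M - 1"
    have "(k + s + 1) * N \<le> M * N" using k by (intro mult_N_le) (auto simp: s_def)
    then have 1: "a + (k + s) * N \<le> M * N" using a(1) by (simp add: algebra_simps)
    have 2: "b + k * N < a + (k + s) * N" using ab b(1) by (auto simp: s_def algebra_simps)
    show "\<not> c * norm v \<le> v \<bullet> X (M * N) (b + k * N) \<and> c * norm v \<le> v \<bullet> X (M * N) (a + (k + s) * N) \<and>
        b + k * N < a + (k + s) * N \<and> a + (k + s) * N \<le> M * N"
      using X_in[OF a(2) 1] X_out[OF b' _ v, of k "M * N"] 1 2 by simp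
  next
    fix k assume "Suc k < M - 1"
    show "a + (k + s) * N \<le> b + Suc k * N" using ab a(1) by (auto simp: s_def algebra_simps)
  qed
qed

text \<open>Master inequality from \<open>capw_integral_ge\<close> and
  \<open>integral_hh_le\<close>. Both possible gains are kept: directions entered twice per turn,
  and the integral of the deficit.\<close>

lemma bound_with_defect:
  assumes Q: "Q \<in> lmeasurable" "Q \<subseteq> ball 0 1 - {0}" and M: "M \<ge> 1"
    and card: "\<And>v. v \<in> Q \<Longrightarrow> 2 * (M - 1) \<le>
      card {j. j < M * N \<and> \<not> c * norm v \<le> v \<bullet> X (M * N) j \<and> c * norm v \<le> v \<bullet> X (M * N) (Suc j)}"
  shows "c * (real (M - 1) * (4 * pi + 3 * measure lebesgue Q)) +
    integral {- pi..th (M * N) + pi} (\<lambda>b. runmax d (M * N) b - 2 * c * capw c (runmax d (M * N) b))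
    \<le> M * len + 2 * rho 0"
proof -
  let ?n = "M * N" let ?I = "{- pi..th (M * N) + pi}"
  have "real (M - 1) * (4 * pi) + real (M - 1) * (3 * measure lebesgue Q)
      \<le> integral ?I (\<lambda>b. 2 * capw c (runmax d ?n b))"
  proof (rule capw_integral_ge[OF c Q(1) _ Q(2)])
    fix v :: "real^3" assume "norm v < 1" "v \<noteq> 0"
    then show "real (M - 1) + real (M - 1) * indicator Q v \<le>
      real (card {j. j < ?n \<and> \<not> c * norm v \<le> v \<bullet> X ?n j \<and> c * norm v \<le> v \<bullet> X ?n (Suc j)})"
      using entries_ge[of v M] card[of v] by (cases "v \<in> Q") auto
  qed simp
  then have "real (M - 1) * (4 * pi + 3 * measure lebesgue Q) \<le> integral ?I (\<lambda>b. 2 * capw c (runmax d ?n b))"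
    by (simp add: algebra_simps)
  then have 1: "c * (real (M - 1) * (4 * pi + 3 * measure lebesgue Q)) \<le> c * integral ?I (\<lambda>b. 2 * capw c (runmax d ?n b))"
    using c by (intro mult_left_mono) auto
  have cw: "continuous_on ?I (\<lambda>b. capw c (runmax d ?n b))"
    unfolding capw_def using c by (intro continuous_intros continuous_on_hh) (auto simp: max_def)
  have "integral ?I (\<lambda>b. runmax d ?n b - 2 * c * capw c (runmax d ?n b))
      = integral ?I (runmax d ?n) - integral ?I (\<lambda>b. 2 * c * capw c (runmax d ?n b))"
    by (rule integral_diff) (intro integrable_continuous_real continuous_intros continuous_on_hh cw)+
  also have "integral ?I (\<lambda>b. 2 * c * capw c (runmax d ?n b)) = c * integral ?I (\<lambda>b. 2 * capw c (runmax d ?n b))"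
    by (subst integral_mult_right[symmetric]) (simp add: mult_ac)
  finally show ?thesis
    using 1 integral_hh_le[of ?n] unfolding sum_len by (simp add: rho_per0)
qed

text \<open>A gain repeated in every turn grows linearly in \<open>M\<close>, whereas the lost turn
  and the open ends contribute bounded terms. Dividing by a large \<open>M\<close> leaves the gain
  of one turn.\<close>

lemma defect_on_periods:
  assumes ab: "0 \<le> \<alpha>" "\<alpha> \<le> \<beta>" "\<beta> \<le> \<Theta>" and k: "\<kappa> \<ge> 0"
    and low: "\<And>(M::nat) (k::nat) b. k < M \<Longrightarrow> k * \<Theta> + \<alpha> \<le> b \<Longrightarrow> b \<le> k * \<Theta> + \<beta> \<Longrightarrow>
      \<kappa> \<le> runmax d (M * N) b - 2 * c * capw c (runmax d (M * N) b)"
  shows "4 * pi * c + (\<beta> - \<alpha>) * \<kappa> \<le> len"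
proof (rule ccontr)
  assume "\<not> ?thesis"
  then have "4 * pi * c + (\<beta> - \<alpha>) * \<kappa> - len > 0" by simp
  \<comment> \<open>The left side collects all terms that do not grow with the number of
    turns.\<close>
  then obtain M0 :: nat where M0: "4 * pi * c + 2 * rho 0 < real M0 * (4 * pi * c + (\<beta> - \<alpha>) * \<kappa> - len)"
    using reals_Archimedean3 by blast
  define M where "M = Suc M0"
  have M: "4 * pi * c + 2 * rho 0 < real M * (4 * pi * c + (\<beta> - \<alpha>) * \<kappa> - len)"
    using M0 \<open>4 * pi * c + (\<beta> - \<alpha>) * \<kappa> - len > 0\<close> unfolding M_def by (simp add: algebra_simps)
  define g where "g = (\<lambda>b. runmax d (M * N) b - 2 * c * capw c (runmax d (M * N) b))"
  have gc: "continuous_on S g" for S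
    unfolding g_def capw_def using c by (intro continuous_intros continuous_on_hh) (auto simp: max_def)
  have gi: "g integrable_on {u..v}" for u v by (intro integrable_continuous_real gc)
  have g0: "g b \<ge> 0" for b unfolding g_def using c hh_nonneg by (intro defect_nonneg) auto
  have step: "k * ((\<beta> - \<alpha>) * \<kappa>) \<le> integral {0..k * \<Theta>} g" if "k \<le> M" for k :: nat
    using that
  proof (induction k)
    case (Suc k)
    have "(\<beta> - \<alpha>) * \<kappa> = integral {k * \<Theta> + \<alpha>..k * \<Theta> + \<beta>} (\<lambda>b. \<kappa>)" using ab by simp
    also have "\<dots> \<le> integral {k * \<Theta> + \<alpha>..k * \<Theta> + \<beta>} g"
      using low[of k M] Suc.prems by (intro integral_le gi) (auto simp: g_def)
    also have "\<dots> \<le> integral {k * \<Theta>..Suc k * \<Theta>} g"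
      using ab g0 by (intro integral_subset_le gi) (auto simp: algebra_simps)
    finally have "(\<beta> - \<alpha>) * \<kappa> \<le> integral {k * \<Theta>..Suc k * \<Theta>} g" .
    moreover have "integral {0..k * \<Theta>} g + integral {k * \<Theta>..Suc k * \<Theta>} g = integral {0..Suc k * \<Theta>} g"
      using \<Theta>_nonneg by (intro Henstock_Kurzweil_Integration.integral_combine gi) (auto simp: algebra_simps)
    ultimately show ?case using Suc by (simp add: algebra_simps)
  qed simp
  have "M * ((\<beta> - \<alpha>) * \<kappa>) \<le> integral {0..M * \<Theta>} g" by (rule step) simp
  also have "\<dots> \<le> integral {- pi..th (M * N) + pi} g"
    using g0 by (intro integral_subset_le gi) (auto simp: th_per0)
  finally have "M * ((\<beta> - \<alpha>) * \<kappa>) \<le> integral {- pi..th (M * N) + pi} g" .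
  moreover have "c * (real (M - 1) * (4 * pi)) + integral {- pi..th (M * N) + pi} g \<le> M * len + 2 * rho 0"
    using bound_with_defect[of "{}" M] by (simp add: g_def M_def)
  ultimately have "c * (real (M - 1) * (4 * pi)) + M * ((\<beta> - \<alpha>) * \<kappa>) \<le> M * len + 2 * rho 0" by linarith
  moreover have "real (M - 1) = real M - 1" by (simp add: M_def)
  ultimately show False using M by (simp add: algebra_simps)
qed

lemma len_ge: "4 * pi * c \<le> len"
proof -
  have "4 * pi * c + (0 - 0) * 0 \<le> len"
    by (rule defect_on_periods) (use \<Theta>_nonneg defect_nonneg[OF c hh_nonneg] in auto)
  then show ?thesis by simp
qed

text \<open>The arch of a far vertex alone keeps the maximum above \<open>H\<close> on an angle
  \<delta> behind it, in each turn.\<close>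

lemma len_ge_of_bump:
  assumes \<delta>: "0 \<le> \<delta>" "\<delta> \<le> \<Theta>" "\<delta> \<le> pi/2" and H: "1 < H" "H \<le> rho 0 * cos \<delta>" and c2: "2 * c\<^sup>2 \<le> 1"
  shows "4 * pi * c + \<delta> * ((1 - 1 / H\<^sup>2)\<^sup>2 / 2) \<le> len"
proof -
  have "4 * pi * c + (\<delta> - 0) * ((1 - 1 / H\<^sup>2)\<^sup>2 / 2) \<le> len"
  proof (rule defect_on_periods)
    fix M k :: nat and b assume k: "k < M" and b: "k * \<Theta> + 0 \<le> b" "b \<le> k * \<Theta> + \<delta>"
    have 1: "cos \<delta> \<le> cos (b - k * \<Theta>)" using b \<delta> pi_gt_zero by (intro cos_monotone_0_pi_le) linarith+
    have 2: "cs (b - th (k * N)) = cos (b - k * \<Theta>)"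
      unfolding th_per0 using b \<delta> pi_gt_zero by (intro cs_eq_cos) linarith+
    have "rho 0 * cos \<delta> \<le> rho 0 * cos (b - k * \<Theta>)" using 1 rho_pos[of 0] by (intro mult_left_mono) auto
    also have "\<dots> = d (k * N) b" by (simp add: d_def rho_per0 2)
    also have "\<dots> \<le> runmax d (M * N) b" using k by (intro runmax_ge) simp
    finally have "H \<le> runmax d (M * N) b" using H(2) by linarith
    then show "(1 - 1 / H\<^sup>2)\<^sup>2 / 2 \<le> runmax d (M * N) b - 2 * c * capw c (runmax d (M * N) b)"
      by (rule defect_above[OF c c2 H(1)])
  qed (use \<delta> in auto)
  then show ?thesis by simp
qed

text \<open>Consecutive angles differ by at most \<open>pi/3\<close>, so some vertex lies within
  \<open>pi/3\<close> before \<open>b\<close>, and \<open>cos (pi/3) = 1/2\<close>.\<close>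

lemma runmax_ge_half:
  assumes r: "\<And>i. r0 \<le> rho i" and b: "0 \<le> b" "b \<le> th n" and r0: "r0 > 0"
  shows "r0 / 2 \<le> runmax d n b"
proof -
  have "\<exists>i\<le>n. th i \<le> b \<and> b \<le> th i + pi/3"
    using b(2)
  proof (induction n)
    case 0 then show ?case using b by (auto simp: th_def)
  next
    case (Suc n)
    show ?case
    proof (cases "b \<le> th n")
      case True then show ?thesis using Suc.IH le_SucI by blast
    next
      case False
      then show ?thesis using Suc.prems phi_le[of n] unfolding th_Suc by (intro exI[of _ n]) auto
    qed
  qed
  then obtain i where i: "i \<le> n" "th i \<le> b" "b \<le> th i + pi/3" by blast
  have "cos (pi/3) \<le> cos (b - th i)" using i pi_gt_zero by (intro cos_monotone_0_pi_le) linarith+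
  then have "1/2 \<le> cs (b - th i)" using i pi_gt_zero by (subst cs_eq_cos) (auto simp: cos_60)
  then have "r0 * (1/2) \<le> rho i * cs (b - th i)" using r[of i] r0 by (intro mult_mono) auto
  then show ?thesis using runmax_ge[OF i(1), of d b] by (simp add: d_def)
qed

lemma cs_le_cos: "0 \<le> \<eta> \<Longrightarrow> \<eta> \<le> pi/2 \<Longrightarrow> \<eta> \<le> \<bar>y\<bar> \<Longrightarrow> cs y \<le> cos \<eta>"
proof (cases "\<bar>y\<bar> \<le> pi/2")
  case True
  assume "0 \<le> \<eta>" "\<eta> \<le> pi/2" "\<eta> \<le> \<bar>y\<bar>"
  then have "cos \<bar>y\<bar> \<le> cos \<eta>" using True pi_gt_zero by (intro cos_monotone_0_pi_le) linarith+
  then show ?thesis using True by (simp add: cs_def)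
next
  case False
  assume "0 \<le> \<eta>" "\<eta> \<le> pi/2"
  then show ?thesis using False cos_ge_zero[of \<eta>] by (simp add: cs_def)
qed

text \<open>On the middle third of an angular stretch \<Phi>, the vertices of the stretch contribute
  at most their radius, and all others are at least \<Phi>/3 away and contribute at most
  \<open>cos (\<Phi>/3)\<close>. Hence the maximum stays below \<open>q < 1\<close> there.\<close>

lemma len_ge_of_gap:
  assumes \<Phi>: "0 < \<Phi>" "\<Phi> \<le> pi/2" "\<Phi> \<le> th m" "m \<le> N"
    and rho1: "\<And>i. rho i \<le> 1" and r0: "\<And>i. r0 \<le> rho i" "r0 > 0"
    and q: "q < 1" "cos (\<Phi>/3) \<le> q" "\<And>i. i \<le> m \<Longrightarrow> rho i \<le> q"
    and c2: "(1 + q\<^sup>2) / 2 \<le> 2 * c\<^sup>2"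
  shows "4 * pi * c + \<Phi>/3 * min (r0/2) (((1 - q\<^sup>2) / 2)\<^sup>2 / 2) \<le> len"
proof -
  have TN: "th m \<le> \<Theta>" unfolding \<Theta>_def using \<Phi> by (intro th_mono)
  have "4 * pi * c + (2 * \<Phi>/3 - \<Phi>/3) * min (r0/2) (((1 - q\<^sup>2) / 2)\<^sup>2 / 2) \<le> len"
  proof (rule defect_on_periods)
    fix M k :: nat and b assume k: "k < M" and b: "k * \<Theta> + \<Phi>/3 \<le> b" "b \<le> k * \<Theta> + 2 * \<Phi>/3"
    have kM: "(real k + 1) * \<Theta> \<le> real M * \<Theta>" using k \<Theta>_nonneg by (intro mult_right_mono) auto
    have b0: "0 \<le> b" "b \<le> th (M * N)"
    proof -
      have "0 \<le> k * \<Theta>" using \<Theta>_nonneg by simp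
      then show "0 \<le> b" using b \<Phi> by linarith
      have "b \<le> k * \<Theta> + \<Theta>" using b \<Phi> TN by linarith
      then show "b \<le> th (M * N)" using kM unfolding th_per0 by (simp add: algebra_simps)
    qed
    have l: "r0 / 2 \<le> runmax d (M * N) b" by (rule runmax_ge_half[OF r0(1) b0 r0(2)])
    obtain i where i: "i \<le> M * N" "runmax d (M * N) b = d i b" using runmax_attained by blast
    have "d i b \<le> q"
    proof (cases "k * N \<le> i \<and> i \<le> k * N + m")
      case True
      then obtain j where j: "i = j + k * N" "j \<le> m" by (metis add.commute le_Suc_ex add_le_cancel_left)
      have "rho i * cs (b - th i) \<le> q * 1" using q(3)[OF j(2)] j rho_pos[of i] cs_le_1[of "b - th i"] cs_nonneg[of "b - th i"]
        by (intro mult_mono) (auto simp: rho_per)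
      then show ?thesis by (simp add: d_def)
    next
      case False
      have "\<Phi>/3 \<le> \<bar>b - th i\<bar>"
      proof (cases "k * N \<le> i")
        case True
        then have "m + k * N \<le> i" using False by simp
        then have "th m + k * \<Theta> \<le> th i" using th_mono th_per by metis
        then show ?thesis using b \<Phi> by linarith
      next
        case False
        then have "th i \<le> k * \<Theta>" using th_mono[of i "k * N"] th_per0 by simp
        then show ?thesis using b \<Phi> by linarith
      qed
      then have "cs (b - th i) \<le> cos (\<Phi>/3)" using \<Phi> by (intro cs_le_cos) auto
      then have "rho i * cs (b - th i) \<le> 1 * q" using q rho1[of i] rho_pos[of i] cs_nonneg[of "b - th i"]
        by (intro mult_mono) auto
      then show ?thesis by (simp add: d_def)
    qed
    then show "min (r0/2) (((1 - q\<^sup>2) / 2)\<^sup>2 / 2) \<le> runmax d (M * N) b - 2 * c * capw c (runmax d (M * N) b)"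
      using l i q c r0 by (intro defect_below c c2 q(1)) auto
  qed (use \<Phi> TN r0 in auto)
  then show ?thesis by simp
qed

text \<open>Directions that are seen, lost, seen and lost again within a turn are entered twice per
  turn, so \<open>Q\<close> counts double.\<close>

lemma len_ge_of_pattern:
  assumes rho1: "\<And>i. rho i = 1" and Q: "Q \<in> lmeasurable" "Q \<subseteq> ball 0 1 - {0}"
    and pat: "i1 < N" "i1 < i2" "i2 < i3" "i3 < i4" "i4 < i1 + N"
    and v: "\<And>v. v \<in> Q \<Longrightarrow> c * norm v \<le> v \<bullet> x i1 \<and> v \<bullet> x i2 < c * norm v \<and> c * norm v \<le> v \<bullet> x i3 \<and> v \<bullet> x i4 < c * norm v"
  shows "c * (4 * pi + 3 * measure lebesgue Q) \<le> len"
proof -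
  \<comment> \<open>On the unit sphere the maximum is at most \<open>1\<close>, so convexification
    moves no vertex and plain invisibility suffices.\<close>
  have X: "X n j = x j" if "j \<le> n" for n j
  proof -
    have "rt n j * cos (th j - th j) \<le> runmax d n (th j)" by (rule rt_cos_le) (use that in auto)
    also have "\<dots> \<le> 1" using runmax_attained[of n d "th j"] cs_le_1 by (auto simp: d_def rho1)
    finally show ?thesis using rt_ge_rho[OF that] by (simp add: X_def rho1)
  qed
  have main: "c * (real (M - 1) * (4 * pi + 3 * measure lebesgue Q)) \<le> M * len + 2" if M: "M \<ge> 1" for M
  proof -
    let ?n = "M * N"
    have "0 \<le> integral {- pi..th ?n + pi} (\<lambda>b. runmax d ?n b - 2 * c * capw c (runmax d ?n b))"
    proof (rule integral_nonneg)
      show "(\<lambda>b. runmax d ?n b - 2 * c * capw c (runmax d ?n b)) integrable_on {- pi..th ?n + pi}"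
        unfolding capw_def using c by (intro integrable_continuous_real continuous_intros continuous_on_hh) (auto simp: max_def)
    qed (use defect_nonneg[OF c hh_nonneg] in auto)
    moreover have "c * (real (M - 1) * (4 * pi + 3 * measure lebesgue Q)) +
      integral {- pi..th ?n + pi} (\<lambda>b. runmax d ?n b - 2 * c * capw c (runmax d ?n b)) \<le> M * len + 2 * rho 0"
    proof (rule bound_with_defect[OF Q M])
      fix v assume vO: "v \<in> Q"
      \<comment> \<open>Two entries per turn: even \<open>m\<close> stands for the passage from
        \<open>i2\<close> to \<open>i3\<close>, odd \<open>m\<close> for the one from
        \<open>i4\<close> to \<open>i1\<close> of the next turn.\<close>
      define e where "e m = (if even m then i2 else i4) + (m div 2) * N" for m
      define f where "f m = (if even m then i3 else i1 + N) + (m div 2) * N" for m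
      show "2 * (M - 1) \<le> card {j. j < ?n \<and> \<not> c * norm v \<le> v \<bullet> X ?n j \<and> c * norm v \<le> v \<bullet> X ?n (Suc j)}"
      proof (rule card_crossings[where e = e and f = f])
        fix m assume m: "m < 2 * (M - 1)"
        have "(m div 2 + 2) * N \<le> M * N" using m by (intro mult_N_le) auto
        then have fn: "f m \<le> M * N" using pat by (auto simp: f_def algebra_simps)
        have ef: "e m < f m" using pat by (auto simp: e_def f_def)
        have "x (e m) = (if even m then x i2 else x i4)" by (auto simp: e_def per_mult)
        moreover have "x (f m) = (if even m then x i3 else x i1)"
          using per_mult[of "i1 + N" "m div 2"] per[of i1] by (auto simp: f_def per_mult)
        ultimately show "\<not> c * norm v \<le> v \<bullet> X ?n (e m) \<and> c * norm v \<le> v \<bullet> X ?n (f m) \<and> e m < f m \<and> f m \<le> ?n"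
          using v[OF vO] fn ef X[of "e m" ?n] X[of "f m" ?n] by auto
      next
        fix m assume "Suc m < 2 * (M - 1)"
        show "f m \<le> e (Suc m)"
        proof (cases "even m")
          case True
          then have "Suc m div 2 = m div 2" by simp
          then show ?thesis using True pat by (simp add: e_def f_def)
        next
          case False
          then have "Suc m div 2 = Suc (m div 2)" by simp
          then show ?thesis using False pat by (simp add: e_def f_def)
        qed
      qed
    qed
    ultimately show ?thesis by (simp add: rho1)
  qed
  show ?thesis
  proof (rule ccontr)
    assume "\<not> ?thesis"
    then have p: "c * (4 * pi + 3 * measure lebesgue Q) - len > 0" by simp
    then obtain M0 :: nat where M0: "c * (4 * pi + 3 * measure lebesgue Q) + 2 < real M0 * (c * (4 * pi + 3 * measure lebesgue Q) - len)"
      using reals_Archimedean3 by blast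
    have "c * (real (Suc M0 - 1) * (4 * pi + 3 * measure lebesgue Q)) \<le> Suc M0 * len + 2" by (rule main) simp
    then have "real M0 * (c * (4 * pi + 3 * measure lebesgue Q) - len) \<le> len + 2" by (simp add: algebra_simps)
    then show False using M0 p by linarith
  qed
qed

end

section \<open>Accumulated angle and change of direction\<close>

lemma norm_sgn_diff_le:
  fixes a b :: "'a::real_inner"
  assumes "r > 0" "r \<le> norm a" "r \<le> norm b"
  shows "norm (sgn a - sgn b) \<le> 2 * norm (a - b) / r"
proof -
  have a: "a \<noteq> 0" and b: "b \<noteq> 0" using assms by auto
  have e: "sgn a - sgn b = (a - b) /\<^sub>R norm a + (1 / norm a - 1 / norm b) *\<^sub>R b"
    by (simp add: sgn_div_norm divide_inverse algebra_simps)
  have "norm (sgn a - sgn b) \<le> norm (a - b) / norm a + \<bar>1 / norm a - 1 / norm b\<bar> * norm b"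
    unfolding e by (rule order_trans[OF norm_triangle_ineq]) (simp add: divide_inverse mult.commute)
  also have "\<bar>1 / norm a - 1 / norm b\<bar> * norm b = \<bar>norm b - norm a\<bar> / norm a"
  proof -
    have "1 / norm a - 1 / norm b = (norm b - norm a) / (norm a * norm b)" using a b by (simp add: field_simps)
    then show ?thesis using a b by (simp add: abs_mult)
  qed
  also have "\<dots> \<le> norm (a - b) / norm a"
    by (intro divide_right_mono) (use norm_triangle_ineq3[of b a] in \<open>simp_all add: norm_minus_commute\<close>)
  finally have "norm (sgn a - sgn b) \<le> 2 * norm (a - b) / norm a" by simp
  also have "\<dots> \<le> 2 * norm (a - b) / r" using assms a by (intro divide_left_mono) auto
  finally show ?thesis .
qed

context polygon begin

lemma norm_sgn_step_le: "norm (sgn (x (Suc i)) - sgn (x i)) \<le> phi i"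
proof -
  have n: "norm (sgn (x j)) = 1" for j using nz by (simp add: norm_sgn)
  have ip: "sgn (x (Suc i)) \<bullet> sgn (x i) = cos (phi i)"
    unfolding cos_phi by (simp add: sgn_div_norm rho_def inner_commute divide_inverse mult_ac)
  have "(norm (sgn (x (Suc i)) - sgn (x i)))\<^sup>2 = 2 - 2 * cos (phi i)"
    using n[of i] n[of "Suc i"] ip
    by (simp add: power2_norm_eq_inner inner_diff inner_commute norm_eq_1)
  also have "\<dots> = (2 * sin (phi i / 2))\<^sup>2"
    using cos_double_sin[of "phi i / 2"] by (simp add: power_mult_distrib)
  also have "\<dots> \<le> (phi i)\<^sup>2"
  proof (rule power_mono)
    show "2 * sin (phi i / 2) \<le> phi i" using sin_x_le_x[of "phi i / 2"] phi_nonneg[of i] by simp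
    show "0 \<le> 2 * sin (phi i / 2)" using phi_nonneg[of i] phi_le[of i] pi_gt_zero
      by (intro mult_nonneg_nonneg sin_ge_zero) linarith+
  qed
  finally show ?thesis using phi_nonneg by (rule power2_le_imp_le)
qed

lemma norm_sgn_diff_le_th: "i \<le> j \<Longrightarrow> norm (sgn (x j) - sgn (x i)) \<le> th j - th i"
proof (induction j rule: dec_induct)
  case (step j)
  have "sgn (x (Suc j)) - sgn (x i) = (sgn (x (Suc j)) - sgn (x j)) + (sgn (x j) - sgn (x i))" by simp
  then have "norm (sgn (x (Suc j)) - sgn (x i)) \<le> norm (sgn (x (Suc j)) - sgn (x j)) + norm (sgn (x j) - sgn (x i))"
    by (metis norm_triangle_ineq)
  then show ?case using step norm_sgn_step_le[of j] by (simp add: th_Suc)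
qed simp

end

text \<open>A vertex that sees \<open>- x 0\<close> makes at least a right angle with
  \<open>x 0\<close>. The bound provides room for an angular window of fixed size in each turn,
  whatever the mesh.\<close>

lemma (in periodic_polygon) \<Theta>_ge_1: "1 \<le> \<Theta>"
proof -
  obtain j where j: "j < N" "c * norm (- x 0) \<le> (- x 0) \<bullet> x j" using cov by blast
  have "0 \<le> c * norm (- x 0)" using c by simp
  then have "x 0 \<bullet> x j \<le> 0" using j(2) by (simp add: inner_minus_left)
  then have ip: "sgn (x j) \<bullet> sgn (x 0) \<le> 0"
    by (simp add: sgn_div_norm inner_commute mult_nonneg_nonpos)
  have n: "norm (sgn (x j)) = 1" for j using nz by (simp add: norm_sgn)
  have "(norm (sgn (x j) - sgn (x 0)))\<^sup>2 = 2 - 2 * (sgn (x j) \<bullet> sgn (x 0))"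
    using n[of j] n[of 0] by (simp add: power2_norm_eq_inner inner_diff inner_commute norm_eq_1)
  then have "1\<^sup>2 \<le> (norm (sgn (x j) - sgn (x 0)))\<^sup>2" using ip by simp
  then have "1 \<le> norm (sgn (x j) - sgn (x 0))" by (rule power2_le_imp_le) simp
  also have "\<dots> \<le> th j - th 0" by (rule norm_sgn_diff_le_th) simp
  also have "\<dots> \<le> \<Theta>" using th_mono[of j N] j(1) by (simp add: \<Theta>_def th_def)
  finally show ?thesis .
qed

section \<open>Lipschitz curves and the inequality\<close>

locale inspecting_curve =
  fixes s :: "real \<Rightarrow> real^3" and l c :: real
  assumes l: "l > 0" and c: "c > 0"
    and periodic: "s (t + l) = s t"
    and lip: "norm (s t - s u) \<le> \<bar>t - u\<bar>"
    and far: "c \<le> norm (s t)"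
    and inspects: "\<exists>t. c * norm v \<le> v \<bullet> s t"
begin

lemma cont: "continuous_on S s"
proof (rule lipschitz_on_continuous_on)
  show "1-lipschitz_on S s" by (rule lipschitz_onI) (simp_all add: dist_norm lip)
qed

lemma periodic_nat: "s (t + real k * l) = s t"
proof (induction k)
  case (Suc k)
  have "s (t + real (Suc k) * l) = s ((t + real k * l) + l)" by (simp add: algebra_simps)
  then show ?case using periodic Suc by simp
qed simp

lemma periodic_int: "s (t + of_int k * l) = s t"
proof (cases "k \<ge> 0")
  case True then show ?thesis using periodic_nat[of t "nat k"] by simp
next
  case False
  then have "(t + of_int k * l) + real (nat (- k)) * l = t" by (simp add: algebra_simps)
  then show ?thesis using periodic_nat[of "t + of_int k * l" "nat (- k)"] by (simp only:)
qed

lemma periodic_minus: "s (t - l) = s t" using periodic[of "t - l"] by simp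

lemma shift_to_window: obtains k :: int where "a \<le> t + of_int k * l" "t + of_int k * l < a + l"
proof
  let ?k = "- \<lfloor>(t - a) / l\<rfloor>"
  have "of_int \<lfloor>(t - a) / l\<rfloor> * l \<le> t - a" using l by (simp add: floor_divide_lower)
  then show "a \<le> t + of_int ?k * l" by simp
  have "t - a < (of_int \<lfloor>(t - a) / l\<rfloor> + 1) * l" using l by (rule floor_divide_upper)
  then show "t + of_int ?k * l < a + l" by (simp add: algebra_simps)
qed

lemma inspects_window: "\<exists>t. a \<le> t \<and> t < a + l \<and> c * norm v \<le> v \<bullet> s t"
proof -
  obtain t where t: "c * norm v \<le> v \<bullet> s t" using inspects by blast
  obtain k :: int where "a \<le> t + of_int k * l" "t + of_int k * l < a + l" by (rule shift_to_window)
  then show ?thesis using t periodic_int by metis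
qed

lemma fine_mesh: "\<eta> > 0 \<Longrightarrow> \<exists>N. (0::nat) < N \<and> l / real N < \<eta>"
proof -
  assume e: "\<eta> > 0"
  obtain N :: nat where N: "l / \<eta> < N" using reals_Archimedean2 by blast
  then have "0 < real N" using l e by (meson divide_pos_pos less_trans)
  then show ?thesis using N e by (intro exI[of _ N]) (auto simp: field_simps)
qed

lemma grid_index:
  fixes N :: nat and t :: real
  assumes "N > 0" "0 \<le> t" "t < l"
  defines "i \<equiv> nat \<lfloor>t * N / l\<rfloor>"
  shows "i < N" "i * (l / N) \<le> t" "t < i * (l / N) + l / N" "norm (s (i * (l / N)) - s t) \<le> l / N"
proof -
  define h where "h = l / N"
  have h: "h > 0" using l assms by (simp add: h_def)
  have e: "t * N / l = t / h" using l assms by (simp add: h_def)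
  have i: "real i = of_int \<lfloor>t / h\<rfloor>" unfolding i_def e using h assms by simp
  have 1: "i * h \<le> t" unfolding i using h by (simp add: floor_divide_lower)
  have 2: "t < i * h + h" unfolding i using floor_divide_upper[OF h, of t] by (simp add: algebra_simps)
  show "i * (l / N) \<le> t" "t < i * (l / N) + l / N" using 1 2 by (simp_all add: h_def)
  have "i * h < N * h" using 1 assms by (simp add: h_def)
  then show "i < N" using h by simp
  show "norm (s (i * (l / N)) - s t) \<le> l / N" using lip[of "i * h" t] 1 2 by (simp add: h_def)
qed

definition grid :: "nat \<Rightarrow> nat \<Rightarrow> real^3" where "grid N i = s (i * (l / N))"

lemma grid_step: "norm (grid N (Suc i) - grid N i) \<le> l / N"
proof -
  have "Suc i * (l / N) - i * (l / N) = l / N" by (simp add: left_diff_distrib[symmetric] del: times_divide_eq_right)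
  then have "\<bar>Suc i * (l / N) - i * (l / N)\<bar> = l / N" using l by (simp only:) simp
  then show ?thesis using lip[of "Suc i * (l / N)" "i * (l / N)"] unfolding grid_def by (simp only:)
qed

text \<open>A vertex within one mesh width of each point of the curve costs \<open>l / N\<close> of
  the threshold. Edges shorter than \<open>c\<close>, seen from distance at least \<open>c\<close>,
  subtend at most \<open>pi/3\<close>.\<close>

lemma grid_polygon:
  assumes N: "N > 0" "l / N < c"
  shows "periodic_polygon (grid N) N (c - l / N)"
proof
  fix i
  show "grid N i \<noteq> 0" using far[of "i * (l / N)"] c by (auto simp: grid_def)
  have st: "norm (grid N i - grid N (Suc i)) \<le> l / N" using grid_step by (simp add: norm_minus_commute)
  let ?a = "grid N i" let ?b = "grid N (Suc i)"
  have n: "c \<le> norm ?a" "c \<le> norm ?b" using far by (auto simp: grid_def)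
  have "(norm (?a - ?b))\<^sup>2 \<le> c\<^sup>2" using st N(2) by (intro power_mono) auto
  also have "c\<^sup>2 \<le> norm ?a * norm ?b" unfolding power2_eq_square using n c by (intro mult_mono) auto
  finally have "(norm (?a - ?b))\<^sup>2 \<le> norm ?a * norm ?b" .
  moreover have "(norm (?a - ?b))\<^sup>2 = (norm ?a)\<^sup>2 + (norm ?b)\<^sup>2 - 2 * (?a \<bullet> ?b)"
    by (simp add: power2_norm_eq_inner inner_diff inner_commute)
  moreover have "2 * (norm ?a * norm ?b) \<le> (norm ?a)\<^sup>2 + (norm ?b)\<^sup>2"
    using sum_squares_bound[of "norm ?a" "norm ?b"] by simp
  ultimately show "norm (grid N i) * norm (grid N (Suc i)) / 2 \<le> grid N i \<bullet> grid N (Suc i)" by linarith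
  show "grid N (i + N) = grid N i"
  proof -
    have "real (i + N) * (l / N) = real i * (l / N) + l" using N by (simp add: field_simps)
    then show ?thesis unfolding grid_def using periodic by simp
  qed
next
  show "0 < N" "0 < c - l / N" using N by auto
  fix v :: "real^3"
  obtain t where t: "0 \<le> t" "t < 0 + l" "c * norm v \<le> v \<bullet> s t" using inspects_window[of 0 v] by auto
  let ?i = "nat \<lfloor>t * N / l\<rfloor>"
  have g: "?i < N" "norm (s (?i * (l / N)) - s t) \<le> l / N" using grid_index[OF N(1) t(1)] t(2) by auto
  have "v \<bullet> s t - v \<bullet> grid N ?i \<le> norm v * (l / N)"
  proof -
    have "v \<bullet> s t - v \<bullet> grid N ?i = v \<bullet> (s t - grid N ?i)" by (simp add: inner_diff_right)
    also have "\<dots> \<le> norm v * norm (s t - grid N ?i)" by (rule norm_cauchy_schwarz)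
    also have "\<dots> \<le> norm v * (l / N)" using g(2) by (intro mult_left_mono) (auto simp: grid_def norm_minus_commute)
    finally show ?thesis .
  qed
  then have "(c - l / N) * norm v \<le> v \<bullet> grid N ?i" using t(3) by (simp add: algebra_simps)
  then show "\<exists>i<N. (c - l / N) * norm v \<le> v \<bullet> grid N i" using g(1) by blast
qed

lemma grid_len_le:
  assumes N: "N > 0" shows "(\<Sum>i<N. norm (grid N (Suc i) - grid N i)) \<le> l"
proof -
  have "(\<Sum>i<N. norm (grid N (Suc i) - grid N i)) \<le> (\<Sum>i<N. l / N)" by (intro sum_mono grid_step)
  then show ?thesis using N by simp
qed

lemma grid_len_ge:
  assumes N: "N > 0" "l / N < c" shows "4 * pi * (c - l / N) \<le> (\<Sum>i<N. norm (grid N (Suc i) - grid N i))"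
proof -
  interpret periodic_polygon "grid N" N "c - l / N" by (rule grid_polygon[OF N])
  show ?thesis using len_ge unfolding len_def .
qed

theorem length_ge: "4 * pi * c \<le> l"
proof (rule ccontr)
  assume "\<not> 4 * pi * c \<le> l"
  then have d: "4 * pi * c - l > 0" by simp
  obtain N :: nat where N: "N > 0" "l / N < min c ((4 * pi * c - l) / (4 * pi))"
    using fine_mesh[of "min c ((4 * pi * c - l) / (4 * pi))"] d c by auto
  have "4 * pi * (c - l / N) \<le> l" using grid_len_ge[of N] grid_len_le[of N] N by linarith
  moreover have "(l / N) * (4 * pi) < 4 * pi * c - l" using N(2) by (simp add: pos_less_divide_eq)
  ultimately show False by (simp add: algebra_simps)
qed

lemma shift: "inspecting_curve (\<lambda>t. s (t + a)) l c"
proof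
  fix t u v
  show "s (t + l + a) = s (t + a)" using periodic[of "t + a"] by (simp add: add_ac)
  show "norm (s (t + a) - s (u + a)) \<le> \<bar>t - u\<bar>" using lip[of "t + a" "u + a"] by simp
  obtain t where "c * norm v \<le> v \<bullet> s t" using inspects by blast
  then show "\<exists>t. c * norm v \<le> v \<bullet> s (t + a)" by (intro exI[of _ "t - a"]) simp
qed (use l c far in auto)

lemma reverse: "inspecting_curve (\<lambda>t. s (- t)) l c"
proof
  fix t u v
  show "s (- (t + l)) = s (- t)" using periodic[of "- t - l"] by simp
  show "norm (s (- t) - s (- u)) \<le> \<bar>t - u\<bar>" using lip[of "- t" "- u"] by simp
  obtain t where "c * norm v \<le> v \<bullet> s t" using inspects by blast
  then show "\<exists>t. c * norm v \<le> v \<bullet> s (- t)" by (intro exI[of _ "- t"]) simp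
qed (use l c far in auto)

end

text \<open>Periodic extension by reduction modulo \<open>l\<close>. The 1-Lipschitz condition,
  instead of parameterization by arclength, is what survives the cutting and gluing to which this is
  applied.\<close>

lemma inspecting_curveI_closed:
  fixes f :: "real \<Rightarrow> real^3"
  assumes l: "l > 0" and c: "c > 0" and cl: "f 0 = f l"
    and lip: "\<And>t u. 0 \<le> t \<Longrightarrow> t \<le> u \<Longrightarrow> u \<le> l \<Longrightarrow> norm (f t - f u) \<le> u - t"
    and far: "\<And>t. 0 \<le> t \<Longrightarrow> t \<le> l \<Longrightarrow> c \<le> norm (f t)"
    and ins: "\<And>v. \<exists>t. 0 \<le> t \<and> t \<le> l \<and> c * norm v \<le> v \<bullet> f t"
  shows "inspecting_curve (\<lambda>t. f (t - l * of_int \<lfloor>t / l\<rfloor>)) l c"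
proof
  define r where "r t = t - l * of_int \<lfloor>t / l\<rfloor>" for t
  have r0: "0 \<le> r t" for t using floor_divide_lower[OF l, of t] by (simp add: r_def mult.commute)
  have rl: "r t < l" for t using floor_divide_upper[OF l, of t] by (simp add: r_def algebra_simps)
  have lip': "norm (f (r t) - f (r u)) \<le> u - t" if tu: "t \<le> u" for t u
  proof (cases "\<lfloor>t / l\<rfloor> = \<lfloor>u / l\<rfloor>")
    case True
    then have e: "u - t = r u - r t" by (simp add: r_def)
    then show ?thesis using lip[of "r t" "r u"] r0[of t] rl[of u] tu by simp
  next
    case False
    have "\<lfloor>t / l\<rfloor> \<le> \<lfloor>u / l\<rfloor>" using tu l by (intro floor_mono divide_right_mono) auto
    then have "\<lfloor>t / l\<rfloor> + 1 \<le> \<lfloor>u / l\<rfloor>" using False by simp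
    then have "l * (of_int \<lfloor>t / l\<rfloor> + 1) \<le> l * of_int \<lfloor>u / l\<rfloor>" using l by (intro mult_left_mono) linarith+
    \<comment> \<open>Between different periods one can pass through the common value at
      \<open>l\<close> and \<open>0\<close>; this detour is no longer than
      \<open>u - t\<close>.\<close>
    then have e: "(l - r t) + r u \<le> u - t" by (simp add: r_def algebra_simps)
    have "norm (f (r t) - f (r u)) \<le> norm (f (r t) - f l) + norm (f 0 - f (r u))"
      using norm_triangle_ineq[of "f (r t) - f l" "f 0 - f (r u)"] cl by simp
    also have "\<dots> \<le> (l - r t) + (r u - 0)"
      using lip[of "r t" l] lip[of 0 "r u"] r0[of t] rl[of t] r0[of u] rl[of u] by (intro add_mono) auto
    finally show ?thesis using e by linarith
  qed
  fix t u v
  have "r (t + l) = r t" using l by (simp add: r_def add_divide_distrib algebra_simps)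
  then show "f (t + l - l * of_int \<lfloor>(t + l) / l\<rfloor>) = f (t - l * of_int \<lfloor>t / l\<rfloor>)" unfolding r_def by (simp only:)
  show "norm (f (t - l * of_int \<lfloor>t / l\<rfloor>) - f (u - l * of_int \<lfloor>u / l\<rfloor>)) \<le> \<bar>t - u\<bar>"
    using lip'[of t u] lip'[of u t] by (cases "t \<le> u") (auto simp: r_def norm_minus_commute)
  show "c \<le> norm (f (t - l * of_int \<lfloor>t / l\<rfloor>))" using far[of "r t"] r0[of t] rl[of t] by (simp add: r_def)
  obtain \<tau> where \<tau>: "0 \<le> \<tau>" "\<tau> \<le> l" "c * norm v \<le> v \<bullet> f \<tau>" using ins by blast
  show "\<exists>t. c * norm v \<le> v \<bullet> f (t - l * of_int \<lfloor>t / l\<rfloor>)"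
  proof (cases "\<tau> = l")
    case True
    then show ?thesis using \<tau> cl by (intro exI[of _ 0]) simp
  next
    case False
    then have "\<lfloor>\<tau> / l\<rfloor> = 0" using \<tau> l by (simp add: floor_eq_iff)
    then show ?thesis using \<tau> by (intro exI[of _ \<tau>]) simp
  qed
qed (use l c in auto)

text \<open>A loop from which nothing is seen that is not seen elsewhere can be cut out, and the
  inequality then holds for the shorter curve. For an extremal curve this is a
  contradiction.\<close>

lemma (in inspecting_curve) length_ge_excised:
  assumes t: "t1 < t2" "t2 < t1 + l" and eq: "s t1 = s t2"
    and cov: "\<And>t v. t1 \<le> t \<Longrightarrow> t \<le> t2 \<Longrightarrow> c * norm v \<le> v \<bullet> s t \<Longrightarrow> \<exists>t'. t2 \<le> t' \<and> t' \<le> t1 + l \<and> c * norm v \<le> v \<bullet> s t'"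
  shows "4 * pi * c \<le> l - (t2 - t1)"
proof -
  have "inspecting_curve (\<lambda>t. s ((t - (l - (t2 - t1)) * of_int \<lfloor>t / (l - (t2 - t1))\<rfloor>) + t2)) (l - (t2 - t1)) c"
  proof (rule inspecting_curveI_closed[where f = "\<lambda>t. s (t + t2)"])
    show "s (0 + t2) = s (l - (t2 - t1) + t2)" using eq periodic[of t1] by (simp add: algebra_simps)
    show "norm (s (t + t2) - s (u + t2)) \<le> u - t" if "t \<le> u" for t u
      using lip[of "t + t2" "u + t2"] that by simp
    fix v
    obtain t where t: "t1 \<le> t" "t < t1 + l" "c * norm v \<le> v \<bullet> s t" using inspects_window by blast
    have "\<exists>t'. t2 \<le> t' \<and> t' \<le> t1 + l \<and> c * norm v \<le> v \<bullet> s t'"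
    proof (cases "t \<le> t2")
      case True then show ?thesis using cov t by blast
    next
      case False then show ?thesis using t by (intro exI[of _ t]) auto
    qed
    then obtain t' where t': "t2 \<le> t'" "t' \<le> t1 + l" "c * norm v \<le> v \<bullet> s t'" by blast
    then show "\<exists>t. 0 \<le> t \<and> t \<le> l - (t2 - t1) \<and> c * norm v \<le> v \<bullet> s (t + t2)"
      by (intro exI[of _ "t' - t2"]) auto
  qed (use t c far in auto)
  then show ?thesis by (rule inspecting_curve.length_ge)
qed

section \<open>Equality: the curve lies on the unit sphere and no cap is entered twice\<close>

locale extremal_curve = inspecting_curve +
  assumes l_eq: "l = 4 * pi * c" and c_sq: "2 * c\<^sup>2 = 1"
begin

lemma shift': "extremal_curve (\<lambda>t. s (t + a)) l c"
  by (rule extremal_curve.intro[OF shift]) (unfold_locales, rule l_eq, rule c_sq)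

lemma reverse': "extremal_curve (\<lambda>t. s (- t)) l c"
  by (rule extremal_curve.intro[OF reverse]) (unfold_locales, rule l_eq, rule c_sq)

lemma no_excision:
  assumes "t1 < t2" "t2 < t1 + l" "s t1 = s t2"
    and "\<And>t v. t1 \<le> t \<Longrightarrow> t \<le> t2 \<Longrightarrow> c * norm v \<le> v \<bullet> s t \<Longrightarrow> \<exists>t'. t2 \<le> t' \<and> t' \<le> t1 + l \<and> c * norm v \<le> v \<bullet> s t'"
  shows False
  using length_ge_excised[OF assms] assms(1) l_eq by simp

lemma nonconstant: "t1 < t2 \<Longrightarrow> \<exists>t. t1 < t \<and> t < t2 \<and> s t \<noteq> s t1"
proof (rule ccontr)
  assume t: "t1 < t2" and "\<not> (\<exists>t. t1 < t \<and> t < t2 \<and> s t \<noteq> s t1)"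
  then have const: "s t = s t1" if "t1 \<le> t" "t < t2" for t using that by (cases "t = t1") auto
  \<comment> \<open>The resting interval is shortened below one period to meet the conditions of
    \<open>no_excision\<close>.\<close>
  define m where "m = min ((t1 + t2) / 2) (t1 + l / 2)"
  have m: "t1 < m" "m < t2" "m < t1 + l" using t l by (auto simp: m_def min_def)
  show False
  proof (rule no_excision[OF m(1,3)])
    show "s t1 = s m" using const[of m] m by simp
    fix t v assume "t1 \<le> t" "t \<le> m" "c * norm v \<le> v \<bullet> s t"
    then show "\<exists>t'. m \<le> t' \<and> t' \<le> t1 + l \<and> c * norm v \<le> v \<bullet> s t'"
      using const[of t] const[of m] m by (intro exI[of _ m]) auto
  qed
qed

text \<open>The polygon bound is weaker than the bound for the curve by
  \<open>4 * pi * l / N\<close> only, so in the case of equality no surplus independent of the mesh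
  is possible.\<close>

lemma small_mesh_bound:
  assumes D: "D > 0" and "\<eta> > 0"
    and b: "\<And>N::nat. N > 0 \<Longrightarrow> l / N < \<eta> \<Longrightarrow> l / N < c \<Longrightarrow>
      4 * pi * (c - l / N) + D \<le> (\<Sum>i<N. norm (grid N (Suc i) - grid N i))"
  shows False
proof -
  obtain N :: nat where N: "N > 0" "l / N < min (min c \<eta>) (D / (4 * pi))"
    using fine_mesh[of "min (min c \<eta>) (D / (4 * pi))"] D c assms(2) by auto
  have "4 * pi * (c - l / N) + D \<le> l" using b[of N] grid_len_le[of N] N by auto
  moreover have "(l / N) * (4 * pi) < D" using N(2) by (simp add: pos_less_divide_eq)
  ultimately show False using l_eq by (simp add: algebra_simps)
qed

text \<open>The parameter \<open>0\<close> is a vertex of every grid; other parameters are reduced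
  to it by a shift.\<close>

lemma norm_0_le_1: "norm (s 0) \<le> 1"
proof (rule ccontr)
  assume "\<not> norm (s 0) \<le> 1"
  define R where "R = norm (s 0)"
  have R: "R > 1" using \<open>\<not> norm (s 0) \<le> 1\<close> by (simp add: R_def)
  \<comment> \<open>Chosen such that \<open>R * q\<close> is the midpoint \<open>H\<close> of
    \<open>1\<close> and \<open>R\<close>.\<close>
  define q where "q = (1 + R) / (2 * R)"
  have q: "0 < q" "q < 1" using R by (auto simp: q_def field_simps)
  \<comment> \<open>The bound \<open>1\<close> lets the window fit into one turn by
    \<open>P.\<Theta>_ge_1\<close>.\<close>
  define \<delta> where "\<delta> = min (arccos q) 1"
  have aq: "0 < arccos q" "arccos q < pi" using q arccos_lt_bounded[of q] by auto
  have \<delta>: "0 < \<delta>" "\<delta> \<le> 1" "\<delta> \<le> pi/2" using aq pi_gt3 by (auto simp: \<delta>_def)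
  have "cos (arccos q) \<le> cos \<delta>" using \<delta> aq by (intro cos_monotone_0_pi_le) (auto simp: \<delta>_def)
  then have cd: "q \<le> cos \<delta>" using q by simp
  define H where "H = (1 + R) / 2"
  have H: "1 < H" "H \<le> R * cos \<delta>"
  proof -
    show "1 < H" using R by (simp add: H_def)
    have "H = R * q" using R by (simp add: H_def q_def)
    also have "\<dots> \<le> R * cos \<delta>" using cd R by (intro mult_left_mono) auto
    finally show "H \<le> R * cos \<delta>" .
  qed
  have H2: "1 < H\<^sup>2" using H(1) by (simp add: one_less_power)
  show False
  proof (rule small_mesh_bound)
    have "1 / H\<^sup>2 < 1" using H2 by (subst divide_less_eq_1_pos) linarith+
    then have "1 - 1 / H\<^sup>2 \<noteq> 0" by linarith
    then show "\<delta> * ((1 - 1 / H\<^sup>2)\<^sup>2 / 2) > 0" using \<delta> by simp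
    fix N :: nat assume N: "N > 0" "l / N < c"
    interpret P: periodic_polygon "grid N" N "c - l / N" by (rule grid_polygon[OF N])
    have r0: "P.rho 0 = R" by (simp add: P.rho_def grid_def R_def)
    have "(c - l / N)\<^sup>2 \<le> c\<^sup>2" using N l by (intro power_mono) auto
    then have "2 * (c - l / N)\<^sup>2 \<le> 1" using c_sq by simp
    then show "4 * pi * (c - l / N) + \<delta> * ((1 - 1 / H\<^sup>2)\<^sup>2 / 2) \<le> (\<Sum>i<N. norm (grid N (Suc i) - grid N i))"
      using P.len_ge_of_bump[of \<delta> H] \<delta> H P.\<Theta>_ge_1 r0 unfolding P.len_def by auto
  qed (rule c)
qed

lemma norm_le_1: "norm (s t) \<le> 1"
proof -
  interpret S: extremal_curve "\<lambda>u. s (u + t)" l c by (rule shift')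
  show ?thesis using S.norm_0_le_1 by simp
qed

text \<open>Turning while strictly inside the sphere would roll out to a positive angle with radii
  below some \<open>q < 1\<close>, and \<open>len_ge_of_gap\<close> would give a surplus independent
  of the mesh.\<close>

lemma sgn_const_aux:
  assumes u: "0 \<le> u" "u < l" and less: "\<And>t. 0 \<le> t \<Longrightarrow> t \<le> u \<Longrightarrow> norm (s t) < 1"
  shows "sgn (s u) = sgn (s 0)"
proof (rule ccontr)
  assume ne: "sgn (s u) \<noteq> sgn (s 0)"
  define \<Phi>0 where "\<Phi>0 = norm (sgn (s u) - sgn (s 0))"
  have \<Phi>0: "\<Phi>0 > 0" using ne by (simp add: \<Phi>0_def)
  define \<Phi> where "\<Phi> = min (\<Phi>0 / 2) 1"
  have \<Phi>: "0 < \<Phi>" "\<Phi> \<le> 1" "\<Phi> \<le> pi/2" "\<Phi> \<le> \<Phi>0 / 2" using \<Phi>0 pi_gt3 by (auto simp: \<Phi>_def)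
  have "\<exists>t\<in>{0..u}. \<forall>t'\<in>{0..u}. norm (s t') \<le> norm (s t)"
    using u by (intro continuous_attains_sup continuous_intros cont) auto
  then obtain tm where tm: "0 \<le> tm" "tm \<le> u" "\<And>t. 0 \<le> t \<Longrightarrow> t \<le> u \<Longrightarrow> norm (s t) \<le> norm (s tm)" by auto
  define q where "q = max (norm (s tm)) (cos (\<Phi>/3))"
  have "cos (\<Phi>/3) < cos 0" using \<Phi> pi_gt_zero by (intro cos_monotone_0_pi) linarith+
  then have q1: "q < 1" using less[OF tm(1,2)] by (simp add: q_def)
  have "norm (s tm) > 0" using far[of tm] c by linarith
  then have q0: "q > 0" unfolding q_def by linarith
  have q2: "q\<^sup>2 < 1" using q0 q1 by (simp add: power_less_one_iff)
  \<comment> \<open>The first term keeps the last vertex within \<Phi>0/2 of the final direction;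
    the second keeps \<open>2 * (c - l / N)^2\<close> above \<open>(1 + q^2) / 2\<close>.\<close>
  define \<eta> where "\<eta> = min (\<Phi>0 * c / 4) ((1 - q\<^sup>2) / (8 * c))"
  show False
  proof (rule small_mesh_bound)
    have "((1 - q\<^sup>2) / 2)\<^sup>2 > 0" using q2 by simp
    then show "\<Phi>/3 * min (c/2) (((1 - q\<^sup>2) / 2)\<^sup>2 / 2) > 0" using \<Phi> c by simp
    show "\<eta> > 0" using \<Phi>0 q2 c by (simp add: \<eta>_def)
    fix N :: nat assume N: "N > 0" and Ne: "l / N < \<eta>" and Nc: "l / N < c"
    interpret P: periodic_polygon "grid N" N "c - l / N" by (rule grid_polygon[OF N Nc])
    define m where "m = nat \<lfloor>u * N / l\<rfloor>"
    note g = grid_index[OF N u, folded m_def]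
    have "norm (sgn (grid N m) - sgn (s u)) \<le> 2 * norm (grid N m - s u) / c"
      using far by (intro norm_sgn_diff_le c) (auto simp: grid_def)
    also have "\<dots> \<le> 2 * (\<Phi>0 * c / 4) / c"
    proof (intro divide_right_mono mult_left_mono)
      have "l / N < \<Phi>0 * c / 4" using Ne unfolding \<eta>_def min_less_iff_conj by (rule conjunct1)
      then show "norm (grid N m - s u) \<le> \<Phi>0 * c / 4" using g(4) unfolding grid_def by linarith
    qed (use c in auto)
    also have "\<dots> = \<Phi>0 / 2" using c by simp
    finally have a: "norm (sgn (grid N m) - sgn (s u)) \<le> \<Phi>0 / 2" .
    have "\<Phi>0 \<le> norm (sgn (grid N m) - sgn (s u)) + norm (sgn (grid N m) - sgn (grid N 0))"
      using norm_triangle_ineq[of "sgn (s u) - sgn (grid N m)" "sgn (grid N m) - sgn (grid N 0)"]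
      by (simp add: \<Phi>0_def grid_def norm_minus_commute)
    then have th: "\<Phi> \<le> P.th m"
      using a \<Phi> P.norm_sgn_diff_le_th[of 0 m] by (simp add: P.th_def)
    have c2: "(1 + q\<^sup>2) / 2 \<le> 2 * (c - l / N)\<^sup>2"
    proof -
      have "l / N < (1 - q\<^sup>2) / (8 * c)" using Ne unfolding \<eta>_def min_less_iff_conj by (rule conjunct2)
      then have "(l / N) * (8 * c) < 1 - q\<^sup>2" using c by (simp add: pos_less_divide_eq)
      define X where "X = (l / N) * (8 * c)"
      have "X < 1 - q\<^sup>2" unfolding X_def by fact
      then have "(1 + q\<^sup>2) / 2 \<le> 1 - X / 2" by (simp add: field_simps)
      also have "1 - X / 2 = 1 - ((l / N) * (8 * c)) / 2" by (simp add: X_def)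
      also have "\<dots> \<le> 1 - ((l / N) * (8 * c)) / 2 + 2 * (l / N)\<^sup>2" by simp
      also have "\<dots> = 2 * (c - l / N)\<^sup>2" using c_sq by (simp add: power2_diff algebra_simps)
      finally show ?thesis .
    qed
    have "4 * pi * (c - l / N) + \<Phi>/3 * min (c/2) (((1 - q\<^sup>2) / 2)\<^sup>2 / 2) \<le> P.len"
    proof (rule P.len_ge_of_gap[OF \<Phi>(1,3) th _ _ _ c q1 _ _ c2])
      show "m \<le> N" using g(1) by simp
      show "P.rho i \<le> 1" for i using norm_le_1 by (simp add: P.rho_def grid_def)
      show "c \<le> P.rho i" for i using far by (simp add: P.rho_def grid_def)
      show "cos (\<Phi>/3) \<le> q" by (simp add: q_def)
      fix i assume "i \<le> m"
      then have "i * (l / N) \<le> m * (l / N)" using l by (intro mult_right_mono) auto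
      then have "i * (l / N) \<le> u" using g(2) by linarith
      moreover have "0 \<le> i * (l / N)" using l by simp
      ultimately show "P.rho i \<le> q" using tm(3) by (simp add: P.rho_def grid_def q_def le_max_iff_disj)
    qed
    then show "4 * pi * (c - l / N) + \<Phi>/3 * min (c/2) (((1 - q\<^sup>2) / 2)\<^sup>2 / 2) \<le> (\<Sum>i<N. norm (grid N (Suc i) - grid N i))"
      unfolding P.len_def .
  qed
qed

lemma sgn_const:
  assumes u: "a \<le> u" "u < a + l" and less: "\<And>t. a \<le> t \<Longrightarrow> t \<le> u \<Longrightarrow> norm (s t) < 1"
  shows "sgn (s u) = sgn (s a)"
proof -
  interpret S: extremal_curve "\<lambda>u. s (u + a)" l c by (rule shift')
  show ?thesis using S.sgn_const_aux[of "u - a"] u less by simp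
qed

lemma not_all_in_halfspace: "\<exists>t. a \<le> t \<and> t < a + l \<and> w \<bullet> s t < 0" if "w \<noteq> 0"
proof -
  obtain t where t: "a \<le> t" "t < a + l" "c * norm (- w) \<le> (- w) \<bullet> s t" using inspects_window by blast
  have "0 < c * norm (- w)" using c that by simp
  then show ?thesis using t by (intro exI[of _ t]) auto
qed

text \<open>A maximal interval off the sphere runs along one ray by \<open>sgn_const\<close>, hence
  is a spur that leaves and returns to the same point of the sphere. Its tip on the sphere sees all
  that the spur sees, so it can be excised. If there is no such interval shorter than a period, the
  whole curve lies on a ray.\<close>

lemma norm_eq_1: "norm (s t0) = 1"
proof (rule ccontr)
  assume "norm (s t0) \<noteq> 1"
  then have lt0: "norm (s t0) < 1" using norm_le_1[of t0] by simp
  define w where "w = sgn (s t0)"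
  have st0: "s t0 \<noteq> 0" using far[of t0] c by auto
  then have w: "norm w = 1" by (simp add: w_def norm_sgn)
  have along: "s t = norm (s t) *\<^sub>R sgn (s t)" for t
  proof -
    have "norm (s t) \<noteq> 0" using far[of t] c by linarith
    then show ?thesis by (simp add: sgn_div_norm)
  qed
  have "\<exists>\<tau>. norm (s \<tau>) = 1"
  proof (rule ccontr)
    assume "\<nexists>\<tau>. norm (s \<tau>) = 1"
    then have all: "norm (s t) < 1" for t using norm_le_1[of t] by (metis less_eq_real_def)
    obtain t where t: "t0 \<le> t" "t < t0 + l" "w \<bullet> s t < 0" using not_all_in_halfspace[of w t0] w by force
    have "sgn (s t) = w" using sgn_const[OF t(1,2)] all by (simp add: w_def)
    then have "w \<bullet> s t = norm (s t) * (w \<bullet> w)" using along[of t] by (metis inner_scaleR_right)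
    moreover have "0 \<le> norm (s t) * (w \<bullet> w)" by simp
    ultimately show False using t(3) by linarith
  qed
  then obtain \<tau> where \<tau>: "norm (s \<tau>) = 1" by blast
  define A where "A = {t. norm (s t) = 1}"
  have Acl: "closed A" unfolding A_def
    using continuous_closed_vimage by (intro closed_Collect_eq continuous_intros cont)
  obtain k :: int where k: "t0 \<le> \<tau> + of_int k * l" by (rule shift_to_window)
  obtain k' :: int where k': "t0 - l \<le> \<tau> + of_int k' * l" "\<tau> + of_int k' * l < t0 - l + l" by (rule shift_to_window)
  have "\<exists>t1. t1 \<in> A \<inter> {..t0} \<and> (\<forall>t\<in>A \<inter> {..t0}. t \<le> t1)"
  proof -
    have "\<tau> + of_int k' * l \<in> A \<inter> {..t0}" using k' \<tau> periodic_int[of \<tau> k'] by (simp add: A_def)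
    then have ne: "A \<inter> {..t0} \<noteq> {}" by blast
    have "Sup (A \<inter> {..t0}) \<in> A \<inter> {..t0}"
      by (intro closed_contains_Sup closed_Int Acl ne) auto
    then show ?thesis using cSup_upper[of _ "A \<inter> {..t0}"] by (meson bdd_above_Int2 bdd_above_Iic)
  qed
  then obtain t1 where t1: "t1 \<in> A" "t1 \<le> t0" "\<And>t. t \<in> A \<Longrightarrow> t \<le> t0 \<Longrightarrow> t \<le> t1" by auto
  have "\<exists>t2. t2 \<in> A \<inter> {t0..} \<and> (\<forall>t\<in>A \<inter> {t0..}. t2 \<le> t)"
  proof -
    have "\<tau> + of_int k * l \<in> A \<inter> {t0..}" using k \<tau> periodic_int[of \<tau> k] by (simp add: A_def)
    then have ne: "A \<inter> {t0..} \<noteq> {}" by blast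
    have "Inf (A \<inter> {t0..}) \<in> A \<inter> {t0..}"
      by (intro closed_contains_Inf closed_Int Acl ne) auto
    then show ?thesis using cInf_lower[of _ "A \<inter> {t0..}"] by (meson bdd_below_Int2 bdd_below_Ici)
  qed
  then obtain t2 where t2: "t2 \<in> A" "t0 \<le> t2" "\<And>t. t \<in> A \<Longrightarrow> t0 \<le> t \<Longrightarrow> t2 \<le> t" by auto
  have t0A: "t0 \<notin> A" using lt0 by (simp add: A_def)
  then have o: "t1 < t0" "t0 < t2" using t1 t2 by (auto simp: less_le)
  have "t1 + l \<in> A" using t1 periodic by (simp add: A_def)
  then have t12: "t2 \<le> t1 + l" using t2(3)[of "t1 + l"] t1(3)[of "t1 + l"] l by force
  have lt: "norm (s t) < 1" if "t1 < t" "t < t2" for t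
  proof -
    have "t \<notin> A" using t1(3)[of t] t2(3)[of t] that by (cases "t \<le> t0") auto
    then show ?thesis using norm_le_1[of t] by (simp add: A_def)
  qed
  have sg: "sgn (s t) = w" if "t1 < t" "t < t2" for t
  proof (cases "t \<le> t0")
    case True
    have "sgn (s t0) = sgn (s t)" by (rule sgn_const) (use True that o t12 lt in auto)
    then show ?thesis by (simp add: w_def)
  next
    case False
    show ?thesis unfolding w_def by (rule sgn_const) (use False that o t12 lt in auto)
  qed
  have lin: "s t = norm (s t) *\<^sub>R w" if "t1 \<le> t" "t \<le> t2" for t
  proof -
    have "closed {t. s t = norm (s t) *\<^sub>R w}" by (intro closed_Collect_eq continuous_intros cont)
    moreover have "{t1<..<t2} \<subseteq> {t. s t = norm (s t) *\<^sub>R w}" using sg along by auto metis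
    ultimately have "closure {t1<..<t2} \<subseteq> {t. s t = norm (s t) *\<^sub>R w}" by (rule closure_minimal[rotated])
    then show ?thesis using that o by auto
  qed
  have e: "s t1 = w" "s t2 = w" using lin[of t1] lin[of t2] t1(1) t2(1) o by (auto simp: A_def)
  show False
  proof (cases "t2 < t1 + l")
    case True
    show False
    proof (rule no_excision[OF _ True])
      show "t1 < t2" using o by simp
      show "s t1 = s t2" using e by simp
      fix t v assume t: "t1 \<le> t" "t \<le> t2" "c * norm v \<le> v \<bullet> s t"
      have vs: "v \<bullet> s t = norm (s t) * (v \<bullet> w)" using lin[OF t(1,2)] by (metis inner_scaleR_right)
      have "0 \<le> c * norm v" using c by simp
      then have "0 \<le> norm (s t) * (v \<bullet> w)" using t(3) vs by linarith
      moreover have "norm (s t) > 0" using far[of t] c by linarith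
      ultimately have "0 \<le> v \<bullet> w" by (simp add: zero_le_mult_iff)
      \<comment> \<open>Points of the spur are multiples of \<open>w\<close> by factors at most
        \<open>1\<close>, and the inner product with \<open>w\<close> is nonnegative.\<close>
      then have "norm (s t) * (v \<bullet> w) \<le> 1 * (v \<bullet> w)" by (intro mult_right_mono norm_le_1)
      then have "c * norm v \<le> v \<bullet> s t2" using t(3) vs e by simp
      then show "\<exists>t'. t2 \<le> t' \<and> t' \<le> t1 + l \<and> c * norm v \<le> v \<bullet> s t'" using True by (intro exI[of _ t2]) auto
    qed
  next
    case False
    obtain t where t: "t1 \<le> t" "t < t1 + l" "w \<bullet> s t < 0" using not_all_in_halfspace[of w t1] w by force
    have "s t = norm (s t) *\<^sub>R w" by (rule lin) (use t False in auto)
    then have "w \<bullet> s t = norm (s t) * (w \<bullet> w)" by (metis inner_scaleR_right)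
    moreover have "0 \<le> norm (s t) * (w \<bullet> w)" by simp
    ultimately show False using t(3) by linarith
  qed
qed

text \<open>All four inequalities are strict, so they hold on a ball of directions and also for a
  fine grid. \<open>len_ge_of_pattern\<close> then yields a surplus proportional to the volume of
  the ball.\<close>

lemma alternation_aux:
  assumes t: "0 < t2" "t2 < t3" "t3 < t4" "t4 < l"
    and w: "c * norm w < w \<bullet> s 0" "w \<bullet> s t2 < c * norm w" "c * norm w < w \<bullet> s t3" "w \<bullet> s t4 < c * norm w"
  shows False
proof -
  have w0: "w \<noteq> 0" using w(1) by auto
  \<comment> \<open>Norm \<open>1/2\<close> keeps a small ball around \<open>v0\<close> inside the
    unit ball and away from its centre.\<close>
  define v0 where "v0 = (1 / (2 * norm w)) *\<^sub>R w"
  have nv0: "norm v0 = 1/2" using w0 by (simp add: v0_def)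
  have sc: "v0 \<bullet> y - c * (1/2) = (1 / (2 * norm w)) * (w \<bullet> y - c * norm w)" for y
    using w0 by (simp add: v0_def field_simps)
  have pw: "1 / (2 * norm w) > 0" using w0 by simp
  define \<eta> where "\<eta> = min 1 (min (min (v0 \<bullet> s 0 - c/2) (c/2 - v0 \<bullet> s t2)) (min (v0 \<bullet> s t3 - c/2) (c/2 - v0 \<bullet> s t4)))"
  have \<eta>: "\<eta> > 0"
  proof -
    have "v0 \<bullet> s 0 - c * (1/2) > 0" "v0 \<bullet> s t3 - c * (1/2) > 0" unfolding sc using pw w by simp_all
    moreover have "v0 \<bullet> s t2 - c * (1/2) < 0" "v0 \<bullet> s t4 - c * (1/2) < 0" unfolding sc using pw w by (simp_all add: mult_pos_neg divide_neg_pos)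
    ultimately show ?thesis by (simp add: \<eta>_def)
  qed
  have \<eta>': "\<eta> \<le> 1" "\<eta> \<le> v0 \<bullet> s 0 - c/2" "\<eta> \<le> c/2 - v0 \<bullet> s t2" "\<eta> \<le> v0 \<bullet> s t3 - c/2" "\<eta> \<le> c/2 - v0 \<bullet> s t4"
    unfolding \<eta>_def by auto
  define Q where "Q = ball v0 (\<eta>/4)"
  have V: "measure lebesgue Q > 0" unfolding Q_def using \<eta> by (simp add: content_ball_pos)
  have "c\<^sup>2 < 1\<^sup>2" using c_sq by simp
  then have c1: "c < 1" by (rule power_less_imp_less_base) simp
  have vQ: "norm v \<le> 1" "v \<noteq> 0" "\<bar>v \<bullet> y - v0 \<bullet> y\<bar> \<le> \<eta>/4 * norm y" "\<bar>c * norm v - c/2\<bar> \<le> \<eta>/4" if "v \<in> Q" for v y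
  proof -
    have d: "norm (v - v0) < \<eta>/4" using that by (simp add: Q_def dist_norm norm_minus_commute)
    have n: "\<bar>norm v - 1/2\<bar> \<le> norm (v - v0)" using norm_triangle_ineq3[of v v0] nv0 by simp
    then have n': "\<bar>norm v - 1/2\<bar> \<le> \<eta>/4" using d by linarith
    show "norm v \<le> 1" using n' \<eta>' by linarith
    show "v \<noteq> 0" using n' \<eta>' by auto
    have "\<bar>v \<bullet> y - v0 \<bullet> y\<bar> = \<bar>(v - v0) \<bullet> y\<bar>" by (simp add: inner_diff_left)
    also have "\<dots> \<le> norm (v - v0) * norm y" by (rule Cauchy_Schwarz_ineq2)
    also have "\<dots> \<le> \<eta>/4 * norm y" using d by (intro mult_right_mono) auto
    finally show "\<bar>v \<bullet> y - v0 \<bullet> y\<bar> \<le> \<eta>/4 * norm y" .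
    have "\<bar>c * norm v - c/2\<bar> = c * \<bar>norm v - 1/2\<bar>" using c by (simp add: abs_mult[symmetric] algebra_simps abs_if)
    also have "\<dots> \<le> 1 * (\<eta>/4)" using c c1 n' by (intro mult_mono) auto
    finally show "\<bar>c * norm v - c/2\<bar> \<le> \<eta>/4" by simp
  qed
  define \<mu> where "\<mu> = measure lebesgue Q"
  define h0 where "h0 = min (\<eta>/4) (min (min t2 (t3 - t2)) (t4 - t3))"
  have h0: "h0 > 0" using \<eta> t by (simp add: h0_def)
  \<comment> \<open>The last entry makes the gain \<open>3 * c * \<mu>\<close> exceed the loss
    \<open>h * (4 * pi + 3 * \<mu>)\<close> caused by the lowered threshold; \<open>h0\<close>
    separates the four indices and keeps the inequalities.\<close>
  define h1 where "h1 = min h0 (min c (c * 3 * \<mu> / (4 * pi + 3 * \<mu>)))"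
  have mp: "4 * pi + 3 * \<mu> > 0" using V by (simp add: \<mu>_def add_pos_pos)
  have "c * 3 * \<mu> / (4 * pi + 3 * \<mu>) > 0" using c V mp unfolding \<mu>_def by (intro divide_pos_pos mult_pos_pos) auto
  then have "h1 > 0" using h0 c unfolding h1_def by (simp only: min_less_iff_conj)
  from fine_mesh[OF this] obtain N :: nat where "N > 0 \<and> l / N < h1" ..
  then have N: "N > 0" "l / N < h1" by simp_all
  define h where "h = l / N"
  have h: "h < h0" "h < c" "h < c * 3 * \<mu> / (4 * pi + 3 * \<mu>)" "h \<ge> 0"
  proof -
    have "h < h1" using N(2) by (simp only: h_def)
    then show "h < h0" "h < c" "h < c * 3 * \<mu> / (4 * pi + 3 * \<mu>)" unfolding h1_def min_less_iff_conj by blast+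
    show "h \<ge> 0" using l by (simp add: h_def)
  qed
  interpret P: periodic_polygon "grid N" N "c - l / N" by (rule grid_polygon[OF N(1) h(2)[unfolded h_def]])
  define ix where "ix t = nat \<lfloor>t * real N / l\<rfloor>" for t :: real
  have g: "ix t < N" "ix t * h \<le> t" "t < ix t * h + h" "norm (grid N (ix t) - s t) \<le> h" if "0 \<le> t" "t < l" for t
    using grid_index[OF N(1) that, folded h_def ix_def] unfolding grid_def h_def[symmetric] by blast+
  have ix_less: "ix t < ix u" if "0 \<le> t" "u < l" "h < u - t" for t u
  proof -
    have "0 \<le> u" "t < l" using that h(4) by linarith+
    then have "ix t * h < ix u * h" using g(2)[of t] g(3)[of u] that by linarith
    then have "real (ix t) < real (ix u)" using h(4) by (rule mult_right_less_imp_less)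
    then show ?thesis by simp
  qed
  have gr: "\<bar>v \<bullet> grid N (ix t) - v \<bullet> s t\<bar> \<le> h" if "v \<in> Q" "0 \<le> t" "t < l" for v t
  proof -
    have "\<bar>v \<bullet> grid N (ix t) - v \<bullet> s t\<bar> = \<bar>v \<bullet> (grid N (ix t) - s t)\<bar>" by (simp add: inner_diff_right)
    also have "\<dots> \<le> norm v * norm (grid N (ix t) - s t)" by (rule Cauchy_Schwarz_ineq2)
    also have "\<dots> \<le> 1 * h" using vQ(1)[OF that(1)] g(4)[OF that(2,3)] by (intro mult_mono) auto
    finally show ?thesis by simp
  qed
  have i0: "ix 0 = 0" by (simp add: ix_def)
  have hh: "h < \<eta>/4" "h < t2" "h < t3 - t2" "h < t4 - t3" using h(1) by (auto simp: h0_def)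
  have "(c - l / N) * (4 * pi + 3 * \<mu>) \<le> P.len"
    unfolding \<mu>_def
  proof (rule P.len_ge_of_pattern[of Q 0 "ix t2" "ix t3" "ix t4"])
    show "P.rho i = 1" for i using norm_eq_1 by (simp add: P.rho_def grid_def)
    show "Q \<in> lmeasurable" by (simp add: Q_def)
    show "Q \<subseteq> ball 0 1 - {0}"
    proof
      fix v assume v: "v \<in> Q"
      have d: "norm (v - v0) < \<eta>/4" using v by (simp add: Q_def dist_norm norm_minus_commute)
      have "norm v \<le> norm v0 + norm (v - v0)" using norm_triangle_ineq[of v0 "v - v0"] by simp
      then show "v \<in> ball 0 1 - {0}" using d nv0 \<eta>' vQ(2)[OF v] by auto
    qed
    show "0 < N" by fact
    show "0 < ix t2" using ix_less[of 0 t2] i0 t hh by simp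
    show "ix t2 < ix t3" using ix_less[of t2 t3] t hh by simp
    show "ix t3 < ix t4" using ix_less[of t3 t4] t hh by simp
    show "ix t4 < 0 + N" using g(1)[of t4] t by simp
    fix v assume v: "v \<in> Q"
    have n: "norm (s t) = 1" for t by (rule norm_eq_1)
    have hv: "0 \<le> h * norm v" "h * norm v \<le> h" using h(4) vQ(1)[OF v] by (auto simp: mult_left_le)
    have key: "\<bar>v \<bullet> grid N (ix t) - v0 \<bullet> s t\<bar> < \<eta>/2" if "0 \<le> t" "t < l" for t
      using gr[OF v that] vQ(3)[OF v, of "s t"] hh(1) unfolding n mult_1_right by linarith
    have cn: "(c - h) * norm v = c * norm v - h * norm v" by (simp add: left_diff_distrib)
    have cv: "c * norm v \<le> c/2 + \<eta>/4" "c/2 - \<eta>/4 \<le> c * norm v" using vQ(4)[OF v] by linarith+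
    have "(c - h) * norm v \<le> v \<bullet> grid N (ix 0)"
      using key[of 0] \<eta>'(2) hv cv l unfolding cn by linarith
    moreover have "(c - h) * norm v \<le> v \<bullet> grid N (ix t3)"
      using key[of t3] \<eta>'(4) hv cv t unfolding cn by linarith
    moreover have "v \<bullet> grid N (ix t2) < (c - h) * norm v"
      using key[of t2] \<eta>'(3) hv cv t hh(1) unfolding cn by linarith
    moreover have "v \<bullet> grid N (ix t4) < (c - h) * norm v"
      using key[of t4] \<eta>'(5) hv cv t hh(1) unfolding cn by linarith
    ultimately show "(c - l / N) * norm v \<le> v \<bullet> grid N 0 \<and> v \<bullet> grid N (ix t2) < (c - l / N) * norm v \<and>
        (c - l / N) * norm v \<le> v \<bullet> grid N (ix t3) \<and> v \<bullet> grid N (ix t4) < (c - l / N) * norm v"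
      unfolding h_def[symmetric] i0 by blast
  qed
  also have "P.len \<le> l" unfolding P.len_def using grid_len_le[OF N(1)] .
  finally have "(c - h) * (4 * pi + 3 * \<mu>) \<le> 4 * pi * c" using l_eq by (simp add: h_def)
  then have "c * 3 * \<mu> \<le> h * (4 * pi + 3 * \<mu>)" by (simp add: algebra_simps)
  then show False using h(3) mp by (simp add: pos_less_divide_eq)
qed

lemma alternation:
  assumes t: "t1 < t2" "t2 < t3" "t3 < t4" "t4 < t1 + l"
    and w: "c * norm w < w \<bullet> s t1" "w \<bullet> s t2 < c * norm w" "c * norm w < w \<bullet> s t3" "w \<bullet> s t4 < c * norm w"
  shows False
proof -
  interpret S: extremal_curve "\<lambda>u. s (u + t1)" l c by (rule shift')
  show False
    by (rule S.alternation_aux[of "t2 - t1" "t3 - t1" "t4 - t1" w]) (use t w in auto)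
qed

text \<open>The whole polygon is short of \<open>l\<close> by at most \<open>4 * pi * l / N\<close>,
  and no edge exceeds \<open>l / N\<close>, so every block of edges has almost full length. This is
  what will give unit speed.\<close>

lemma chord_sum_ge:
  fixes N m :: nat
  assumes N: "N > 0" "l / N < c" and m: "m \<le> N"
  shows "m * (l / N) - 4 * pi * (l / N) \<le> (\<Sum>i<m. norm (s (t + Suc i * (l / N)) - s (t + i * (l / N))))"
proof -
  interpret S: extremal_curve "\<lambda>u. s (u + t)" l c by (rule shift')
  let ?f = "\<lambda>i. norm (s (t + Suc i * (l / N)) - s (t + i * (l / N)))"
  have f: "norm (S.grid N (Suc i) - S.grid N i) = ?f i" for i by (simp add: S.grid_def add.commute)
  have "4 * pi * (c - l / N) \<le> (\<Sum>i<N. ?f i)" using S.grid_len_ge[OF N] unfolding f .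
  also have "(\<Sum>i<N. ?f i) = (\<Sum>i<m. ?f i) + (\<Sum>i<N - m. ?f (i + m))"
    using sum_lessThan_add[of ?f m "N - m"] m by simp
  also have "(\<Sum>i<N - m. ?f (i + m)) \<le> (\<Sum>i<N - m. l / N)"
    by (intro sum_mono) (use S.grid_step f in metis)
  also have "\<dots> = l - m * (l / N)" using m N by (simp add: of_nat_diff field_simps)
  finally show ?thesis using l_eq by (simp add: algebra_simps)
qed

end

section \<open>One-sided tangents, touching caps, injectivity\<close>

lemma pos_below_four:
  fixes a b c d :: real
  assumes "0 < a" "0 < b" "0 < c" "0 < d"
  shows "\<exists>\<eta>>0. \<eta> < a \<and> \<eta> < b \<and> \<eta> < c \<and> \<eta> < d"
  by (rule exI[of _ "min (min a b) (min c d) / 2"]) (use assms in \<open>auto simp: min_def\<close>)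

context extremal_curve begin

lemma inner_self [simp]: "s t \<bullet> s t = 1"
  using norm_eq_1[of t] by (simp add: dot_square_norm)

lemma cnorm_sq: "(c * norm w)\<^sup>2 = (w \<bullet> w) / 2"
proof -
  have "(c * norm w)\<^sup>2 = c\<^sup>2 * (w \<bullet> w)" by (simp add: power_mult_distrib power2_norm_eq_inner)
  moreover have "c\<^sup>2 = 1/2" using c_sq by simp
  ultimately show ?thesis by simp
qed

lemma cnorm_nonneg: "0 \<le> c * norm w" using c by simp

lemma cnorm_lessI: "r \<ge> 0 \<Longrightarrow> w \<bullet> w < 2 * r\<^sup>2 \<Longrightarrow> c * norm w < r"
  by (rule power2_less_imp_less) (simp_all add: cnorm_sq)

lemma cnorm_leI: "r \<ge> 0 \<Longrightarrow> w \<bullet> w \<le> 2 * r\<^sup>2 \<Longrightarrow> c * norm w \<le> r"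
  by (rule power2_le_imp_le) (simp_all add: cnorm_sq)

lemma less_cnormI: "2 * r\<^sup>2 < w \<bullet> w \<Longrightarrow> r < c * norm w"
  by (rule power2_less_imp_less[OF _ cnorm_nonneg]) (simp add: cnorm_sq)

text \<open>From here on a cap is represented by \<open>w\<close> with
  \<open>w \<bullet> w = 2\<close>, for which the threshold is \<open>1\<close>; on the unit sphere
  this is a cap of angular radius \<open>pi/4\<close>.\<close>

lemma cnorm_eq_1: "w \<bullet> w = 2 \<Longrightarrow> c * norm w = 1"
  using cnorm_sq[of w] cnorm_nonneg[of w] by (simp add: power2_eq_1_iff)

lemma norm_le_2: "w \<bullet> w = 2 \<Longrightarrow> norm w \<le> 2"
  by (rule power2_le_imp_le) (simp_all add: power2_norm_eq_inner)

lemma c_gt: "7/10 < c"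
  by (rule power2_less_imp_less) (use c_sq c in \<open>auto simp: power2_eq_square\<close>)

lemma l_gt_8: "l > 8"
proof -
  have "4 * 3 * (7/10) \<le> 4 * pi * c" using pi_gt3 c_gt by (intro mult_mono) auto
  then show ?thesis unfolding l_eq by simp
qed

lemma cover2: "w \<bullet> w = 2 \<Longrightarrow> \<exists>t. a \<le> t \<and> t < a + l \<and> 1 \<le> s t \<bullet> w"
  using inspects_window[of a w] cnorm_eq_1[of w] by (auto simp: inner_commute)

lemma cover2_opposite: "w \<bullet> w = 2 \<Longrightarrow> \<exists>t. a \<le> t \<and> t < a + l \<and> s t \<bullet> w \<le> - 1"
  using cover2[of "- w" a] by auto

lemma alternation':
  assumes "t1 < t2" "t2 < t3" "t3 < t4" "t4 < t1 + l" "w \<bullet> w = 2"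
    and "1 < s t1 \<bullet> w" "s t2 \<bullet> w < 1" "1 < s t3 \<bullet> w" "s t4 \<bullet> w < 1"
  shows False
  by (rule alternation[OF assms(1-4), of w]) (use assms cnorm_eq_1[of w] in \<open>auto simp: inner_commute\<close>)

text \<open>A cluster point of the secant directions rather than their limit: compactness then gives
  existence without any regularity.\<close>

definition right_direction :: "real \<Rightarrow> real^3 \<Rightarrow> bool" where
  "right_direction t e \<longleftrightarrow> norm e = 1 \<and> e \<bullet> s t = 0 \<and>
    (\<forall>\<epsilon>>0. \<exists>h. 0 < h \<and> h < \<epsilon> \<and> s (t + h) \<noteq> s t \<and> norm (sgn (s (t + h) - s t) - e) < \<epsilon>)"

lemma right_direction_exists: "\<exists>e. right_direction t e"
proof -
  have "\<exists>h. 0 < h \<and> h < inverse (real (Suc n)) \<and> s (t + h) \<noteq> s t" for n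
  proof -
    obtain u where "t < u" "u < t + inverse (real (Suc n))" "s u \<noteq> s t"
      using nonconstant[of t "t + inverse (real (Suc n))"] by auto
    then show ?thesis by (intro exI[of _ "u - t"]) auto
  qed
  then obtain h where h: "\<And>n. 0 < h n" "\<And>n. h n < inverse (real (Suc n))" "\<And>n. s (t + h n) \<noteq> s t" by metis
  define g where "g n = sgn (s (t + h n) - s t)" for n
  have gn: "norm (g n) = 1" for n using h(3) by (simp add: g_def norm_sgn)
  have "compact (sphere (0::real^3) 1)" by simp
  moreover have "g n \<in> sphere 0 1" for n using gn by simp
  ultimately obtain e r where e: "e \<in> sphere 0 1" "strict_mono r" "(g \<circ> r) \<longlonglongrightarrow> e"
    unfolding compact_eq_seq_compact_metric seq_compact_def by metis
  have h0: "h \<longlonglongrightarrow> 0"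
    by (rule tendsto_sandwich[OF _ _ tendsto_const LIMSEQ_inverse_real_of_nat])
      (use h(1,2) in \<open>auto intro!: always_eventually less_imp_le\<close>)
  have hr0: "(h \<circ> r) \<longlonglongrightarrow> 0" using LIMSEQ_subseq_LIMSEQ[OF h0 e(2)] .
  have gx: "\<bar>g n \<bullet> s t\<bar> \<le> h n" for n
  proof -
    let ?d = "s (t + h n) - s t"
    have d0: "norm ?d \<noteq> 0" using h(3) by simp
    \<comment> \<open>Both points lie on the unit sphere, so a chord is orthogonal to
      \<open>s t\<close> up to second order.\<close>
    have "?d \<bullet> ?d = - 2 * (?d \<bullet> s t)" by (simp add: inner_diff inner_commute)
    then have "?d \<bullet> s t = - (norm ?d * norm ?d) / 2" by (simp add: dot_square_norm power2_eq_square)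
    then have "g n \<bullet> s t = - norm ?d / 2" using d0 by (simp add: g_def sgn_div_norm)
    moreover have "norm ?d \<le> h n" using lip[of "t + h n" t] h(1)[of n] by simp
    ultimately show ?thesis using h(1)[of n] norm_ge_zero[of ?d] by linarith
  qed
  have "(\<lambda>n. (g \<circ> r) n \<bullet> s t) \<longlonglongrightarrow> e \<bullet> s t" using e(3) by (intro tendsto_intros)
  moreover have "(\<lambda>n. (g \<circ> r) n \<bullet> s t) \<longlonglongrightarrow> 0"
    by (rule Lim_null_comparison[OF _ hr0]) (use gx in auto)
  ultimately have es: "e \<bullet> s t = 0" by (rule LIMSEQ_unique)
  have "\<exists>h. 0 < h \<and> h < \<epsilon> \<and> s (t + h) \<noteq> s t \<and> norm (sgn (s (t + h) - s t) - e) < \<epsilon>" if "\<epsilon> > 0" for \<epsilon>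
  proof -
    have "\<forall>\<^sub>F n in sequentially. dist ((g \<circ> r) n) e < \<epsilon>" using e(3) that by (rule tendstoD)
    moreover have "\<forall>\<^sub>F n in sequentially. dist ((h \<circ> r) n) 0 < \<epsilon>" using hr0 that by (rule tendstoD)
    ultimately have "\<forall>\<^sub>F n in sequentially. dist ((g \<circ> r) n) e < \<epsilon> \<and> dist ((h \<circ> r) n) 0 < \<epsilon>" by (rule eventually_conj)
    then obtain n where "dist ((g \<circ> r) n) e < \<epsilon>" "dist ((h \<circ> r) n) 0 < \<epsilon>"
      using eventually_happens' trivial_limit_sequentially by blast
    then show ?thesis using h(1)[of "r n"] h(3)[of "r n"] by (intro exI[of _ "h (r n)"]) (auto simp: g_def dist_norm)
  qed
  then show ?thesis using e(1) es by (intro exI[of _ e]) (simp add: right_direction_def)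
qed

definition left_direction :: "real \<Rightarrow> real^3 \<Rightarrow> bool" where
  "left_direction t e \<longleftrightarrow> norm e = 1 \<and> e \<bullet> s t = 0 \<and>
    (\<forall>\<epsilon>>0. \<exists>h. 0 < h \<and> h < \<epsilon> \<and> s (t - h) \<noteq> s t \<and> norm (sgn (s t - s (t - h)) - e) < \<epsilon>)"

lemma left_direction_exists: "\<exists>e. left_direction t e"
proof -
  interpret R: extremal_curve "\<lambda>u. s (- u)" l c by (rule reverse')
  obtain e where e: "R.right_direction (- t) e" using R.right_direction_exists by blast
  have sg: "norm (sgn (s (t - h) - s t) - e) = norm (sgn (s t - s (t - h)) - (- e))" for h
  proof -
    have "sgn (s t - s (t - h)) = - sgn (s (t - h) - s t)"
      by (metis minus_diff_eq sgn_minus)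
    then have "sgn (s t - s (t - h)) - (- e) = - (sgn (s (t - h) - s t) - e)" by simp
    then show ?thesis by (metis norm_minus_cancel)
  qed
  have "left_direction t (- e)"
    using e unfolding left_direction_def R.right_direction_def sg[symmetric] by simp
  then show ?thesis by blast
qed

text \<open>A tangent pointing strictly into a cap through \<open>s t\<close> brings points of the
  open cap just after \<open>t\<close>. With \<open>norm w \<le> 2\<close>, the tolerance \<kappa>/4
  costs at most half of \<kappa>.\<close>

lemma ahead:
  assumes r: "right_direction t e" and w: "w \<bullet> w = 2" "w \<bullet> s t = 1" "\<kappa> > 0" "\<kappa> \<le> w \<bullet> e" and \<eta>: "\<eta> > 0"
  obtains h where "0 < h" "h < \<eta>" "1 < s (t + h) \<bullet> w"
proof -
  let ?e = "min \<eta> (\<kappa>/4)"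
  have "?e > 0" using w \<eta> by simp
  then obtain h where h: "0 < h" "h < ?e" "s (t + h) \<noteq> s t" "norm (sgn (s (t + h) - s t) - e) < ?e"
    using r unfolding right_direction_def by blast
  let ?d = "s (t + h) - s t"
  have "\<bar>w \<bullet> (sgn ?d - e)\<bar> \<le> norm w * norm (sgn ?d - e)" by (rule Cauchy_Schwarz_ineq2)
  also have "\<dots> \<le> 2 * (\<kappa>/4)" using norm_le_2[OF w(1)] h(4) by (intro mult_mono) auto
  finally have "w \<bullet> sgn ?d > 0" using w unfolding inner_diff_right by linarith
  then have "0 < norm ?d * (w \<bullet> sgn ?d)" using h(3) by simp
  also have "norm ?d * (w \<bullet> sgn ?d) = w \<bullet> ?d" using h(3) by (simp add: sgn_div_norm)
  finally have "1 < s (t + h) \<bullet> w" using w(2) by (simp add: inner_diff_right inner_commute)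
  then show ?thesis using that h by auto
qed

lemma ahead_below:
  assumes r: "right_direction t e" and w: "w \<bullet> w = 2" "w \<bullet> s t = 1" "\<kappa> > 0" "w \<bullet> e \<le> - \<kappa>" and \<eta>: "\<eta> > 0"
  obtains h where "0 < h" "h < \<eta>" "s (t + h) \<bullet> w < 1"
proof -
  let ?e = "min \<eta> (\<kappa>/4)"
  have "?e > 0" using w \<eta> by simp
  then obtain h where h: "0 < h" "h < ?e" "s (t + h) \<noteq> s t" "norm (sgn (s (t + h) - s t) - e) < ?e"
    using r unfolding right_direction_def by blast
  let ?d = "s (t + h) - s t"
  have "\<bar>w \<bullet> (sgn ?d - e)\<bar> \<le> norm w * norm (sgn ?d - e)" by (rule Cauchy_Schwarz_ineq2)
  also have "\<dots> \<le> 2 * (\<kappa>/4)" using norm_le_2[OF w(1)] h(4) by (intro mult_mono) auto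
  finally have "w \<bullet> sgn ?d < 0" using w unfolding inner_diff_right by linarith
  then have "norm ?d * (w \<bullet> sgn ?d) < 0" using h(3) by (simp add: mult_pos_neg)
  also have "norm ?d * (w \<bullet> sgn ?d) = w \<bullet> ?d" using h(3) by (simp add: sgn_div_norm)
  finally have "s (t + h) \<bullet> w < 1" using w(2) by (simp add: inner_diff_right inner_commute)
  then show ?thesis using that h by auto
qed

lemma left_direction_reverse:
  assumes "left_direction t e"
  shows "extremal_curve.right_direction (\<lambda>u. s (- u)) (- t) (- e)"
proof -
  interpret R: extremal_curve "\<lambda>u. s (- u)" l c by (rule reverse')
  have sg: "norm (sgn (s t - s (t - h)) - e) = norm (sgn (s (t - h) - s t) - (- e))" for h
  proof -
    have "sgn (s t - s (t - h)) = - sgn (s (t - h) - s t)" by (metis minus_diff_eq sgn_minus)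
    then have "sgn (s (t - h) - s t) - (- e) = - (sgn (s t - s (t - h)) - e)" by simp
    then show ?thesis by (metis norm_minus_cancel)
  qed
  show ?thesis using assms unfolding left_direction_def R.right_direction_def sg by simp
qed

lemma behind:
  assumes r: "left_direction t e" and w: "w \<bullet> w = 2" "w \<bullet> s t = 1" "\<kappa> > 0" "w \<bullet> e \<le> - \<kappa>" and \<eta>: "\<eta> > 0"
  obtains h where "0 < h" "h < \<eta>" "1 < s (t - h) \<bullet> w"
proof -
  interpret R: extremal_curve "\<lambda>u. s (- u)" l c by (rule reverse')
  show ?thesis
    by (rule R.ahead[OF left_direction_reverse[OF r], of w \<kappa> \<eta>]) (use w \<eta> that in auto)
qed

lemma behind_below:
  assumes r: "left_direction t e" and w: "w \<bullet> w = 2" "w \<bullet> s t = 1" "\<kappa> > 0" "\<kappa> \<le> w \<bullet> e" and \<eta>: "\<eta> > 0"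
  obtains h where "0 < h" "h < \<eta>" "s (t - h) \<bullet> w < 1"
proof -
  interpret R: extremal_curve "\<lambda>u. s (- u)" l c by (rule reverse')
  show ?thesis
    by (rule R.ahead_below[OF left_direction_reverse[OF r], of w \<kappa> \<eta>]) (use w \<eta> that in auto)
qed

lemma inner_near: "\<bar>v \<bullet> s u - v \<bullet> s t\<bar> \<le> norm v * \<bar>u - t\<bar>"
proof -
  have "\<bar>v \<bullet> s u - v \<bullet> s t\<bar> = \<bar>v \<bullet> (s u - s t)\<bar>" by (simp add: inner_diff_right)
  also have "\<dots> \<le> norm v * norm (s u - s t)" by (rule Cauchy_Schwarz_ineq2)
  also have "\<dots> \<le> norm v * \<bar>u - t\<bar>" using lip by (intro mult_left_mono) auto
  finally show ?thesis .
qed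

text \<open>If the two one-sided directions differed, the cap tangent to their difference would be left and
  re-entered at \<open>t\<close>.\<close>

lemma directions_agree:
  assumes r: "right_direction t e" and lf: "left_direction t e'"
  shows "e = e'"
proof (rule ccontr)
  assume "e \<noteq> e'"
  define x where "x = s t"
  have e: "e \<bullet> e = 1" "e' \<bullet> e' = 1" "e \<bullet> x = 0" "e' \<bullet> x = 0"
    using r lf by (auto simp: right_direction_def left_direction_def x_def dot_square_norm)
  define \<mu> where "\<mu> = norm (e - e')"
  have \<mu>: "\<mu> > 0" using \<open>e \<noteq> e'\<close> by (simp add: \<mu>_def)
  have \<mu>2: "\<mu>\<^sup>2 = 2 * (1 - e \<bullet> e')" unfolding \<mu>_def power2_norm_eq_inner using e by (simp add: inner_diff inner_commute)
  define m where "m = (1 / \<mu>) *\<^sub>R (e - e')"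
  have mm: "m \<bullet> m = 1" using \<mu> by (simp add: m_def \<mu>_def dot_square_norm power2_eq_square)
  have mx: "m \<bullet> x = 0" using e by (simp add: m_def inner_diff_left)
  have me: "m \<bullet> e = \<mu>/2" "m \<bullet> e' = - (\<mu>/2)"
  proof -
    have 1: "(1 / \<mu>) * (1 - e \<bullet> e') = \<mu>/2" using \<mu> \<mu>2 by (simp add: field_simps power2_eq_square)
    have "m \<bullet> e = (1 / \<mu>) * (e \<bullet> e - e' \<bullet> e)" "m \<bullet> e' = (1 / \<mu>) * (e \<bullet> e' - e' \<bullet> e')"
      unfolding m_def inner_scaleR_left inner_diff_left by (rule refl)+
    moreover have "(1 / \<mu>) * (e \<bullet> e' - 1) = - ((1 / \<mu>) * (1 - e \<bullet> e'))" by (simp add: algebra_simps)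
    ultimately show "m \<bullet> e = \<mu>/2" "m \<bullet> e' = - (\<mu>/2)" unfolding e inner_commute[of e' e] by (simp_all only: 1)
  qed
  \<comment> \<open>The cap through \<open>s t\<close> whose inward direction \<open>m\<close> is
    entered by the forward tangent and left by the backward one.\<close>
  define w where "w = x + m"
  have w: "w \<bullet> w = 2" "w \<bullet> s t = 1" "w \<bullet> e = \<mu>/2" "w \<bullet> e' = - (\<mu>/2)"
    using mm mx me e by (simp_all add: w_def x_def[symmetric] inner_add inner_commute) (simp_all add: x_def)
  obtain h1 where h1: "0 < h1" "h1 < 1/8" "1 < s (t + h1) \<bullet> w"
    by (rule ahead[OF r w(1,2), of "\<mu>/2" "1/8"]) (use \<mu> w in auto)
  obtain h2 where h2: "0 < h2" "h2 < 1/8" "1 < s (t - h2) \<bullet> w"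
    by (rule behind[OF lf w(1,2), of "\<mu>/2" "1/8"]) (use \<mu> w in auto)
  define g where "g = min (s (t + h1) \<bullet> w - 1) (s (t - h2) \<bullet> w - 1)"
  have g: "g > 0" "1 + g \<le> s (t + h1) \<bullet> w" "1 + g \<le> s (t - h2) \<bullet> w" using h1 h2 by (auto simp: g_def)
  define \<delta> where "\<delta> = min (g/2) (1/8)"
  have \<delta>: "0 < \<delta>" "\<delta> < g" "\<delta> \<le> 1/8" using g by (auto simp: \<delta>_def)
  \<comment> \<open>The cap is moved away from \<open>s t\<close>: the value there drops to
    \<open>1 - \<delta>\<close>, the threshold only to
    \<open>sqrt (1 - \<delta> + \<delta>^2 / 2)\<close>. The neighbours exceed \<open>1\<close> by
    more than \<delta> and stay inside.\<close>
  define v where "v = w - \<delta> *\<^sub>R x"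
  have wx: "w \<bullet> x = 1" "x \<bullet> w = 1" "x \<bullet> x = 1" using w(2) by (auto simp: x_def inner_commute)
  have vv: "v \<bullet> v = 2 - 2 * \<delta> + \<delta>\<^sup>2"
    using w(1) wx by (simp add: v_def inner_diff power2_eq_square algebra_simps)
  have d2: "\<delta>\<^sup>2 \<le> \<delta>/8" using \<delta> by (simp add: power2_eq_square mult_left_mono)
  have c1: "c * norm v \<le> 1" by (rule cnorm_leI) (use vv d2 \<delta> in auto)
  have xs: "x \<bullet> s u \<le> 1" for u using norm_cauchy_schwarz[of x "s u"] by (simp add: x_def norm_eq_1)
  have vs: "v \<bullet> s u \<ge> s u \<bullet> w - \<delta>" for u
  proof -
    have "v \<bullet> s u = s u \<bullet> w - \<delta> * (x \<bullet> s u)" by (simp add: v_def inner_diff_left inner_commute[of "s u" w])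
    moreover have "\<delta> * (x \<bullet> s u) \<le> \<delta> * 1" using \<delta> xs by (intro mult_left_mono) auto
    ultimately show ?thesis by simp
  qed
  have p1: "c * norm v < v \<bullet> s (t + h1)" and p2: "c * norm v < v \<bullet> s (t - h2)"
    using c1 vs[of "t + h1"] vs[of "t - h2"] g \<delta> by linarith+
  have vt: "v \<bullet> s t = 1 - \<delta>" using wx by (simp add: v_def inner_diff_left x_def[symmetric])
  have n1: "v \<bullet> s t < c * norm v"
    unfolding vt by (rule less_cnormI) (use vv d2 \<delta> in \<open>simp add: power2_diff\<close>)
  \<comment> \<open>The fourth, invisible parameter is one that sees the opposite direction.\<close>
  obtain t' where t': "t - h2 \<le> t'" "t' < t - h2 + l" "c * norm (- v) \<le> (- v) \<bullet> s t'" using inspects_window by blast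
  have n2: "v \<bullet> s t' \<le> - (c * norm v)" using t'(3) by simp
  have "v \<bullet> v \<le> 2\<^sup>2" using vv d2 \<delta> by simp
  then have nv: "norm v \<le> 2" by (metis power2_norm_eq_inner power2_le_imp_le zero_le_numeral)
  have "t + h1 < t'"
  proof (rule ccontr)
    assume "\<not> t + h1 < t'"
    then have "\<bar>t' - t\<bar> \<le> 1/8" using t' h1 h2 by linarith
    then have "norm v * \<bar>t' - t\<bar> \<le> 2 * (1/8)" using nv by (intro mult_mono) auto
    then have "v \<bullet> s t' \<ge> 1 - \<delta> - 1/4" using inner_near[of v t' t] vt by linarith
    then show False using n2 cnorm_nonneg[of v] \<delta> by linarith
  qed
  moreover have "v \<bullet> s t' < c * norm v" using n2 p1 p2 n1 vt \<delta> cnorm_nonneg[of v] by linarith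
  ultimately show False
    by (intro alternation[of "t - h2" t "t + h1" t' v]) (use p1 p2 n1 t' h1 h2 in auto)
qed

definition T :: "real \<Rightarrow> real^3" where "T t = (SOME e. right_direction t e)"

lemma T_right: "right_direction t (T t)"
  unfolding T_def using right_direction_exists by (rule someI_ex)

lemma T_left: "left_direction t (T t)"
  using left_direction_exists[of t] directions_agree[OF T_right] by metis

lemma T_periodic: "T (t + l) = T t"
proof -
  have "s (t + l + h) = s (t + h)" for h using periodic[of "t + h"] by (simp add: algebra_simps)
  then show ?thesis by (simp add: T_def right_direction_def periodic)
qed

lemma norm_T: "norm (T t) = 1" and T_T [simp]: "T t \<bullet> T t = 1" and T_s [simp]: "T t \<bullet> s t = 0" and s_T [simp]: "s t \<bullet> T t = 0"
  using T_right[of t] by (auto simp: right_direction_def dot_square_norm inner_commute)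

definition n :: "real \<Rightarrow> real^3" where "n t = cross3 (s t) (T t)"

lemma n_n [simp]: "n t \<bullet> n t = 1" and n_s [simp]: "n t \<bullet> s t = 0" and s_n [simp]: "s t \<bullet> n t = 0"
  and n_T [simp]: "n t \<bullet> T t = 0" and T_n [simp]: "T t \<bullet> n t = 0"
proof -
  show "n t \<bullet> n t = 1" using norm_cross_dot[of "s t" "T t"] by (simp add: n_def norm_T norm_eq_1 power2_norm_eq_inner)
qed (simp_all add: n_def dot_cross_self)

lemma frame: "v \<bullet> v = (v \<bullet> s t)\<^sup>2 + (v \<bullet> T t)\<^sup>2 + (v \<bullet> n t)\<^sup>2"
  "v = (v \<bullet> s t) *\<^sub>R s t + (v \<bullet> T t) *\<^sub>R T t + (v \<bullet> n t) *\<^sub>R n t"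
  using orthonormal_expansion[of "s t" "T t" v] by (simp_all add: n_def norm_T norm_eq_1 power2_norm_eq_inner)

text \<open>The curve avoids the open cap \<open>1 < x \<bullet> w\<close>; whether it actually
  reaches the boundary circle is left open.\<close>

definition touching :: "real^3 \<Rightarrow> bool" where
  "touching w \<longleftrightarrow> w \<bullet> w = 2 \<and> (\<forall>t. s t \<bullet> w \<le> 1)"

text \<open>Rotating the cap about \<open>s t\<close> in either direction makes it cross the curve at \<open>t\<close>; one of the two
  crossing directions is incompatible with another visit of the cap.\<close>

lemma touching_frame:
  assumes e: "e = 1 \<or> e = -1"
  shows "touching (s t + e *\<^sub>R n t)"
proof -
  define w where "w = s t + e *\<^sub>R n t"
  have ee: "e * e = 1" using e by auto
  have w: "w \<bullet> w = 2" "w \<bullet> s t = 1" using ee by (simp_all add: w_def inner_add)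
  have "s u0 \<bullet> w \<le> 1" for u0
  proof (rule ccontr)
    assume "\<not> s u0 \<bullet> w \<le> 1"
    obtain k :: int where "t \<le> u0 + of_int k * l" "u0 + of_int k * l < t + l" by (rule shift_to_window)
    then obtain u where u: "t \<le> u" "u < t + l" "1 < s u \<bullet> w" using \<open>\<not> s u0 \<bullet> w \<le> 1\<close> periodic_int[of u0 k] by fastforce
    then have ut: "t < u" using w(2) by (cases "u = t") (auto simp: inner_commute)
    obtain t' where t': "t \<le> t'" "t' < t + l" "s t' \<bullet> w \<le> -1" using cover2_opposite[OF w(1)] by blast
    then have tt': "t < t'" using w(2) by (cases "t' = t") (auto simp: inner_commute)
    define g where "g = s u \<bullet> w - 1"
    have g: "g > 0" using u by (simp add: g_def)
    \<comment> \<open>Tilting by \<beta> changes inner products by at most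
      \<open>2 * \<beta>\<close>, so \<open>u\<close> remains inside and \<open>t'\<close>
      outside.\<close>
    define \<beta> where "\<beta> = min (g/4) (1/2)"
    have \<beta>: "0 < \<beta>" "\<beta> \<le> 1/2" "\<beta> \<le> g/4" using g by (auto simp: \<beta>_def)
    define a where "a = sqrt (1 - \<beta>\<^sup>2)"
    have b2: "\<beta>\<^sup>2 \<le> 1" using \<beta> by (simp add: power_le_one)
    have a2: "a\<^sup>2 = 1 - \<beta>\<^sup>2" "a \<ge> 0" using b2 by (auto simp: a_def)
    have a1: "1 - \<beta>\<^sup>2 \<le> a"
    proof -
      have "a \<le> 1" using b2 by (simp add: a_def)
      then have "a * a \<le> a" using a2 by (simp add: mult_left_le)
      then show ?thesis using a2 by (simp add: power2_eq_square)
    qed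
    \<comment> \<open>The centre is tilted along the tangent while \<open>s t\<close> stays on the
      boundary circle, so the curve crosses it at \<open>t\<close>.\<close>
    define wb where "wb b = s t + (a * e) *\<^sub>R n t + b *\<^sub>R T t" for b
    have wb: "wb b \<bullet> wb b = 2" "wb b \<bullet> s t = 1" "wb b \<bullet> T t = b" "\<bar>s v \<bullet> wb b - s v \<bullet> w\<bar> \<le> 2 * \<beta>"
      if b: "b = \<beta> \<or> b = - \<beta>" for b v
    proof -
      have bb: "b * b = \<beta>\<^sup>2" using b by (auto simp: power2_eq_square)
      have "(a * e) * (a * e) = a\<^sup>2" using ee by (simp add: power2_eq_square mult_ac)
      then show "wb b \<bullet> wb b = 2" using a2 bb by (simp add: wb_def inner_add)
      show "wb b \<bullet> s t = 1" "wb b \<bullet> T t = b" by (simp_all add: wb_def inner_add)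
      have "wb b - w = ((a - 1) * e) *\<^sub>R n t + b *\<^sub>R T t" by (simp add: wb_def w_def algebra_simps)
      then have "(norm (wb b - w))\<^sup>2 = ((a - 1) * e) * ((a - 1) * e) + b * b"
        by (simp add: power2_norm_eq_inner inner_add)
      also have "((a - 1) * e) * ((a - 1) * e) = (a - 1)\<^sup>2" using ee by (simp add: power2_eq_square mult_ac)
      also have "(a - 1)\<^sup>2 + b * b = 2 - 2 * a" using a2 bb by (simp add: power2_diff)
      also have "\<dots> \<le> 4 * \<beta>\<^sup>2" using a1 zero_le_power2[of \<beta>] by linarith
      also have "\<dots> = (2 * \<beta>)\<^sup>2" by (simp add: power_mult_distrib)
      finally have "(norm (wb b - w))\<^sup>2 \<le> (2 * \<beta>)\<^sup>2" .
      then have "norm (wb b - w) \<le> 2 * \<beta>" by (rule power2_le_imp_le) (use \<beta>(1) in simp)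
      then have "norm (s v) * norm (wb b - w) \<le> 2 * \<beta>" unfolding norm_eq_1 mult_1_left .
      then have "\<bar>s v \<bullet> (wb b - w)\<bar> \<le> 2 * \<beta>" using Cauchy_Schwarz_ineq2[of "s v" "wb b - w"] by linarith
      then show "\<bar>s v \<bullet> wb b - s v \<bullet> w\<bar> \<le> 2 * \<beta>" by (simp add: inner_diff_right)
    qed
    have su: "1 < s u \<bullet> wb b" and st': "s t' \<bullet> wb b < 1" if "b = \<beta> \<or> b = - \<beta>" for b
      using wb(4)[OF that, of u] wb(4)[OF that, of t'] \<beta> g t'(3) g_def by linarith+
    have ut': "u \<noteq> t'" using u(3) t'(3) by auto
    obtain \<eta> where \<eta>: "\<eta> > 0" "\<eta> < u - t" "\<eta> < t' - t" "\<eta> < t + l - u" "\<eta> < t + l - t'"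
      using pos_below_four[of "u - t" "t' - t" "t + l - u" "t + l - t'"] ut tt' u(2) t'(2) by auto
    show False
    \<comment> \<open>The order of \<open>u\<close> and \<open>t'\<close> decides whether the tilted
      cap should be left or entered at \<open>t\<close> so that inside and outside alternate four
      times.\<close>
    proof (cases "u < t'")
      case True
      note B = wb[of "- \<beta>", simplified]
      obtain h1 where h1: "0 < h1" "h1 < \<eta>" "1 < s (t - h1) \<bullet> wb (- \<beta>)"
        by (rule behind[OF T_left B(1,2) \<beta>(1) _ \<eta>(1)]) (use B(3) in auto)
      obtain h2 where h2: "0 < h2" "h2 < \<eta>" "s (t + h2) \<bullet> wb (- \<beta>) < 1"
        by (rule ahead_below[OF T_right B(1,2) \<beta>(1) _ \<eta>(1)]) (use B(3) in auto)
      show False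
        by (rule alternation'[of "t - h1" "t + h2" u t' "wb (- \<beta>)"])
          (use h1 h2 \<eta> True su[of "- \<beta>"] st'[of "- \<beta>"] B(1) in auto)
    next
      case False
      then have F: "t' < u" using ut' by simp
      note B = wb[of "\<beta>", simplified]
      obtain h1 where h1: "0 < h1" "h1 < \<eta>" "s (t - h1) \<bullet> wb \<beta> < 1"
        by (rule behind_below[OF T_left B(1,2) \<beta>(1) _ \<eta>(1)]) (use B(3) in auto)
      obtain h2 where h2: "0 < h2" "h2 < \<eta>" "1 < s (t + h2) \<bullet> wb \<beta>"
        by (rule ahead[OF T_right B(1,2) \<beta>(1) _ \<eta>(1)]) (use B(3) in auto)
      have "s (t - h1 + l) = s (t - h1)" by (rule periodic)
      then show False
        by (intro alternation'[of "t + h2" t' u "t - h1 + l" "wb \<beta>"])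
          (use h1 h2 \<eta> F su[of \<beta>] st'[of \<beta>] B(1) in auto)
    qed
  qed
  then show ?thesis using w(1) by (simp add: touching_def w_def)
qed

text \<open>Moving a touching cap towards two of its contact points that are not opposite makes both interior, so
  the curve can leave the cap on only one of the two time arcs between them.\<close>

lemma contact_connected:
  assumes w: "touching w" and t: "t1 < t2" "t2 < t1 + l" "s t1 \<bullet> w = 1" "s t2 \<bullet> w = 1" and ne: "s t1 + s t2 \<noteq> w"
  shows "(\<forall>t\<in>{t1..t2}. s t \<bullet> w = 1) \<or> (\<forall>t\<in>{t2..t1 + l}. s t \<bullet> w = 1)"
proof (rule ccontr)
  assume "\<not> ?thesis"
  then obtain u u' where "u \<in> {t1..t2}" "s u \<bullet> w \<noteq> 1" "u' \<in> {t2..t1 + l}" "s u' \<bullet> w \<noteq> 1" by blast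
  moreover have w2: "w \<bullet> w = 2" and le: "s t \<bullet> w \<le> 1" for t using w by (auto simp: touching_def)
  ultimately have u: "t1 \<le> u" "u \<le> t2" "s u \<bullet> w < 1" "t2 \<le> u'" "u' \<le> t1 + l" "s u' \<bullet> w < 1"
    using order.not_eq_order_implies_strict[OF _ le] by auto
  have o: "t1 < u" "u < t2" "t2 < u'" "u' < t1 + l"
    using u t periodic[of t1] by (auto simp: less_le)
  \<comment> \<open>Orthogonal to \<open>w\<close>, and with the same inner product \<open>p\<close>
    with both contact points. Since \<open>m \<bullet> m = 2 * p\<close>, this is positive unless
    the contact points are opposite.\<close>
  define m where "m = s t1 + s t2 - w"
  have m0: "m \<noteq> 0" using ne by (simp add: m_def)
  have ws: "w \<bullet> s t1 = 1" "w \<bullet> s t2 = 1" using t by (simp_all add: inner_commute)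
  have wm: "w \<bullet> m = 0" "m \<bullet> w = 0" using w2 t ws by (simp_all add: m_def inner_diff inner_add)
  have mm: "m \<bullet> m = 2 * (s t1 \<bullet> s t2)" "s t1 \<bullet> m = s t1 \<bullet> s t2" "s t2 \<bullet> m = s t1 \<bullet> s t2"
    using w2 t ws by (simp_all add: m_def inner_diff inner_add inner_commute)
  define p where "p = s t1 \<bullet> s t2"
  have "m \<bullet> m > 0" using m0 by simp
  then have p: "p > 0" unfolding mm(1) p_def by simp
  have p1: "p \<le> 1" using norm_cauchy_schwarz[of "s t1" "s t2"] by (simp add: p_def norm_eq_1)
  define g where "g = min (1 - s u \<bullet> w) (1 - s u' \<bullet> w)"
  have g: "g > 0" "s u \<bullet> w \<le> 1 - g" "s u' \<bullet> w \<le> 1 - g" using u by (auto simp: g_def)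
  define \<epsilon> where "\<epsilon> = min 1 (g/4)"
  have \<epsilon>: "0 < \<epsilon>" "\<epsilon> \<le> 1" "\<epsilon> \<le> g/4" using g by (auto simp: \<epsilon>_def)
  define v where "v = w + \<epsilon> *\<^sub>R m"
  have vv: "v \<bullet> v = 2 + \<epsilon>\<^sup>2 * (2 * p)"
    using w2 wm mm by (simp add: v_def inner_add p_def power2_eq_square)
  have e2: "\<epsilon>\<^sup>2 \<le> \<epsilon>" using \<epsilon> by (simp add: power2_eq_square mult_left_le)
  have ep: "\<epsilon>\<^sup>2 * (2 * p) \<le> \<epsilon> * (2 * p)" using e2 p by (intro mult_right_mono) auto
  have epp: "\<epsilon> * p > 0" using \<epsilon> p by simp
  have vs: "v \<bullet> s t1 = 1 + \<epsilon> * p" "v \<bullet> s t2 = 1 + \<epsilon> * p"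
  proof -
    have "m \<bullet> s t1 = p" unfolding p_def mm(2)[symmetric] by (rule inner_commute)
    moreover have "m \<bullet> s t2 = p" unfolding p_def mm(3)[symmetric] by (rule inner_commute)
    ultimately show "v \<bullet> s t1 = 1 + \<epsilon> * p" "v \<bullet> s t2 = 1 + \<epsilon> * p"
      unfolding v_def inner_add_left inner_scaleR_left ws by simp_all
  qed
  have "2 * (1 + \<epsilon> * p)\<^sup>2 = 2 + 4 * (\<epsilon> * p) + 2 * (\<epsilon> * p)\<^sup>2" by (simp add: power2_sum)
  \<comment> \<open>The inner products grow to first order in \<epsilon>, the norm only to second
    order.\<close>
  then have "v \<bullet> v < 2 * (1 + \<epsilon> * p)\<^sup>2" unfolding vv using ep epp zero_le_power2[of "\<epsilon> * p"] by linarith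
  then have pos: "c * norm v < v \<bullet> s t1" "c * norm v < v \<bullet> s t2"
    unfolding vs using epp by (auto intro!: cnorm_lessI)
  have nm: "norm m \<le> 2"
    by (rule power2_le_imp_le) (use mm(1) p1 in \<open>simp_all add: power2_norm_eq_inner p_def\<close>)
  have cv: "1 \<le> c * norm v"
  proof (rule power2_le_imp_le[OF _ cnorm_nonneg])
    show "1\<^sup>2 \<le> (c * norm v)\<^sup>2" unfolding cnorm_sq vv using p by simp
  qed
  have neg: "v \<bullet> s t < c * norm v" if "s t \<bullet> w \<le> 1 - g" for t
  proof -
    have "m \<bullet> s t \<le> norm m * norm (s t)" by (rule norm_cauchy_schwarz)
    then have "m \<bullet> s t \<le> 2" using nm by (simp add: norm_eq_1)
    then have "\<epsilon> * (m \<bullet> s t) \<le> \<epsilon> * 2" using \<epsilon>(1) by (intro mult_left_mono) auto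
    moreover have "v \<bullet> s t = s t \<bullet> w + \<epsilon> * (m \<bullet> s t)" by (simp add: v_def inner_add_left inner_commute[of "s t" w])
    ultimately show ?thesis using that g(1) \<epsilon>(3) cv by linarith
  qed
  show False by (rule alternation[OF o pos(1) neg[OF g(2)] pos(2) neg[OF g(3)]])
qed

text \<open>At a double point \<open>contact_connected\<close> applies to both caps around
  \<open>s t0 \<plusminus> n t0\<close>. If both touch along the same time arc, the curve rests
  there; if each touches along one of the two arcs, the whole curve lies in the half-space
  \<open>0 \<le> s t \<bullet> s t0\<close>.\<close>

lemma same_point_False:
  assumes t: "t0 < t1" "t1 < t0 + l" "s t0 = s t1"
  shows False
proof -
  let ?x = "s t0"
  have con: "(\<forall>t\<in>{t0..t1}. s t \<bullet> (?x + e *\<^sub>R n t0) = 1) \<or> (\<forall>t\<in>{t1..t0 + l}. s t \<bullet> (?x + e *\<^sub>R n t0) = 1)"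
    if e: "e = 1 \<or> e = -1" for e
  proof (rule contact_connected[OF touching_frame[OF e] t(1,2)])
    show "s t0 \<bullet> (?x + e *\<^sub>R n t0) = 1" by (simp add: inner_add)
    then show "s t1 \<bullet> (?x + e *\<^sub>R n t0) = 1" using t(3) by simp
    have "s t1 \<bullet> s t0 = 1" using t(3) by (metis inner_self)
    then have "(s t0 + s t1) \<bullet> s t0 = 2" "(?x + e *\<^sub>R n t0) \<bullet> s t0 = 1" by (simp_all add: inner_add_left)
    then show "s t0 + s t1 \<noteq> ?x + e *\<^sub>R n t0" by auto
  qed
  have both: False if "u < v" and b1: "\<forall>t\<in>{u..v}. s t \<bullet> (?x + 1 *\<^sub>R n t0) = 1" and b2: "\<forall>t\<in>{u..v}. s t \<bullet> (?x + (-1) *\<^sub>R n t0) = 1" for u v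
  proof -
    have "s t = ?x" if "t \<in> {u..v}" for t
    proof -
      have "s t \<bullet> (?x + 1 *\<^sub>R n t0) = 1" "s t \<bullet> (?x + (-1) *\<^sub>R n t0) = 1" using b1 b2 that by blast+
      then have "s t \<bullet> ?x = 1" by (simp add: inner_add inner_diff_right)
      then have "(norm (s t - ?x))\<^sup>2 = 0" by (simp add: power2_norm_eq_inner inner_diff inner_commute)
      then show ?thesis by simp
    qed
    note eq = this
    obtain y where y: "u < y" "y < v" "s y \<noteq> s u" using nonconstant[OF \<open>u < v\<close>] by blast
    have "s y = ?x" "s u = ?x" by (rule eq; use y \<open>u < v\<close> in simp)+
    then show False using y(3) by simp
  qed
  have cross: False if b1: "\<forall>t\<in>{t0..t1}. s t \<bullet> (?x + e *\<^sub>R n t0) = 1" and b2: "\<forall>t\<in>{t1..t0 + l}. s t \<bullet> (?x + (- e) *\<^sub>R n t0) = 1"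
    and e: "e = 1 \<or> e = -1" for e
  proof -
    have sn: "\<bar>s t \<bullet> n t0\<bar> \<le> 1" for t
      using Cauchy_Schwarz_ineq2[of "s t" "n t0"] unfolding norm_eq_1 norm_eq_sqrt_inner[of "n t0"] by simp
    have "0 \<le> s t \<bullet> ?x" if "t0 \<le> t" "t \<le> t0 + l" for t
    proof (cases "t \<le> t1")
      case True
      then have "s t \<bullet> (?x + e *\<^sub>R n t0) = 1" using that b1 by simp
      then show ?thesis using sn[of t] e by (auto simp: inner_add)
    next
      case False
      then have "s t \<bullet> (?x + (- e) *\<^sub>R n t0) = 1" using that b2 by simp
      then show ?thesis using sn[of t] e by (auto simp: inner_add inner_diff_right)
    qed
    note nonneg = this
    have "?x \<noteq> 0" using norm_eq_1[of t0] by auto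
    from not_all_in_halfspace[OF this, of t0] obtain y where y: "t0 \<le> y" "y < t0 + l" "?x \<bullet> s y < 0" by blast
    then have "0 \<le> s y \<bullet> ?x" by (intro nonneg) simp_all
    then show False using y(3) inner_commute[of "s y" ?x] by linarith
  qed
  note c1 = con[of 1, OF disjI1[OF refl]] and c2 = con[of "-1", OF disjI2[OF refl]]
  show False
    using c1
  proof (rule disjE)
    assume a: "\<forall>t\<in>{t0..t1}. s t \<bullet> (?x + 1 *\<^sub>R n t0) = 1"
    show False using c2 by (rule disjE) (rule both[OF t(1) a], assumption, rule cross[OF a], assumption, simp)
  next
    assume a: "\<forall>t\<in>{t1..t0 + l}. s t \<bullet> (?x + 1 *\<^sub>R n t0) = 1"
    then have a': "\<forall>t\<in>{t1..t0 + l}. s t \<bullet> (?x + (- (-1)) *\<^sub>R n t0) = 1" by simp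
    show False using c2 by (rule disjE) (rule cross[OF _ a'], assumption, simp, rule both[OF t(2) a], assumption)
  qed
qed

lemma inj: "s t = s u \<Longrightarrow> \<bar>t - u\<bar> < l \<Longrightarrow> t = u"
  using same_point_False[of t u] same_point_False[of u t] by (cases t u rule: linorder_cases) auto

end

section \<open>The Lipschitz tangent and unit speed\<close>

lemma norm_cross3_le: "norm (cross3 x y) \<le> norm x * norm y"
proof (rule power2_le_imp_le)
  have "0 \<le> (x \<bullet> y)\<^sup>2" by simp
  then show "(norm (cross3 x y))\<^sup>2 \<le> (norm x * norm y)\<^sup>2" using norm_cross_dot[of x y] by linarith
qed simp

lemma constant_of_quadratic:
  fixes f :: "real \<Rightarrow> 'a::real_normed_vector"
  assumes f: "\<And>u v. u \<in> {a<..<b} \<Longrightarrow> v \<in> {a<..<b} \<Longrightarrow> norm (f u - f v) \<le> K * (u - v)\<^sup>2" and K: "K > 0"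
    and uv: "u \<in> {a<..<b}" "v \<in> {a<..<b}"
  shows "f u = f v"
proof -
  have "(f has_derivative (\<lambda>h. 0)) (at x within {a<..<b})" if x: "x \<in> {a<..<b}" for x
    unfolding has_derivative_within_alt
  proof (intro conjI allI impI bounded_linear_zero)
    fix e :: real assume e: "e > 0"
    show "\<exists>d>0. \<forall>y\<in>{a<..<b}. norm (y - x) < d \<longrightarrow> norm (f y - f x - 0) \<le> e * norm (y - x)"
    proof (intro exI[of _ "e / K"] conjI ballI impI)
      show "e / K > 0" using e K by simp
      fix y assume y: "y \<in> {a<..<b}" "norm (y - x) < e / K"
      have "norm (f y - f x) \<le> K * \<bar>y - x\<bar> * \<bar>y - x\<bar>" using f[OF y(1) x] by (simp add: power2_eq_square)
      also have "\<dots> \<le> e * \<bar>y - x\<bar>" using y(2) K by (intro mult_right_mono) (auto simp: field_simps)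
      finally show "norm (f y - f x - 0) \<le> e * norm (y - x)" by simp
    qed
  qed
  from has_derivative_zero_constant[OF _ this] show ?thesis using uv by auto
qed

context extremal_curve begin

text \<open>The two touching caps at \<open>t\<close> pinch the curve between their circles, so its
  deviation along \<open>n t\<close> is at most half the squared chord. Up to fourth order the
  squared chord is therefore carried by the tangent.\<close>

lemma chord_frame:
  assumes tu: "t \<noteq> u" "\<bar>u - t\<bar> < 1"
  defines "D \<equiv> s u - s t"
  shows "D \<noteq> 0" "norm D \<le> \<bar>u - t\<bar>" "(norm D)\<^sup>2 - (norm D)^4 / 2 \<le> (D \<bullet> T t)\<^sup>2" "\<bar>s u \<bullet> n t\<bar> \<le> 1 - s u \<bullet> s t"
    "(norm D)\<^sup>2 = 2 * (1 - s u \<bullet> s t)"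
proof -
  show "D \<noteq> 0" using inj[of u t] tu l_gt_8 by (auto simp: D_def)
  show "norm D \<le> \<bar>u - t\<bar>" unfolding D_def by (rule lip)
  have "s u \<bullet> (s t + 1 *\<^sub>R n t) \<le> 1" "s u \<bullet> (s t + (-1) *\<^sub>R n t) \<le> 1"
    using touching_frame[of 1 t] touching_frame[of "-1" t] unfolding touching_def by blast+
  then show ab: "\<bar>s u \<bullet> n t\<bar> \<le> 1 - s u \<bullet> s t" by (simp add: inner_add_right inner_diff_right)
  show DD: "(norm D)\<^sup>2 = 2 * (1 - s u \<bullet> s t)" by (simp add: D_def power2_norm_eq_inner inner_diff inner_commute)
  define p where "p = 1 - s u \<bullet> s t"
  have "p \<ge> 0" using DD zero_le_power2[of "norm D"] unfolding p_def by argo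
  have "D \<bullet> s t = - p" "D \<bullet> n t = s u \<bullet> n t" by (simp_all add: D_def p_def inner_diff_left)
  then have "(norm D)\<^sup>2 = p\<^sup>2 + (D \<bullet> T t)\<^sup>2 + (s u \<bullet> n t)\<^sup>2" using frame(1)[of D t] by (simp add: power2_norm_eq_inner)
  moreover have "(s u \<bullet> n t)\<^sup>2 \<le> p\<^sup>2" using ab \<open>p \<ge> 0\<close> by (simp add: p_def abs_le_square_iff[symmetric])
  moreover have "(norm D)^4 / 2 = 2 * p\<^sup>2"
  proof -
    have "(norm D)^4 = ((norm D)\<^sup>2)\<^sup>2" by (simp flip: power_mult)
    moreover have "(norm D)\<^sup>2 = 2 * p" unfolding DD p_def ..
    ultimately show ?thesis by (simp add: power_mult_distrib)
  qed
  ultimately show "(norm D)\<^sup>2 - (norm D)^4 / 2 \<le> (D \<bullet> T t)\<^sup>2" by linarith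
qed

lemma chord_T_nonzero: "t \<noteq> u \<Longrightarrow> \<bar>u - t\<bar> < 1 \<Longrightarrow> (s u - s t) \<bullet> T t \<noteq> 0"
proof
  assume a: "t \<noteq> u" "\<bar>u - t\<bar> < 1" "(s u - s t) \<bullet> T t = 0"
  note f = chord_frame[OF a(1,2)]
  let ?d = "norm (s u - s t)"
  have d: "0 < ?d" "?d < 1" using f(1,2) a by auto
  then have "?d^4 / 2 < ?d\<^sup>2"
  proof -
    have "?d^4 = ?d\<^sup>2 * ?d\<^sup>2" by (simp flip: power_add)
    also have "\<dots> \<le> ?d\<^sup>2 * 1" using d by (intro mult_left_mono) (auto simp: power_le_one)
    finally have "?d^4 \<le> ?d\<^sup>2" by simp
    moreover have "0 < ?d\<^sup>2" using d(1) by (rule zero_less_power)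
    ultimately show ?thesis by linarith
  qed
  then show False using f(3) a(3) by simp
qed

lemma chord_T_lower_aux:
  assumes tu: "t \<noteq> u" "\<bar>u - t\<bar> < 1" and pos: "X > 0" "X\<^sup>2 = ((s u - s t) \<bullet> T t)\<^sup>2"
  shows "norm (s u - s t) * (1 - (norm (s u - s t))\<^sup>2 / 2) \<le> X"
proof (rule power2_le_imp_le)
  let ?d = "norm (s u - s t)"
  note f = chord_frame[OF tu]
  have d: "0 \<le> ?d" "?d \<le> 1" using f(2) tu by auto
  have "(?d * (1 - ?d\<^sup>2 / 2))\<^sup>2 = ?d\<^sup>2 - ?d^4 + ?d^4 * ?d\<^sup>2 / 4"
    by (simp add: power_mult_distrib power2_diff algebra_simps power2_eq_square eval_nat_numeral)
  also have "?d^4 * ?d\<^sup>2 \<le> ?d^4 * 1" using d by (intro mult_left_mono) (auto simp: power_le_one)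
  finally have "(?d * (1 - ?d\<^sup>2 / 2))\<^sup>2 \<le> ?d\<^sup>2 - ?d^4 + ?d^4 / 4" by simp
  also have "\<dots> \<le> ?d\<^sup>2 - ?d^4 / 2" using zero_le_power[OF d(1), of 4] by linarith
  finally show "(?d * (1 - ?d\<^sup>2 / 2))\<^sup>2 \<le> X\<^sup>2" using f(3) pos by linarith
qed (use pos in simp)

lemma right_near_pos:
  assumes "\<eta> > 0" shows "\<exists>h. 0 < h \<and> h < \<eta> \<and> (s (t + h) - s t) \<bullet> T t > 0"
proof -
  obtain h where h: "0 < h" "h < min \<eta> (1/2)" "s (t + h) \<noteq> s t" "norm (sgn (s (t + h) - s t) - T t) < min \<eta> (1/2)"
    using T_right[of t] assms unfolding right_direction_def by (metis min_less_iff_conj zero_less_divide_1_iff zero_less_numeral)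
  let ?d = "s (t + h) - s t"
  have "\<bar>(sgn ?d - T t) \<bullet> T t\<bar> \<le> norm (sgn ?d - T t) * norm (T t)" by (rule Cauchy_Schwarz_ineq2)
  then have "\<bar>sgn ?d \<bullet> T t - 1\<bar> < 1/2" using h(4) by (simp add: norm_T inner_diff_left)
  then have "0 < sgn ?d \<bullet> T t" by linarith
  then have "0 < norm ?d * (sgn ?d \<bullet> T t)" using h(3) by (intro mult_pos_pos) auto
  also have "\<dots> = ?d \<bullet> T t" using h(3) by (simp add: sgn_div_norm)
  finally show ?thesis using h by auto
qed

lemma left_near_pos:
  assumes "\<eta> > 0" shows "\<exists>h. 0 < h \<and> h < \<eta> \<and> (s t - s (t - h)) \<bullet> T t > 0"
proof -
  obtain h where h: "0 < h" "h < min \<eta> (1/2)" "s (t - h) \<noteq> s t" "norm (sgn (s t - s (t - h)) - T t) < min \<eta> (1/2)"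
    using T_left[of t] assms unfolding left_direction_def by (metis min_less_iff_conj zero_less_divide_1_iff zero_less_numeral)
  let ?d = "s t - s (t - h)"
  have "\<bar>(sgn ?d - T t) \<bullet> T t\<bar> \<le> norm (sgn ?d - T t) * norm (T t)" by (rule Cauchy_Schwarz_ineq2)
  then have "\<bar>sgn ?d \<bullet> T t - 1\<bar> < 1/2" using h(4) by (simp add: norm_T inner_diff_left)
  then have "0 < sgn ?d \<bullet> T t" by linarith
  then have "0 < norm ?d * (sgn ?d \<bullet> T t)" using h(3) by (intro mult_pos_pos) auto
  also have "\<dots> = ?d \<bullet> T t" using h(3) by (simp add: sgn_div_norm)
  finally show ?thesis using h by auto
qed

text \<open>Positive close to the base point by the one-sided directions, and never zero by
  \<open>chord_T_nonzero\<close>.\<close>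

lemma chord_T_pos:
  assumes tu: "t < u" "u - t < 1"
  shows "(s u - s t) \<bullet> T t > 0" "(s u - s t) \<bullet> T u > 0"
proof -
  obtain h where h: "0 < h" "h < u - t" "(s (t + h) - s t) \<bullet> T t > 0" using right_near_pos[of "u - t" t] tu by auto
  show "(s u - s t) \<bullet> T t > 0"
  proof (rule ccontr)
    assume "\<not> ?thesis"
    then have "\<exists>v. t + h \<le> v \<and> v \<le> u \<and> (s v - s t) \<bullet> T t = 0"
      using h by (intro IVT2' continuous_intros cont) auto
    then show False using chord_T_nonzero[of t] h tu by force
  qed
  obtain h' where h': "0 < h'" "h' < u - t" "(s u - s (u - h')) \<bullet> T u > 0" using left_near_pos[of "u - t" u] tu by auto
  show "(s u - s t) \<bullet> T u > 0"
  proof (rule ccontr)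
    assume "\<not> ?thesis"
    then have "\<exists>v. t \<le> v \<and> v \<le> u - h' \<and> (s u - s v) \<bullet> T u = 0"
      using h' by (intro IVT' continuous_intros cont) auto
    then obtain v where v: "t \<le> v" "v \<le> u - h'" "(s u - s v) \<bullet> T u = 0" by blast
    then have "(s v - s u) \<bullet> T u = 0" by (simp add: inner_diff_left)
    then show False using chord_T_nonzero[of u v] h' v tu by auto
  qed
qed

lemma chord_T_lower:
  assumes tu: "t < u" "u - t < 1"
  shows "norm (s u - s t) * (1 - (norm (s u - s t))\<^sup>2 / 2) \<le> (s u - s t) \<bullet> T t"
    "norm (s u - s t) * (1 - (norm (s u - s t))\<^sup>2 / 2) \<le> (s u - s t) \<bullet> T u"
proof -
  show "norm (s u - s t) * (1 - (norm (s u - s t))\<^sup>2 / 2) \<le> (s u - s t) \<bullet> T t"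
    by (rule chord_T_lower_aux) (use tu chord_T_pos[OF tu] in auto)
  have "norm (s t - s u) * (1 - (norm (s t - s u))\<^sup>2 / 2) \<le> (s u - s t) \<bullet> T u"
    by (rule chord_T_lower_aux) (use tu chord_T_pos[OF tu] in \<open>auto simp: inner_diff_left power2_commute\<close>)
  then show "norm (s u - s t) * (1 - (norm (s u - s t))\<^sup>2 / 2) \<le> (s u - s t) \<bullet> T u" by (simp add: norm_minus_commute)
qed

text \<open>Each of the two tangents differs from the normalized chord by at most the chord
  length.\<close>

lemma T_lipschitz_aux:
  assumes tu: "t < u" "u - t < 1"
  shows "norm (T u - T t) \<le> 2 * (u - t)"
proof -
  let ?D = "s u - s t" let ?d = "norm (s u - s t)"
  have f: "?D \<noteq> 0" "?d \<le> u - t" using chord_frame(1,2)[of t u] tu by auto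
  have near: "norm (sgn ?D - V) \<le> ?d" if V: "norm V = 1" "?d * (1 - ?d\<^sup>2 / 2) \<le> ?D \<bullet> V" for V
  proof (rule power2_le_imp_le)
    have "sgn ?D \<bullet> V = (?D \<bullet> V) / ?d" by (simp add: sgn_div_norm divide_inverse mult.commute)
    also have "\<dots> \<ge> (?d * (1 - ?d\<^sup>2 / 2)) / ?d" using V(2) by (intro divide_right_mono) auto
    finally have "1 - ?d\<^sup>2 / 2 \<le> sgn ?D \<bullet> V" using f(1) by simp
    moreover have "(norm (sgn ?D - V))\<^sup>2 = 2 - 2 * (sgn ?D \<bullet> V)"
    proof -
      have "sgn ?D \<bullet> sgn ?D = 1" "V \<bullet> V = 1" using f(1) V(1) by (simp_all add: dot_square_norm norm_sgn)
      then show ?thesis by (simp add: power2_norm_eq_inner inner_diff inner_commute)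
    qed
    ultimately show "(norm (sgn ?D - V))\<^sup>2 \<le> ?d\<^sup>2" by linarith
  qed simp
  have "norm (T u - T t) \<le> norm (sgn ?D - T t) + norm (sgn ?D - T u)"
    using norm_triangle_ineq4[of "sgn ?D - T t" "sgn ?D - T u"] by (simp add: norm_minus_commute algebra_simps)
  then show ?thesis using near[OF norm_T chord_T_lower(1)[OF tu]] near[OF norm_T chord_T_lower(2)[OF tu]] f(2) by argo
qed

lemma T_lipschitz: "\<bar>u - t\<bar> < 1 \<Longrightarrow> norm (T u - T t) \<le> 2 * \<bar>u - t\<bar>"
  using T_lipschitz_aux[of t u] T_lipschitz_aux[of u t]
  by (cases t u rule: linorder_cases) (auto simp: norm_minus_commute)

lemma T_cont: "continuous_on S T"
proof (rule continuous_on_subset[of UNIV])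
  show "continuous_on UNIV T"
    unfolding continuous_on_iff
  proof (intro ballI allI impI)
    fix t e :: real assume "e > 0"
    then show "\<exists>d>0. \<forall>u\<in>UNIV. dist u t < d \<longrightarrow> dist (T u) (T t) < e"
      using T_lipschitz by (intro exI[of _ "min 1 (e/2)"]) (fastforce simp: dist_norm)
  qed
qed simp

lemma n_cont: "continuous_on S n"
  unfolding n_def by (intro continuous_on_cross cont T_cont)

lemma n_lipschitz: assumes "\<bar>u - t\<bar> < 1" shows "norm (n u - n t) \<le> 3 * \<bar>u - t\<bar>"
proof -
  have e: "n u - n t = cross3 (s u - s t) (T u) + cross3 (s t) (T u - T t)"
    by (simp add: n_def Cross3.left_diff_distrib Cross3.right_diff_distrib)
  have "norm (n u - n t) \<le> norm (s u - s t) * norm (T u) + norm (s t) * norm (T u - T t)"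
    unfolding e by (rule order_trans[OF norm_triangle_ineq]) (intro add_mono norm_cross3_le)
  also have "\<dots> \<le> \<bar>u - t\<bar> + 2 * \<bar>u - t\<bar>" using lip[of u t] T_lipschitz[OF assms] by (simp add: norm_T norm_eq_1)
  finally show ?thesis by simp
qed

text \<open>So far the curve might be slower than its parameter. On a fine grid the tangents differ
  from \<open>T t\<close> by at most \<open>2 * (u - t)\<close>, so the chords add up along
  \<open>T t\<close> almost without loss, and \<open>chord_sum_ge\<close> says that their lengths
  add up to almost \<open>u - t\<close>.\<close>

lemma progress:
  assumes tu: "t < u" "u - t < 1/2"
  shows "(1 - 2 * (u - t)) * (u - t) \<le> (s u - s t) \<bullet> T t"
proof -
  define \<delta> where "\<delta> = u - t"
  have \<delta>: "0 < \<delta>" "\<delta> < 1/2" using tu by (auto simp: \<delta>_def)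
  define h where "h k = l * inverse (real (Suc k))" for k
  have h0: "h \<longlonglongrightarrow> 0" unfolding h_def using tendsto_mult_left[OF LIMSEQ_inverse_real_of_nat, of l] by simp
  \<comment> \<open>The bound obtained with mesh \<open>h k\<close>; the final subtraction accounts
    for the rest between the last grid point and \<open>u\<close>.\<close>
  define X where "X k = (1 - h k - 2 * \<delta>) * (\<delta> - (1 + 4 * pi) * h k) - h k" for k
  have "X \<longlonglongrightarrow> (1 - 0 - 2 * \<delta>) * (\<delta> - (1 + 4 * pi) * 0) - 0"
    unfolding X_def by (intro tendsto_intros h0)
  then have lim: "X \<longlonglongrightarrow> (1 - 2 * \<delta>) * \<delta>" by simp
  have "\<forall>\<^sub>F k in sequentially. h k < min (min c (1/2)) (1 - 2 * \<delta>)"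
    using h0 \<delta> c by (intro order_tendstoD(2)) auto
  then have "\<forall>\<^sub>F k in sequentially. X k \<le> (s u - s t) \<bullet> T t"
  proof (rule eventually_mono)
    fix k assume hk: "h k < min (min c (1/2)) (1 - 2 * \<delta>)"
    define N where "N = Suc k"
    define \<eta> where "\<eta> = l / N"
    have e: "h k = \<eta>" by (simp add: h_def \<eta>_def N_def divide_inverse)
    have \<eta>: "0 < \<eta>" "\<eta> < c" "\<eta> < 1/2" "\<eta> < 1 - 2 * \<delta>" using hk l unfolding e by (auto simp: \<eta>_def N_def)
    define m where "m = nat \<lfloor>\<delta> / \<eta>\<rfloor>"
    have m: "real m = of_int \<lfloor>\<delta> / \<eta>\<rfloor>" unfolding m_def using \<delta> \<eta> by simp
    have m1: "m * \<eta> \<le> \<delta>" unfolding m using \<eta>(1) by (rule floor_divide_lower)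
    have m2: "\<delta> < m * \<eta> + \<eta>" unfolding m using floor_divide_upper[OF \<eta>(1), of \<delta>] by (simp add: algebra_simps)
    have "N * \<eta> = l" by (simp add: \<eta>_def N_def)
    then have "m * \<eta> \<le> N * \<eta>" using m1 \<delta> l_gt_8 by linarith
    then have mN: "m \<le> N" using \<eta>(1) by simp
    define \<Delta> where "\<Delta> i = s (t + Suc i * \<eta>) - s (t + i * \<eta>)" for i
    have sum1: "m * \<eta> - 4 * pi * \<eta> \<le> (\<Sum>i<m. norm (\<Delta> i))"
      using chord_sum_ge[OF _ _ mN, of t] \<eta> unfolding \<Delta>_def \<eta>_def by (simp add: N_def)
    have step: "norm (\<Delta> i) * (1 - \<eta> - 2 * \<delta>) \<le> \<Delta> i \<bullet> T t" if i: "i < m" for i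
    proof -
      have "Suc i * \<eta> \<le> m * \<eta>" using i \<eta>(1) by (intro mult_right_mono) auto
      moreover have se: "Suc i * \<eta> = i * \<eta> + \<eta>" by (simp add: algebra_simps)
      ultimately have i1: "i * \<eta> \<le> \<delta>" using m1 \<eta>(1) by linarith
      have i0: "0 \<le> i * \<eta>" using \<eta>(1) by simp
      have o: "t + i * \<eta> < t + Suc i * \<eta>" "t + Suc i * \<eta> - (t + i * \<eta>) < 1" using \<eta> unfolding se by auto
      have dn: "norm (\<Delta> i) \<le> \<eta>" unfolding \<Delta>_def using lip[of "t + Suc i * \<eta>" "t + i * \<eta>"] \<eta>(1) unfolding se by simp
      have "(norm (\<Delta> i))\<^sup>2 \<le> \<eta> * 1" unfolding power2_eq_square using dn \<eta> by (intro mult_mono) auto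
      then have "norm (\<Delta> i) * (1 - \<eta>) \<le> norm (\<Delta> i) * (1 - (norm (\<Delta> i))\<^sup>2 / 2)"
        using \<eta>(1) by (intro mult_left_mono) auto
      also have "\<dots> \<le> \<Delta> i \<bullet> T (t + i * \<eta>)" unfolding \<Delta>_def by (rule chord_T_lower(1)[OF o])
      finally have 1: "norm (\<Delta> i) * (1 - \<eta>) \<le> \<Delta> i \<bullet> T (t + i * \<eta>)" .
      have "norm (T (t + i * \<eta>) - T t) \<le> 2 * \<bar>i * \<eta>\<bar>" using T_lipschitz[of "t + i * \<eta>" t] i1 i0 \<delta> by simp
      then have "norm (T (t + i * \<eta>) - T t) \<le> 2 * \<delta>" using i1 i0 by simp
      then have "norm (\<Delta> i) * norm (T (t + i * \<eta>) - T t) \<le> norm (\<Delta> i) * (2 * \<delta>)" by (intro mult_left_mono) auto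
      then have "\<bar>\<Delta> i \<bullet> (T (t + i * \<eta>) - T t)\<bar> \<le> norm (\<Delta> i) * (2 * \<delta>)"
        using Cauchy_Schwarz_ineq2 order_trans by blast
      then have "\<Delta> i \<bullet> T (t + i * \<eta>) - \<Delta> i \<bullet> T t \<le> norm (\<Delta> i) * (2 * \<delta>)" by (simp add: inner_diff_right)
      moreover have "norm (\<Delta> i) * (1 - \<eta> - 2 * \<delta>) = norm (\<Delta> i) * (1 - \<eta>) - norm (\<Delta> i) * (2 * \<delta>)" by (simp add: algebra_simps)
      ultimately show ?thesis using 1 by linarith
    qed
    have "(\<Sum>i<m. norm (\<Delta> i)) * (1 - \<eta> - 2 * \<delta>) \<le> (\<Sum>i<m. \<Delta> i \<bullet> T t)"
      unfolding sum_distrib_right by (intro sum_mono step) simp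
    also have "\<dots> = (\<Sum>i<m. \<Delta> i) \<bullet> T t" by (simp add: inner_sum_left)
    also have "(\<Sum>i<m. \<Delta> i) = s (t + m * \<eta>) - s t"
      unfolding \<Delta>_def using sum_lessThan_telescope[of "\<lambda>i. s (t + real i * \<eta>)" m] by simp
    finally have 2: "(\<Sum>i<m. norm (\<Delta> i)) * (1 - \<eta> - 2 * \<delta>) \<le> (s (t + m * \<eta>) - s t) \<bullet> T t" .
    have "\<delta> - (1 + 4 * pi) * \<eta> \<le> m * \<eta> - 4 * pi * \<eta>" using m2 by (simp add: algebra_simps)
    then have "(1 - \<eta> - 2 * \<delta>) * (\<delta> - (1 + 4 * pi) * \<eta>) \<le> (1 - \<eta> - 2 * \<delta>) * (\<Sum>i<m. norm (\<Delta> i))"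
      using sum1 \<eta> by (intro mult_left_mono) auto
    then have 3: "(1 - \<eta> - 2 * \<delta>) * (\<delta> - (1 + 4 * pi) * \<eta>) \<le> (s (t + m * \<eta>) - s t) \<bullet> T t"
      using 2 by (simp add: mult.commute)
    have "\<bar>T t \<bullet> s u - T t \<bullet> s (t + m * \<eta>)\<bar> \<le> norm (T t) * \<bar>u - (t + m * \<eta>)\<bar>" by (rule inner_near)
    also have "\<dots> \<le> \<eta>" using m1 m2 by (simp add: norm_T \<delta>_def)
    finally have "\<bar>T t \<bullet> s u - T t \<bullet> s (t + m * \<eta>)\<bar> \<le> \<eta>" .
    moreover have "(s u - s (t + m * \<eta>)) \<bullet> T t = T t \<bullet> s u - T t \<bullet> s (t + m * \<eta>)"
      by (metis inner_commute inner_diff_right)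
    ultimately have "(s u - s (t + m * \<eta>)) \<bullet> T t \<ge> - \<eta>" by linarith
    moreover have "(s u - s t) \<bullet> T t = (s u - s (t + m * \<eta>)) \<bullet> T t + (s (t + m * \<eta>) - s t) \<bullet> T t"
      by (simp add: inner_diff_left)
    ultimately show "X k \<le> (s u - s t) \<bullet> T t" using 3 unfolding X_def e by linarith
  qed
  then have "(1 - 2 * \<delta>) * \<delta> \<le> (s u - s t) \<bullet> T t"
    by (rule tendsto_upperbound[OF lim]) simp
  then show ?thesis by (simp add: \<delta>_def)
qed

lemma first_order_aux:
  assumes tu: "t < u" "u - t < 1/2"
  shows "norm (s u - s t - (u - t) *\<^sub>R T t) \<le> 2 * (u - t) * sqrt (u - t)"
proof -
  define \<delta> where "\<delta> = u - t"
  define D where "D = s u - s t"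
  have \<delta>: "\<delta> > 0" using tu by (simp add: \<delta>_def)
  have "norm D \<le> \<delta>" using lip[of u t] tu by (simp add: D_def \<delta>_def)
  then have 1: "(norm D)\<^sup>2 \<le> \<delta>\<^sup>2" by (intro power_mono) auto
  have 2: "(norm (D - \<delta> *\<^sub>R T t))\<^sup>2 = (norm D)\<^sup>2 - 2 * (\<delta> * (D \<bullet> T t)) + \<delta>\<^sup>2"
    unfolding power2_norm_eq_inner
    by (simp add: inner_diff_left inner_diff_right inner_commute[of "T t" D] power2_eq_square algebra_simps)
  have "\<delta> * ((1 - 2 * \<delta>) * \<delta>) \<le> \<delta> * (D \<bullet> T t)"
    using progress[OF tu] \<delta> by (intro mult_left_mono) (auto simp: \<delta>_def D_def)
  moreover have "\<delta> * ((1 - 2 * \<delta>) * \<delta>) = \<delta>\<^sup>2 - 2 * \<delta>^3" by (simp add: power2_eq_square power3_eq_cube algebra_simps)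
  ultimately have 3: "\<delta>\<^sup>2 - 2 * \<delta>^3 \<le> \<delta> * (D \<bullet> T t)" by simp
  have 4: "(2 * \<delta> * sqrt \<delta>)\<^sup>2 = 4 * \<delta>^3" using \<delta> by (simp add: power_mult_distrib power2_eq_square power3_eq_cube)
  have "norm (D - \<delta> *\<^sub>R T t) \<le> 2 * \<delta> * sqrt \<delta>"
  proof (rule power2_le_imp_le)
    show "(norm (D - \<delta> *\<^sub>R T t))\<^sup>2 \<le> (2 * \<delta> * sqrt \<delta>)\<^sup>2" unfolding 4 2 using 1 3 by linarith
  qed (use \<delta> in simp)
  then show ?thesis by (simp add: D_def \<delta>_def)
qed

lemma le_sqrt_self: "0 \<le> x \<Longrightarrow> x \<le> 1 \<Longrightarrow> x \<le> sqrt x"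
  by (rule real_le_rsqrt) (simp add: power2_eq_square mult_left_le)

lemma first_order:
  assumes tu: "\<bar>u - t\<bar> < 1/2"
  shows "norm (s u - s t - (u - t) *\<^sub>R T t) \<le> 4 * sqrt \<bar>u - t\<bar> * \<bar>u - t\<bar>"
proof -
  have q: "\<bar>u - t\<bar> \<le> sqrt \<bar>u - t\<bar>" using tu by (intro le_sqrt_self) auto
  consider "u = t" | "t < u" | "u < t" by linarith
  then show ?thesis
  proof cases
    case 2
    have "0 \<le> 2 * (u - t) * sqrt (u - t)" using 2 by simp
    moreover have "4 * sqrt \<bar>u - t\<bar> * \<bar>u - t\<bar> = 2 * (2 * (u - t) * sqrt (u - t))" using 2 by simp
    moreover have "norm (s u - s t - (u - t) *\<^sub>R T t) \<le> 2 * (u - t) * sqrt (u - t)"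
      using first_order_aux[of t u] 2 tu by simp
    ultimately show ?thesis by linarith
  next
    case 3
    have e: "s u - s t - (u - t) *\<^sub>R T t = - (s t - s u - (t - u) *\<^sub>R T u) + (t - u) *\<^sub>R (T t - T u)"
      by (simp add: algebra_simps)
    have "norm (s u - s t - (u - t) *\<^sub>R T t) \<le> norm (s t - s u - (t - u) *\<^sub>R T u) + norm ((t - u) *\<^sub>R (T t - T u))"
      unfolding e by (metis norm_minus_cancel norm_triangle_ineq)
    also have "\<dots> \<le> 2 * (t - u) * sqrt (t - u) + (t - u) * (2 * (t - u))"
      using first_order_aux[of u t] T_lipschitz[of t u] 3 tu by (intro add_mono) auto
    also have "(t - u) * (2 * (t - u)) \<le> (t - u) * (2 * sqrt (t - u))" using q 3 by (intro mult_left_mono) auto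
    finally show ?thesis using 3 by (simp add: algebra_simps)
  qed simp
qed

lemma s_derivative: "(s has_vector_derivative T t) (at t)"
  unfolding has_vector_derivative_def has_derivative_at_alt
proof (intro conjI allI impI)
  show "bounded_linear (\<lambda>x. x *\<^sub>R T t)" by (rule bounded_linear_scaleR_left)
  fix e :: real assume e: "e > 0"
  show "\<exists>d>0. \<forall>y. norm (y - t) < d \<longrightarrow> norm (s y - s t - (y - t) *\<^sub>R T t) \<le> e * norm (y - t)"
  proof (intro exI[of _ "min (1/2) ((e/4)\<^sup>2)"] conjI allI impI)
    show "min (1/2) ((e/4)\<^sup>2) > 0" using e by simp
    fix y assume y: "norm (y - t) < min (1/2) ((e/4)\<^sup>2)"
    then have "sqrt \<bar>y - t\<bar> \<le> sqrt ((e/4)\<^sup>2)" by (intro real_sqrt_le_mono) auto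
    then have "4 * sqrt \<bar>y - t\<bar> \<le> e" using e by simp
    then have "4 * sqrt \<bar>y - t\<bar> * \<bar>y - t\<bar> \<le> e * \<bar>y - t\<bar>" by (intro mult_right_mono) auto
    then show "norm (s y - s t - (y - t) *\<^sub>R T t) \<le> e * norm (y - t)" using first_order[of y t] y by auto
  qed
qed

section \<open>Arcs of contact with a touching cap\<close>

lemma contact_frame:
  assumes w: "touching w" and t: "s t \<bullet> w = 1"
  shows "T t \<bullet> w = 0" "w = s t + 1 *\<^sub>R n t \<or> w = s t + (-1) *\<^sub>R n t" "w \<bullet> n t = 1 \<or> w \<bullet> n t = -1"
    "w = s t + (w \<bullet> n t) *\<^sub>R n t"
proof -
  have le: "s u \<bullet> w \<le> 1" and ww: "w \<bullet> w = 2" for u using w by (auto simp: touching_def)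
  have "((\<lambda>u. s u \<bullet> w) has_vector_derivative T t \<bullet> w) (at t)"
    by (rule bounded_linear.has_vector_derivative[OF bounded_linear_inner_left s_derivative])
  then have "((\<lambda>u. s u \<bullet> w) has_real_derivative T t \<bullet> w) (at t)"
    by (simp add: has_real_derivative_iff_has_vector_derivative)
  \<comment> \<open>The value \<open>1\<close> at a contact is the maximum along the curve, so the
    cap is tangent there, which leaves only the centres \<open>s t \<plusminus> n t\<close>.\<close>
  then show Tw: "T t \<bullet> w = 0" by (rule DERIV_local_max[of _ _ _ 1]) (use le t in auto)
  have wT: "w \<bullet> T t = 0" "w \<bullet> s t = 1" using Tw t by (simp_all add: inner_commute)
  have "(w \<bullet> n t)\<^sup>2 = 1" using frame(1)[of w t] ww wT by simp
  then show pm: "w \<bullet> n t = 1 \<or> w \<bullet> n t = -1" by (simp add: power2_eq_1_iff)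
  show fr: "w = s t + (w \<bullet> n t) *\<^sub>R n t" using frame(2)[of w t] wT by simp
  show "w = s t + 1 *\<^sub>R n t \<or> w = s t + (-1) *\<^sub>R n t" using pm fr by metis
qed

lemma cross_wT: "\<epsilon> = 1 \<or> \<epsilon> = -1 \<Longrightarrow> w = s t + \<epsilon> *\<^sub>R n t \<Longrightarrow> T t = \<epsilon> *\<^sub>R cross3 w (s t)"
proof -
  assume e: "\<epsilon> = 1 \<or> \<epsilon> = -1" and w: "w = s t + \<epsilon> *\<^sub>R n t"
  have "cross3 (n t) (s t) = - cross3 (s t) (cross3 (s t) (T t))" by (metis cross_skew n_def)
  also have "\<dots> = T t" unfolding Lagrange by simp
  finally have "cross3 (n t) (s t) = T t" .
  then show ?thesis unfolding w using e by (auto simp: cross_add_left cross_mult_left)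
qed

text \<open>The sign is a continuous function of the time with values in
  \<open>{1, -1}\<close>.\<close>

lemma contact_sign:
  assumes w: "touching w" and pq: "p \<le> q" and Z: "\<And>t. p \<le> t \<Longrightarrow> t \<le> q \<Longrightarrow> s t \<bullet> w = 1" and t: "p \<le> t" "t \<le> q"
  shows "w \<bullet> n t = w \<bullet> n p"
proof -
  have "(\<lambda>t. w \<bullet> n t) constant_on {p..q}"
  proof (rule continuous_finite_range_constant)
    show "continuous_on {p..q} (\<lambda>t. w \<bullet> n t)" by (intro continuous_intros n_cont)
    have "(\<lambda>t. w \<bullet> n t) ` {p..q} \<subseteq> {1, -1}"
    proof (rule image_subsetI)
      fix t assume "t \<in> {p..q}"
      then show "w \<bullet> n t \<in> {1, -1}" using contact_frame(3)[OF w Z[of t]] by simp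
    qed
    then show "finite ((\<lambda>t. w \<bullet> n t) ` {p..q})" by (rule finite_subset) simp
  qed simp
  then show ?thesis using t pq unfolding constant_on_def by (metis atLeastAtMost_iff order_refl)
qed

text \<open>Along an arc of contact with a touching cap the curve solves \<open>s' = \<plusminus> w \<times> s\<close>, hence rotates about \<open>w\<close>
  with angular speed \<open>norm w = 1 / c\<close>.\<close>

lemma contact_rotation:
  assumes w: "touching w" and pq: "p \<le> q" and Z: "\<And>t. p \<le> t \<Longrightarrow> t \<le> q \<Longrightarrow> s t \<bullet> w = 1"
  obtains b where "b \<bullet> b = 1/2" "(s p - (1/2) *\<^sub>R w) \<bullet> b = 0" "b \<bullet> w = 0"
    "(s p - (1/2) *\<^sub>R w) \<bullet> (s p - (1/2) *\<^sub>R w) = 1/2"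
    "\<And>t. p \<le> t \<Longrightarrow> t \<le> q \<Longrightarrow> s t = (1/2) *\<^sub>R w + cos ((t - p) / c) *\<^sub>R (s p - (1/2) *\<^sub>R w) + sin ((t - p) / c) *\<^sub>R b"
proof -
  have ww: "w \<bullet> w = 2" using w by (simp add: touching_def)
  define \<epsilon> where "\<epsilon> = w \<bullet> n p"
  have eps: "w \<bullet> n t = \<epsilon>" if "p \<le> t" "t \<le> q" for t
    unfolding \<epsilon>_def by (rule contact_sign[OF w pq Z that])
  have e1: "\<epsilon> = 1 \<or> \<epsilon> = -1" using contact_frame(3)[OF w Z[of p]] pq by (simp add: \<epsilon>_def)
  then have ee: "\<epsilon> * \<epsilon> = 1" by auto
  have ode: "T t = \<epsilon> *\<^sub>R cross3 w (s t)" if "p \<le> t" "t \<le> q" for t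
    using contact_frame(4)[OF w Z[OF that]] cross_wT[of \<epsilon> w t] e1 unfolding eps[OF that] by blast
  define a where "a = s p - (1/2) *\<^sub>R w"
  define b where "b = (c * \<epsilon>) *\<^sub>R cross3 w a"
  have sw: "s p \<bullet> w = 1" "w \<bullet> s p = 1" using Z[of p] pq by (simp_all add: inner_commute)
  have aw: "a \<bullet> w = 0" "w \<bullet> a = 0" using sw ww by (simp_all add: a_def inner_diff_left inner_diff_right)
  have aa: "a \<bullet> a = 1/2" using sw ww by (simp add: a_def inner_diff_left inner_diff_right)
  have ww': "cross3 w (cross3 w a) = - 2 *\<^sub>R a" unfolding Lagrange using aw ww by simp
  have cc: "c * c = 1/2" using c_sq by (simp add: power2_eq_square)
  have bb: "b \<bullet> b = 1/2"
  proof -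
    have "cross3 w a \<bullet> cross3 w a = 1"
      using norm_cross_dot[of w a] aw ww aa by (simp add: power2_norm_eq_inner power_mult_distrib)
    moreover have "b \<bullet> b = (c * c) * (\<epsilon> * \<epsilon>) * (cross3 w a \<bullet> cross3 w a)" by (simp add: b_def mult_ac)
    ultimately show ?thesis by (simp add: cc ee)
  qed
  have ab: "a \<bullet> b = 0" "b \<bullet> w = 0" by (simp_all add: b_def dot_cross_self)
  define C where "C t = (1/2) *\<^sub>R w + cos ((t - p) / c) *\<^sub>R a + sin ((t - p) / c) *\<^sub>R b" for t
  have Cd: "(C has_vector_derivative \<epsilon> *\<^sub>R cross3 w (C t)) (at t)" for t
  proof -
    have "(C has_vector_derivative (- (sin ((t - p) / c) * (1 / c))) *\<^sub>R a + (cos ((t - p) / c) * (1 / c)) *\<^sub>R b) (at t)"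
      unfolding C_def using c by (auto intro!: derivative_eq_intros)
    moreover have "\<epsilon> *\<^sub>R cross3 w (C t) = (- (sin ((t - p) / c) * (1 / c))) *\<^sub>R a + (cos ((t - p) / c) * (1 / c)) *\<^sub>R b"
    proof -
      have 1: "\<epsilon> *\<^sub>R cross3 w a = (1 / c) *\<^sub>R b" using c by (simp add: b_def)
      have ic: "2 * c = 1 / c" using cc c by (simp add: field_simps)
      have 2: "\<epsilon> *\<^sub>R cross3 w b = (- (1 / c)) *\<^sub>R a"
      proof -
        have "\<epsilon> *\<^sub>R cross3 w b = (\<epsilon> * (c * \<epsilon>)) *\<^sub>R cross3 w (cross3 w a)" by (simp add: b_def cross_mult_right)
        also have "\<epsilon> * (c * \<epsilon>) = c" using ee by (simp add: mult_ac)
        also have "c *\<^sub>R cross3 w (cross3 w a) = (- (2 * c)) *\<^sub>R a" unfolding ww' by simp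
        finally show ?thesis unfolding ic .
      qed
      have "\<epsilon> *\<^sub>R cross3 w (C t) = cos ((t - p) / c) *\<^sub>R (\<epsilon> *\<^sub>R cross3 w a) + sin ((t - p) / c) *\<^sub>R (\<epsilon> *\<^sub>R cross3 w b)"
        unfolding C_def by (simp add: cross_add_right cross_mult_right scaleR_add_right mult.commute)
      then show ?thesis unfolding 1 2 by simp
    qed
    ultimately show ?thesis by simp
  qed
  have "s t = C t" if t: "p \<le> t" "t \<le> q" for t
  proof -
    \<comment> \<open>Uniqueness for the linear equation: the difference of two solutions has
      constant norm because \<open>w \<times> y\<close> is orthogonal to \<open>y\<close>.\<close>
    define f where "f u = (s u - C u) \<bullet> (s u - C u)" for u
    have fd: "(f has_real_derivative 0) (at u)" if u: "p \<le> u" "u \<le> q" for u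
    proof -
      have yd: "((\<lambda>u. s u - C u) has_vector_derivative \<epsilon> *\<^sub>R cross3 w (s u - C u)) (at u)"
      proof -
        have "\<epsilon> *\<^sub>R cross3 w (s u - C u) = T u - \<epsilon> *\<^sub>R cross3 w (C u)"
          unfolding ode[OF u] by (simp add: Cross3.right_diff_distrib scaleR_diff_right)
        then show ?thesis using has_vector_derivative_diff[OF s_derivative[of u] Cd[of u]] by simp
      qed
      have "(f has_derivative (\<lambda>h. (s u - C u) \<bullet> (h *\<^sub>R (\<epsilon> *\<^sub>R cross3 w (s u - C u))) +
          (h *\<^sub>R (\<epsilon> *\<^sub>R cross3 w (s u - C u))) \<bullet> (s u - C u))) (at u)"
        unfolding f_def
        by (rule has_derivative_inner[OF yd[unfolded has_vector_derivative_def] yd[unfolded has_vector_derivative_def]])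
      moreover have "(*) (0::real) = (\<lambda>h. 0)" by auto
      ultimately show ?thesis unfolding has_field_derivative_def by (simp add: dot_cross_self)
    qed
    have "f t = f p"
    proof (cases "t = p")
      case False
      show ?thesis
      proof (rule DERIV_isconst_end[of p t f])
        show "p < t" using False t by simp
        have d: "(f has_real_derivative 0) (at x)" if "p \<le> x" "x \<le> t" for x
          by (rule fd) (use that t in auto)
        show "continuous_on {p..t} f"
          by (rule DERIV_atLeastAtMost_imp_continuous_on) (use d in blast)
        show "(f has_real_derivative 0) (at x)" if "p < x" "x < t" for x
          by (rule d) (use that in auto)
      qed
    qed simp
    also have "f p = 0" by (simp add: f_def C_def a_def)
    finally show ?thesis by (simp add: f_def)
  qed
  then show ?thesis using that[of b] bb ab aa unfolding C_def a_def by blast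
qed

end

text \<open>To be read with \<open>a\<close>, \<open>b\<close> the lengths of the increments of
  \<open>s\<close> and \<open>n\<close>, and \<open>P\<close> their inner product. The tangential
  parts dominate, so \<open>\<bar>P\<bar>\<close> is almost \<open>a * b\<close>; as it is also
  bounded by both squares, \<open>a\<close> and \<open>b\<close> are almost equal, and the
  increments agree up to sign and a higher-order error.\<close>

lemma frame_pair_estimate:
  fixes a b P \<alpha> \<beta> A B :: real
  assumes ab: "0 < a" "0 < b" and P: "P = - (a\<^sup>2/2) * \<beta> + A * B - \<alpha> * (b\<^sup>2/2)"
    and al: "\<bar>\<alpha>\<bar> \<le> a\<^sup>2/2" "\<bar>\<beta>\<bar> \<le> b\<^sup>2/2"
    and A: "a\<^sup>2 = (a\<^sup>2/2)\<^sup>2 + A\<^sup>2 + \<alpha>\<^sup>2" and B: "b\<^sup>2 = \<beta>\<^sup>2 + B\<^sup>2 + (b\<^sup>2/2)\<^sup>2"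
    and Pab: "\<bar>P\<bar> \<le> a\<^sup>2" "\<bar>P\<bar> \<le> b\<^sup>2" and small: "a\<^sup>2 + b\<^sup>2 \<le> 1/2"
  shows "P \<noteq> 0" "a\<^sup>2 + b\<^sup>2 - 2 * \<bar>P\<bar> \<le> 2 * (a\<^sup>2 + b\<^sup>2)\<^sup>2"
proof -
  define \<sigma> where "\<sigma> = a\<^sup>2 + b\<^sup>2"
  have \<sigma>: "0 < \<sigma>" "\<sigma> \<le> 1/2" using ab small by (auto simp: \<sigma>_def add_pos_pos)
  have abp: "0 < a * b" using ab by simp
  have ab\<sigma>: "2 * (a * b) \<le> \<sigma>" using sum_squares_bound[of a b] by (simp add: \<sigma>_def)
  have "\<alpha>\<^sup>2 \<le> (a\<^sup>2/2)\<^sup>2" using al(1) by (simp add: abs_le_square_iff[symmetric])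
  then have A2: "a\<^sup>2 * (1 - a\<^sup>2/2) \<le> A\<^sup>2" using A by (simp add: power2_eq_square algebra_simps)
  have "\<beta>\<^sup>2 \<le> (b\<^sup>2/2)\<^sup>2" using al(2) by (simp add: abs_le_square_iff[symmetric])
  then have B2: "b\<^sup>2 * (1 - b\<^sup>2/2) \<le> B\<^sup>2" using B by (simp add: power2_eq_square algebra_simps)
  have a1: "0 \<le> 1 - a\<^sup>2/2" "0 \<le> 1 - b\<^sup>2/2" using \<sigma> zero_le_power2[of a] zero_le_power2[of b] unfolding \<sigma>_def by linarith+
  have "(a * b * (1 - \<sigma>/2))\<^sup>2 \<le> (a * b)\<^sup>2 * ((1 - a\<^sup>2/2) * (1 - b\<^sup>2/2))"
  proof -
    have "(1 - \<sigma>/2)\<^sup>2 \<le> (1 - \<sigma>/2) * 1" unfolding power2_eq_square using \<sigma> by (intro mult_left_mono) auto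
    also have "\<dots> \<le> (1 - a\<^sup>2/2) * (1 - b\<^sup>2/2)"
    proof -
      have "(1 - a\<^sup>2/2) * (1 - b\<^sup>2/2) = 1 - \<sigma>/2 + a\<^sup>2 * b\<^sup>2 / 4" by (simp add: \<sigma>_def field_simps)
      moreover have "0 \<le> a\<^sup>2 * b\<^sup>2 / 4" by simp
      ultimately show ?thesis by simp
    qed
    finally show ?thesis unfolding power_mult_distrib by (intro mult_left_mono) auto
  qed
  also have "\<dots> = (a\<^sup>2 * (1 - a\<^sup>2/2)) * (b\<^sup>2 * (1 - b\<^sup>2/2))" by (simp add: power_mult_distrib)
  also have "\<dots> \<le> A\<^sup>2 * B\<^sup>2" using A2 B2 a1 by (intro mult_mono) auto
  also have "\<dots> = \<bar>A * B\<bar>\<^sup>2" by (simp add: power_mult_distrib)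
  finally have "(a * b * (1 - \<sigma>/2))\<^sup>2 \<le> \<bar>A * B\<bar>\<^sup>2" .
  then have AB: "a * b * (1 - \<sigma>/2) \<le> \<bar>A * B\<bar>" by (rule power2_le_imp_le) simp
  have r1: "\<bar>(a\<^sup>2/2) * \<beta>\<bar> \<le> (a\<^sup>2/2) * (b\<^sup>2/2)" unfolding abs_mult using al(2) by (intro mult_mono) auto
  have r2: "\<bar>\<alpha> * (b\<^sup>2/2)\<bar> \<le> (a\<^sup>2/2) * (b\<^sup>2/2)" unfolding abs_mult using al(1) by (intro mult_mono) auto
  have q: "(a\<^sup>2/2) * (b\<^sup>2/2) \<le> a * b * (\<sigma>/8)"
  proof -
    have "(a * b) * (2 * (a * b)) \<le> (a * b) * \<sigma>" using ab\<sigma> abp by (intro mult_left_mono) auto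
    then have "(a * b) * (2 * (a * b)) / 8 \<le> (a * b) * \<sigma> / 8" by (rule divide_right_mono) simp
    moreover have "(a\<^sup>2/2) * (b\<^sup>2/2) = (a * b) * (2 * (a * b)) / 8" by (simp add: power2_eq_square)
    ultimately show ?thesis by (simp only: times_divide_eq_right)
  qed
  have "\<bar>A * B\<bar> \<le> \<bar>P\<bar> + \<bar>(a\<^sup>2/2) * \<beta>\<bar> + \<bar>\<alpha> * (b\<^sup>2/2)\<bar>"
  proof -
    have gen: "\<bar>y\<bar> \<le> \<bar>- x + y - z\<bar> + \<bar>x\<bar> + \<bar>z\<bar>" for x y z :: real by linarith
    have "P = - ((a\<^sup>2/2) * \<beta>) + A * B - \<alpha> * (b\<^sup>2/2)" using P by simp
    then show ?thesis by (simp only: gen)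
  qed
  moreover have "k \<le> p + x + z \<Longrightarrow> x \<le> y \<Longrightarrow> z \<le> y \<Longrightarrow> y \<le> u \<Longrightarrow> k \<le> p + 2 * u" for k p x y z u :: real by linarith
  ultimately have A1: "\<bar>A * B\<bar> \<le> \<bar>P\<bar> + 2 * (a * b * (\<sigma>/8))" using r1 r2 q by blast
  define m where "m = a * b"
  define M where "M = a * b * \<sigma>"
  have "m - M / 2 \<le> \<bar>A * B\<bar>" using AB by (simp add: m_def M_def algebra_simps)
  moreover have "\<bar>A * B\<bar> \<le> \<bar>P\<bar> + M / 4" using A1 by (simp add: M_def mult_ac)
  moreover have "0 \<le> M" using abp \<sigma> by (simp add: M_def)
  ultimately have mM: "m - M \<le> \<bar>P\<bar>" by linarith
  then have low: "a * b * (1 - \<sigma>) \<le> \<bar>P\<bar>" by (simp add: m_def M_def algebra_simps)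
  have "0 < a * b * (1 - \<sigma>)" using abp \<sigma> by simp
  then show "P \<noteq> 0" using low by auto
  \<comment> \<open>Here the bounds by \<open>a^2\<close> and by \<open>b^2\<close> are turned into
    comparability of \<open>a\<close> and \<open>b\<close>.\<close>
  have "a * (b * (1 - \<sigma>)) \<le> a * a" using low Pab(1) by (simp add: power2_eq_square mult.assoc)
  then have 1: "b * (1 - \<sigma>) \<le> a" using ab by (simp only: mult_le_cancel_left_pos)
  have "b * (a * (1 - \<sigma>)) \<le> b * b" using low Pab(2) by (simp add: power2_eq_square mult_ac)
  then have 2: "a * (1 - \<sigma>) \<le> b" using ab by (simp only: mult_le_cancel_left_pos)
  have "\<bar>a - b\<bar> \<le> \<sigma> * max a b"
  proof (cases "a \<le> b")
    case True
    have "b * (1 - \<sigma>) = b - \<sigma> * b" by (simp add: algebra_simps)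
    then show ?thesis using 1 True by (simp add: max_def)
  next
    case False
    have "a * (1 - \<sigma>) = a - \<sigma> * a" by (simp add: algebra_simps)
    then show ?thesis using 2 False by (simp add: max_def)
  qed
  then have "\<bar>a - b\<bar>\<^sup>2 \<le> (\<sigma> * max a b)\<^sup>2" by (intro power_mono) auto
  also have "\<dots> = \<sigma>\<^sup>2 * (max a b)\<^sup>2" by (simp add: power_mult_distrib)
  also have "\<dots> \<le> \<sigma>\<^sup>2 * 1"
  proof (rule mult_left_mono)
    have "(max a b)\<^sup>2 \<le> \<sigma>" by (simp add: max_def \<sigma>_def)
    then show "(max a b)\<^sup>2 \<le> 1" using \<sigma> by linarith
  qed simp
  finally have d: "(a - b)\<^sup>2 \<le> \<sigma>\<^sup>2" by simp
  have "2 * M \<le> \<sigma>\<^sup>2" using mult_right_mono[OF ab\<sigma>, of \<sigma>] \<sigma> by (simp add: power2_eq_square mult.assoc M_def)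
  moreover have "\<sigma> = (a - b)\<^sup>2 + 2 * m" by (simp add: \<sigma>_def power2_diff m_def)
  ultimately have "\<sigma> - 2 * \<bar>P\<bar> \<le> 2 * \<sigma>\<^sup>2" using d mM by simp
  then show "a\<^sup>2 + b\<^sup>2 - 2 * \<bar>P\<bar> \<le> 2 * (a\<^sup>2 + b\<^sup>2)\<^sup>2" by (simp add: \<sigma>_def)
qed

text \<open>The bound \<open>R\<close> makes the supremum exist; exit points arbitrarily close to
  \<open>q\<close> are claimed only if the search stopped before \<open>t + R\<close>.\<close>

lemma maximal_right_interval:
  fixes Z :: "real set"
  assumes "closed Z" "t \<in> Z" "0 \<le> R"
  obtains q where "t \<le> q" "q \<le> t + R" "{t..q} \<subseteq> Z" "\<And>\<epsilon>. q < t + R \<Longrightarrow> \<epsilon> > 0 \<Longrightarrow> \<exists>u. q < u \<and> u < q + \<epsilon> \<and> u \<notin> Z"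
proof -
  define A where "A = {q. t \<le> q \<and> q \<le> t + R \<and> {t..q} \<subseteq> Z}"
  define q where "q = Sup A"
  have tA: "t \<in> A" using assms by (auto simp: A_def)
  have bdd: "bdd_above A" by (intro bdd_aboveI[of _ "t + R"]) (auto simp: A_def)
  have tq: "t \<le> q" unfolding q_def using tA bdd by (rule cSup_upper)
  have qR: "q \<le> t + R" unfolding q_def
  proof (rule cSup_least)
    show "A \<noteq> {}" using tA by blast
  qed (simp add: A_def)
  have sub: "{t..q} \<subseteq> Z"
  proof (cases "t = q")
    case False
    then have "t < q" using tq by simp
    have "{t<..<q} \<subseteq> Z"
    proof
      fix u assume u: "u \<in> {t<..<q}"
      then obtain v where "v \<in> A" "u < v" using less_cSup_iff[of A u] tA bdd by (auto simp: q_def)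
      then show "u \<in> Z" using u by (auto simp: A_def)
    qed
    then have "closure {t<..<q} \<subseteq> Z" using assms(1) by (rule closure_minimal)
    then show ?thesis using \<open>t < q\<close> by simp
  qed (use assms in auto)
  have "\<exists>u. q < u \<and> u < q + \<epsilon> \<and> u \<notin> Z" if "q < t + R" "\<epsilon> > 0" for \<epsilon>
  proof (rule ccontr)
    assume n: "\<not> ?thesis"
    define v where "v = min (q + \<epsilon>/2) (t + R)"
    have v: "q < v" "v < q + \<epsilon>" "v \<le> t + R" using that by (auto simp: v_def)
    have "{t..v} \<subseteq> Z"
    proof
      fix u assume u: "u \<in> {t..v}"
      show "u \<in> Z"
      proof (cases "u \<le> q")
        case True then show ?thesis using sub u by auto
      next
        case False then show ?thesis using n u v by auto
      qed
    qed
    then have "v \<in> A" using v tq by (simp add: A_def)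
    then have "v \<le> q" unfolding q_def using bdd by (rule cSup_upper)
    then show False using v by simp
  qed
  then show ?thesis using that[of q] tq qR sub by blast
qed

lemma maximal_left_interval:
  fixes Z :: "real set"
  assumes "closed Z" "t \<in> Z" "0 \<le> R"
  obtains p where "p \<le> t" "t - R \<le> p" "{p..t} \<subseteq> Z" "\<And>\<epsilon>. t - R < p \<Longrightarrow> \<epsilon> > 0 \<Longrightarrow> \<exists>u. p - \<epsilon> < u \<and> u < p \<and> u \<notin> Z"
proof -
  have "closed (uminus ` Z)" using assms(1) by (simp add: closed_negations)
  moreover have "- t \<in> uminus ` Z" using assms(2) by simp
  ultimately obtain q where q: "- t \<le> q" "q \<le> - t + R" "{- t..q} \<subseteq> uminus ` Z"
    "\<And>\<epsilon>. q < - t + R \<Longrightarrow> \<epsilon> > 0 \<Longrightarrow> \<exists>u. q < u \<and> u < q + \<epsilon> \<and> u \<notin> uminus ` Z"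
    by (rule maximal_right_interval[of "uminus ` Z" "- t" R, OF _ _ assms(3)]) (rule that)
  have m: "u \<in> uminus ` Z \<longleftrightarrow> - u \<in> Z" for u by (metis image_iff minus_minus)
  show ?thesis
  proof (rule that[of "- q"])
    show "{- q..t} \<subseteq> Z"
    proof
      fix u assume "u \<in> {- q..t}"
      then have "- u \<in> {- t..q}" by auto
      then have "- u \<in> uminus ` Z" using q(3) by blast
      then show "u \<in> Z" unfolding m by simp
    qed
    fix \<epsilon> :: real assume "t - R < - q" "\<epsilon> > 0"
    then obtain u where "q < u" "u < q + \<epsilon>" "u \<notin> uminus ` Z" using q(4)[of \<epsilon>] by auto
    then show "\<exists>u. - q - \<epsilon> < u \<and> u < - q \<and> u \<notin> Z" unfolding m by (intro exI[of _ "- u"]) auto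
  qed (use q in auto)
qed

section \<open>Covering the curve by contact arcs of half a circle\<close>

context extremal_curve begin

text \<open>The time of a half turn at angular speed \<open>1 / c\<close>, and also a quarter of the
  period.\<close>

definition lam :: real where "lam = pi * c"

lemma lam_pos: "lam > 0" using c by (simp add: lam_def)
lemma l_lam: "l = 4 * lam" using l_eq by (simp add: lam_def)

text \<open>The boundary circle of the cap has centre \<open>w / 2\<close>, so the condition
  \<open>op\<close> makes the two points antipodal on it. Rotation at speed \<open>1 / c\<close>
  needs the angle \<open>pi\<close> for that.\<close>

lemma half_turn:
  assumes w: "touching w" and pt: "p \<le> t" and Z: "\<And>u. p \<le> u \<Longrightarrow> u \<le> t \<Longrightarrow> s u \<bullet> w = 1" and op: "s p + s t = w"
  shows "lam \<le> t - p"
proof -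
  define a where "a = s p - (1/2) *\<^sub>R w"
  obtain b where b: "a \<bullet> b = 0" "a \<bullet> a = 1/2" "\<And>u. p \<le> u \<Longrightarrow> u \<le> t \<Longrightarrow> s u = (1/2) *\<^sub>R w + cos ((u - p) / c) *\<^sub>R a + sin ((u - p) / c) *\<^sub>R b"
    using contact_rotation[OF w pt Z] unfolding a_def by metis
  have "s t = (1/2) *\<^sub>R w - a"
  proof -
    have "w = (1/2) *\<^sub>R w + (1/2) *\<^sub>R w" by (simp flip: scaleR_add_left)
    then show ?thesis using op unfolding a_def by (simp add: algebra_simps)
  qed
  moreover have "s t - (1/2) *\<^sub>R w = cos ((t - p) / c) *\<^sub>R a + sin ((t - p) / c) *\<^sub>R b" using b(3)[of t] pt by simp
  ultimately have "cos ((t - p) / c) *\<^sub>R a + sin ((t - p) / c) *\<^sub>R b = - a" by simp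
  then have "(cos ((t - p) / c) *\<^sub>R a + sin ((t - p) / c) *\<^sub>R b) \<bullet> a = - (a \<bullet> a)" by simp
  moreover have "b \<bullet> a = 0" using b(1) by (simp add: inner_commute)
  ultimately have "cos ((t - p) / c) * (1/2) = - (1/2)" unfolding inner_add_left inner_scaleR_left b(2) by simp
  then have cm: "cos ((t - p) / c) = - 1" by simp
  have "pi \<le> (t - p) / c"
  proof (rule ccontr)
    assume "\<not> pi \<le> (t - p) / c"
    then have "cos pi < cos ((t - p) / c)" using pt c by (intro cos_monotone_0_pi) auto
    then show False using cm by simp
  qed
  then show ?thesis using c by (simp add: lam_def pos_le_divide_eq)
qed

text \<open>A full turn takes half a period and returns to the same point, against
  injectivity.\<close>

lemma full_turn_False:
  assumes w: "touching w" and Z: "\<And>u. p \<le> u \<Longrightarrow> u \<le> p + 2 * lam \<Longrightarrow> s u \<bullet> w = 1"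
  shows False
proof -
  have pl: "p \<le> p + 2 * lam" using lam_pos by simp
  obtain b where "\<And>u. p \<le> u \<Longrightarrow> u \<le> p + 2 * lam \<Longrightarrow> s u = (1/2) *\<^sub>R w + cos ((u - p) / c) *\<^sub>R (s p - (1/2) *\<^sub>R w) + sin ((u - p) / c) *\<^sub>R b"
    using contact_rotation[OF w pl Z] by metis
  from this[of "p + 2 * lam"] have "s (p + 2 * lam) = s p" using pl c by (simp add: lam_def)
  then have "p + 2 * lam = p" by (rule inj) (use lam_pos l_lam in simp)
  then show False using lam_pos by simp
qed

lemma closed_contact: "closed {t. s t \<bullet> w = 1}"
  by (intro closed_Collect_eq continuous_intros cont)

text \<open>Shift the cap slightly towards \<open>v\<close>. The threshold does not drop, so some
  point sees the shifted cap, and it must have \<open>0 \<le> s t \<bullet> v\<close> because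
  \<open>s t \<bullet> w \<le> 1\<close>. If no such point were a contact, compactness would bound
  \<open>s t \<bullet> w\<close> away from \<open>1\<close> on them, and a small shift would be seen
  by none.\<close>

lemma contact_not_in_halfcircle:
  assumes w: "touching w" and v: "v \<bullet> w = 0"
  shows "\<exists>t. a \<le> t \<and> t \<le> a + l \<and> s t \<bullet> w = 1 \<and> 0 \<le> s t \<bullet> v"
proof (rule ccontr)
  assume none: "\<not> ?thesis"
  have ww: "w \<bullet> w = 2" and le: "s t \<bullet> w \<le> 1" for t using w by (auto simp: touching_def)
  have ex: "\<exists>t. a \<le> t \<and> t \<le> a + l \<and> 1 \<le> s t \<bullet> w + \<epsilon> * (s t \<bullet> v)" if "\<epsilon> > 0" for \<epsilon>
  proof -
    obtain t where t: "a \<le> t" "t < a + l" "c * norm (w + \<epsilon> *\<^sub>R v) \<le> (w + \<epsilon> *\<^sub>R v) \<bullet> s t" using inspects_window by blast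
    have "(w + \<epsilon> *\<^sub>R v) \<bullet> (w + \<epsilon> *\<^sub>R v) = 2 + \<epsilon> * \<epsilon> * (v \<bullet> v)"
      using ww v by (simp add: inner_add inner_commute)
    then have "1\<^sup>2 \<le> (c * norm (w + \<epsilon> *\<^sub>R v))\<^sup>2" unfolding cnorm_sq by simp
    then have "1 \<le> c * norm (w + \<epsilon> *\<^sub>R v)" using cnorm_nonneg by (rule power2_le_imp_le)
    moreover have "(w + \<epsilon> *\<^sub>R v) \<bullet> s t = s t \<bullet> w + \<epsilon> * (s t \<bullet> v)"
      unfolding inner_add_left inner_scaleR_left inner_commute[of w "s t"] inner_commute[of v "s t"] ..
    ultimately show ?thesis using t by (intro exI[of _ t]) linarith
  qed
  define K where "K = {a..a + l} \<inter> {t. 0 \<le> s t \<bullet> v}"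
  have K: "compact K" unfolding K_def
    by (intro compact_Int_closed closed_Collect_le continuous_intros cont) auto
  obtain t1 where t1: "a \<le> t1" "t1 \<le> a + l" "1 \<le> s t1 \<bullet> w + 1 * (s t1 \<bullet> v)" using ex[of 1] by auto
  have "t1 \<in> K" using t1 le[of t1] by (simp add: K_def)
  then have "K \<noteq> {}" by auto
  moreover have "continuous_on K (\<lambda>t. s t \<bullet> w)" by (intro continuous_intros cont)
  ultimately have "\<exists>x\<in>K. \<forall>y\<in>K. s y \<bullet> w \<le> s x \<bullet> w" by (rule continuous_attains_sup[OF K])
  then obtain tm where tm: "tm \<in> K" "\<And>t. t \<in> K \<Longrightarrow> s t \<bullet> w \<le> s tm \<bullet> w" by blast
  have "s tm \<bullet> w \<noteq> 1" using none tm(1) by (auto simp: K_def)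
  then have g: "0 < 1 - s tm \<bullet> w" using le[of tm] by simp
  define \<epsilon> where "\<epsilon> = (1 - s tm \<bullet> w) / (2 * (1 + norm v))"
  have nv: "0 < 2 * (1 + norm v)" "norm v < 2 * (1 + norm v)" using norm_ge_zero[of v] by argo+
  have \<epsilon>: "\<epsilon> > 0" using g nv(1) by (simp add: \<epsilon>_def)
  obtain t where t: "a \<le> t" "t \<le> a + l" "1 \<le> s t \<bullet> w + \<epsilon> * (s t \<bullet> v)" using ex[OF \<epsilon>] by blast
  then have "0 \<le> \<epsilon> * (s t \<bullet> v)" using le[of t] by linarith
  then have "t \<in> K" using t \<epsilon> by (simp add: K_def zero_le_mult_iff)
  then have "s t \<bullet> w \<le> s tm \<bullet> w" by (rule tm(2))
  moreover have "\<epsilon> * (s t \<bullet> v) < 1 - s tm \<bullet> w"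
  proof -
    have "s t \<bullet> v \<le> norm v" using norm_cauchy_schwarz[of "s t" v] by (simp add: norm_eq_1)
    then have "\<epsilon> * (s t \<bullet> v) \<le> \<epsilon> * norm v" using \<epsilon> by (intro mult_left_mono) auto
    also have "\<dots> < \<epsilon> * (2 * (1 + norm v))" using \<epsilon> nv(2) by (intro mult_strict_left_mono)
    also have "\<dots> = 1 - s tm \<bullet> w" using nv(1) by (simp add: \<epsilon>_def)
    finally show ?thesis .
  qed
  ultimately show False using t(3) by linarith
qed

definition arc_start :: "real \<Rightarrow> real \<Rightarrow> bool" where
  "arc_start e t \<longleftrightarrow> (\<forall>u\<in>{t..t + lam}. s u \<bullet> (s t + e *\<^sub>R n t) = 1)"

definition covered :: "real \<Rightarrow> bool" where
  "covered t \<longleftrightarrow> (\<exists>e t'. (e = 1 \<or> e = -1) \<and> t' \<le> t \<and> t \<le> t' + lam \<and> arc_start e t')"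

lemma covered_by_contact:
  assumes w: "touching w" and Z: "\<And>u. t' \<le> u \<Longrightarrow> u \<le> t' + lam \<Longrightarrow> s u \<bullet> w = 1" and t: "t' \<le> t" "t \<le> t' + lam"
  shows "covered t"
proof -
  have "s t' \<bullet> w = 1" using Z[of t'] lam_pos by simp
  from contact_frame(2)[OF w this] obtain e where "e = 1 \<or> e = -1" "w = s t' + e *\<^sub>R n t'" by blast
  then show ?thesis using Z t unfolding covered_def arc_start_def by (intro exI[of _ e] exI[of _ t']) auto
qed

text \<open>Without an opposite contact, \<open>contact_connected\<close> joins every contact to
  \<open>t\<close>, so all contact points lie on one arc. If that is shorter than half a circle, it
  violates \<open>contact_not_in_halfcircle\<close>.\<close>

lemma covered_or_opposite:
  assumes w: "touching w" and t: "s t \<bullet> w = 1"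
  shows "covered t \<or> (\<exists>t2. s t2 = w - s t)"
proof (rule ccontr)
  assume "\<not> ?thesis"
  then have nc: "\<not> covered t" and no: "\<And>t2. s t2 \<noteq> w - s t" by auto
  have ww: "w \<bullet> w = 2" using w by (simp add: touching_def)
  define Z where "Z = {t. s t \<bullet> w = 1}"
  have Zc: "closed Z" unfolding Z_def by (rule closed_contact)
  have tZ: "t \<in> Z" using t by (simp add: Z_def)
  obtain q where q: "t \<le> q" "q \<le> t + lam" "{t..q} \<subseteq> Z" "\<And>\<epsilon>. q < t + lam \<Longrightarrow> \<epsilon> > 0 \<Longrightarrow> \<exists>u. q < u \<and> u < q + \<epsilon> \<and> u \<notin> Z"
    by (rule maximal_right_interval[OF Zc tZ less_imp_le[OF lam_pos]]) (rule that)
  obtain p where p: "p \<le> t" "t - lam \<le> p" "{p..t} \<subseteq> Z" "\<And>\<epsilon>. t - lam < p \<Longrightarrow> \<epsilon> > 0 \<Longrightarrow> \<exists>u. p - \<epsilon> < u \<and> u < p \<and> u \<notin> Z"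
    by (rule maximal_left_interval[OF Zc tZ less_imp_le[OF lam_pos]]) (rule that)
  have pqZ: "u \<in> Z" if "p \<le> u" "u \<le> q" for u
  proof (cases "u \<le> t")
    case True then show ?thesis using p(3) that by auto
  next
    case False then show ?thesis using q(3) that by auto
  qed
  have short: "q - p < lam"
  proof (rule ccontr)
    assume "\<not> q - p < lam"
    then have "covered t" by (intro covered_by_contact[OF w, of "q - lam"]) (use pqZ q in \<open>auto simp: Z_def\<close>)
    then show False using nc by simp
  qed
  have q': "q < t + lam" and p': "t - lam < p" using short p(1) q(1) by linarith+
  have loc: "\<exists>u. p \<le> u \<and> u \<le> q \<and> s u = s t2" if t2: "t \<le> t2" "t2 \<le> t + l" "s t2 \<bullet> w = 1" for t2
  proof -
    consider "t2 = t" | "t2 = t + l" | "t < t2" "t2 < t + l" using t2 by linarith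
    then show ?thesis
    proof cases
      case 1 then show ?thesis using p q by (intro exI[of _ t]) auto
    next
      case 2 then show ?thesis using p q periodic by (intro exI[of _ t]) auto
    next
      case 3
      have "s t + s t2 \<noteq> w" using no[of t2] by (metis add_diff_cancel_left')
      from contact_connected[OF w 3 t t2(3) this] show ?thesis
      proof
        assume all: "\<forall>u\<in>{t..t2}. s u \<bullet> w = 1"
        have "t2 \<le> q"
        proof (rule ccontr)
          assume "\<not> t2 \<le> q"
          then obtain u where "q < u" "u < q + (t2 - q)" "u \<notin> Z" using q(4)[OF q', of "t2 - q"] by auto
          then show False using all q(1) by (auto simp: Z_def)
        qed
        then show ?thesis using 3 p by (intro exI[of _ t2]) auto
      next
        assume all: "\<forall>u\<in>{t2..t + l}. s u \<bullet> w = 1"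
        have "p \<le> t2 - l"
        proof (rule ccontr)
          assume "\<not> p \<le> t2 - l"
          then obtain u where u: "p - (p - (t2 - l)) < u" "u < p" "u \<notin> Z" using p(4)[OF p', of "p - (t2 - l)"] by auto
          then have "s (u + l) \<bullet> w = 1" using all p(1) by auto
          then show False using u by (simp add: Z_def periodic)
        qed
        then show ?thesis using 3 q periodic_minus by (intro exI[of _ "t2 - l"]) auto
      qed
    qed
  qed
  define m where "m = (p + q) / 2"
  have m: "p \<le> m" "m \<le> q" "m - p = (q - p) / 2" "q - m = (q - p) / 2" using p q by (auto simp: m_def field_simps)
  \<comment> \<open>Points from the midpoint of the arc to the centre of the circle; every point of
    an arc shorter than half a circle has negative inner product with it.\<close>
  define v where "v = (1/2) *\<^sub>R w - s m"
  have sm: "s m \<bullet> w = 1" "w \<bullet> s m = 1" using pqZ[OF m(1,2)] by (simp_all add: Z_def inner_commute)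
  have vw: "v \<bullet> w = 0" using ww sm by (simp add: v_def inner_diff_left)
  obtain t2 where t2: "t \<le> t2" "t2 \<le> t + l" "s t2 \<bullet> w = 1" "0 \<le> s t2 \<bullet> v"
    using contact_not_in_halfcircle[OF w vw] by blast
  obtain u where u: "p \<le> u" "u \<le> q" "s u = s t2" using loc[OF t2(1-3)] by blast
  have pq: "p \<le> q" using p q by simp
  define a where "a = s p - (1/2) *\<^sub>R w"
  obtain b where b: "b \<bullet> b = 1/2" "a \<bullet> b = 0" "b \<bullet> w = 0" "a \<bullet> a = 1/2"
    "\<And>t. p \<le> t \<Longrightarrow> t \<le> q \<Longrightarrow> s t = (1/2) *\<^sub>R w + cos ((t - p) / c) *\<^sub>R a + sin ((t - p) / c) *\<^sub>R b"
  proof (rule contact_rotation[OF w pq])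
    show "s t \<bullet> w = 1" if "p \<le> t" "t \<le> q" for t using pqZ[OF that] by (simp add: Z_def)
  qed (unfold a_def[symmetric], rule that)
  have v': "v = - (cos ((m - p) / c) *\<^sub>R a + sin ((m - p) / c) *\<^sub>R b)" unfolding v_def b(5)[OF m(1,2)] by simp
  have ba: "b \<bullet> a = 0" using b(2) by (simp add: inner_commute)
  have "s u \<bullet> v = (s u - (1/2) *\<^sub>R w) \<bullet> v" using vw by (simp add: inner_diff_left inner_commute[of w v])
  also have "s u - (1/2) *\<^sub>R w = cos ((u - p) / c) *\<^sub>R a + sin ((u - p) / c) *\<^sub>R b" using b(5)[OF u(1,2)] by simp
  also have "(cos ((u - p) / c) *\<^sub>R a + sin ((u - p) / c) *\<^sub>R b) \<bullet> v
      = - (1/2) * (cos ((u - p) / c) * cos ((m - p) / c) + sin ((u - p) / c) * sin ((m - p) / c))"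
  proof -
    have "(C *\<^sub>R a + S *\<^sub>R b) \<bullet> (- (C' *\<^sub>R a + S' *\<^sub>R b)) = - (C * C' * (a \<bullet> a) + S * S' * (b \<bullet> b))" for C S C' S'
      using b(2) ba by (simp add: inner_add algebra_simps)
    note bil = this
    show ?thesis unfolding v' bil b(1) b(4) by (simp add: algebra_simps)
  qed
  also have "\<dots> = - (1/2) * cos ((u - p) / c - (m - p) / c)" by (simp add: cos_diff)
  also have "(u - p) / c - (m - p) / c = (u - m) / c" by (simp add: diff_divide_distrib)
  finally have sv: "s u \<bullet> v = - (1/2) * cos ((u - m) / c)" .
  have "\<bar>u - m\<bar> \<le> (q - p) / 2" using u m by linarith
  then have "\<bar>u - m\<bar> < pi/2 * c" using short by (simp add: lam_def)
  then have "\<bar>(u - m) / c\<bar> < pi/2" using c by (simp add: pos_divide_less_eq)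
  then have "cos ((u - m) / c) > 0" by (intro cos_gt_zero_pi) linarith+
  then show False using sv t2(4) u(3) by simp
qed

lemma closed_arc_start: "closed {t. arc_start e t}"
proof -
  have eq: "{t. arc_start e t} = (\<Inter>\<tau>\<in>{0..lam}. {t. s (t + \<tau>) \<bullet> (s t + e *\<^sub>R n t) = 1})"
  proof (intro set_eqI iffI)
    fix t assume t: "t \<in> (\<Inter>\<tau>\<in>{0..lam}. {t. s (t + \<tau>) \<bullet> (s t + e *\<^sub>R n t) = 1})"
    show "t \<in> {t. arc_start e t}"
      unfolding mem_Collect_eq arc_start_def
    proof
      fix u assume "u \<in> {t..t + lam}"
      then have "u - t \<in> {0..lam}" by auto
      moreover have "\<forall>\<tau>\<in>{0..lam}. s (t + \<tau>) \<bullet> (s t + e *\<^sub>R n t) = 1" using t by simp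
      ultimately have "s (t + (u - t)) \<bullet> (s t + e *\<^sub>R n t) = 1" by (rule bspec[rotated])
      then show "s u \<bullet> (s t + e *\<^sub>R n t) = 1" by simp
    qed
  qed (auto simp: arc_start_def)
  have "closed {t. s (t + \<tau>) \<bullet> (s t + e *\<^sub>R n t) = 1}" for \<tau>
  proof (rule closed_Collect_eq)
    have "continuous_on UNIV (\<lambda>t. s (t + \<tau>))"
      by (rule continuous_on_compose2[OF cont[of UNIV]]) (auto intro!: continuous_intros)
    then show "continuous_on UNIV (\<lambda>t. s (t + \<tau>) \<bullet> (s t + e *\<^sub>R n t))"
      by (intro continuous_on_inner continuous_on_add continuous_on_scaleR continuous_on_const cont n_cont)
  qed simp
  then show ?thesis unfolding eq by (intro closed_INT) simp
qed

text \<open>For each sign the covered parameters are the sum of a closed set of starting times and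
  the compact interval \<open>{0..lam}\<close>.\<close>

lemma closed_covered: "closed {t. covered t}"
proof -
  define S where "S e = (\<Union>x\<in>{t. arc_start e t}. \<Union>y\<in>{0..lam}. {x + y})" for e
  have cl: "closed (S e)" for e
    unfolding S_def by (rule closed_compact_sums[OF closed_arc_start compact_Icc])
  have mem: "t \<in> S e \<longleftrightarrow> (\<exists>t'. t' \<le> t \<and> t \<le> t' + lam \<and> arc_start e t')" for t e
  proof
    assume "t \<in> S e"
    then obtain x y where "arc_start e x" "0 \<le> y" "y \<le> lam" "t = x + y" by (auto simp: S_def)
    then show "\<exists>t'. t' \<le> t \<and> t \<le> t' + lam \<and> arc_start e t'" by (intro exI[of _ x]) simp
  next
    assume "\<exists>t'. t' \<le> t \<and> t \<le> t' + lam \<and> arc_start e t'"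
    then obtain t' where t': "t' \<le> t" "t \<le> t' + lam" "arc_start e t'" by blast
    then have "t - t' \<in> {0..lam}" "t \<in> {t' + (t - t')}" by simp_all
    then show "t \<in> S e" unfolding S_def using t'(3) by blast
  qed
  have "{t. covered t} = S 1 \<union> S (-1)" by (auto simp: covered_def mem)
  then show ?thesis using closed_Un[OF cl cl] by simp
qed

text \<open>Two different touching caps with a common contact \<open>s u\<close> must be the two
  caps \<open>s u \<plusminus> n u\<close>, so their centres add up to
  \<open>2 *\<^sub>R s u\<close>. On an interval this would make \<open>s\<close> constant.\<close>

lemma contact_overlap:
  assumes w: "touching w" "touching w'" and pq: "p < q"
    and Z: "\<And>u. p \<le> u \<Longrightarrow> u \<le> q \<Longrightarrow> s u \<bullet> w = 1" "\<And>u. p \<le> u \<Longrightarrow> u \<le> q \<Longrightarrow> s u \<bullet> w' = 1"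
  shows "w = w'"
proof (rule ccontr)
  assume ne: "w \<noteq> w'"
  have sum: "w + w' = 2 *\<^sub>R s u" if u: "p \<le> u" "u \<le> q" for u
  proof -
    have "w = s u + 1 *\<^sub>R n u \<or> w = s u + (-1) *\<^sub>R n u" "w' = s u + 1 *\<^sub>R n u \<or> w' = s u + (-1) *\<^sub>R n u"
      using contact_frame(2)[OF w(1) Z(1)[OF u]] contact_frame(2)[OF w(2) Z(2)[OF u]] by blast+
    then show ?thesis using ne by (auto simp: scaleR_2)
  qed
  define r where "r = min q (p + 1)"
  have r: "p < r" "r \<le> q" "r - p \<le> 1" using pq by (auto simp: r_def)
  have "2 *\<^sub>R s p = 2 *\<^sub>R s r" using sum[of p] sum[of r] r by simp
  then have "s p = s r" by simp
  then have "p = r" by (rule inj) (use r l_gt_8 in auto)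
  then show False using r by simp
qed

lemma arc_start_periodic: "arc_start e (t + l) \<longleftrightarrow> arc_start e t"
proof -
  have n: "n (t + l) = n t" by (simp add: n_def periodic T_periodic)
  have "(\<forall>u\<in>{t + l..t + l + lam}. s u \<bullet> w = 1) \<longleftrightarrow> (\<forall>u\<in>{t..t + lam}. s u \<bullet> w = 1)" for w
  proof
    assume a: "\<forall>u\<in>{t + l..t + l + lam}. s u \<bullet> w = 1"
    show "\<forall>u\<in>{t..t + lam}. s u \<bullet> w = 1"
    proof
      fix u assume "u \<in> {t..t + lam}"
      then have "s (u + l) \<bullet> w = 1" using a by auto
      then show "s u \<bullet> w = 1" by (simp add: periodic)
    qed
  next
    assume a: "\<forall>u\<in>{t..t + lam}. s u \<bullet> w = 1"
    show "\<forall>u\<in>{t + l..t + l + lam}. s u \<bullet> w = 1"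
    proof
      fix u assume "u \<in> {t + l..t + l + lam}"
      then have "s (u - l) \<bullet> w = 1" using a by auto
      then show "s u \<bullet> w = 1" by (simp add: periodic_minus)
    qed
  qed
  then show ?thesis by (simp add: arc_start_def periodic n)
qed

end

context extremal_curve begin

text \<open>If the curve passes through the common value \<open>n t1 = n t2\<close> at \<tau>, it
  touches there the caps of both times. So \<open>T \<tau>\<close> is orthogonal to
  \<open>n t1\<close>, \<open>s t1\<close> and \<open>s t2\<close>, hence parallel to
  \<open>T t1\<close>, which forces \<open>s t2\<close> to be
  \<open>\<plusminus> s t1\<close>.\<close>

lemma frames_differ:
  assumes t: "t1 \<noteq> t2" "\<bar>t2 - t1\<bar> < 1" and \<tau>: "s \<tau> = n t1"
  shows "n t1 \<noteq> n t2"
proof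
  assume eq: "n t1 = n t2"
  have perp: "T \<tau> \<bullet> s t = 0" if "s \<tau> = n t" for t
  proof -
    have w: "touching (s t + 1 *\<^sub>R n t)" by (rule touching_frame) simp
    have "s \<tau> \<bullet> (s t + 1 *\<^sub>R n t) = 1" unfolding that by (simp add: inner_add_right)
    then have "T \<tau> \<bullet> (s t + 1 *\<^sub>R n t) = 0" by (rule contact_frame(1)[OF w])
    moreover have "T \<tau> \<bullet> n t = 0" using T_s[of \<tau>] unfolding that .
    ultimately show ?thesis by (simp add: inner_add_right)
  qed
  have p: "T \<tau> \<bullet> s t1 = 0" "T \<tau> \<bullet> s t2 = 0" using perp \<tau> eq by auto
  have "T \<tau> \<bullet> n t1 = 0" using T_s[of \<tau>] unfolding \<tau> .
  then have Tt: "T \<tau> = (T \<tau> \<bullet> T t1) *\<^sub>R T t1" using frame(2)[of "T \<tau>" t1] p by simp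
  then have "T \<tau> \<bullet> T t1 \<noteq> 0" by (metis T_T inner_zero_left scaleR_zero_left zero_neq_one)
  then have xT: "s t2 \<bullet> T t1 = 0" using p(2) Tt by (metis inner_commute inner_scaleR_left mult_eq_0_iff)
  have xn: "s t2 \<bullet> n t1 = 0" unfolding eq by simp
  define r where "r = s t2 \<bullet> s t1"
  have "r\<^sup>2 = 1" using frame(1)[of "s t2" t1] xT xn by (simp add: r_def)
  moreover have "r > 0"
  proof -
    have "(norm (s t2 - s t1))\<^sup>2 = 2 - 2 * r" by (simp add: r_def power2_norm_eq_inner inner_diff inner_commute)
    moreover have "norm (s t2 - s t1) \<le> 1" using lip[of t2 t1] t by linarith
    then have "(norm (s t2 - s t1))\<^sup>2 \<le> 1" by (simp add: power_le_one)
    ultimately show ?thesis by linarith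
  qed
  ultimately have "r = 1" by (simp add: power2_eq_1_iff)
  then have "s t2 = s t1" using frame(2)[of "s t2" t1] xT xn by (simp add: r_def)
  then have "t2 = t1" by (rule inj) (use t l_gt_8 in linarith)
  then show False using t by simp
qed

text \<open>Where both touching caps have their second contact point opposite to \<open>s t\<close>, the curve also runs through
  \<open>\<plusminus> n\<close>. The touching conditions at two such parameters then force the increments of \<open>s\<close> and \<open>n\<close> to agree up
  to sign and second order, so one of \<open>s \<plusminus> n\<close> is constant.\<close>

lemma all_covered: "covered t0"
proof (rule ccontr)
  assume nc0: "\<not> covered t0"
  have "open (- {t. covered t})" using closed_covered by (rule open_Compl)
  then obtain \<delta>1 where \<delta>1: "\<delta>1 > 0" "\<And>t. dist t t0 < \<delta>1 \<Longrightarrow> \<not> covered t"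
    using nc0 unfolding open_dist by auto
  define \<delta> where "\<delta> = min \<delta>1 (1/40)"
  have \<delta>: "0 < \<delta>" "\<delta> \<le> \<delta>1" "\<delta> \<le> 1/40" using \<delta>1 by (auto simp: \<delta>_def)
  define J where "J = {t0 - \<delta><..<t0 + \<delta>}"
  have Jnc: "\<not> covered t" if "t \<in> J" for t
  proof -
    have "\<bar>t - t0\<bar> < \<delta>1" using that \<delta>(2) unfolding J_def greaterThanLessThan_iff by linarith
    then show ?thesis using \<delta>1(2)[of t] by (simp add: dist_real_def)
  qed
  \<comment> \<open>Near an uncovered time every time is uncovered, so both caps have their contact
    opposite to \<open>s t\<close>, and that point is \<open>\<plusminus> n t\<close>.\<close>
  have opp: "\<exists>\<tau>. s \<tau> = e *\<^sub>R n t" if "t \<in> J" "e = 1 \<or> e = -1" for t e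
  proof -
    have "s t \<bullet> (s t + e *\<^sub>R n t) = 1" by (simp add: inner_add_right)
    from covered_or_opposite[OF touching_frame[OF that(2)] this] Jnc[OF that(1)]
    show ?thesis by auto
  qed
  \<comment> \<open>The points \<open>\<plusminus> n t2\<close> lie on the curve and so outside both
    open caps at \<open>t1\<close>: four inequalities in all.\<close>
  have cr: "\<bar>n t2 \<bullet> s t1\<bar> + \<bar>n t2 \<bullet> n t1\<bar> \<le> 1" if "t2 \<in> J" for t1 t2
  proof -
    have "e2 * (n t2 \<bullet> s t1) + e2 * (e1 * (n t2 \<bullet> n t1)) \<le> 1" if e: "e1 = 1 \<or> e1 = -1" "e2 = 1 \<or> e2 = -1" for e1 e2
    proof -
      obtain \<tau> where "s \<tau> = e2 *\<^sub>R n t2" using opp[OF \<open>t2 \<in> J\<close> e(2)] by blast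
      then have "(e2 *\<^sub>R n t2) \<bullet> (s t1 + e1 *\<^sub>R n t1) \<le> 1" using touching_frame[OF e(1), of t1] unfolding touching_def by metis
      then show ?thesis by (simp add: inner_add_right algebra_simps)
    qed
    from this[of 1 1] this[of 1 "-1"] this[of "-1" 1] this[of "-1" "-1"] show ?thesis by (simp add: abs_if)
  qed
  define P where "P t1 t2 = (s t2 - s t1) \<bullet> (n t2 - n t1)" for t1 t2
  have Psym: "P t2 t1 = P t1 t2" for t1 t2 by (simp add: P_def inner_diff algebra_simps)
  have est: "P t1 t2 \<noteq> 0 \<and> (norm (s t2 - s t1))\<^sup>2 + (norm (n t2 - n t1))\<^sup>2 - 2 * \<bar>P t1 t2\<bar> \<le> 200 * (t2 - t1)^4"
    if t: "t1 \<in> J" "t2 \<in> J" "t1 \<noteq> t2" for t1 t2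
  proof -
    define h where "h = \<bar>t2 - t1\<bar>"
    have h: "h < 1/20" "h > 0"
    proof -
      have b: "t0 - \<delta> < t1" "t1 < t0 + \<delta>" "t0 - \<delta> < t2" "t2 < t0 + \<delta>" using t by (auto simp: J_def)
      show "h < 1/20" using b \<delta>(3) unfolding h_def by linarith
      show "h > 0" using t(3) by (simp add: h_def)
    qed
    define a where "a = norm (s t2 - s t1)"
    define b where "b = norm (n t2 - n t1)"
    have ah: "a \<le> h" unfolding a_def h_def by (rule lip)
    have bh: "b \<le> 3 * h" unfolding b_def h_def by (rule n_lipschitz) (use h in \<open>simp add: h_def\<close>)
    have a0: "a > 0" using chord_frame(1)[of t1 t2] t(3) h by (auto simp: a_def h_def)
    obtain \<tau> where "s \<tau> = 1 *\<^sub>R n t1" using opp[OF t(1), of 1] by auto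
    then have b0: "b > 0" using frames_differ[OF t(3), of \<tau>] h by (auto simp: b_def h_def)
    have a2: "a\<^sup>2 = 2 * (1 - s t2 \<bullet> s t1)" by (simp add: a_def power2_norm_eq_inner inner_diff inner_commute)
    have b2: "b\<^sup>2 = 2 * (1 - n t2 \<bullet> n t1)" by (simp add: b_def power2_norm_eq_inner inner_diff inner_commute)
    define \<alpha> where "\<alpha> = s t2 \<bullet> n t1"
    define \<beta> where "\<beta> = n t2 \<bullet> s t1"
    define A where "A = (s t2 - s t1) \<bullet> T t1"
    define B where "B = (n t2 - n t1) \<bullet> T t1"
    have c1: "(s t2 - s t1) \<bullet> s t1 = - (a\<^sup>2/2)" "(s t2 - s t1) \<bullet> n t1 = \<alpha>" unfolding a2 by (simp_all add: \<alpha>_def inner_diff_left diff_divide_distrib)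
    have c2: "(n t2 - n t1) \<bullet> s t1 = \<beta>" "(n t2 - n t1) \<bullet> n t1 = - (b\<^sup>2/2)" unfolding b2 by (simp_all add: \<beta>_def inner_diff_left diff_divide_distrib)
    have al: "\<bar>\<alpha>\<bar> \<le> a\<^sup>2/2" using chord_frame(4)[of t1 t2] t(3) h unfolding a2 \<alpha>_def h_def by (simp add: diff_divide_distrib)
    have al': "\<bar>\<beta>\<bar> \<le> a\<^sup>2/2"
      using chord_frame(4)[of t2 t1] t(3) h unfolding a2 \<beta>_def h_def by (simp add: inner_commute abs_minus_commute)
    have be: "\<bar>\<beta>\<bar> \<le> b\<^sup>2/2" using cr[OF t(2), of t1] unfolding b2 \<beta>_def by (simp add: abs_if split: if_splits)
    have be': "\<bar>\<alpha>\<bar> \<le> b\<^sup>2/2" using cr[OF t(1), of t2] unfolding b2 \<alpha>_def by (simp add: inner_commute abs_if split: if_splits)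
    have Pe: "P t1 t2 = - \<alpha> - \<beta>" by (simp add: P_def \<alpha>_def \<beta>_def inner_diff inner_commute)
    have Pf: "P t1 t2 = - (a\<^sup>2/2) * \<beta> + A * B - \<alpha> * (b\<^sup>2/2)"
    proof -
      have "P t1 t2 = (s t2 - s t1) \<bullet> (((n t2 - n t1) \<bullet> s t1) *\<^sub>R s t1 + ((n t2 - n t1) \<bullet> T t1) *\<^sub>R T t1 + ((n t2 - n t1) \<bullet> n t1) *\<^sub>R n t1)"
        unfolding P_def using frame(2)[of "n t2 - n t1" t1] by simp
      also have "\<dots> = \<beta> * (- (a\<^sup>2/2)) + B * A + (- (b\<^sup>2/2)) * \<alpha>"
        unfolding inner_add_right inner_scaleR_right c1 c2 A_def B_def ..
      finally show ?thesis by (simp add: algebra_simps)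
    qed
    have Aq: "a\<^sup>2 = (a\<^sup>2/2)\<^sup>2 + A\<^sup>2 + \<alpha>\<^sup>2"
    proof -
      have "a\<^sup>2 = (- (a\<^sup>2/2))\<^sup>2 + A\<^sup>2 + \<alpha>\<^sup>2"
        using frame(1)[of "s t2 - s t1" t1] unfolding c1 A_def[symmetric] by (simp add: a_def power2_norm_eq_inner)
      then show ?thesis by simp
    qed
    have Bq: "b\<^sup>2 = \<beta>\<^sup>2 + B\<^sup>2 + (b\<^sup>2/2)\<^sup>2"
    proof -
      have "b\<^sup>2 = \<beta>\<^sup>2 + B\<^sup>2 + (- (b\<^sup>2/2))\<^sup>2"
        using frame(1)[of "n t2 - n t1" t1] unfolding c2 B_def[symmetric] by (simp add: b_def power2_norm_eq_inner)
      then show ?thesis by simp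
    qed
    have aa: "a\<^sup>2 \<le> h\<^sup>2" using ah a0 by (intro power_mono) auto
    have "b\<^sup>2 \<le> (3 * h)\<^sup>2" using bh b0 by (intro power_mono) auto
    then have ab: "a\<^sup>2 + b\<^sup>2 \<le> 10 * h\<^sup>2" using aa by (simp add: power_mult_distrib)
    have "h\<^sup>2 \<le> (1/20)\<^sup>2" using h by (intro power_mono) auto
    then have "h\<^sup>2 \<le> 1/400" by (simp add: power_divide)
    then have small: "a\<^sup>2 + b\<^sup>2 \<le> 1/2" using ab by linarith
    have Pa: "\<bar>P t1 t2\<bar> \<le> a\<^sup>2" "\<bar>P t1 t2\<bar> \<le> b\<^sup>2" unfolding Pe using al al' be be' by linarith+
    note fe = frame_pair_estimate[OF a0 b0 Pf al be Aq Bq Pa small]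
    have "(a\<^sup>2 + b\<^sup>2)\<^sup>2 \<le> (10 * h\<^sup>2)\<^sup>2" using ab by (intro power_mono) auto
    also have "\<dots> = 100 * (t2 - t1)^4" by (simp add: h_def power_mult_distrib)
    finally show ?thesis using fe unfolding a_def b_def by linarith
  qed
  have Pcont: "continuous_on S (\<lambda>\<theta>. P (f \<theta>) (g \<theta>))" if "continuous_on S f" "continuous_on S g" for S and f g :: "real \<Rightarrow> real"
    unfolding P_def using that
    by (intro continuous_intros continuous_on_compose2[OF cont[of UNIV]] continuous_on_compose2[OF n_cont[of UNIV]]) auto
  define cc where "cc = sgn (P t0 (t0 + \<delta>/2))"
  have ref: "t0 \<in> J" "t0 + \<delta>/2 \<in> J" using \<delta> by (auto simp: J_def)
  have cc: "cc = 1 \<or> cc = -1" using est[OF ref] \<delta> by (auto simp: cc_def sgn_if)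
  have sg: "\<bar>P t1 t2\<bar> = cc * P t1 t2" if t: "t1 \<in> J" "t2 \<in> J" "t1 < t2" for t1 t2
  proof (rule ccontr)
    assume ne: "\<bar>P t1 t2\<bar> \<noteq> cc * P t1 t2"
    \<comment> \<open>The pairs of increasing times form a convex set, so the nonvanishing
      \<open>P\<close> has one sign along the segment that joins two of them.\<close>
    define f where "f \<theta> = (1 - \<theta>) * t0 + \<theta> * t1" for \<theta>
    define g where "g \<theta> = (1 - \<theta>) * (t0 + \<delta>/2) + \<theta> * t2" for \<theta>
    define q where "q \<theta> = P (f \<theta>) (g \<theta>)" for \<theta>
    have qc: "continuous_on {0..1} q" unfolding q_def f_def g_def by (intro Pcont continuous_intros)
    have q01: "q 0 = P t0 (t0 + \<delta>/2)" "q 1 = P t1 t2" by (simp_all add: q_def f_def g_def)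
    have J_conv: "convex J" by (simp add: J_def)
    have q_ne: "q \<theta> \<noteq> 0" if "0 \<le> \<theta>" "\<theta> \<le> 1" for \<theta>
    proof -
      have fg: "f \<theta> \<in> J" "g \<theta> \<in> J" unfolding f_def g_def
        using convexD_alt[OF J_conv ref(1) t(1) that] convexD_alt[OF J_conv ref(2) t(2) that] by simp_all
      have lt: "f \<theta> < g \<theta>"
      proof (cases "\<theta> = 1")
        case True then show ?thesis using t by (simp add: f_def g_def)
      next
        case False
        then have "(1 - \<theta>) * t0 < (1 - \<theta>) * (t0 + \<delta>/2)" using that \<delta> by (intro mult_strict_left_mono) auto
        moreover have "\<theta> * t1 \<le> \<theta> * t2" using that t by (intro mult_left_mono) auto
        ultimately show ?thesis unfolding f_def g_def by linarith
      qed
      show ?thesis unfolding q_def by (rule conjunct1[OF est[OF fg]]) (use lt in simp)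
    qed
    have "q 0 \<noteq> 0" by (rule q_ne) simp_all
    have c: "\<bar>q 1\<bar> \<noteq> sgn (q 0) * q 1" using ne unfolding q01 cc_def .
    have "q 0 < 0 \<and> 0 < q 1 \<or> 0 < q 0 \<and> q 1 < 0"
    proof (cases "q 0 < 0")
      case True
      then have "\<bar>q 1\<bar> \<noteq> - q 1" using c by simp
      then have "0 < q 1" by linarith
      then show ?thesis using True by blast
    next
      case False
      then have p: "0 < q 0" using \<open>q 0 \<noteq> 0\<close> by linarith
      then have "\<bar>q 1\<bar> \<noteq> q 1" using c by simp
      then have "q 1 < 0" by linarith
      then show ?thesis using p by blast
    qed
    then consider "q 0 < 0" "0 < q 1" | "0 < q 0" "q 1 < 0" by blast
    then show False
    proof cases
      case 1
      then have "\<exists>x\<ge>0. x \<le> 1 \<and> q x = 0" by (intro IVT'[OF _ _ _ qc]) simp_all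
      then show False using q_ne by blast
    next
      case 2
      then have "\<exists>x\<ge>0. x \<le> 1 \<and> q x = 0" by (intro IVT2'[OF _ _ _ qc]) simp_all
      then show False using q_ne by blast
    qed
  qed
  define g where "g t = n t - cc *\<^sub>R s t" for t
  have gq: "norm (g t2 - g t1) \<le> 15 * (t2 - t1)\<^sup>2" if t: "t1 \<in> J" "t2 \<in> J" "t1 < t2" for t1 t2
  proof (rule power2_le_imp_le)
    have "g t2 - g t1 = (n t2 - n t1) - cc *\<^sub>R (s t2 - s t1)" by (simp add: g_def algebra_simps)
    then have "(norm (g t2 - g t1))\<^sup>2 = (norm (n t2 - n t1))\<^sup>2 - 2 * (cc * P t1 t2) + cc * cc * (norm (s t2 - s t1))\<^sup>2"
      unfolding power2_norm_eq_inner P_def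
      by (simp only: inner_diff_left[of "n t2 - n t1"] inner_diff_right[of _ "n t2 - n t1"] inner_scaleR_left inner_scaleR_right
          inner_commute[of "s t2 - s t1" "n t2 - n t1"]) (simp add: algebra_simps)
    also have "cc * cc = 1" using cc by auto
    finally have "(norm (g t2 - g t1))\<^sup>2 \<le> 200 * (t2 - t1)^4" using est[OF t(1,2)] sg[OF t] t(3) by auto
    also have "\<dots> \<le> 225 * (t2 - t1)^4" by (intro mult_right_mono) auto
    also have "\<dots> = (15 * (t2 - t1)\<^sup>2)\<^sup>2" by (simp add: power_mult_distrib)
    finally show "(norm (g t2 - g t1))\<^sup>2 \<le> (15 * (t2 - t1)\<^sup>2)\<^sup>2" .
  qed simp
  have gq': "norm (g u - g v) \<le> 15 * (u - v)\<^sup>2" if "u \<in> {t0 - \<delta><..<t0 + \<delta>}" "v \<in> {t0 - \<delta><..<t0 + \<delta>}" for u v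
    using that gq[of u v] gq[of v u] unfolding J_def
    by (cases u v rule: linorder_cases) (auto simp: norm_minus_commute power2_commute)
  have gconst: "g t = g t0" if "t \<in> J" for t
    by (rule constant_of_quadratic[OF gq']) (use that ref in \<open>auto simp: J_def\<close>)
  \<comment> \<open>With this sign \<open>s t + e *\<^sub>R n t\<close> is a multiple of the
    constant \<open>g\<close>, so one cap touches throughout \<open>J\<close>.\<close>
  define e where "e = - cc"
  have e: "e = 1 \<or> e = -1" using cc by (auto simp: e_def)
  define w where "w = s t0 + e *\<^sub>R n t0"
  have w: "touching w" unfolding w_def using e by (rule touching_frame)
  have wJ: "s t \<bullet> w = 1" if "t \<in> J" for t
  proof -
    have eg: "s x + e *\<^sub>R n x = e *\<^sub>R g x" for x
      using cc by (auto simp: e_def g_def algebra_simps)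
    have "s t + e *\<^sub>R n t = e *\<^sub>R g t" by (rule eg)
    also have "\<dots> = e *\<^sub>R g t0" using gconst[OF that] by simp
    also have "\<dots> = w" unfolding w_def eg ..
    finally have "w = s t + e *\<^sub>R n t" by simp
    then show ?thesis by (simp add: inner_add_right)
  qed
  obtain \<tau> where \<tau>: "s \<tau> = e *\<^sub>R n t0" using opp[OF ref(1) e] by blast
  \<comment> \<open>The second contact is opposite to \<open>s t0\<close>, where
    \<open>contact_connected\<close> is silent. Starting from the nearby contact \<open>t3\<close>
    it applies, and either time arc yields half a circle of contact through
    \<open>t0\<close>.\<close>
  define t3 where "t3 = t0 + \<delta>/2"
  have t3: "t0 < t3" "t3 < t0 + \<delta>" "t3 < t0 + 1" "t3 \<in> J" using \<delta> ref by (auto simp: t3_def)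
  obtain k :: int where k: "t3 \<le> \<tau> + of_int k * l" "\<tau> + of_int k * l < t3 + l" by (rule shift_to_window)
  define t2 where "t2 = \<tau> + of_int k * l"
  have st2: "s t2 = e *\<^sub>R n t0" using \<tau> periodic_int by (simp add: t2_def)
  have nn: "s t2 \<noteq> s t" if "t0 \<le> t" "t \<le> t3" for t
  proof
    assume "s t2 = s t"
    then have "s t = e *\<^sub>R n t0" using st2 by metis
    then have "s t \<bullet> s t0 = 0" by simp
    then have "(norm (s t - s t0))\<^sup>2 = 2" by (simp add: power2_norm_eq_inner inner_diff inner_commute)
    moreover have "norm (s t - s t0) \<le> 1" using lip[of t t0] that t3 by linarith
    then have "(norm (s t - s t0))\<^sup>2 \<le> 1" by (simp add: power_le_one)
    ultimately show False by simp
  qed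
  have "t2 \<noteq> t3" using nn[of t3] t3 by auto
  then have t23: "t3 < t2" "t2 < t3 + l" using k by (auto simp: t2_def)
  have t2l: "t2 < t0 + l"
  proof (rule ccontr)
    assume "\<not> t2 < t0 + l"
    then have "s t2 \<noteq> s (t2 - l)" using t23 by (intro nn) auto
    then show False by (simp add: periodic_minus)
  qed
  have st2w: "s t2 \<bullet> w = 1" using st2 e by (auto simp: w_def inner_add_right)
  have sum0: "s t0 + s t2 = w" by (simp add: st2 w_def)
  have ne3: "s t3 + s t2 \<noteq> w"
  proof
    assume "s t3 + s t2 = w"
    then have "s t3 = s t0" using sum0 by (metis add_right_imp_eq)
    then have "t3 = t0" by (rule inj) (use t3 l_gt_8 in auto)
    then show False using t3 by simp
  qed
  have near: "s u \<bullet> w = 1" if "t0 \<le> u" "u \<le> t3" for u using wJ[of u] that t3 \<delta> by (auto simp: J_def)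
  from contact_connected[OF w t23 wJ[OF t3(4)] st2w ne3] show False
  proof
    assume all: "\<forall>t\<in>{t3..t2}. s t \<bullet> w = 1"
    have Z: "s u \<bullet> w = 1" if "t0 \<le> u" "u \<le> t2" for u using all near that by (cases "u \<le> t3") auto
    have "lam \<le> t2 - t0" by (rule half_turn[OF w _ Z sum0]) (use t23 t3 in auto)
    then have "covered t0" by (intro covered_by_contact[OF w, of t0]) (use Z lam_pos in auto)
    then show False using nc0 by simp
  next
    assume all: "\<forall>t\<in>{t2..t3 + l}. s t \<bullet> w = 1"
    have Z: "s u \<bullet> w = 1" if "t2 \<le> u" "u \<le> t0 + l" for u using all that t3 by auto
    have "s t2 + s (t0 + l) = w" using sum0 unfolding periodic[of t0] by (simp only: add.commute[of "s t2"])
    then have "lam \<le> t0 + l - t2" using t2l by (intro half_turn[OF w _ Z]) auto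
    then have "s u \<bullet> w = 1" if "t0 - lam \<le> u" "u \<le> t0" for u
      using Z[of "u + l"] that by (simp add: periodic)
    then have "covered t0" by (intro covered_by_contact[OF w, of "t0 - lam"]) (use lam_pos in auto)
    then show False using nc0 by simp
  qed
qed

text \<open>Immediately after a maximal contact arc the curve is covered by other contact arcs, which cannot overlap it
  and therefore start at its end; the touching cap has to lie on the other side there.\<close>

lemma next_arc:
  assumes e: "e = 1 \<or> e = -1" and a: "arc_start e t"
  obtains q where "t + lam \<le> q" "q < t + 2 * lam" "\<And>u. t \<le> u \<Longrightarrow> u \<le> q \<Longrightarrow> s u \<bullet> (s t + e *\<^sub>R n t) = 1" "arc_start (- e) q"
proof -
  define w where "w = s t + e *\<^sub>R n t"
  have w: "touching w" unfolding w_def using e by (rule touching_frame)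
  define Z where "Z = {t. s t \<bullet> w = 1}"
  have Zc: "closed Z" unfolding Z_def by (rule closed_contact)
  have aZ: "u \<in> Z" if "t \<le> u" "u \<le> t + lam" for u using a that by (auto simp: arc_start_def Z_def w_def)
  have tZ: "t \<in> Z" using aZ lam_pos by simp
  obtain q where q: "t \<le> q" "q \<le> t + 2 * lam" "{t..q} \<subseteq> Z" "\<And>\<epsilon>. q < t + 2 * lam \<Longrightarrow> \<epsilon> > 0 \<Longrightarrow> \<exists>u. q < u \<and> u < q + \<epsilon> \<and> u \<notin> Z"
  proof (rule maximal_right_interval[OF Zc tZ, of "2 * lam"])
    show "0 \<le> 2 * lam" using lam_pos by simp
  qed (rule that)
  have "q \<noteq> t + 2 * lam"
  proof
    assume qe: "q = t + 2 * lam"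
    have "s u \<bullet> w = 1" if "t \<le> u" "u \<le> t + 2 * lam" for u
    proof -
      have "u \<in> {t..q}" using that qe by simp
      then show ?thesis using q(3) unfolding Z_def by blast
    qed
    then show False by (rule full_turn_False[OF w, of t])
  qed
  then have q2: "q < t + 2 * lam" using q(2) by simp
  have q1: "t + lam \<le> q"
  proof (rule ccontr)
    assume "\<not> t + lam \<le> q"
    then obtain u where "q < u" "u < q + (t + lam - q)" "u \<notin> Z" using q(4)[OF q2, of "t + lam - q"] by auto
    then show False using aZ[of u] q(1) by auto
  qed
  have qZ: "s u \<bullet> w = 1" if "t \<le> u" "u \<le> q" for u using q(3) that by (auto simp: Z_def)
  have start: "\<exists>p e'. q \<le> p \<and> p < q + \<epsilon> \<and> (e' = 1 \<or> e' = -1) \<and> arc_start e' p" if \<epsilon>: "\<epsilon> > 0" for \<epsilon>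
  proof -
    obtain u where u: "q < u" "u < q + \<epsilon>" "u \<notin> Z" using q(4)[OF q2 \<epsilon>] by blast
    obtain e' p where p: "e' = 1 \<or> e' = -1" "p \<le> u" "u \<le> p + lam" "arc_start e' p"
      using all_covered[of u] unfolding covered_def by blast
    have "q \<le> p"
    proof (rule ccontr)
      assume "\<not> q \<le> p"
      define w' where "w' = s p + e' *\<^sub>R n p"
      have w': "touching w'" unfolding w'_def using p(1) by (rule touching_frame)
      have pZ: "s v \<bullet> w' = 1" if "p \<le> v" "v \<le> p + lam" for v using p(4) that by (auto simp: arc_start_def w'_def)
      \<comment> \<open>An arc that began before \<open>q\<close> would overlap the old one, hence
        belong to the same cap and contain \<open>u\<close> in its contact set.\<close>
      have "w = w'"
        by (rule contact_overlap[OF w w', of "max p t" q]) (use \<open>\<not> q \<le> p\<close> q1 lam_pos qZ pZ u p in auto)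
      then have "u \<in> Z" using pZ[OF p(2,3)] unfolding Z_def by blast
      then show False using u(3) by blast
    qed
    moreover have "p < q + \<epsilon>" using p(2) u(2) by linarith
    ultimately show ?thesis using p(1,4) by blast
  qed
  have near: "arc_start e' q" if ex: "\<And>\<epsilon>. \<epsilon> > 0 \<Longrightarrow> \<exists>p. q \<le> p \<and> p < q + \<epsilon> \<and> arc_start e' p" for e'
  proof -
    have "q \<in> closure {t. arc_start e' t}"
      unfolding closure_approachable
    proof (intro allI impI)
      fix \<epsilon> :: real assume "\<epsilon> > 0"
      then obtain p where "q \<le> p" "p < q + \<epsilon>" "arc_start e' p" using ex[of \<epsilon>] by blast
      then show "\<exists>y\<in>{t. arc_start e' t}. dist y q < \<epsilon>" by (intro bexI[of _ p]) (auto simp: dist_real_def)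
    qed
    then show ?thesis using closed_arc_start[of e'] by (simp add: closure_closed)
  qed
  \<comment> \<open>Arcs start arbitrarily close to \<open>q\<close>; one of the two signs recurs,
    and its starting times form a closed set.\<close>
  have "arc_start e q \<or> arc_start (- e) q"
  proof (rule ccontr)
    assume "\<not> ?thesis"
    then have n: "\<not> arc_start e q" "\<not> arc_start (- e) q" by blast+
    obtain \<epsilon>1 where e1: "\<epsilon>1 > 0" "\<not> (\<exists>p. q \<le> p \<and> p < q + \<epsilon>1 \<and> arc_start e p)" using near[of e] n(1) by blast
    obtain \<epsilon>2 where e2: "\<epsilon>2 > 0" "\<not> (\<exists>p. q \<le> p \<and> p < q + \<epsilon>2 \<and> arc_start (- e) p)" using near[of "- e"] n(2) by blast
    have \<epsilon>: "\<epsilon>1 > 0" "\<epsilon>2 > 0" "\<And>p. q \<le> p \<Longrightarrow> p < q + \<epsilon>1 \<Longrightarrow> \<not> arc_start e p"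
      "\<And>p. q \<le> p \<Longrightarrow> p < q + \<epsilon>2 \<Longrightarrow> \<not> arc_start (- e) p"
      using e1 e2 by blast+
    obtain p e' where p: "q \<le> p" "p < q + min \<epsilon>1 \<epsilon>2" "e' = 1 \<or> e' = -1" "arc_start e' p"
      using start[of "min \<epsilon>1 \<epsilon>2"] \<epsilon>(1,2) unfolding min_less_iff_conj by blast
    have "e' = e \<or> e' = - e" using p(3) e by auto
    moreover have "p < q + \<epsilon>1" "p < q + \<epsilon>2" using p(2) by linarith+
    ultimately show False using p(4) \<epsilon>(3)[OF p(1)] \<epsilon>(4)[OF p(1)] by blast
  qed
  moreover have "\<not> arc_start e q"
  proof
    assume aq: "arc_start e q"
    \<comment> \<open>The same sign at \<open>q\<close> would mean the same cap, and the contact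
      would continue beyond its maximal interval.\<close>
    have "w \<bullet> n q = w \<bullet> n t" by (rule contact_sign[OF w q(1) qZ]) (use q in auto)
    also have "w \<bullet> n t = e" by (simp add: w_def inner_add_left)
    finally have "w = s q + e *\<^sub>R n q" using contact_frame(4)[OF w qZ[of q]] q by simp
    then have wq: "s u \<bullet> w = 1" if "q \<le> u" "u \<le> q + lam" for u using aq that by (auto simp: arc_start_def)
    obtain u where "q < u" "u < q + lam" "u \<notin> Z" using q(4)[OF q2 lam_pos] by blast
    then show False using wq[of u] by (simp add: Z_def)
  qed
  ultimately have "arc_start (- e) q" by blast
  then show ?thesis using that[of q] q1 q2 qZ unfolding w_def by blast
qed

text \<open>Each maximal arc lasts at least \<open>lam\<close> and less than \<open>2 * lam\<close>,
  and the signs alternate. Following them from \<open>t1\<close>, where one cap is exchanged for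
  another, the exchange must recur after one period \<open>4 * lam\<close>; this leaves room for
  exactly four arcs of minimal duration.\<close>

lemma four_arcs:
  obtains t e where "e = 1 \<or> e = -1" "arc_start e t" "arc_start (- e) (t + lam)" "arc_start e (t + 2 * lam)" "arc_start (- e) (t + 3 * lam)"
proof -
  obtain e0 t0 where e0: "e0 = 1 \<or> e0 = -1" "arc_start e0 t0" using all_covered[of 0] unfolding covered_def by blast
  define e where "e = - e0"
  have e: "e = 1 \<or> e = -1" "- e = 1 \<or> - e = -1" using e0 by (auto simp: e_def)
  define w0 where "w0 = s t0 + e0 *\<^sub>R n t0"
  have w0: "touching w0" unfolding w0_def using e0(1) by (rule touching_frame)
  obtain t1 where t1: "t0 + lam \<le> t1" "\<And>u. t0 \<le> u \<Longrightarrow> u \<le> t1 \<Longrightarrow> s u \<bullet> w0 = 1" "arc_start e t1"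
    using next_arc[OF e0] unfolding w0_def e_def by metis
  define W where "W e t = s t + e *\<^sub>R n t" for e t
  have W: "touching (W e' t)" if "e' = 1 \<or> e' = -1" for e' t unfolding W_def using that by (rule touching_frame)
  obtain t2 where t2: "t1 + lam \<le> t2" "t2 < t1 + 2 * lam" "\<And>u. t1 \<le> u \<Longrightarrow> u \<le> t2 \<Longrightarrow> s u \<bullet> W e t1 = 1" "arc_start (- e) t2"
    using next_arc[OF e(1) t1(3)] unfolding W_def by metis
  obtain t3 where t3: "t2 + lam \<le> t3" "t3 < t2 + 2 * lam" "\<And>u. t2 \<le> u \<Longrightarrow> u \<le> t3 \<Longrightarrow> s u \<bullet> W (- e) t2 = 1" "arc_start e t3"
    using next_arc[OF e(2) t2(4)] unfolding W_def minus_minus by metis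
  obtain t4 where t4: "t3 + lam \<le> t4" "t4 < t3 + 2 * lam" "\<And>u. t3 \<le> u \<Longrightarrow> u \<le> t4 \<Longrightarrow> s u \<bullet> W e t3 = 1" "arc_start (- e) t4"
    using next_arc[OF e(1) t3(4)] unfolding W_def by metis
  obtain t5 where t5: "t4 + lam \<le> t5" "t5 < t4 + 2 * lam" "\<And>u. t4 \<le> u \<Longrightarrow> u \<le> t5 \<Longrightarrow> s u \<bullet> W (- e) t4 = 1" "arc_start e t5"
    using next_arc[OF e(2) t4(4)] unfolding W_def minus_minus by metis
  define X where "X = t1 + l"
  have X: "X = t1 + 4 * lam" by (simp add: X_def l_lam)
  have aX: "arc_start e X" unfolding X_def arc_start_periodic by (rule t1(3))
  have rX: "s u \<bullet> W e X = 1" if "X \<le> u" "u \<le> X + lam" for u using aX that by (auto simp: arc_start_def W_def)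
  have lX: "s u \<bullet> w0 = 1" if "X - lam \<le> u" "u \<le> X" for u
  proof -
    have "s (u - l) \<bullet> w0 = 1" by (rule t1(2)) (use that t1(1) in \<open>auto simp: X_def\<close>)
    then show ?thesis by (simp add: periodic_minus)
  qed
  have w0X: "w0 \<noteq> W e X"
  proof
    assume eq: "w0 = W e X"
    have "w0 \<bullet> n t1 = w0 \<bullet> n t0" by (rule contact_sign[OF w0 _ t1(2)]) (use t1 lam_pos in auto)
    also have "\<dots> = - e" by (simp add: w0_def inner_add_left e_def)
    finally have "w0 \<bullet> n t1 = - e" .
    moreover have "n X = n t1" by (simp add: X_def n_def periodic T_periodic)
    ultimately have "W e X \<bullet> n X = - e" using eq by simp
    moreover have "W e X \<bullet> n X = e" by (simp add: W_def inner_add_left)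
    ultimately show False using e by auto
  qed
  \<comment> \<open>At \<open>X\<close> the curve passes from the cap \<open>w0\<close> to the
    different cap \<open>W e X\<close>, so no single cap touches on both sides of
    \<open>X\<close>.\<close>
  have inside: False if ab: "a < X" "X < b" and Zab: "\<And>u. a \<le> u \<Longrightarrow> u \<le> b \<Longrightarrow> s u \<bullet> w = 1" and w: "touching w" for a b w
  proof -
    have "w = w0" by (rule contact_overlap[OF w w0, of "max a (X - lam)" X]) (use ab Zab lX lam_pos in auto)
    moreover have "w = W e X" by (rule contact_overlap[OF w W[OF e(1)], of X "min b (X + lam)"]) (use ab Zab rX lam_pos in auto)
    ultimately show False using w0X by simp
  qed
  have n2: "\<not> (t2 < X \<and> X < t3)" and n3: "\<not> (t3 < X \<and> X < t4)" and n4: "\<not> (t4 < X \<and> X < t5)"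
    using inside[OF _ _ t3(3) W[OF e(2)]] inside[OF _ _ t4(3) W[OF e(1)]] inside[OF _ _ t5(3) W[OF e(2)]] by blast+
  \<comment> \<open>The arc at \<open>t4\<close> has sign \<open>- e\<close>, the one at
    \<open>X\<close> has sign \<open>e\<close>. Since \<open>t3 < X\<close> and
    \<open>X \<le> t5\<close>, only \<open>X = t5\<close> remains.\<close>
  have n4': "X \<noteq> t4"
  proof
    assume "X = t4"
    then have "W (- e) X = W e X"
      using t4(4) by (intro contact_overlap[OF W[OF e(2)] W[OF e(1)], of X "X + lam"])
        (use rX lam_pos in \<open>auto simp: arc_start_def W_def\<close>)
    then have "W (- e) X \<bullet> n X = W e X \<bullet> n X" by simp
    then show False using e by (auto simp: W_def inner_add_left inner_diff_left)
  qed
  have X5: "X = t5"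
    using t2(1,2) t3(1,2) t4(1,2) t5(1,2) n2 n3 n4 n4' X lam_pos by linarith
  have "t2 = t1 + lam" "t3 = t1 + 2 * lam" "t4 = t1 + 3 * lam"
    using t2(1) t3(1) t4(1) t5(1) X X5 by linarith+
  then show ?thesis using that[of e t1] e(1) t1(3) t2(4) t3(4) t4(4) by simp
qed

end

section \<open>Arclength and the inscribed sphere\<close>

definition polygon_lengths :: "(real \<Rightarrow> real^3) \<Rightarrow> real \<Rightarrow> real \<Rightarrow> real set" where
  "polygon_lengths g u v = {(\<Sum>i<n. norm (g (t (Suc i)) - g (t i))) | n t. partition_of u v n t}"

lemma curve_length_eq: "curve_length u v g = Sup (ereal ` polygon_lengths g u v)"
proof -
  have "{ereal (\<Sum>i<n. norm (g (t (Suc i)) - g (t i))) | n t. partition_of u v n t} = ereal ` polygon_lengths g u v"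
    unfolding polygon_lengths_def by blast
  then show ?thesis by (simp add: curve_length_def)
qed

lemma polygon_lengths_chord: "u \<le> v \<Longrightarrow> norm (g v - g u) \<in> polygon_lengths g u v"
  unfolding polygon_lengths_def mem_Collect_eq
  by (intro exI[of _ 1] exI[of _ "\<lambda>i. if i = 0 then u else v"]) (simp add: partition_of_def)

lemma polygon_lengths_concat:
  assumes "x \<in> polygon_lengths g u v" "y \<in> polygon_lengths g v w"
  shows "x + y \<in> polygon_lengths g u w"
proof -
  obtain n t where t: "x = (\<Sum>i<n. norm (g (t (Suc i)) - g (t i)))" "partition_of u v n t"
    using assms(1) unfolding polygon_lengths_def by blast
  obtain m t' where t': "y = (\<Sum>i<m. norm (g (t' (Suc i)) - g (t' i)))" "partition_of v w m t'"
    using assms(2) unfolding polygon_lengths_def by blast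
  define r where "r i = (if i \<le> n then t i else t' (i - n))" for i
  have e: "t n = v" "t' 0 = v" using t(2) t'(2) by (auto simp: partition_of_def)
  have r': "r (i + n) = t' i" for i by (cases "i = 0") (simp_all add: r_def e)
  have rn: "r (Suc (i + n)) = t' (Suc i)" for i using r'[of "Suc i"] by simp
  have "partition_of u w (n + m) r"
    unfolding partition_of_def
  proof (intro conjI allI impI)
    show "r 0 = u" using t(2) by (simp add: r_def partition_of_def)
    show "r (n + m) = w" using r'[of m] t'(2) by (simp add: add.commute partition_of_def)
    fix i assume i: "i < n + m"
    show "r i \<le> r (Suc i)"
    proof (cases "i < n")
      case True then show ?thesis using t(2) by (simp add: r_def partition_of_def)
    next
      case False
      then obtain k where k: "i = k + n" by (metis add.commute le_Suc_ex not_less)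
      then have "k < m" using i by simp
      then show ?thesis unfolding k r' rn using t'(2) by (simp add: partition_of_def)
    qed
  qed
  moreover have "x + y = (\<Sum>i<n + m. norm (g (r (Suc i)) - g (r i)))"
  proof -
    have "(\<Sum>i<n + m. norm (g (r (Suc i)) - g (r i))) = (\<Sum>i<n. norm (g (r (Suc i)) - g (r i))) + (\<Sum>i<m. norm (g (r (Suc (i + n))) - g (r (i + n))))"
      by (rule sum_lessThan_add)
    also have "(\<Sum>i<n. norm (g (r (Suc i)) - g (r i))) = x" unfolding t(1) by (intro sum.cong) (auto simp: r_def)
    also have "(\<Sum>i<m. norm (g (r (Suc (i + n))) - g (r (i + n)))) = y" unfolding t'(1) r' rn ..
    finally show ?thesis by simp
  qed
  ultimately show ?thesis unfolding polygon_lengths_def by blast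
qed

lemma partition_of_bounds:
  assumes "partition_of u v n t" "i \<le> n"
  shows "u \<le> t i" "t i \<le> v"
proof -
  have st: "t 0 = u" "t n = v" "\<And>i. i < n \<Longrightarrow> t i \<le> t (Suc i)" using assms(1) by (auto simp: partition_of_def)
  have mono: "t j \<le> t (j + k)" if "j + k \<le> n" for j k
    using that
  proof (induction k)
    case (Suc k)
    then have "t j \<le> t (j + k)" "t (j + k) \<le> t (Suc (j + k))" using st(3)[of "j + k"] by simp_all
    then show ?case by simp
  qed simp
  show "u \<le> t i" using mono[of 0 i] assms(2) st(1) by simp
  show "t i \<le> v" using mono[of i "n - i"] assms(2) st(2) by simp
qed

lemma polygon_lengths_point: "x \<in> polygon_lengths g u u \<Longrightarrow> x = 0"
proof -
  assume "x \<in> polygon_lengths g u u"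
  then obtain n t where t: "x = (\<Sum>i<n. norm (g (t (Suc i)) - g (t i)))" "partition_of u u n t"
    unfolding polygon_lengths_def by blast
  note b = partition_of_bounds[OF t(2)]
  have "t i = u" if "i \<le> n" for i using b[OF that] by simp
  then show ?thesis unfolding t(1) by simp
qed

text \<open>The inverse of the arclength function is taken in the generalised sense, so that no continuity of the
  arclength is needed for the inequality; a jump of the arclength would make the new curve constant on an interval.\<close>

lemma arclength_curve:
  fixes g :: "real \<Rightarrow> real^3"
  assumes ab: "a < b" and cont: "continuous_on {a..b} g" and L: "curve_length a b g = ereal L"
  obtains \<sigma> \<Lambda> where "\<And>x y. 0 \<le> x \<Longrightarrow> x \<le> y \<Longrightarrow> y \<le> L \<Longrightarrow> norm (\<sigma> x - \<sigma> y) \<le> y - x"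
    "\<And>x. 0 \<le> x \<Longrightarrow> x \<le> L \<Longrightarrow> \<sigma> x \<in> g ` {a..b}" "\<sigma> 0 = g a" "\<sigma> L = g b"
    "\<And>t. a \<le> t \<Longrightarrow> t \<le> b \<Longrightarrow> 0 \<le> \<Lambda> t \<and> \<Lambda> t \<le> L \<and> g t = \<sigma> (\<Lambda> t)"
    "\<And>t u. a \<le> t \<Longrightarrow> t \<le> u \<Longrightarrow> u \<le> b \<Longrightarrow> \<Lambda> t \<le> \<Lambda> u"
    "\<And>x. 0 \<le> x \<Longrightarrow> x \<le> L \<Longrightarrow> (\<exists>t. a \<le> t \<and> t \<le> b \<and> \<Lambda> t = x) \<or> (\<exists>y z. 0 \<le> y \<and> y < z \<and> z \<le> L \<and> (\<forall>w. y < w \<and> w < z \<longrightarrow> \<sigma> w = \<sigma> ((y + z) / 2)))"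
proof -
  have ub: "x \<le> L" if "x \<in> polygon_lengths g a b" for x
  proof -
    have "ereal x \<le> Sup (ereal ` polygon_lengths g a b)" using that by (intro Sup_upper) auto
    then show ?thesis using L unfolding curve_length_eq by simp
  qed
  have ub': "x \<le> L" if x: "x \<in> polygon_lengths g u v" and uv: "a \<le> u" "u \<le> v" "v \<le> b" for x u v
  proof -
    \<comment> \<open>A polygon over a subinterval is completed by two chords to one over the whole
      interval.\<close>
    have "norm (g u - g a) + x + norm (g b - g v) \<in> polygon_lengths g a b"
      by (intro polygon_lengths_concat[of _ _ _ v] polygon_lengths_concat[of _ _ _ u] polygon_lengths_chord x uv)
    from ub[OF this] show ?thesis by (smt (verit) norm_ge_zero)
  qed
  define \<Lambda> where "\<Lambda> t = Sup (polygon_lengths g a t)" for t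
  have ne: "polygon_lengths g a t \<noteq> {}" if "a \<le> t" for t using polygon_lengths_chord[OF that] by blast
  have bdd: "bdd_above (polygon_lengths g a t)" if "a \<le> t" "t \<le> b" for t
    using ub'[OF _ order_refl that] by (intro bdd_aboveI[of _ L])
  have add: "norm (g u - g t) \<le> \<Lambda> u - \<Lambda> t" if tu: "a \<le> t" "t \<le> u" "u \<le> b" for t u
  proof -
    have "\<Lambda> t \<le> \<Lambda> u - norm (g u - g t)"
      unfolding \<Lambda>_def[of t]
    proof (rule cSup_least)
      show "polygon_lengths g a t \<noteq> {}" using ne tu by blast
      fix x assume "x \<in> polygon_lengths g a t"
      then have "x + norm (g u - g t) \<in> polygon_lengths g a u" using polygon_lengths_chord[OF tu(2)] by (rule polygon_lengths_concat)
      then have "x + norm (g u - g t) \<le> \<Lambda> u" unfolding \<Lambda>_def using bdd[of u] tu by (intro cSup_upper) auto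
      then show "x \<le> \<Lambda> u - norm (g u - g t)" by simp
    qed
    then show ?thesis by simp
  qed
  have mono: "\<Lambda> t \<le> \<Lambda> u" if "a \<le> t" "t \<le> u" "u \<le> b" for t u
    using add[OF that] norm_ge_zero[of "g u - g t"] by linarith
  have "0 \<in> polygon_lengths g a a" using polygon_lengths_chord[of a a g] by simp
  then have "polygon_lengths g a a = {0}" using polygon_lengths_point by blast
  then have \<Lambda>a: "\<Lambda> a = 0" by (simp add: \<Lambda>_def)
  have \<Lambda>b: "\<Lambda> b = L"
  proof -
    have "ereal (\<Lambda> b) = Sup (ereal ` polygon_lengths g a b)"
      unfolding \<Lambda>_def using bdd[of b] ne[of b] ab
      by (intro ereal_Sup) (use L in \<open>auto simp: curve_length_eq\<close>)
    then show ?thesis using L unfolding curve_length_eq by simp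
  qed
  have \<Lambda>0: "0 \<le> \<Lambda> t" "\<Lambda> t \<le> L" if "a \<le> t" "t \<le> b" for t
    using mono[of a t] mono[of t b] that \<Lambda>a \<Lambda>b by auto
  define A where "A x = {t. a \<le> t \<and> t \<le> b \<and> \<Lambda> t \<le> x}" for x
  \<comment> \<open>The last time at which the arclength has not exceeded \<open>x\<close>. The
    arclength at \<tau> itself may lie on either side of \<open>x\<close>, so it is controlled only
    strictly before and after.\<close>
  define \<tau> where "\<tau> x = Sup (A x)" for x
  define \<sigma> where "\<sigma> x = g (\<tau> x)" for x
  have Ane: "a \<in> A x" if "0 \<le> x" for x using that ab \<Lambda>a by (simp add: A_def)
  have Abdd: "bdd_above (A x)" for x by (intro bdd_aboveI[of _ b]) (simp add: A_def)
  have \<tau>: "a \<le> \<tau> x" "\<tau> x \<le> b" if "0 \<le> x" for x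
  proof -
    show "a \<le> \<tau> x" unfolding \<tau>_def by (rule cSup_upper[OF Ane[OF that] Abdd])
    show "\<tau> x \<le> b" unfolding \<tau>_def
    proof (rule cSup_least)
      show "A x \<noteq> {}" using Ane[OF that] by blast
    qed (simp add: A_def)
  qed
  have below: "\<Lambda> t \<le> x" if x: "0 \<le> x" and t: "a \<le> t" "t < \<tau> x" for x t
  proof -
    have ne: "A x \<noteq> {}" using Ane[OF x] by blast
    obtain t' where t': "t' \<in> A x" "t < t'" using t(2) unfolding \<tau>_def less_cSup_iff[OF ne Abdd] by blast
    then have "\<Lambda> t \<le> \<Lambda> t'" using t by (intro mono) (auto simp: A_def)
    then show ?thesis using t'(1) by (simp add: A_def)
  qed
  have above: "x < \<Lambda> t" if x: "0 \<le> x" and t: "\<tau> x < t" "t \<le> b" for x t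
  proof (rule ccontr)
    assume "\<not> x < \<Lambda> t"
    then have "t \<in> A x" using t \<tau>(1)[OF x] by (simp add: A_def)
    then have "t \<le> \<tau> x" unfolding \<tau>_def by (rule cSup_upper[OF _ Abdd])
    then show False using t by simp
  qed
  have \<tau>mono: "\<tau> x \<le> \<tau> y" if "0 \<le> x" "x \<le> y" for x y
    unfolding \<tau>_def
  proof (rule cSup_subset_mono)
    show "A x \<noteq> {}" using Ane[OF that(1)] by blast
    show "A x \<subseteq> A y" using that by (auto simp: A_def)
  qed (rule Abdd)
  have near: "\<exists>d>0. \<forall>u. a \<le> u \<and> u \<le> b \<and> \<bar>u - t\<bar> < d \<longrightarrow> norm (g u - g t) < \<epsilon>" if "\<epsilon> > 0" "a \<le> t" "t \<le> b" for \<epsilon> t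
    using cont that unfolding continuous_on_iff dist_norm real_norm_def by (metis atLeastAtMost_iff)
  have lip: "norm (\<sigma> x - \<sigma> y) \<le> y - x" if xy: "0 \<le> x" "x \<le> y" for x y
  proof (cases "\<tau> x = \<tau> y")
    case True then show ?thesis using xy by (simp add: \<sigma>_def)
  next
    case False
    then have lt: "\<tau> x < \<tau> y" using \<tau>mono[OF xy] by simp
    have y0: "0 \<le> y" using xy by simp
    show ?thesis
    proof (rule field_le_epsilon)
      fix \<epsilon> :: real assume e: "\<epsilon> > 0"
      obtain d1 where d1: "d1 > 0" "\<And>u. a \<le> u \<Longrightarrow> u \<le> b \<Longrightarrow> \<bar>u - \<tau> x\<bar> < d1 \<Longrightarrow> norm (g u - g (\<tau> x)) < \<epsilon>/2"
        using near[of "\<epsilon>/2" "\<tau> x"] e \<tau>[OF xy(1)] by auto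
      obtain d2 where d2: "d2 > 0" "\<And>u. a \<le> u \<Longrightarrow> u \<le> b \<Longrightarrow> \<bar>u - \<tau> y\<bar> < d2 \<Longrightarrow> norm (g u - g (\<tau> y)) < \<epsilon>/2"
        using near[of "\<epsilon>/2" "\<tau> y"] e \<tau>[OF y0] by auto
      define k where "k = min (min (d1/2) (d2/2)) ((\<tau> y - \<tau> x) / 2)"
      have k: "k > 0" "k < d1" "k < d2" "\<tau> x + k \<le> \<tau> y - k" using d1(1) d2(1) lt by (auto simp: k_def min_def field_simps)
      define u where "u = \<tau> x + k"
      define v where "v = \<tau> y - k"
      have uv: "a \<le> u" "u \<le> v" "v \<le> b" "\<tau> x < u" "v < \<tau> y" "u \<le> b" "a \<le> v"
        using k \<tau>[OF xy(1)] \<tau>[OF y0] by (auto simp: u_def v_def)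
      have "norm (g v - g u) \<le> y - x"
        \<comment> \<open>The times \<open>u\<close> and \<open>v\<close> lie strictly between
          \<open>\<tau> x\<close> and \<open>\<tau> y\<close>, where the arclength is between
          \<open>x\<close> and \<open>y\<close>.\<close>
        using add[OF uv(1-3)] above[OF xy(1) uv(4) uv(6)] below[OF y0 uv(7) uv(5)] by linarith
      moreover have "norm (g u - g (\<tau> x)) < \<epsilon>/2" by (rule d1(2)) (use uv k in \<open>auto simp: u_def\<close>)
      moreover have "norm (g v - g (\<tau> y)) < \<epsilon>/2" by (rule d2(2)) (use uv k in \<open>auto simp: v_def\<close>)
      moreover have "norm (\<sigma> x - \<sigma> y) \<le> norm (g u - g (\<tau> x)) + norm (g v - g u) + norm (g v - g (\<tau> y))"
      proof -
        have "\<sigma> x - \<sigma> y = - (g u - g (\<tau> x)) - (g v - g u) + (g v - g (\<tau> y))" by (simp add: \<sigma>_def)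
        then have "norm (\<sigma> x - \<sigma> y) = norm (- (g u - g (\<tau> x)) - (g v - g u) + (g v - g (\<tau> y)))" by (rule arg_cong)
        moreover have "norm (- (g u - g (\<tau> x)) - (g v - g u) + (g v - g (\<tau> y))) \<le>
            norm (- (g u - g (\<tau> x)) - (g v - g u)) + norm (g v - g (\<tau> y))" by (rule norm_triangle_ineq)
        moreover have "norm (- (g u - g (\<tau> x)) - (g v - g u)) \<le> norm (- (g u - g (\<tau> x))) + norm (g v - g u)"
          by (rule norm_triangle_ineq4)
        ultimately show ?thesis unfolding norm_minus_cancel by linarith
      qed
      ultimately show "norm (\<sigma> x - \<sigma> y) \<le> y - x + \<epsilon>" by linarith
    qed
  qed
  have rep: "g t = \<sigma> (\<Lambda> t)" if t: "a \<le> t" "t \<le> b" for t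
  proof -
    let ?x = "\<Lambda> t"
    have x0: "0 \<le> ?x" using \<Lambda>0 t by blast
    have "t \<in> A ?x" using t by (simp add: A_def)
    then have le: "t \<le> \<tau> ?x" unfolding \<tau>_def by (rule cSup_upper[OF _ Abdd])
    have const: "g u = g t" if "t \<le> u" "u < \<tau> ?x" for u
    proof -
      have "\<Lambda> u \<le> \<Lambda> t" using below[OF x0, of u] that t by simp
      moreover have "u \<le> b" using that \<tau>(2)[OF x0] by simp
      ultimately have "norm (g u - g t) \<le> 0" using add[of t u] t that by linarith
      then show ?thesis by simp
    qed
    have "norm (g t - g (\<tau> ?x)) \<le> 0"
    proof (cases "t = \<tau> ?x")
      case False
      then have lt: "t < \<tau> ?x" using le by simp
      show ?thesis
      proof (rule field_le_epsilon)
        fix \<epsilon> :: real assume e: "\<epsilon> > 0"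
        obtain d where d: "d > 0" "\<And>u. a \<le> u \<Longrightarrow> u \<le> b \<Longrightarrow> \<bar>u - \<tau> ?x\<bar> < d \<Longrightarrow> norm (g u - g (\<tau> ?x)) < \<epsilon>"
          using near[OF e \<tau>[OF x0]] by auto
        define u where "u = max t (\<tau> ?x - d/2)"
        have u: "t \<le> u" "u < \<tau> ?x" "\<bar>u - \<tau> ?x\<bar> < d" using lt d(1) by (auto simp: u_def max_def)
        have "norm (g u - g (\<tau> ?x)) < \<epsilon>" by (rule d(2)) (use u t \<tau>(2)[OF x0] in auto)
        then show "norm (g t - g (\<tau> ?x)) \<le> 0 + \<epsilon>" using const[OF u(1,2)] by simp
      qed
    qed simp
    then show ?thesis by (simp add: \<sigma>_def)
  qed
  have sur: "(\<exists>t. a \<le> t \<and> t \<le> b \<and> \<Lambda> t = x) \<or> (\<exists>y z. 0 \<le> y \<and> y < z \<and> z \<le> L \<and> (\<forall>w. y < w \<and> w < z \<longrightarrow> \<sigma> w = \<sigma> ((y + z) / 2)))"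
    if x: "0 \<le> x" "x \<le> L" for x
  proof (cases "\<Lambda> (\<tau> x) = x")
    case True then show ?thesis using \<tau>[OF x(1)] by blast
  next
    case False
    define y where "y = min x (\<Lambda> (\<tau> x))"
    define z where "z = max x (\<Lambda> (\<tau> x))"
    have yz: "0 \<le> y" "y < z" "z \<le> L" using False x \<Lambda>0[OF \<tau>[OF x(1)]] by (auto simp: y_def z_def min_def max_def)
    \<comment> \<open>If \<open>x\<close> is not the arclength at \<open>\<tau> x\<close>, the
      arclength jumps there, and all values in between have the same generalised inverse.\<close>
    have same: "\<tau> w = \<tau> x" if w: "y < w" "w < z" for w
    proof -
      have w0: "0 \<le> w" using w yz by simp
      consider "x < w" "w < \<Lambda> (\<tau> x)" | "\<Lambda> (\<tau> x) < w" "w < x" using w False by (auto simp: y_def z_def min_def max_def split: if_splits)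
      then show ?thesis
      proof cases
        case 1
        have "\<not> \<tau> x < \<tau> w" using below[OF w0 \<tau>(1)[OF x(1)]] 1 by auto
        then show ?thesis using \<tau>mono[OF x(1), of w] 1 by simp
      next
        case 2
        have "\<not> \<tau> w < \<tau> x" using above[OF w0 _ \<tau>(2)[OF x(1)]] 2 by auto
        then show ?thesis using \<tau>mono[OF w0, of x] 2 by simp
      qed
    qed
    have "\<sigma> w = \<sigma> ((y + z) / 2)" if "y < w" "w < z" for w
      unfolding \<sigma>_def using same[OF that] same[of "(y + z) / 2"] yz(2) by (simp add: field_simps)
    then show ?thesis using yz by blast
  qed
  show ?thesis
  proof (rule that[of \<sigma> \<Lambda>])
    show "\<sigma> 0 = g a" using rep[of a] ab \<Lambda>a by simp
    show "\<sigma> L = g b" using rep[of b] ab \<Lambda>b by simp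
    show "\<sigma> x \<in> g ` {a..b}" if "0 \<le> x" for x using \<tau>[OF that] by (auto simp: \<sigma>_def)
    show "norm (\<sigma> x - \<sigma> y) \<le> y - x" if "0 \<le> x" "x \<le> y" for x y by (rule lip[OF that])
    show "0 \<le> \<Lambda> t \<and> \<Lambda> t \<le> L \<and> g t = \<sigma> (\<Lambda> t)" if "a \<le> t" "t \<le> b" for t using \<Lambda>0[OF that] rep[OF that] by blast
    show "\<Lambda> t \<le> \<Lambda> u" if "a \<le> t" "t \<le> u" "u \<le> b" for t u by (rule mono[OF that])
  qed (rule sur)
qed

text \<open>The sphere lies in every supporting half-space of the curve, so each direction is seen.
  In particular some point lies outside the sphere, and a connected curve that avoids the sphere
  then lies outside altogether.\<close>

lemma inscribed_sphere_conditions: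
  fixes g :: "real \<Rightarrow> real^3"
  assumes ab: "a < b" and cont: "continuous_on {a..b} g" and \<rho>: "0 < \<rho>"
    and sp: "sphere p \<rho> \<subseteq> conv (g ` {a..b})" "sphere p \<rho> \<inter> g ` {a..b} = {}"
  shows "\<exists>t\<in>{a..b}. \<rho> * norm v \<le> v \<bullet> (g t - p)" "t \<in> {a..b} \<Longrightarrow> \<rho> \<le> norm (g t - p)"
proof -
  have cov: "\<exists>t\<in>{a..b}. \<rho> * norm v \<le> v \<bullet> (g t - p)" for v
  proof (cases "v = 0")
    case True then show ?thesis using ab by (intro bexI[of _ a]) auto
  next
    case False
    have "\<exists>x\<in>{a..b}. \<forall>y\<in>{a..b}. v \<bullet> g y \<le> v \<bullet> g x"
      using ab cont by (intro continuous_attains_sup continuous_intros) auto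
    then obtain x where x: "x \<in> {a..b}" "\<And>y. y \<in> {a..b} \<Longrightarrow> v \<bullet> g y \<le> v \<bullet> g x" by blast
    have "p + (\<rho> / norm v) *\<^sub>R v \<in> sphere p \<rho>" using False \<rho> by (simp add: dist_norm)
    then have "p + (\<rho> / norm v) *\<^sub>R v \<in> conv (g ` {a..b})" using sp by blast
    moreover have "closed_halfspace {y. v \<bullet> y \<le> v \<bullet> g x} \<and> g ` {a..b} \<subseteq> {y. v \<bullet> y \<le> v \<bullet> g x}"
      using False x(2) unfolding closed_halfspace_def by blast
    ultimately have "v \<bullet> (p + (\<rho> / norm v) *\<^sub>R v) \<le> v \<bullet> g x" unfolding conv_def by blast
    moreover have "v \<bullet> ((\<rho> / norm v) *\<^sub>R v) = \<rho> * norm v" using False by (simp add: dot_square_norm power2_eq_square)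
    ultimately show ?thesis using x(1) by (intro bexI[of _ x]) (simp_all add: inner_add_right inner_diff_right)
  qed
  show "\<exists>t\<in>{a..b}. \<rho> * norm v \<le> v \<bullet> (g t - p)" by (rule cov)
  have off: "norm (g t - p) \<noteq> \<rho>" if "t \<in> {a..b}" for t using sp(2) that by (auto simp: dist_norm norm_minus_commute)
  have "\<exists>v::real^3. norm v = 1" by (intro exI[of _ "axis 1 1"]) simp
  then obtain v :: "real^3" where v: "norm v = 1" by blast
  obtain x where x: "x \<in> {a..b}" "\<rho> * norm v \<le> v \<bullet> (g x - p)" using cov by blast
  have "v \<bullet> (g x - p) \<le> norm v * norm (g x - p)" by (rule norm_cauchy_schwarz)
  then have gx: "\<rho> \<le> norm (g x - p)" using x(2) v by simp
  assume t: "t \<in> {a..b}"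
  show "\<rho> \<le> norm (g t - p)"
  proof (rule ccontr)
    assume n: "\<not> \<rho> \<le> norm (g t - p)"
    have "connected ((\<lambda>t. norm (g t - p)) ` {a..b})"
      using cont by (intro connected_continuous_image continuous_intros) auto
    then have "\<rho> \<in> (\<lambda>t. norm (g t - p)) ` {a..b}"
      unfolding connected_iff_interval using n gx t x(1) by (meson imageI le_cases not_le)
    then obtain t' where t': "\<rho> = norm (g t' - p)" "t' \<in> {a..b}" by (rule imageE)
    show False using off[OF t'(2)] t'(1) by simp
  qed
qed

text \<open>The supremum need not be attained by an admissible sphere, since the limiting sphere may
  meet the curve. The two conditions of \<open>inscribed_sphere_conditions\<close> are closed and
  survive the limit.\<close>

lemma inradius_attained:
  fixes g :: "real \<Rightarrow> real^3"
  assumes ab: "a < b" and cont: "continuous_on {a..b} g" and r: "inradius a b g = ereal r" "r > 0"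
  obtains p where "\<And>v. \<exists>t\<in>{a..b}. r * norm v \<le> v \<bullet> (g t - p)" "\<And>t. t \<in> {a..b} \<Longrightarrow> r \<le> norm (g t - p)"
proof -
  define S where "S = {ereal \<rho> | \<rho> p. 0 < \<rho> \<and> sphere p \<rho> \<subseteq> conv (g ` {a..b}) \<and> sphere p \<rho> \<inter> g ` {a..b} = {}}"
  have SupS: "Sup S = ereal r" using r(1) by (simp add: inradius_def S_def)
  have ex: "\<exists>\<rho> p. r - inverse (real (Suc k)) < \<rho> \<and> 0 < \<rho> \<and> sphere p \<rho> \<subseteq> conv (g ` {a..b}) \<and> sphere p \<rho> \<inter> g ` {a..b} = {}" for k
  proof -
    have "ereal (r - inverse (real (Suc k))) < Sup S" unfolding SupS by simp
    then obtain y where y: "y \<in> S" "ereal (r - inverse (real (Suc k))) < y" unfolding less_Sup_iff by blast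
    from y(1) obtain \<rho> p where "y = ereal \<rho>" "0 < \<rho>" "sphere p \<rho> \<subseteq> conv (g ` {a..b})" "sphere p \<rho> \<inter> g ` {a..b} = {}"
      unfolding S_def by blast
    with \<open>ereal (r - inverse (real (Suc k))) < y\<close> show ?thesis by (intro exI[of _ \<rho>] exI[of _ p]) simp
  qed
  then obtain \<rho> p where \<rho>: "\<And>k. r - inverse (real (Suc k)) < \<rho> k" "\<And>k. 0 < \<rho> k"
    "\<And>k. sphere (p k) (\<rho> k) \<subseteq> conv (g ` {a..b})" "\<And>k. sphere (p k) (\<rho> k) \<inter> g ` {a..b} = {}" by metis
  note c1 = inscribed_sphere_conditions(1)[OF ab cont \<rho>(2) \<rho>(3) \<rho>(4)]
    and c2 = inscribed_sphere_conditions(2)[OF ab cont \<rho>(2) \<rho>(3) \<rho>(4)]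
  have "bounded (g ` {a..b})" using cont by (intro compact_imp_bounded compact_continuous_image) auto
  then obtain B where B': "\<forall>x\<in>g ` {a..b}. norm x \<le> B" unfolding bounded_iff by blast
  have B: "norm (g t) \<le> B" if "t \<in> {a..b}" for t using B' that by blast
  \<comment> \<open>The direction \<open>p k\<close> is seen from some point of the curve, which
    bounds the centre by the norm of that point.\<close>
  have pB: "p k \<in> cball 0 B" for k
  proof -
    obtain t where t: "t \<in> {a..b}" "\<rho> k * norm (p k) \<le> p k \<bullet> (g t - p k)" using c1[where v = "p k"] by blast
    have "0 \<le> \<rho> k * norm (p k)" using \<rho>(2)[of k] by simp
    then have "p k \<bullet> p k \<le> p k \<bullet> g t" using t(2) by (simp add: inner_diff_right)
    also have "\<dots> \<le> norm (p k) * norm (g t)" by (rule norm_cauchy_schwarz)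
    also have "\<dots> \<le> norm (p k) * B" using B[OF t(1)] by (intro mult_left_mono) auto
    finally have "norm (p k) * norm (p k) \<le> norm (p k) * B" by (simp add: dot_square_norm power2_eq_square)
    moreover have "0 \<le> B" using B[of a] ab norm_ge_zero[of "g a"] by (meson atLeastAtMost_iff less_imp_le order_refl order_trans)
    ultimately have "norm (p k) \<le> B" by (cases "p k = 0") auto
    then show ?thesis by simp
  qed
  have "compact (cball (0::real^3) B)" by simp
  then obtain q f where q: "strict_mono f" "(p \<circ> f) \<longlonglongrightarrow> q"
    unfolding compact_eq_seq_compact_metric seq_compact_def using pB by metis
  have "(\<lambda>k. r - inverse (real (Suc k))) \<longlonglongrightarrow> r - 0" by (intro tendsto_intros LIMSEQ_inverse_real_of_nat)
  then have R: "(\<lambda>k. r - inverse (real (Suc (f k)))) \<longlonglongrightarrow> r"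
    using LIMSEQ_subseq_LIMSEQ[OF _ q(1)] by (fastforce simp: o_def)
  show ?thesis
  proof (rule that[of q])
    fix t assume t: "t \<in> {a..b}"
    have "(\<lambda>k. norm (g t - (p \<circ> f) k)) \<longlonglongrightarrow> norm (g t - q)" by (intro tendsto_intros q(2))
    then show "r \<le> norm (g t - q)"
    proof (rule LIMSEQ_le[OF R], intro exI allI impI)
      fix k show "r - inverse (real (Suc (f k))) \<le> norm (g t - (p \<circ> f) k)"
        using \<rho>(1)[of "f k"] c2[OF t, of "f k"] by simp
    qed
  next
    fix v
    have "\<exists>x\<in>{a..b}. \<forall>y\<in>{a..b}. v \<bullet> g y \<le> v \<bullet> g x"
      using ab cont by (intro continuous_attains_sup continuous_intros) auto
    then obtain x where x: "x \<in> {a..b}" "\<And>y. y \<in> {a..b} \<Longrightarrow> v \<bullet> g y \<le> v \<bullet> g x" by blast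
    have l1: "(\<lambda>k. (r - inverse (real (Suc (f k)))) * norm v) \<longlonglongrightarrow> r * norm v" by (intro tendsto_intros R)
    have "(\<lambda>k. v \<bullet> (g x - (p \<circ> f) k)) \<longlonglongrightarrow> v \<bullet> (g x - q)" by (intro tendsto_intros q(2))
    then have "r * norm v \<le> v \<bullet> (g x - q)"
    proof (rule LIMSEQ_le[OF l1], intro exI allI impI)
      fix k
      obtain t where t: "t \<in> {a..b}" "\<rho> (f k) * norm v \<le> v \<bullet> (g t - p (f k))" using c1 by blast
      have "(r - inverse (real (Suc (f k)))) * norm v \<le> \<rho> (f k) * norm v" using \<rho>(1)[of "f k"] by (intro mult_right_mono) auto
      then show "(r - inverse (real (Suc (f k)))) * norm v \<le> v \<bullet> (g x - (p \<circ> f) k)"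
        using t(2) x(2)[OF t(1)] by (simp add: inner_diff_right)
    qed
    then show "\<exists>t\<in>{a..b}. r * norm v \<le> v \<bullet> (g t - q)" using x(1) by blast
  qed
qed

section \<open>Length of a semicircle and the model of the extremal curve\<close>

lemma norm_chord_le:
  fixes u v :: "real^3"
  assumes uv: "norm u = 1" "norm v = 1" "u \<bullet> v = 0"
  shows "norm ((cos x *\<^sub>R u + sin x *\<^sub>R v) - (cos y *\<^sub>R u + sin y *\<^sub>R v)) = 2 * \<bar>sin ((x - y) / 2)\<bar>"
proof -
  have uu: "u \<bullet> u = 1" "v \<bullet> v = 1" "v \<bullet> u = 0" using uv by (auto simp: norm_eq_1 inner_commute)
  have "(norm ((cos x *\<^sub>R u + sin x *\<^sub>R v) - (cos y *\<^sub>R u + sin y *\<^sub>R v)))\<^sup>2 = (cos x - cos y)\<^sup>2 + (sin x - sin y)\<^sup>2"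
  proof -
    have e: "(cos x *\<^sub>R u + sin x *\<^sub>R v) - (cos y *\<^sub>R u + sin y *\<^sub>R v) = (cos x - cos y) *\<^sub>R u + (sin x - sin y) *\<^sub>R v"
      by (simp add: algebra_simps)
    show ?thesis unfolding e power2_norm_eq_inner using uu uv(3) by (simp add: inner_add power2_eq_square)
  qed
  also have "\<dots> = ((cos x)\<^sup>2 + (sin x)\<^sup>2) + ((cos y)\<^sup>2 + (sin y)\<^sup>2) - 2 * cos (x - y)"
    by (simp only: power2_diff cos_diff) (simp only: algebra_simps)
  also have "\<dots> = 2 - 2 * cos (2 * ((x - y) / 2))" 
  proof -
    have h: "2 * ((x - y) / 2) = x - y" by (simp add: field_simps)
    show ?thesis unfolding h sin_cos_squared_add2 by simp
  qed
  also have "\<dots> = (2 * \<bar>sin ((x - y) / 2)\<bar>)\<^sup>2" unfolding cos_double_sin by (simp add: power_mult_distrib)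
  finally show ?thesis by (rule power2_eq_imp_eq) simp_all
qed

text \<open>Upper bound: chords are shorter than arcs. Lower bound: regular inscribed polygons, with
  the limit of \<open>sin x / x\<close>.\<close>

lemma semicircle_length:
  fixes f :: "real \<Rightarrow> real^3"
  assumes uv: "norm u = 1" "norm v = 1" "u \<bullet> v = 0" and r: "r > 0" and cd: "c < d"
    and f: "\<And>t. c \<le> t \<Longrightarrow> t \<le> d \<Longrightarrow> f t = p + r *\<^sub>R (cos (pi * (t - c) / (d - c)) *\<^sub>R u + sin (pi * (t - c) / (d - c)) *\<^sub>R v)"
  shows "curve_length c d f = ereal (pi * r)"
proof -
  define \<theta> where "\<theta> t = pi * (t - c) / (d - c)" for t
  have ch: "norm (f t - f t') = r * (2 * \<bar>sin ((\<theta> t - \<theta> t') / 2)\<bar>)" if "c \<le> t" "t \<le> d" "c \<le> t'" "t' \<le> d" for t t'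
  proof -
    have "f t - f t' = r *\<^sub>R ((cos (\<theta> t) *\<^sub>R u + sin (\<theta> t) *\<^sub>R v) - (cos (\<theta> t') *\<^sub>R u + sin (\<theta> t') *\<^sub>R v))"
      using f[of t] f[of t'] that unfolding \<theta>_def by (simp add: scaleR_diff_right)
    then show ?thesis using r norm_chord_le[OF uv] by simp
  qed
  have \<theta>mono: "\<theta> t \<le> \<theta> t'" if "t \<le> t'" for t t' unfolding \<theta>_def using that cd by (intro divide_right_mono mult_left_mono) auto
  have up: "x \<le> pi * r" if x: "x \<in> polygon_lengths f c d" for x
  proof -
    obtain n t where t: "x = (\<Sum>i<n. norm (f (t (Suc i)) - f (t i)))" "partition_of c d n t"
      using x unfolding polygon_lengths_def by blast
    note lo = partition_of_bounds(1)[OF t(2)] and hi = partition_of_bounds(2)[OF t(2)]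
    have "norm (f (t (Suc i)) - f (t i)) \<le> r * (\<theta> (t (Suc i)) - \<theta> (t i))" if i: "i < n" for i
    proof -
      have "\<theta> (t i) \<le> \<theta> (t (Suc i))" using t(2) i by (intro \<theta>mono) (simp add: partition_of_def)
      then have "2 * \<bar>sin ((\<theta> (t (Suc i)) - \<theta> (t i)) / 2)\<bar> \<le> \<theta> (t (Suc i)) - \<theta> (t i)"
        using abs_sin_x_le_abs_x[of "(\<theta> (t (Suc i)) - \<theta> (t i)) / 2"] by simp
      then have "r * (2 * \<bar>sin ((\<theta> (t (Suc i)) - \<theta> (t i)) / 2)\<bar>) \<le> r * (\<theta> (t (Suc i)) - \<theta> (t i))"
        using r by (intro mult_left_mono) auto
      moreover have "norm (f (t (Suc i)) - f (t i)) = r * (2 * \<bar>sin ((\<theta> (t (Suc i)) - \<theta> (t i)) / 2)\<bar>)"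
        by (rule ch) (use lo[of i] lo[of "Suc i"] hi[of i] hi[of "Suc i"] i in simp_all)
      ultimately show ?thesis by simp
    qed
    then have "x \<le> (\<Sum>i<n. r * (\<theta> (t (Suc i)) - \<theta> (t i)))" unfolding t(1) by (intro sum_mono) simp
    also have "\<dots> = r * (\<theta> (t n) - \<theta> (t 0))"
      unfolding sum_distrib_left[symmetric] by (simp add: sum_lessThan_telescope[of "\<lambda>i. \<theta> (t i)"])
    also have "\<dots> = pi * r" using t(2) cd by (simp add: partition_of_def \<theta>_def)
    finally show ?thesis .
  qed
  define x where "x n = pi / (2 * real (Suc n))" for n
  have low: "pi * r * (sin (x n) / x n) \<in> polygon_lengths f c d" for n
  proof -
    let ?N = "Suc n"
    define h where "h = (d - c) / ?N"
    define t where "t i = c + real i * h" for i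
    have h: "h > 0" "real ?N * h = d - c" using cd by (simp_all add: h_def)
    have tN: "t ?N = d" unfolding t_def h(2) by simp
    have tmono: "t i \<le> t j" if "i \<le> j" for i j
      unfolding t_def using that h(1) by (intro add_left_mono mult_right_mono) auto
    have part: "partition_of c d ?N t"
      unfolding partition_of_def using tN tmono by (simp add: t_def[of 0])
    have \<theta>t: "\<theta> (t i) = real i * (2 * x n)" for i
    proof -
      have "\<theta> (t i) = pi * (real i * h) / (real ?N * h)" unfolding \<theta>_def h(2) by (simp add: t_def)
      also have "\<dots> = pi * real i / real ?N" using h(1) by simp
      also have "\<dots> = real i * (2 * x n)" by (simp add: x_def field_simps del: of_nat_Suc)
      finally show ?thesis .
    qed
    have tin: "c \<le> t i" "t i \<le> d" if "i \<le> ?N" for i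
      using tmono[of 0 i] tmono[OF that] tN by (simp_all add: t_def[of 0])
    have xp: "0 < x n" "x n \<le> pi/2"
      unfolding x_def by (simp, rule divide_left_mono) auto
    have "norm (f (t (Suc i)) - f (t i)) = r * (2 * sin (x n))" if "i < ?N" for i
    proof -
      have "(\<theta> (t (Suc i)) - \<theta> (t i)) / 2 = x n" unfolding \<theta>t by (simp add: algebra_simps)
      moreover have "0 \<le> sin (x n)" using xp by (intro sin_ge_zero) auto
      ultimately show ?thesis using ch[of "t (Suc i)" "t i"] tin[of i] tin[of "Suc i"] that by simp
    qed
    then have "(\<Sum>i<?N. norm (f (t (Suc i)) - f (t i))) = real ?N * (r * (2 * sin (x n)))" by simp
    also have "\<dots> = pi * r * (sin (x n) / x n)" by (simp add: x_def field_simps)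
    finally show ?thesis unfolding polygon_lengths_def using part by force
  qed
  have lim: "(\<lambda>n. pi * r * (sin (x n) / x n)) \<longlonglongrightarrow> pi * r * 1"
  proof (rule tendsto_mult[OF tendsto_const])
    have s: "((\<lambda>h. sin h / h) \<longlongrightarrow> (1::real)) (at 0)" 
      using DERIV_sin[of "0::real"] by (simp only: DERIV_def add_0 sin_zero diff_zero cos_zero)
    have xe: "x = (\<lambda>n. pi / 2 * inverse (real (Suc n)))"
      by (simp only: x_def fun_eq_iff divide_inverse inverse_mult_distrib mult.assoc simp_thms)
    have "x \<longlonglongrightarrow> pi / 2 * 0" unfolding xe by (rule tendsto_mult[OF tendsto_const LIMSEQ_inverse_real_of_nat])
    then have "x \<longlonglongrightarrow> 0" by simp
    then have "filterlim x (at 0) sequentially" by (rule filterlim_atI) (simp add: x_def)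
    then show "(\<lambda>n. sin (x n) / x n) \<longlonglongrightarrow> 1" by (rule filterlim_compose[OF s])
  qed
  have "Sup (ereal ` polygon_lengths f c d) \<le> ereal (pi * r)" by (intro Sup_least) (use up in auto)
  moreover have "ereal (pi * r) \<le> Sup (ereal ` polygon_lengths f c d)"
  proof (rule LIMSEQ_le_const2)
    show "(\<lambda>n. ereal (pi * r * (sin (x n) / x n))) \<longlonglongrightarrow> ereal (pi * r)" using lim by simp
    show "\<exists>N. \<forall>n\<ge>N. ereal (pi * r * (sin (x n) / x n)) \<le> Sup (ereal ` polygon_lengths f c d)"
      using low by (intro exI allI impI Sup_upper imageI)
  qed
  ultimately show ?thesis unfolding curve_length_eq by (rule antisym)
qed

lemma (in extremal_curve) four_contact_arcs:
  obtains t where "0 \<le> t" "t < l"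
    "\<And>i. i < (4::nat) \<Longrightarrow> \<exists>w. touching w \<and> (\<forall>u. t + real i * lam \<le> u \<and> u \<le> t + real i * lam + lam \<longrightarrow> s u \<bullet> w = 1)"
proof -
  obtain t e where e: "e = 1 \<or> e = -1" "arc_start e t" "arc_start (- e) (t + lam)" "arc_start e (t + 2 * lam)" "arc_start (- e) (t + 3 * lam)"
    by (rule four_arcs)
  obtain k :: int where k: "0 \<le> t + of_int k * l" "t + of_int k * l < 0 + l" by (rule shift_to_window)
  have arc: "\<exists>w. touching w \<and> (\<forall>u. y + of_int k * l \<le> u \<and> u \<le> y + of_int k * l + lam \<longrightarrow> s u \<bullet> w = 1)"
    if "e' = 1 \<or> e' = -1" "arc_start e' y" for e' y
  proof (intro exI[of _ "s y + e' *\<^sub>R n y"] conjI allI impI)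
    show "touching (s y + e' *\<^sub>R n y)" using that(1) by (rule touching_frame)
    fix u assume "y + of_int k * l \<le> u \<and> u \<le> y + of_int k * l + lam"
    then have "s (u + of_int (- k) * l) \<bullet> (s y + e' *\<^sub>R n y) = 1" using that(2) unfolding arc_start_def by simp
    then show "s u \<bullet> (s y + e' *\<^sub>R n y) = 1" unfolding periodic_int .
  qed
  have e': "- e = 1 \<or> - e = -1" using e(1) by auto
  show ?thesis
  proof (rule that[of "t + of_int k * l"])
    fix i :: nat assume "i < 4"
    then consider "i = 0" | "i = 1" | "i = 2" | "i = 3" by linarith
    then show "\<exists>w. touching w \<and> (\<forall>u. t + of_int k * l + real i * lam \<le> u \<and> u \<le> t + of_int k * l + real i * lam + lam \<longrightarrow> s u \<bullet> w = 1)"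
    proof cases
      case 1 then show ?thesis using arc[OF e(1,2)] by simp
    next
      case 2 then show ?thesis using arc[OF e' e(3)] by (simp add: algebra_simps)
    next
      case 3 then show ?thesis using arc[OF e(1) e(4)] by (simp add: algebra_simps)
    next
      case 4 then show ?thesis using arc[OF e' e(5)] by (simp add: algebra_simps)
    qed
  qed (use k in simp_all)
qed

lemma (in extremal_curve) T_lipschitz_global: "norm (T u - T t) \<le> 2 * \<bar>u - t\<bar>"
proof (cases "\<bar>u - t\<bar> < 1")
  case False
  have "norm (T u - T t) \<le> norm (T u) + norm (T t)" by (rule norm_triangle_ineq4)
  then show ?thesis using False by (simp add: norm_T)
qed (rule T_lipschitz)

context extremal_curve begin

text \<open>\<open>sqrt 2 * r\<close> undoes the normalization \<open>c = 1 / sqrt 2\<close>, and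
  the affine change of parameter gives constant speed on \<open>{a..b}\<close>, the
  reparameterization that is to be exhibited.\<close>

definition model_curve :: "real \<Rightarrow> real \<Rightarrow> real \<Rightarrow> real^3 \<Rightarrow> real \<Rightarrow> real^3" where
  "model_curve a b r p t = p + (sqrt 2 * r) *\<^sub>R s ((t - a) * (l / (b - a)))"

lemma model_curve_periodic:
  assumes ab: "a < b"
  shows "model_curve a b r p (t + (b - a)) = model_curve a b r p t"
proof -
  have "(t + (b - a) - a) * (l / (b - a)) = (t - a) * (l / (b - a)) + (b - a) * (l / (b - a))"
    unfolding distrib_right[symmetric] by simp
  also have "(b - a) * (l / (b - a)) = l" using ab by simp
  finally show ?thesis unfolding model_curve_def by (simp only: periodic)
qed

lemma model_curve_derivative:
  "(model_curve a b r p has_vector_derivative (sqrt 2 * r) *\<^sub>R ((l / (b - a)) *\<^sub>R T ((t - a) * (l / (b - a))))) (at t)"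
proof -
  define \<kappa> where "\<kappa> = l / (b - a)"
  have "((\<lambda>t. (t - a) * \<kappa>) has_real_derivative \<kappa>) (at t)" by (auto intro!: derivative_eq_intros)
  then have "((\<lambda>t. (t - a) * \<kappa>) has_vector_derivative \<kappa>) (at t)" unfolding has_real_derivative_iff_has_vector_derivative .
  from vector_diff_chain_at[OF this s_derivative]
  have "((\<lambda>t. s ((t - a) * \<kappa>)) has_vector_derivative \<kappa> *\<^sub>R T ((t - a) * \<kappa>)) (at t)" by (simp only: o_def)
  from bounded_linear.has_vector_derivative[OF bounded_linear_scaleR_right this, of "sqrt 2 * r"]
  have "((\<lambda>t. p + (sqrt 2 * r) *\<^sub>R s ((t - a) * \<kappa>)) has_vector_derivative 0 + (sqrt 2 * r) *\<^sub>R (\<kappa> *\<^sub>R T ((t - a) * \<kappa>))) (at t)"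
    by (intro has_vector_derivative_add has_vector_derivative_const)
  then show ?thesis unfolding model_curve_def \<kappa>_def[symmetric] by simp
qed

lemma model_curve_closed:
  assumes ab: "a < b"
  shows "closed_curve_on a b (model_curve a b r p)"
  unfolding closed_curve_on_def curve_on_def
proof (intro conjI ab)
  show "continuous_on {a..b} (model_curve a b r p)"
    by (intro continuous_at_imp_continuous_on ballI has_vector_derivative_continuous[OF model_curve_derivative])
  show "model_curve a b r p a = model_curve a b r p b" using model_curve_periodic[OF ab, of r p a] by simp
qed

lemma model_curve_simple:
  assumes ab: "a < b" and r: "r > 0"
  shows "simple_closed_on a b (model_curve a b r p)"
  unfolding simple_closed_on_def
proof (intro conjI model_curve_closed[OF ab] inj_onI)
  fix t u assume tu: "t \<in> {a..<b}" "u \<in> {a..<b}" and eq: "model_curve a b r p t = model_curve a b r p u"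
  define \<kappa> where "\<kappa> = l / (b - a)"
  have k: "\<kappa> > 0" "(b - a) * \<kappa> = l" using ab l by (simp_all add: \<kappa>_def)
  have "\<bar>t - u\<bar> < b - a" using tu unfolding atLeastLessThan_iff by linarith
  then have "\<bar>t - u\<bar> * \<kappa> < (b - a) * \<kappa>" using k(1) by (rule mult_strict_right_mono)
  moreover have "(t - a) * \<kappa> - (u - a) * \<kappa> = (t - u) * \<kappa>" by (simp add: algebra_simps)
  ultimately have "\<bar>(t - a) * \<kappa> - (u - a) * \<kappa>\<bar> < l" using k by (simp add: abs_mult)
  moreover have "s ((t - a) * \<kappa>) = s ((u - a) * \<kappa>)" using eq r by (simp add: model_curve_def \<kappa>_def)
  ultimately have "(t - a) * \<kappa> = (u - a) * \<kappa>" by (intro inj)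
  then show "t = u" using k(1) by simp
qed

lemma model_curve_C11:
  assumes ab: "a < b" and r: "r > 0"
  shows "C11_closed_on a b (model_curve a b r p)"
proof -
  define \<kappa> where "\<kappa> = l / (b - a)"
  have k: "\<kappa> > 0" "(b - a) * \<kappa> = l" using ab l by (simp_all add: \<kappa>_def)
  define D where "D t = (sqrt 2 * r) *\<^sub>R (\<kappa> *\<^sub>R T ((t - a) * \<kappa>))" for t
  have der: "curve_deriv a b (model_curve a b r p) t = D t" if "t \<in> {a..b}" for t
    unfolding curve_deriv_def D_def \<kappa>_def
    by (rule vector_derivative_at_within_ivl[OF model_curve_derivative]) (use that ab in auto)
  have lips: "(sqrt 2 * r * \<kappa> * (2 * \<kappa>))-lipschitz_on {a..b} (curve_deriv a b (model_curve a b r p))"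
  proof (rule lipschitz_onI)
    fix x y assume xy: "x \<in> {a..b}" "y \<in> {a..b}"
    have "(x - a) * \<kappa> - (y - a) * \<kappa> = (x - y) * \<kappa>" by (simp add: algebra_simps)
    then have "norm (T ((x - a) * \<kappa>) - T ((y - a) * \<kappa>)) \<le> 2 * (\<bar>x - y\<bar> * \<kappa>)"
      using T_lipschitz_global[of "(x - a) * \<kappa>" "(y - a) * \<kappa>"] k(1) by (simp add: abs_mult)
    then have "sqrt 2 * r * \<kappa> * norm (T ((x - a) * \<kappa>) - T ((y - a) * \<kappa>)) \<le> sqrt 2 * r * \<kappa> * (2 * (\<bar>x - y\<bar> * \<kappa>))"
      using r k(1) by (intro mult_left_mono) auto
    moreover have "norm (D x - D y) = sqrt 2 * r * \<kappa> * norm (T ((x - a) * \<kappa>) - T ((y - a) * \<kappa>))"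
      unfolding D_def scaleR_diff_right[symmetric] norm_scaleR using r k(1) by simp
    ultimately show "dist (curve_deriv a b (model_curve a b r p) x) (curve_deriv a b (model_curve a b r p) y) \<le> sqrt 2 * r * \<kappa> * (2 * \<kappa>) * dist x y"
      unfolding der[OF xy(1)] der[OF xy(2)] dist_norm real_norm_def by (simp only: mult_ac)
  qed (use r k in simp)
  have "T ((b - a) * \<kappa>) = T 0" unfolding k(2) using T_periodic[of 0] by simp
  then have Dab: "D a = D b" unfolding D_def by (simp only: diff_self mult_zero_left)
  have "a \<in> {a..b}" "b \<in> {a..b}" using ab by simp_all
  then have "curve_deriv a b (model_curve a b r p) a = curve_deriv a b (model_curve a b r p) b"
    by (simp only: der Dab)
  moreover have "model_curve a b r p differentiable_on {a..b}"
    unfolding differentiable_on_def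
    by (rule ballI) (rule differentiable_at_withinI[OF differentiableI_vector[OF model_curve_derivative]])
  ultimately show ?thesis
    unfolding C11_closed_on_def C1_closed_on_def
    using model_curve_closed[OF ab] lips lipschitz_on_continuous_on[OF lips] by blast
qed

lemma model_curve_sphere:
  assumes "r > 0" shows "model_curve a b r p ` X \<subseteq> sphere p (sqrt 2 * r)"
  using assms by (auto simp: model_curve_def dist_norm norm_eq_1)

lemma model_curve_cyclic_shift:
  assumes ab: "a < b"
  shows "cyclic_shift a b (a + x * ((b - a) / l)) (model_curve a b r p) t = p + (sqrt 2 * r) *\<^sub>R s ((t - a) * (l / (b - a)) + x)"
proof -
  have e: "(t + x * ((b - a) / l) - a) * (l / (b - a)) = (t - a) * (l / (b - a)) + x"
    using ab l by (simp add: field_simps)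
  have "model_curve a b r p (t + x * ((b - a) / l) - (b - a)) = model_curve a b r p (t + x * ((b - a) / l))"
    using model_curve_periodic[OF ab, of r p "t + x * ((b - a) / l) - (b - a)"] by simp
  then have "cyclic_shift a b (a + x * ((b - a) / l)) (model_curve a b r p) t = model_curve a b r p (t + x * ((b - a) / l))"
    by (simp add: cyclic_shift_def)
  then show ?thesis unfolding model_curve_def e .
qed

lemma model_curve_semicircles:
  assumes ab: "a < b" and r: "r > 0"
  shows "traces_four_semicircles a b (model_curve a b r p) r"
proof -
  obtain x where x: "0 \<le> x" "x < l"
    "\<And>i. i < (4::nat) \<Longrightarrow> \<exists>w. touching w \<and> (\<forall>u. x + real i * lam \<le> u \<and> u \<le> x + real i * lam + lam \<longrightarrow> s u \<bullet> w = 1)"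
    by (rule four_contact_arcs) (rule that)
  define \<kappa> where "\<kappa> = l / (b - a)"
  define h where "h = (b - a) / 4"
  have h: "h > 0" "4 * h = b - a" using ab by (simp_all add: h_def)
  have k: "\<kappa> > 0" "h * \<kappa> = lam" using ab l l_lam by (simp_all add: \<kappa>_def h_def)
  \<comment> \<open>On a quarter of the parameter interval the angle advances by exactly
    \<open>pi\<close>.\<close>
  have kc: "\<kappa> / c = pi / h" using c ab unfolding \<kappa>_def h_def l_eq by simp
  define S where "S = a + x * ((b - a) / l)"
  define f where "f = cyclic_shift a b S (model_curve a b r p)"
  have f: "f t = p + (sqrt 2 * r) *\<^sub>R s ((t - a) * \<kappa> + x)" for t
    unfolding f_def S_def \<kappa>_def by (rule model_curve_cyclic_shift[OF ab])
  have S: "S \<in> {a..b}"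
  proof -
    have "0 \<le> x * ((b - a) / l)" using x(1) ab l by simp
    moreover have "x * ((b - a) / l) \<le> l * ((b - a) / l)" using x(2) ab l by (intro mult_right_mono) auto
    moreover have "l * ((b - a) / l) = b - a" using l by simp
    ultimately show ?thesis unfolding S_def atLeastAtMost_iff by linarith
  qed
  define \<tau> where "\<tau> i = a + real i * h" for i
  have half: "traces_semicircle (\<tau> i) (\<tau> (Suc i)) f r \<and> curve_length (\<tau> i) (\<tau> (Suc i)) f = ereal (pi * r)" if i: "i < 4" for i
  proof -
    let ?P = "x + real i * lam"
    obtain w where w: "touching w" and wZ: "\<And>u. ?P \<le> u \<Longrightarrow> u \<le> ?P + lam \<Longrightarrow> s u \<bullet> w = 1" using x(3)[OF i] by blast
    have Pl: "?P \<le> ?P + lam" using lam_pos by simp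
    obtain v where v: "v \<bullet> v = 1/2" "(s ?P - (1/2) *\<^sub>R w) \<bullet> v = 0"
      "(s ?P - (1/2) *\<^sub>R w) \<bullet> (s ?P - (1/2) *\<^sub>R w) = 1/2"
      "\<And>t. ?P \<le> t \<Longrightarrow> t \<le> ?P + lam \<Longrightarrow> s t = (1/2) *\<^sub>R w + cos ((t - ?P) / c) *\<^sub>R (s ?P - (1/2) *\<^sub>R w) + sin ((t - ?P) / c) *\<^sub>R v"
      by (rule contact_rotation[OF w Pl wZ]) (assumption | rule that)+
    \<comment> \<open>The boundary circle of a cap has radius \<open>1 / sqrt 2\<close>; the factor
      makes the frame orthonormal, and scaling by \<open>sqrt 2 * r\<close> gives radius
      \<open>r\<close>.\<close>
    define U where "U = sqrt 2 *\<^sub>R (s ?P - (1/2) *\<^sub>R w)"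
    define V where "V = sqrt 2 *\<^sub>R v"
    define p' where "p' = p + (sqrt 2 * r) *\<^sub>R ((1/2) *\<^sub>R w)"
    have "U \<bullet> U = 1" "V \<bullet> V = 1" and UV: "U \<bullet> V = 0"
      unfolding U_def V_def inner_scaleR_left inner_scaleR_right v(1-3) by simp_all
    then have UV1: "norm U = 1" "norm V = 1" by (simp_all add: norm_eq_sqrt_inner)
    have \<tau>: "\<tau> i < \<tau> (Suc i)" "\<tau> (Suc i) - \<tau> i = h" using h(1) by (simp_all add: \<tau>_def algebra_simps)
    have rep: "f t = p' + r *\<^sub>R (cos (pi * (t - \<tau> i) / (\<tau> (Suc i) - \<tau> i)) *\<^sub>R U + sin (pi * (t - \<tau> i) / (\<tau> (Suc i) - \<tau> i)) *\<^sub>R V)"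
      if t: "\<tau> i \<le> t" "t \<le> \<tau> (Suc i)" for t
    proof -
      have X: "(t - a) * \<kappa> + x = ?P + (t - \<tau> i) * \<kappa>"
        unfolding k(2)[symmetric] \<tau>_def by (simp add: algebra_simps)
      have X0: "0 \<le> (t - \<tau> i) * \<kappa>" using t(1) k(1) by simp
      have X1: "(t - \<tau> i) * \<kappa> \<le> lam"
        unfolding k(2)[symmetric] using t(2) \<tau>(2) k(1) by (intro mult_right_mono) auto
      have "s ((t - a) * \<kappa> + x) = (1/2) *\<^sub>R w + cos ((t - \<tau> i) * \<kappa> / c) *\<^sub>R (s ?P - (1/2) *\<^sub>R w) + sin ((t - \<tau> i) * \<kappa> / c) *\<^sub>R v"
        unfolding X using v(4)[of "?P + (t - \<tau> i) * \<kappa>"] X0 X1 by simp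
      moreover have "(t - \<tau> i) * \<kappa> / c = pi * (t - \<tau> i) / h"
        unfolding times_divide_eq_right[symmetric] kc by simp
      ultimately show ?thesis
        unfolding f p'_def U_def V_def \<tau>(2) by (simp add: scaleR_add_right mult_ac)
    qed
    have th: "continuous_on {\<tau> i..\<tau> (Suc i)} (\<lambda>t. pi * (t - \<tau> i) / h)"
      using h(1) by (intro continuous_intros) auto
    have mono: "mono_on {\<tau> i..\<tau> (Suc i)} (\<lambda>t. pi * (t - \<tau> i) / h)"
      using h(1) by (intro mono_onI divide_right_mono mult_left_mono) auto
    have "traces_semicircle (\<tau> i) (\<tau> (Suc i)) f r"
      unfolding traces_semicircle_def
    proof (rule exI[of _ p'], rule exI[of _ U], rule exI[of _ V], rule exI[of _ "\<lambda>t. pi * (t - \<tau> i) / h"], intro conjI UV1 UV th mono)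
      show "pi * (\<tau> i - \<tau> i) / h = 0" by simp
      show "pi * (\<tau> (Suc i) - \<tau> i) / h = pi" unfolding \<tau>(2) using h(1) by simp
      show "\<forall>t\<in>{\<tau> i..\<tau> (Suc i)}. f t = p' + r *\<^sub>R (cos (pi * (t - \<tau> i) / h) *\<^sub>R U + sin (pi * (t - \<tau> i) / h) *\<^sub>R V)"
        using rep unfolding \<tau>(2) by simp
    qed
    moreover have "curve_length (\<tau> i) (\<tau> (Suc i)) f = ereal (pi * r)"
      by (rule semicircle_length[OF UV1 UV r \<tau>(1) rep])
    ultimately show ?thesis by blast
  qed
  show ?thesis
    unfolding traces_four_semicircles_def f_def[symmetric]
  proof (intro bexI[OF _ S] exI[of _ \<tau>] conjI allI impI)
    show "\<tau> 0 = a" "\<tau> 4 = b" using h(2) by (simp_all add: \<tau>_def)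
    fix i :: nat assume i: "i < 4"
    show "\<tau> i < \<tau> (Suc i)" using h(1) by (simp add: \<tau>_def algebra_simps)
    show "traces_semicircle (\<tau> i) (\<tau> (Suc i)) (cyclic_shift a b S (model_curve a b r p)) r"
      "curve_length (\<tau> i) (\<tau> (Suc i)) (cyclic_shift a b S (model_curve a b r p)) = ereal (pi * r)"
      using half[OF i] unfolding f_def by blast+
  qed
qed

end

section \<open>Return to the given curve\<close>

lemma continuous_on_mono_onto:
  fixes f :: "real \<Rightarrow> real"
  assumes ab: "a < b" and mono: "\<And>t u. a \<le> t \<Longrightarrow> t \<le> u \<Longrightarrow> u \<le> b \<Longrightarrow> f t \<le> f u"
    and img: "f ` {a..b} = {0..L}"
  shows "continuous_on {a..b} f"
proof -
  show ?thesis
    unfolding continuous_on_iff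
  proof (intro ballI allI impI)
    fix t \<epsilon> :: real assume t: "t \<in> {a..b}" and e: "\<epsilon> > 0"
    have "f t \<in> {0..L}" using img t by blast
    then have ft: "0 \<le> f t" "f t \<le> L" by simp_all
    \<comment> \<open>Either the level \<open>f t + \<epsilon>/2\<close> exceeds all values, or it
      is attained at some \<open>u0\<close> and monotonicity keeps \<open>f\<close> below it before
      \<open>u0\<close>: a jump would leave a hole in the image.\<close>
    have up: "\<exists>d>0. \<forall>u\<in>{a..b}. u < t + d \<longrightarrow> f u < f t + \<epsilon>"
    proof (cases "f t + \<epsilon>/2 \<le> L")
      case False
      then have "f u < f t + \<epsilon>" if "u \<in> {a..b}" for u
      proof -
        have "f u \<in> {0..L}" using img that by blast
        then show ?thesis using False e by simp
      qed
      then show ?thesis by (intro exI[of _ 1]) simp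
    next
      case True
      then have "f t + \<epsilon>/2 \<in> f ` {a..b}" unfolding img using ft e by simp
      then obtain u0 where u0: "f t + \<epsilon>/2 = f u0" "u0 \<in> {a..b}" by (rule imageE)
      have "t < u0"
      proof (rule ccontr)
        assume "\<not> t < u0"
        then have "f u0 \<le> f t" using t u0(2) by (intro mono) auto
        then show False using u0(1) e by linarith
      qed
      moreover have "f u < f t + \<epsilon>" if "u \<in> {a..b}" "u < t + (u0 - t)" for u
      proof -
        have "f u \<le> f u0" using that u0(2) by (intro mono) auto
        then show ?thesis using u0(1) e by linarith
      qed
      ultimately show ?thesis by (intro exI[of _ "u0 - t"]) auto
    qed
    have dn: "\<exists>d>0. \<forall>u\<in>{a..b}. t - d < u \<longrightarrow> f t - \<epsilon> < f u"
    proof (cases "0 \<le> f t - \<epsilon>/2")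
      case False
      then have "f t - \<epsilon> < f u" if "u \<in> {a..b}" for u
      proof -
        have "f u \<in> {0..L}" using img that by blast
        then show ?thesis using False e by simp
      qed
      then show ?thesis by (intro exI[of _ 1]) simp
    next
      case True
      then have "f t - \<epsilon>/2 \<in> f ` {a..b}" unfolding img using ft e by simp
      then obtain u0 where u0: "f t - \<epsilon>/2 = f u0" "u0 \<in> {a..b}" by (rule imageE)
      have "u0 < t"
      proof (rule ccontr)
        assume "\<not> u0 < t"
        then have "f t \<le> f u0" using t u0(2) by (intro mono) auto
        then show False using u0(1) e by linarith
      qed
      moreover have "f t - \<epsilon> < f u" if "u \<in> {a..b}" "t - (t - u0) < u" for u
      proof -
        have "f u0 \<le> f u" using that u0(2) by (intro mono) auto
        then show ?thesis using u0(1) e by linarith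
      qed
      ultimately show ?thesis by (intro exI[of _ "t - u0"]) auto
    qed
    obtain d1 where d1: "d1 > 0" "\<forall>u\<in>{a..b}. u < t + d1 \<longrightarrow> f u < f t + \<epsilon>" using up by blast
    obtain d2 where d2: "d2 > 0" "\<forall>u\<in>{a..b}. t - d2 < u \<longrightarrow> f t - \<epsilon> < f u" using dn by blast
    show "\<exists>d>0. \<forall>u\<in>{a..b}. dist u t < d \<longrightarrow> dist (f u) (f t) < \<epsilon>"
    proof (intro exI[of _ "min d1 d2"] conjI ballI impI)
      fix u assume u: "u \<in> {a..b}" "dist u t < min d1 d2"
      have "u < t + d1" "t - d2 < u" using u(2) unfolding dist_real_def by linarith+
      then have "f u < f t + \<epsilon>" "f t - \<epsilon> < f u" using d1(2) d2(2) u(1) by blast+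
      then show "dist (f u) (f t) < \<epsilon>" unfolding dist_real_def by linarith
    qed (use d1(1) d2(1) in simp)
  qed
qed

lemma inspecting_curve_rescaled:
  fixes \<sigma> :: "real \<Rightarrow> real^3"
  assumes pos: "L > 0" "r > 0" "k > 0" and cl: "\<sigma> 0 = \<sigma> L"
    and lip: "\<And>x y. 0 \<le> x \<Longrightarrow> x \<le> y \<Longrightarrow> y \<le> L \<Longrightarrow> norm (\<sigma> x - \<sigma> y) \<le> y - x"
    and far: "\<And>x. 0 \<le> x \<Longrightarrow> x \<le> L \<Longrightarrow> r \<le> norm (\<sigma> x - p)"
    and cov: "\<And>v. \<exists>x. 0 \<le> x \<and> x \<le> L \<and> r * norm v \<le> v \<bullet> (\<sigma> x - p)"
  obtains s where "inspecting_curve s (L / k) (r / k)" "\<And>x. 0 \<le> x \<Longrightarrow> x \<le> L \<Longrightarrow> \<sigma> x = p + k *\<^sub>R s (x / k)"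
proof -
  define f where "f x = (1 / k) *\<^sub>R (\<sigma> (k * x) - p)" for x
  define l where "l = L / k"
  have l: "l > 0" "k * l = L" using pos by (simp_all add: l_def)
  have in_range: "0 \<le> k * x" "k * x \<le> L" if "0 \<le> x" "x \<le> l" for x
    using that pos l(2) mult_left_mono[of x l k] by simp_all
  have insp: "inspecting_curve (\<lambda>t. f (t - l * of_int \<lfloor>t / l\<rfloor>)) l (r / k)"
  proof (rule inspecting_curveI_closed[where f = f])
    show "l > 0" by (rule l)
    show "r / k > 0" using pos by simp
    show "f 0 = f l" unfolding f_def l(2) using cl by simp
    {
      fix t u :: real assume t0: "0 \<le> t" and tu: "t \<le> u" "u \<le> l"
      have u0: "0 \<le> u" using t0 tu by simp
      have "norm (\<sigma> (k * t) - \<sigma> (k * u)) \<le> k * u - k * t"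
        by (rule lip) (use in_range[OF t0] in_range[OF u0 tu(2)] tu pos in \<open>auto intro: mult_left_mono\<close>)
      moreover have "f t - f u = (1 / k) *\<^sub>R (\<sigma> (k * t) - \<sigma> (k * u))"
        unfolding f_def scaleR_diff_right[symmetric] by simp
      ultimately have "norm (f t - f u) \<le> (1 / k) * (k * u - k * t)"
        using pos(3) by (simp add: divide_right_mono)
      also have "\<dots> = u - t" using pos(3) by (simp add: field_simps)
      finally show "norm (f t - f u) \<le> u - t" .
    }
    fix t :: real assume t0: "0 \<le> t" and tl: "t \<le> l"
    show "r / k \<le> norm (f t)"
      using far[OF in_range[OF t0 tl]] pos(3) by (simp add: f_def divide_right_mono)
  next
    fix v
    obtain x where x: "0 \<le> x" "x \<le> L" "r * norm v \<le> v \<bullet> (\<sigma> x - p)" using cov by blast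
    have "(r * norm v) / k \<le> (v \<bullet> (\<sigma> x - p)) / k" using x(3) pos(3) by (intro divide_right_mono) auto
    then have "r / k * norm v \<le> v \<bullet> f (x / k)" using pos(3) by (simp add: f_def)
    then show "\<exists>t. 0 \<le> t \<and> t \<le> l \<and> r / k * norm v \<le> v \<bullet> f t"
      using x pos(3) by (intro exI[of _ "x / k"]) (simp add: l_def divide_right_mono)
  qed
  show ?thesis
  proof (rule that)
    show "inspecting_curve (\<lambda>t. f (t - l * of_int \<lfloor>t / l\<rfloor>)) (L / k) (r / k)" using insp unfolding l_def .
    fix x assume x: "0 \<le> x" "x \<le> L"
    have fx: "\<sigma> x = p + k *\<^sub>R f (x / k)" using pos(3) by (simp add: f_def)
    show "\<sigma> x = p + k *\<^sub>R f (x / k - l * of_int \<lfloor>x / k / l\<rfloor>)"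
    proof (cases "x = L")
      case True
      then have "x / k / l = 1" "x / k - l = 0" using pos l(1) by (simp_all add: l_def)
      moreover have "f (x / k) = f 0" using True cl pos(3) by (simp add: f_def)
      ultimately show ?thesis using fx by simp
    next
      case False
      have xl: "x / k / l = x / L" using pos by (simp add: l_def)
      have "0 \<le> x / L" "x / L < 1" using x False pos by simp_all
      then have fl: "\<lfloor>x / L\<rfloor> = 0" by (intro floor_unique) simp_all
      show ?thesis unfolding xl fl using fx by simp
    qed
  qed
qed

theorem theorem1p1:
  fixes \<gamma> :: "real \<Rightarrow> real^3" and a b L r :: real
  assumes "closed_curve_on a b \<gamma>"
    and "rectifiable_on a b \<gamma>"
    and "curve_length a b \<gamma> = ereal L"
    and "inradius a b \<gamma> = ereal r"
    and "r > 0"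
  shows "L \<ge> 4 * pi * r \<and>
    (L = 4 * pi * r \<longrightarrow>
      (\<exists>\<gamma>'. reparameterization_on a b \<gamma>' \<gamma> \<and>
            simple_closed_on a b \<gamma>' \<and>
            C11_closed_on a b \<gamma>' \<and>
            (\<exists>p. \<gamma>' ` {a..b} \<subseteq> sphere p (sqrt 2 * r)) \<and>
            traces_four_semicircles a b \<gamma>' r))"
proof -
  have ab: "a < b" and cont: "continuous_on {a..b} \<gamma>" and closed: "\<gamma> a = \<gamma> b"
    using assms(1) by (auto simp: closed_curve_on_def curve_on_def)
  obtain p where p: "\<And>v. \<exists>t\<in>{a..b}. r * norm v \<le> v \<bullet> (\<gamma> t - p)" "\<And>t. t \<in> {a..b} \<Longrightarrow> r \<le> norm (\<gamma> t - p)"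
    by (rule inradius_attained[OF ab cont assms(4,5)]) (rule that)
  obtain \<sigma> \<Lambda> where \<sigma>: "\<And>x y. 0 \<le> x \<Longrightarrow> x \<le> y \<Longrightarrow> y \<le> L \<Longrightarrow> norm (\<sigma> x - \<sigma> y) \<le> y - x"
      "\<And>x. 0 \<le> x \<Longrightarrow> x \<le> L \<Longrightarrow> \<sigma> x \<in> \<gamma> ` {a..b}" "\<sigma> 0 = \<gamma> a" "\<sigma> L = \<gamma> b"
    and \<Lambda>: "\<And>t. a \<le> t \<Longrightarrow> t \<le> b \<Longrightarrow> 0 \<le> \<Lambda> t \<and> \<Lambda> t \<le> L \<and> \<gamma> t = \<sigma> (\<Lambda> t)"
      "\<And>t u. a \<le> t \<Longrightarrow> t \<le> u \<Longrightarrow> u \<le> b \<Longrightarrow> \<Lambda> t \<le> \<Lambda> u"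
      "\<And>x. 0 \<le> x \<Longrightarrow> x \<le> L \<Longrightarrow> (\<exists>t. a \<le> t \<and> t \<le> b \<and> \<Lambda> t = x) \<or> (\<exists>y z. 0 \<le> y \<and> y < z \<and> z \<le> L \<and> (\<forall>w. y < w \<and> w < z \<longrightarrow> \<sigma> w = \<sigma> ((y + z) / 2)))"
    by (rule arclength_curve[OF ab cont assms(3)]) (rule that)
  have far: "r \<le> norm (\<sigma> x - p)" if "0 \<le> x" "x \<le> L" for x using \<sigma>(2)[OF that] p(2) by auto
  have cov: "\<exists>x. 0 \<le> x \<and> x \<le> L \<and> r * norm v \<le> v \<bullet> (\<sigma> x - p)" for v
  proof -
    obtain t where t: "t \<in> {a..b}" "r * norm v \<le> v \<bullet> (\<gamma> t - p)" using p(1) by blast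
    have "0 \<le> \<Lambda> t \<and> \<Lambda> t \<le> L \<and> \<gamma> t = \<sigma> (\<Lambda> t)" using \<Lambda>(1) t(1) by simp
    then show ?thesis using t(2) by (intro exI[of _ "\<Lambda> t"]) simp
  qed
  have L: "L > 0"
  proof (rule ccontr)
    assume "\<not> L > 0"
    then have z: "x = 0" if "0 \<le> x" "x \<le> L" for x using that by simp
    obtain x where x: "0 \<le> x" "x \<le> L" "r * norm (axis 1 1 :: real^3) \<le> axis 1 1 \<bullet> (\<sigma> x - p)" using cov by blast
    obtain y where y: "0 \<le> y" "y \<le> L" "r * norm (- axis 1 1 :: real^3) \<le> (- axis 1 1) \<bullet> (\<sigma> y - p)" using cov by blast
    \<comment> \<open>One point cannot see two opposite directions.\<close>
    have "x = y" using z x(1,2) y(1,2) by metis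
    then have "r + r \<le> 0" using x(3) y(3) by simp
    then show False using assms(5) by simp
  qed
  \<comment> \<open>After division by \<open>k\<close> the radius becomes \<open>1 / sqrt 2\<close>,
    as \<open>extremal_curve\<close> requires.\<close>
  define k where "k = sqrt 2 * r"
  have k: "k > 0" using assms(5) by (simp add: k_def)
  have \<sigma>0L: "\<sigma> 0 = \<sigma> L" using \<sigma>(3,4) closed by simp
  obtain s where s: "inspecting_curve s (L / k) (r / k)" "\<And>x. 0 \<le> x \<Longrightarrow> x \<le> L \<Longrightarrow> \<sigma> x = p + k *\<^sub>R s (x / k)"
    by (rule inspecting_curve_rescaled[OF L assms(5) k \<sigma>0L \<sigma>(1) far cov]) (assumption | rule that)+
  have "4 * pi * (r / k) \<le> L / k" by (rule inspecting_curve.length_ge[OF s(1)])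
  then have ge: "L \<ge> 4 * pi * r" using k by (simp add: divide_le_cancel)
  have "\<exists>\<gamma>'. reparameterization_on a b \<gamma>' \<gamma> \<and> simple_closed_on a b \<gamma>' \<and> C11_closed_on a b \<gamma>' \<and>
      (\<exists>p. \<gamma>' ` {a..b} \<subseteq> sphere p (sqrt 2 * r)) \<and> traces_four_semicircles a b \<gamma>' r"
    if eq: "L = 4 * pi * r"
  proof -
    have "L / k = 4 * pi * (r / k)" using eq by simp
    moreover have "2 * (r / k)\<^sup>2 = 1" using assms(5) by (simp add: k_def power_divide power_mult_distrib)
    ultimately have ext: "extremal_curve s (L / k) (r / k)"
      by (intro extremal_curve.intro[OF s(1)] extremal_curve_axioms.intro)
    interpret extremal_curve s "L / k" "r / k" by (rule ext)
    \<comment> \<open>A jump of the arclength would make the rescaled curve rest on an interval,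
      which \<open>nonconstant\<close> forbids. So the monotone arclength is onto and thereby
      continuous.\<close>
    have img: "\<Lambda> ` {a..b} = {0..L}"
    proof (intro equalityI subsetI)
      fix x assume "x \<in> \<Lambda> ` {a..b}" then show "x \<in> {0..L}" using \<Lambda>(1) by auto
    next
      fix x assume "x \<in> {0..L}"
      then have "0 \<le> x" "x \<le> L" by simp_all
      from \<Lambda>(3)[OF this] show "x \<in> \<Lambda> ` {a..b}"
      proof
        assume "\<exists>t. a \<le> t \<and> t \<le> b \<and> \<Lambda> t = x"
        then show ?thesis by auto
      next
        assume "\<exists>y z. 0 \<le> y \<and> y < z \<and> z \<le> L \<and> (\<forall>w. y < w \<and> w < z \<longrightarrow> \<sigma> w = \<sigma> ((y + z) / 2))"
        then obtain y z where yz: "0 \<le> y" "y < z" "z \<le> L" "\<And>w. y < w \<Longrightarrow> w < z \<Longrightarrow> \<sigma> w = \<sigma> ((y + z) / 2)" by blast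
        define m where "m = (y + z) / 2"
        have m: "y < m" "m < z" using yz(2) by (simp_all add: m_def)
        have "m / k < z / k" using m(2) k by (rule divide_strict_right_mono)
        then obtain t where t: "m / k < t" "t < z / k" "s t \<noteq> s (m / k)" using nonconstant by blast
        have tk: "m < t * k" "t * k < z"
          using t(1,2) unfolding pos_divide_less_eq[OF k] pos_less_divide_eq[OF k] .
        have "\<sigma> (t * k) = \<sigma> m" unfolding m_def by (rule yz(4)) (use tk m in simp_all)
        moreover have "\<sigma> (t * k) = p + k *\<^sub>R s (t * k / k)" by (rule s(2)) (use tk m yz(1,3) in linarith)+
        moreover have "\<sigma> m = p + k *\<^sub>R s (m / k)" by (rule s(2)) (use m yz(1,3) in linarith)+
        moreover have "t * k / k = t" using k by simp
        ultimately have "k *\<^sub>R s t = k *\<^sub>R s (m / k)" by (metis add_left_imp_eq)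
        then have "s t = s (m / k)" using k by simp
        with t(3) show ?thesis by (rule notE)
      qed
    qed
    have \<Lambda>cont: "continuous_on {a..b} \<Lambda>" by (rule continuous_on_mono_onto[OF ab \<Lambda>(2) img])
    \<comment> \<open>Arclength rescaled to \<open>{a..b}\<close>: it may be constant on intervals
      where the given curve rests, so the model reparameterizes the curve in the nondecreasing
      sense.\<close>
    define \<phi> where "\<phi> t = a + \<Lambda> t * ((b - a) / L)" for t
    let ?m = "model_curve a b r p"
    have "reparameterization_on a b ?m \<gamma>"
      unfolding reparameterization_on_def
    proof (intro conjI exI[of _ \<phi>])
      show "curve_on a b ?m" using model_curve_closed[OF ab] by (simp add: closed_curve_on_def)
      show "continuous_on {a..b} \<phi>" unfolding \<phi>_def by (intro continuous_intros \<Lambda>cont)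
      show "mono_on {a..b} \<phi>"
        unfolding \<phi>_def by (intro mono_onI add_left_mono mult_right_mono \<Lambda>(2)) (use ab L in simp_all)
      show "\<phi> ` {a..b} \<subseteq> {a..b}"
      proof
        fix y assume "y \<in> \<phi> ` {a..b}"
        then obtain t where t: "y = \<phi> t" "t \<in> {a..b}" by (rule imageE)
        have "0 \<le> \<Lambda> t \<and> \<Lambda> t \<le> L \<and> \<gamma> t = \<sigma> (\<Lambda> t)" by (rule \<Lambda>(1)) (use t(2) in simp_all)
        then have tl: "0 \<le> \<Lambda> t" "\<Lambda> t \<le> L" by blast+
        define q where "q = (b - a) / L"
        have q: "0 \<le> q" "L * q = b - a" using ab L by (simp_all add: q_def)
        have "0 \<le> \<Lambda> t * q" by (rule mult_nonneg_nonneg[OF tl(1) q(1)])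
        moreover have "\<Lambda> t * q \<le> b - a" unfolding q(2)[symmetric] by (rule mult_right_mono[OF tl(2) q(1)])
        ultimately show "y \<in> {a..b}" unfolding t(1) \<phi>_def q_def[symmetric] atLeastAtMost_iff by (intro conjI) linarith+
      qed
      show "\<forall>t\<in>{a..b}. \<gamma> t = ?m (\<phi> t)"
      proof
        fix t assume t: "t \<in> {a..b}"
        have "0 \<le> \<Lambda> t \<and> \<Lambda> t \<le> L \<and> \<gamma> t = \<sigma> (\<Lambda> t)" by (rule \<Lambda>(1)) (use t in simp_all)
        then have tl: "0 \<le> \<Lambda> t" "\<Lambda> t \<le> L" "\<gamma> t = \<sigma> (\<Lambda> t)" by blast+
        define D where "D = b - a"
        have D: "D > 0" using ab by (simp add: D_def)
        have "\<phi> t - a = \<Lambda> t * (D / L)" unfolding \<phi>_def D_def by simp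
        then have "(\<phi> t - a) * (L / k / D) = \<Lambda> t / k" using D L k by (simp add: field_simps)
        then have "(\<phi> t - a) * (L / k / (b - a)) = \<Lambda> t / k" unfolding D_def .
        then show "\<gamma> t = ?m (\<phi> t)"
          unfolding model_curve_def tl(3) s(2)[OF tl(1,2)] k_def[symmetric] by simp
      qed
    qed
    then show ?thesis
      using model_curve_simple[OF ab assms(5)] model_curve_C11[OF ab assms(5)] model_curve_sphere[OF assms(5)]
        model_curve_semicircles[OF ab assms(5)] by blast
  qed
  then show ?thesis using ge by blast
qed

end
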